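(* Let $T>0$, $\nu>0$, $\tilde F\in L^2(0,T;V')$ and $u_0\in H$. Then there exists at least one function $u$ such that $u\in L^2(0,T;V)$, $u'\in L^1(0,T;V')$, $u'+\nu Au+Bu=\tilde F$ on $]0,T[$ (as an equality in $V'$), and $u(0)=u_0$.
   Context: Let $a,b>0$ and $R=]0,a[\times]0,b[$, with unit normal $\mathbf n$ on $\partial R$. Write $\nabla^\bot=(-\partial_{x_2},\partial_{x_1})$, so $\nabla^\bot\cdot u=-\partial_{x_2}u_1+\partial_{x_1}u_2$; $\mathbf L^2(R)=L^2(R)^2$, $\mathbf H^k(R)=H^k(R)^2$. Let $\mathcal D_1(R)=\{u\in C^\infty(\overline R)^2: \nabla\cdot u=0 \text{ in } R,\ u\cdot\mathbf n=0 \text{ and } \nabla^\bot\cdot u=0\text{ on }\partial R\}$. Define $H=\{u\in\mathbf L^2(R):\nabla\cdot u=0,\ u\cdot\mathbf n=0\text{ on }\partial R\}$ with the $\mathbf L^2$ scalar product $(\cdot,\cdot)$ and norm $|\cdot|$; $V$ = closure of $\mathcal D_1(R)$ in $\mathbf H^1(R)$, with scalar product $((u,v))=\sum_{i=1}^2\int_R\nabla u_i\cdot\nabla v_i\,dx$ and norm $\|\cdot\|$ (equivalent to the $\mathbf H^1$ norm on $V$). $H$ is identified with its dual, so $V\subset H\subset V'$, and $\langle f,v\rangle=(f,v)$ for $f\in H$, $v\in V$. $A:V\to V'$ is defined by $\langle Au,v\rangle=((u,v))$. For $u,v,w\in\mathbf H^1(R)$, $b(u,v,w)=\sum_{i,j=1}^2\int_R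 u_i(\partial_i v_j)w_j\,dx$, and for $u\in V$, $Bu\in V'$ is defined by $\langle Bu,w\rangle=b(u,u,w)$, $w\in V$. $u'$ is the $V'$-valued distributional time derivative; a function $u$ with $u\in L^2(0,T;V)$, $u'\in L^1(0,T;V')$ is a.e. equal to a continuous function $[0,T]\to V'$, which gives meaning to $u(0)$. *)

theory Defs
  imports "HOL-Analysis.Analysis"
begin

text \<open>Elements of the function spaces below are represented by total functions on the plane; only
  their values (almost everywhere) on the rectangle matter, and the "norms" are accordingly
  seminorms on representatives.\<close>

type_synonym point = "real ^ 2"
type_synonym field = "real ^ 2 \<Rightarrow> real ^ 2"

definition rect :: "real \<Rightarrow> real \<Rightarrow> point set" where
  "rect a b = {x. 0 < x $ 1 \<and> x $ 1 < a \<and> 0 < x $ 2 \<and> x $ 2 < b}"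

text \<open>At a corner both one-sided outer unit normals are included; for continuous fields this
  gives the same condition \<open>u \<bullet> n = 0\<close> on the boundary as leaving out the corners.\<close>

definition unit_normals :: "real \<Rightarrow> real \<Rightarrow> point \<Rightarrow> point set" where
  "unit_normals a b x =
     {n. (x $ 1 = 0 \<and> n = - axis 1 1) \<or> (x $ 1 = a \<and> n = axis 1 1) \<or>
         (x $ 2 = 0 \<and> n = - axis 2 1) \<or> (x $ 2 = b \<and> n = axis 2 1)}"


section \<open>Smooth functions and test functions\<close>

primrec Ck :: "nat \<Rightarrow> ('a::euclidean_space \<Rightarrow> 'b::real_normed_vector) \<Rightarrow> bool" where
  "Ck 0 f \<longleftrightarrow> continuous_on UNIV f"
| "Ck (Suc k) f \<longleftrightarrow> (\<forall>x. f differentiable (at x)) \<and>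
     (\<forall>e\<in>Basis. Ck k (\<lambda>x. frechet_derivative f (at x) e))"

definition smooth :: "('a::euclidean_space \<Rightarrow> 'b::real_normed_vector) \<Rightarrow> bool" where
  "smooth f \<longleftrightarrow> (\<forall>k. Ck k f)"

definition test_functions :: "'a::euclidean_space set \<Rightarrow> ('a \<Rightarrow> real) set" where
  "test_functions S =
     {\<phi>. smooth \<phi> \<and> compact (closure {x. \<phi> x \<noteq> 0}) \<and> closure {x. \<phi> x \<noteq> 0} \<subseteq> S}"

definition partial :: "2 \<Rightarrow> (point \<Rightarrow> real) \<Rightarrow> point \<Rightarrow> real" where
  "partial i f x = frechet_derivative f (at x) (axis i 1)"

definition divergence :: "field \<Rightarrow> point \<Rightarrow> real" where
  "divergence u x = partial 1 (\<lambda>y. u y $ 1) x + partial 2 (\<lambda>y. u y $ 2) x"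

definition curl :: "field \<Rightarrow> point \<Rightarrow> real" where
  "curl u x = - partial 2 (\<lambda>y. u y $ 1) x + partial 1 (\<lambda>y. u y $ 2) x"

text \<open>A function that is smooth up to the boundary is represented by a smooth extension to the whole
  plane; the values on the closed rectangle of all its derivatives do not depend on the extension.\<close>

definition D1 :: "real \<Rightarrow> real \<Rightarrow> field set" where
  "D1 a b = {u. smooth u \<and> (\<forall>x\<in>rect a b. divergence u x = 0) \<and>
     (\<forall>x\<in>frontier (rect a b). (\<forall>n\<in>unit_normals a b x. u x \<bullet> n = 0) \<and> curl u x = 0)}"


section \<open>Square integrable functions and weak derivatives\<close>

definition L2 :: "point set \<Rightarrow> (point \<Rightarrow> 'b::euclidean_space) set" where
  "L2 S = {f. f \<in> borel_measurable (lebesgue_on S) \<and>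
              integrable (lebesgue_on S) (\<lambda>x. (norm (f x))\<^sup>2)}"

definition is_weak_partial ::
    "point set \<Rightarrow> 2 \<Rightarrow> (point \<Rightarrow> real) \<Rightarrow> (point \<Rightarrow> real) \<Rightarrow> bool" where
  "is_weak_partial S i f g \<longleftrightarrow> (\<forall>\<phi>\<in>test_functions S.
     (LINT x|lebesgue_on S. f x * partial i \<phi> x) = - (LINT x|lebesgue_on S. g x * \<phi> x))"

definition weak_partial :: "point set \<Rightarrow> 2 \<Rightarrow> (point \<Rightarrow> real) \<Rightarrow> point \<Rightarrow> real" where
  "weak_partial S i f = (SOME g. g \<in> L2 S \<and> is_weak_partial S i f g)"

definition H1 :: "point set \<Rightarrow> (point \<Rightarrow> real) set" where
  "H1 S = {f \<in> L2 S. \<forall>i. \<exists>g\<in>L2 S. is_weak_partial S i f g}"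

definition H1_field :: "point set \<Rightarrow> field set" where
  "H1_field S = {u. \<forall>j. (\<lambda>x. u x $ j) \<in> H1 S}"

definition H1_norm :: "point set \<Rightarrow> field \<Rightarrow> real" where
  "H1_norm S u = sqrt (\<Sum>j\<in>UNIV. (LINT x|lebesgue_on S. (u x $ j)\<^sup>2) +
     (\<Sum>i\<in>UNIV. LINT x|lebesgue_on S. (weak_partial S i (\<lambda>y. u y $ j) x)\<^sup>2))"

definition is_weak_div :: "point set \<Rightarrow> field \<Rightarrow> (point \<Rightarrow> real) \<Rightarrow> bool" where
  "is_weak_div S u d \<longleftrightarrow> (\<forall>\<phi>\<in>test_functions S.
     (LINT x|lebesgue_on S. (\<Sum>i\<in>UNIV. u x $ i * partial i \<phi> x))
       = - (LINT x|lebesgue_on S. d x * \<phi> x))"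

definition weak_div :: "point set \<Rightarrow> field \<Rightarrow> point \<Rightarrow> real" where
  "weak_div S u = (SOME d. d \<in> L2 S \<and> is_weak_div S u d)"

text \<open>For a square integrable field with square integrable divergence, the normal trace \<open>u \<bullet> n\<close> is the
  functional on the boundary traces of \<open>H\<^sup>1\<close> functions \<open>\<psi>\<close> given by Green's formula.\<close>

definition normal_trace :: "point set \<Rightarrow> field \<Rightarrow> (point \<Rightarrow> real) \<Rightarrow> real" where
  "normal_trace S u \<psi> = (LINT x|lebesgue_on S.
     (\<Sum>i\<in>UNIV. u x $ i * weak_partial S i \<psi> x) + weak_div S u x * \<psi> x)"


section \<open>The spaces H, V and the dual of V\<close>

definition H_space :: "real \<Rightarrow> real \<Rightarrow> field set" where
  "H_space a b = {u \<in> L2 (rect a b). is_weak_div (rect a b) u (\<lambda>x. 0) \<and>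
     (\<forall>\<psi>\<in>H1 (rect a b). normal_trace (rect a b) u \<psi> = 0)}"

definition H_inner :: "real \<Rightarrow> real \<Rightarrow> field \<Rightarrow> field \<Rightarrow> real" where
  "H_inner a b u v = (LINT x|lebesgue_on (rect a b). u x \<bullet> v x)"

definition V_space :: "real \<Rightarrow> real \<Rightarrow> field set" where
  "V_space a b = {u \<in> H1_field (rect a b).
     \<forall>\<epsilon>>0. \<exists>w\<in>D1 a b. H1_norm (rect a b) (\<lambda>x. u x - w x) < \<epsilon>}"

definition V_inner :: "real \<Rightarrow> real \<Rightarrow> field \<Rightarrow> field \<Rightarrow> real" where
  "V_inner a b u v = (\<Sum>i\<in>UNIV. LINT x|lebesgue_on (rect a b).
     (\<Sum>j\<in>UNIV. weak_partial (rect a b) j (\<lambda>y. u y $ i) x *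
                 weak_partial (rect a b) j (\<lambda>y. v y $ i) x))"

definition V_norm :: "real \<Rightarrow> real \<Rightarrow> field \<Rightarrow> real" where
  "V_norm a b u = sqrt (V_inner a b u u)"

text \<open>Only the values of a functional on \<open>V\<close> matter: two functionals are equal as elements of the
  dual iff they agree on \<open>V\<close>. Boundedness makes them independent of the chosen representatives.\<close>

definition V_dual :: "real \<Rightarrow> real \<Rightarrow> (field \<Rightarrow> real) set" where
  "V_dual a b = {l.
     (\<forall>u\<in>V_space a b. \<forall>v\<in>V_space a b. l (\<lambda>x. u x + v x) = l u + l v) \<and>
     (\<forall>c. \<forall>u\<in>V_space a b. l (\<lambda>x. c *\<^sub>R u x) = c * l u) \<and>
     (\<exists>C. \<forall>u\<in>V_space a b. \<bar>l u\<bar> \<le> C * V_norm a b u)}"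

definition V_dual_norm :: "real \<Rightarrow> real \<Rightarrow> (field \<Rightarrow> real) \<Rightarrow> real" where
  "V_dual_norm a b l = (SUP v\<in>{v \<in> V_space a b. V_norm a b v \<le> 1}. \<bar>l v\<bar>)"

text \<open>The inclusion of \<open>H\<close> in the dual of \<open>V\<close>.\<close>

definition emb :: "real \<Rightarrow> real \<Rightarrow> field \<Rightarrow> field \<Rightarrow> real" where
  "emb a b f = (\<lambda>v. H_inner a b f v)"

definition A_op :: "real \<Rightarrow> real \<Rightarrow> field \<Rightarrow> field \<Rightarrow> real" where
  "A_op a b u = (\<lambda>v. V_inner a b u v)"

definition b_form :: "real \<Rightarrow> real \<Rightarrow> field \<Rightarrow> field \<Rightarrow> field \<Rightarrow> real" where
  "b_form a b u v w = (\<Sum>i\<in>UNIV. \<Sum>j\<in>UNIV. LINT x|lebesgue_on (rect a b).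
     u x $ i * weak_partial (rect a b) i (\<lambda>y. v y $ j) x * w x $ j)"

definition B_op :: "real \<Rightarrow> real \<Rightarrow> field \<Rightarrow> field \<Rightarrow> real" where
  "B_op a b u = (\<lambda>w. b_form a b u u w)"


section \<open>Vector-valued functions of time\<close>

text \<open>Here \<open>X\<close> is a space of functions \<open>'p \<Rightarrow> 'q\<close> (with pointwise operations) and \<open>N\<close> its norm;
  it is not a type, hence the Bochner integral of the library does not apply. \<open>M\<close> is always a finite
  measure.\<close>

definition simple_in :: "'t measure \<Rightarrow> 'x set \<Rightarrow> ('t \<Rightarrow> 'x) \<Rightarrow> bool" where
  "simple_in M X s \<longleftrightarrow> simple_function M s \<and> s ` space M \<subseteq> X"

definition strongly_measurable ::
    "'t measure \<Rightarrow> ('p \<Rightarrow> 'q::real_vector) set \<Rightarrow> (('p \<Rightarrow> 'q) \<Rightarrow> real) \<Rightarrow> ('t \<Rightarrow> 'p \<Rightarrow> 'q) \<Rightarrow> bool" where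
  "strongly_measurable M X N f \<longleftrightarrow> (AE t in M. f t \<in> X) \<and>
     (\<exists>s. (\<forall>n::nat. simple_in M X (s n)) \<and>
          (AE t in M. (\<lambda>n. N (\<lambda>p. s n t p - f t p)) \<longlonglongrightarrow> 0))"

definition simple_integral_in ::
    "'t measure \<Rightarrow> ('t \<Rightarrow> 'p \<Rightarrow> 'q::real_vector) \<Rightarrow> 'p \<Rightarrow> 'q" where
  "simple_integral_in M s =
     (\<lambda>p. \<Sum>y\<in>s ` space M. measure M (s -` {y} \<inter> space M) *\<^sub>R y p)"

definition has_bochner_integral_in ::
    "'t measure \<Rightarrow> ('p \<Rightarrow> 'q::real_vector) set \<Rightarrow> (('p \<Rightarrow> 'q) \<Rightarrow> real) \<Rightarrow>
     ('t \<Rightarrow> 'p \<Rightarrow> 'q) \<Rightarrow> ('p \<Rightarrow> 'q) \<Rightarrow> bool" where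
  "has_bochner_integral_in M X N f I \<longleftrightarrow> strongly_measurable M X N f \<and> I \<in> X \<and>
     (\<exists>s. (\<forall>n::nat. simple_in M X (s n)) \<and>
          (\<lambda>n. \<integral>\<^sup>+ t. ennreal (N (\<lambda>p. s n t p - f t p)) \<partial>M) \<longlonglongrightarrow> 0 \<and>
          (\<lambda>n. N (\<lambda>p. simple_integral_in M (s n) p - I p)) \<longlonglongrightarrow> 0)"

definition bochner_L ::
    "nat \<Rightarrow> real \<Rightarrow> ('p \<Rightarrow> 'q::real_vector) set \<Rightarrow> (('p \<Rightarrow> 'q) \<Rightarrow> real) \<Rightarrow> (real \<Rightarrow> 'p \<Rightarrow> 'q) set" where
  "bochner_L r T X N = {f. strongly_measurable (lebesgue_on {0<..<T}) X N f \<and>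
     integrable (lebesgue_on {0<..<T}) (\<lambda>t. N (f t) ^ r)}"

text \<open>\<open>g\<close> is the \<open>X\<close>-valued distributional derivative of \<open>f\<close> on \<open>]0,T[\<close>:
  the integral of \<open>\<phi> g\<close> is the negative of that of \<open>\<phi>' f\<close>, as elements of \<open>X\<close>.\<close>

definition has_time_derivative ::
    "real \<Rightarrow> ('p \<Rightarrow> 'q::real_vector) set \<Rightarrow> (('p \<Rightarrow> 'q) \<Rightarrow> real) \<Rightarrow>
     (real \<Rightarrow> 'p \<Rightarrow> 'q) \<Rightarrow> (real \<Rightarrow> 'p \<Rightarrow> 'q) \<Rightarrow> bool" where
  "has_time_derivative T X N f g \<longleftrightarrow> (\<forall>\<phi>\<in>test_functions {0<..<T}. \<exists>I.
     has_bochner_integral_in (lebesgue_on {0<..<T}) X N (\<lambda>t p. deriv \<phi> t *\<^sub>R f t p) I \<and>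
     has_bochner_integral_in (lebesgue_on {0<..<T}) X N (\<lambda>t p. \<phi> t *\<^sub>R g t p) (\<lambda>p. - I p))"

text \<open>The continuous representative on \<open>[0,T]\<close> of \<open>f\<close> takes the value \<open>x0\<close> at time 0.\<close>

definition has_initial_value ::
    "real \<Rightarrow> ('p \<Rightarrow> 'q::real_vector) set \<Rightarrow> (('p \<Rightarrow> 'q) \<Rightarrow> real) \<Rightarrow>
     (real \<Rightarrow> 'p \<Rightarrow> 'q) \<Rightarrow> ('p \<Rightarrow> 'q) \<Rightarrow> bool" where
  "has_initial_value T X N f x0 \<longleftrightarrow> (\<exists>w.
     (\<forall>t\<in>{0..T}. w t \<in> X \<and> ((\<lambda>s. N (\<lambda>p. w s p - w t p)) \<longlongrightarrow> 0) (at t within {0..T})) \<and>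
     (AE t in lebesgue_on {0<..<T}. N (\<lambda>p. w t p - f t p) = 0) \<and>
     N (\<lambda>p. w 0 p - x0 p) = 0)"

end

theory Submission
  imports Defs "HOL-Complex_Analysis.Great_Picard" "HOL-Probability.Discrete_Topology"
begin

text \<open>The fields \<open>(-\<partial>\<^sub>2 \<psi>, \<partial>\<^sub>1 \<psi>)\<close> with \<open>\<psi> = sin (m \<pi> x\<^sub>1 / a) sin (n \<pi> x\<^sub>2 / b)\<close> belong to \<open>D1\<close> and are, up to
  normalization, orthonormal in \<open>L\<^sup>2\<close> and eigenfields of \<open>A\<close>. Hence \<open>V\<close> is isometric to the sequences
  with \<open>\<Sum> \<lambda>\<^sub>k c\<^sub>k\<^sup>2 < \<infinity>\<close>, and the equation becomes a system
  \<open>c\<^sub>k' = F\<^sub>k - \<nu> \<lambda>\<^sub>k c\<^sub>k + q\<^sub>k(c)\<close> in which \<open>q\<^sub>k\<close> is quadratic and, because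
  \<open>b(u, w\<^sub>k, u)\<close> puts no derivative on \<open>u\<close>, locally Lipschitz in \<open>l\<^sup>2\<close>. Galerkin truncations are solved by
  Picard iteration; the cancellation \<open>\<Sum> c\<^sub>k q\<^sub>k(c) = 0\<close> gives the energy bound. A subsequence converges
  coefficientwise uniformly in time, and the tail bound \<open>\<Sum>\<^bsub>k \<ge> N\<^esub> c\<^sub>k\<^sup>2 \<le> (\<Sum> \<lambda>\<^sub>k c\<^sub>k\<^sup>2) / inf\<^bsub>k \<ge> N\<^esub> \<lambda>\<^sub>k\<close> turns this
  into convergence in \<open>L\<^sup>2(0,T; l\<^sup>2)\<close>, which suffices to pass to the limit in \<open>q\<^sub>k\<close>.\<close>

section \<open>Indefinite integrals and Picard iteration\<close>

text \<open>The boundary conditions decouple along the sides of the rectangle: when a field of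
  \<open>D1\<close> is paired with an eigenfield, every boundary term vanishes, either through the
  normal component of the field or through a sine factor of the eigenfield. This gives the spectrum
  without spectral theory, and the growth of the eigenvalues takes over the role of a compact
  embedding. Completeness of the eigenfields in \<open>V\<close> is the delicate point; it comes
  from Stone-Weierstrass for cosine polynomials, because elements of \<open>V\<close> are orthogonal
  to gradients. The force is merely integrable in time, so the coefficients are only absolutely
  continuous: the equations stay in integral form, and the energy identity needs a product rule for
  indefinite integrals. The dual norm of \<open>B u\<close> is bounded by a multiple of the squared
  norm of \<open>u\<close> in \<open>V\<close>, whence \<open>u'\<close> in \<open>L^1\<close>. This
  \<open>u'\<close> is defined by the equation, and that it is the time derivative only has to be
  tested on eigenfields. All spaces consist of representatives and weak derivatives are arbitrary
  choices, so identities hold almost everywhere and norms are seminorms.\<close>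

lemma eq_if_small_increments:
  fixes D G :: "real \<Rightarrow> real"
  assumes "a \<le> b"
    and "\<And>\<epsilon>. 0 < \<epsilon> \<Longrightarrow> \<exists>\<delta>>0. \<forall>s t. a \<le> s \<and> s \<le> t \<and> t \<le> b \<and> t - s < \<delta> \<longrightarrow> \<bar>D t - D s\<bar> \<le> \<epsilon> * (G t - G s)"
  shows "D b = D a"
proof -
  \<comment> \<open>On a partition finer than \<open>\<delta>\<close> the increments of
    \<open>D\<close> add up by the triangle inequality while those of \<open>G\<close> telescope.
    The bound therefore holds on the whole interval, where \<open>G b - G a\<close> is fixed and
    \<open>\<epsilon>\<close> is free.\<close>
  have *: "\<bar>D b - D a\<bar> \<le> \<epsilon> * (G b - G a)" if e0: "0 < \<epsilon>" for \<epsilon>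
  proof -
    obtain \<delta> where \<delta>: "\<delta> > 0" "\<And>s t. a \<le> s \<Longrightarrow> s \<le> t \<Longrightarrow> t \<le> b \<Longrightarrow> t - s < \<delta> \<Longrightarrow> \<bar>D t - D s\<bar> \<le> \<epsilon> * (G t - G s)"
      using assms(2)[OF e0] by metis
    obtain N :: nat where N: "(b - a) / \<delta> < real N" using reals_Archimedean2 by blast
    have N0: "0 < real N" using N assms(1) \<delta>(1) by (meson divide_nonneg_pos diff_ge_0_iff_ge le_less_trans)
    define p where "p i = a + real i * ((b - a) / real N)" for i
    have h: "0 \<le> (b - a) / real N" "(b - a) / real N < \<delta>"
      using assms(1) N N0 \<delta>(1) by (auto simp: field_simps)
    have pN: "p N = b" using N0 by (simp add: p_def)
    have step: "p (Suc i) = p i + (b - a) / real N" for i by (simp add: p_def distrib_right add_divide_distrib)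
    have "\<bar>D (p i) - D a\<bar> \<le> \<epsilon> * (G (p i) - G a)" if "i \<le> N" for i
      using that
    proof (induction i)
      case 0 then show ?case by (simp add: p_def)
    next
      case (Suc i)
      have "real (Suc i) * ((b - a) / real N) \<le> real N * ((b - a) / real N)"
        using Suc.prems h(1) by (intro mult_right_mono) auto
      then have "p (Suc i) \<le> b" using N0 by (simp add: p_def)
      moreover have "a \<le> p i" using mult_nonneg_nonneg[OF of_nat_0_le_iff h(1)] by (simp add: p_def)
      ultimately have "\<bar>D (p (Suc i)) - D (p i)\<bar> \<le> \<epsilon> * (G (p (Suc i)) - G (p i))"
        using h step by (intro \<delta>(2)) auto
      with Suc show ?case by (simp add: algebra_simps)
    qed
    from this[of N] show ?thesis by (simp add: pN)
  qed
  have "\<bar>D b - D a\<bar> \<le> 0"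
  proof (rule field_le_epsilon)
    fix e :: real assume "0 < e"
    \<comment> \<open>The summand 1 keeps the divisor positive when
      \<open>G b = G a\<close>.\<close>
    define K where "K = \<bar>G b - G a\<bar> + 1"
    have "\<bar>D b - D a\<bar> \<le> (e / K) * (G b - G a)"
      using \<open>0 < e\<close> by (intro *) (simp add: K_def)
    also have "\<dots> \<le> (e / K) * K" using \<open>0 < e\<close> by (intro mult_left_mono) (auto simp: K_def)
    also have "\<dots> = e" by (simp add: K_def)
    finally show "\<bar>D b - D a\<bar> \<le> 0 + e" by simp
  qed
  then show ?thesis by simp
qed

lemma absolutely_integrable_mult_continuous:
  fixes g d :: "real \<Rightarrow> real"
  assumes "g absolutely_integrable_on {a..b}" "continuous_on {a..b} d"
  shows "(\<lambda>s. g s * d s) absolutely_integrable_on {a..b}"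
proof -
  have "d \<in> borel_measurable (lebesgue_on {a..b})"
    using assms(2) by (intro continuous_imp_measurable_on_sets_lebesgue) auto
  from absolutely_integrable_bounded_measurable_product_real[OF this _ _ assms(1)]
  have "(\<lambda>s. d s * g s) absolutely_integrable_on {a..b}"
    using assms(2) by (simp add: compact_imp_bounded compact_continuous_image)
  then show ?thesis by (simp only: mult.commute)
qed

lemma indefinite_integral_diff:
  fixes g :: "real \<Rightarrow> real"
  assumes "g integrable_on {a..b}" "a \<le> s" "s \<le> t" "t \<le> b"
  shows "integral {a..t} g - integral {a..s} g = integral {s..t} g"
proof -
  have "g integrable_on {a..t}" by (rule integrable_on_subinterval[OF assms(1)]) (use assms in auto)
  from Henstock_Kurzweil_Integration.integral_combine[OF assms(2,3) this] show ?thesis by simp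
qed

text \<open>Product rule for absolutely continuous functions given as indefinite integrals, whose
  pointwise derivatives exist only almost everywhere. No differentiation is used: the difference
  between the product and the integral of the expected derivative moves, over a short interval, by
  at most \<open>e\<close> times the integral of \<open>\<bar>g\<bar> + \<bar>h\<bar>\<close>,
  because \<open>c\<close> and \<open>d\<close> are uniformly continuous.\<close>

lemma ac_product:
  fixes g h c d :: "real \<Rightarrow> real"
  assumes ab: "a \<le> b" and g: "g absolutely_integrable_on {a..b}" and h: "h absolutely_integrable_on {a..b}"
    and c: "\<And>t. t \<in> {a..b} \<Longrightarrow> c t = c0 + integral {a..t} g"
    and d: "\<And>t. t \<in> {a..b} \<Longrightarrow> d t = d0 + integral {a..t} h"
  shows "(\<lambda>s. g s * d s + c s * h s) absolutely_integrable_on {a..b}"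
    and "integral {a..b} (\<lambda>s. g s * d s + c s * h s) = c b * d b - c a * d a"
proof -
  have gi: "g integrable_on {a..b}" and hi: "h integrable_on {a..b}"
    using g h by (auto intro: set_lebesgue_integral_eq_integral(1))
  have cc: "continuous_on {a..b} c"
    using indefinite_integral_continuous_1[OF gi]
    by (subst continuous_on_cong[OF refl c]) (auto intro!: continuous_intros)
  have dc: "continuous_on {a..b} d"
    using indefinite_integral_continuous_1[OF hi]
    by (subst continuous_on_cong[OF refl d]) (auto intro!: continuous_intros)
  have gd: "(\<lambda>s. g s * d s) absolutely_integrable_on {a..b}"
    and ch: "(\<lambda>s. c s * h s) absolutely_integrable_on {a..b}"
    using absolutely_integrable_mult_continuous[OF g dc] absolutely_integrable_mult_continuous[OF h cc]
    by (auto simp: mult.commute)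
  show I: "(\<lambda>s. g s * d s + c s * h s) absolutely_integrable_on {a..b}"
    using gd ch by (rule set_integral_add)
  let ?k = "\<lambda>s. g s * d s + c s * h s"
  have ki: "?k integrable_on {a..b}" using I by (auto intro: set_lebesgue_integral_eq_integral(1))
  have gn: "(\<lambda>r. \<bar>g r\<bar> + \<bar>h r\<bar>) absolutely_integrable_on {a..b}"
    using g h by (intro set_integral_add) (auto simp: set_integrable_abs)
  have gni: "(\<lambda>r. \<bar>g r\<bar> + \<bar>h r\<bar>) integrable_on {a..b}"
    using gn by (auto intro: set_lebesgue_integral_eq_integral(1))
  define D where "D t = c t * d t - integral {a..t} ?k" for t
  define G where "G t = integral {a..t} (\<lambda>r. \<bar>g r\<bar> + \<bar>h r\<bar>)" for t
  have "D b = D a"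
  proof (rule eq_if_small_increments[OF ab])
    fix e :: real assume e: "0 < e"
    obtain d1 where d1: "d1 > 0" "\<And>x y. x \<in> {a..b} \<Longrightarrow> y \<in> {a..b} \<Longrightarrow> dist y x < d1 \<Longrightarrow> dist (c y) (c x) < e"
      using compact_uniformly_continuous[OF cc compact_Icc] e unfolding uniformly_continuous_on_def by metis
    obtain d2 where d2: "d2 > 0" "\<And>x y. x \<in> {a..b} \<Longrightarrow> y \<in> {a..b} \<Longrightarrow> dist y x < d2 \<Longrightarrow> dist (d y) (d x) < e"
      using compact_uniformly_continuous[OF dc compact_Icc] e unfolding uniformly_continuous_on_def by metis
    show "\<exists>\<delta>>0. \<forall>s t. a \<le> s \<and> s \<le> t \<and> t \<le> b \<and> t - s < \<delta> \<longrightarrow> \<bar>D t - D s\<bar> \<le> e * (G t - G s)"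
    proof (intro exI[of _ "min d1 d2"] conjI allI impI)
      show "0 < min d1 d2" using d1 d2 by simp
      fix s t assume "a \<le> s \<and> s \<le> t \<and> t \<le> b \<and> t - s < min d1 d2"
      then have st: "a \<le> s" "s \<le> t" "t \<le> b" "t - s < d1" "t - s < d2" by auto
      have sub: "{s..t} \<subseteq> {a..b}" using st by auto
      note si = integrable_on_subinterval[OF _ sub]
      have sgd: "(\<lambda>r. g r * d t) integrable_on {s..t}" by (intro integrable_on_mult_left si[OF gi])
      have sgh: "(\<lambda>r. c s * h r) integrable_on {s..t}" by (intro integrable_on_mult_right si[OF hi])
      have e1: "c t - c s = integral {s..t} g" "d t - d s = integral {s..t} h"
        using c[of t] c[of s] d[of t] d[of s] st indefinite_integral_diff[OF gi, of s t] indefinite_integral_diff[OF hi, of s t]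
        by auto
      have "D t - D s = (c t - c s) * d t + c s * (d t - d s) - integral {s..t} ?k"
        unfolding D_def using indefinite_integral_diff[OF ki, of s t] st by (simp add: algebra_simps)
      also have "\<dots> = integral {s..t} (\<lambda>r. g r * d t) + integral {s..t} (\<lambda>r. c s * h r) - integral {s..t} ?k"
        by (simp add: e1)
      also have "\<dots> = integral {s..t} (\<lambda>r. g r * d t + c s * h r - ?k r)"
        using sgd sgh
        by (simp only: Henstock_Kurzweil_Integration.integral_diff Henstock_Kurzweil_Integration.integral_add
              integrable_add si[OF ki])
      finally have eq: "D t - D s = integral {s..t} (\<lambda>r. g r * d t + c s * h r - ?k r)" .
      have "norm (integral {s..t} (\<lambda>r. g r * d t + c s * h r - ?k r)) \<le> integral {s..t} (\<lambda>r. e * (\<bar>g r\<bar> + \<bar>h r\<bar>))"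
      proof (rule integral_norm_bound_integral)
        show "(\<lambda>r. g r * d t + c s * h r - ?k r) integrable_on {s..t}"
          by (rule integrable_diff[OF integrable_add[OF sgd sgh] si[OF ki]])
        show "(\<lambda>r. e * (\<bar>g r\<bar> + \<bar>h r\<bar>)) integrable_on {s..t}"
          by (rule integrable_on_mult_right[OF si[OF gni]])
        fix r assume r: "r \<in> {s..t}"
        have 1: "\<bar>d t - d r\<bar> \<le> e" using d2(2)[of r t] r st by (auto simp: dist_real_def)
        have 2: "\<bar>c s - c r\<bar> \<le> e" using d1(2)[of r s] r st by (auto simp: dist_real_def)
        have "g r * d t + c s * h r - ?k r = g r * (d t - d r) + (c s - c r) * h r" by (simp add: algebra_simps)
        also have "norm \<dots> \<le> \<bar>g r\<bar> * \<bar>d t - d r\<bar> + \<bar>c s - c r\<bar> * \<bar>h r\<bar>"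
          by (simp add: abs_mult[symmetric] abs_triangle_ineq)
        also have "\<dots> \<le> \<bar>g r\<bar> * e + e * \<bar>h r\<bar>" using 1 2 by (intro add_mono mult_mono) auto
        finally show "norm (g r * d t + c s * h r - ?k r) \<le> e * (\<bar>g r\<bar> + \<bar>h r\<bar>)" by (simp add: algebra_simps)
      qed
      then show "\<bar>D t - D s\<bar> \<le> e * (G t - G s)"
        unfolding eq G_def using indefinite_integral_diff[OF gni, of s t] st by simp
    qed
  qed
  then show "integral {a..b} ?k = c b * d b - c a * d a" by (simp add: D_def)
qed

section \<open>Finite Lipschitz systems of integral equations\<close>

text \<open>The hypothesis is Lipschitz continuity in the maximum of the first \<open>n\<close>
  coordinates. Taken with \<open>e = 0\<close> it also says that \<open>G\<close> ignores the later
  coordinates, so only the functions \<open>x i\<close> with \<open>i < n\<close> have to be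
  continuous.\<close>

lemma continuous_on_finite_lipschitz:
  fixes G :: "(nat \<Rightarrow> real) \<Rightarrow> real" and x :: "nat \<Rightarrow> 'a::metric_space \<Rightarrow> real"
  assumes L: "0 < L" and lip: "\<And>x y e. (\<And>i. i < n \<Longrightarrow> \<bar>x i - y i\<bar> \<le> e) \<Longrightarrow> 0 \<le> e \<Longrightarrow> \<bar>G x - G y\<bar> \<le> L * e"
    and x: "\<And>i. i < n \<Longrightarrow> continuous_on S (x i)"
  shows "continuous_on S (\<lambda>s. G (\<lambda>i. x i s))"
  unfolding continuous_on_def
proof (intro ballI tendstoI)
  fix s e assume s: "s \<in> S" and e: "(0::real) < e"
  have "\<forall>i\<in>{..<n}. eventually (\<lambda>t. \<bar>x i t - x i s\<bar> < e / (2 * L)) (at s within S)"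
    using x s L e unfolding continuous_on_def tendsto_iff dist_real_def by (auto simp: )
  then have "eventually (\<lambda>t. \<forall>i\<in>{..<n}. \<bar>x i t - x i s\<bar> < e / (2 * L)) (at s within S)"
    by (rule eventually_ball_finite[rotated]) simp
  then show "eventually (\<lambda>t. dist (G (\<lambda>i. x i t)) (G (\<lambda>i. x i s)) < e) (at s within S)"
  proof eventually_elim
    case (elim t)
    have "\<bar>G (\<lambda>i. x i t) - G (\<lambda>i. x i s)\<bar> \<le> L * (e / (2 * L))"
      using elim e L by (intro lip) (auto intro: less_imp_le)
    also have "\<dots> < e" using L e by simp
    finally show ?case by (simp add: dist_real_def)
  qed
qed

text \<open>The inhomogeneity enters through its integral \<open>\<Phi>\<close>, so a force that is
  merely integrable in time causes no difficulty. The whole vector of unknowns is a single bounded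
  continuous function on \<open>real \<times> nat discrete\<close>, which makes Banach's fixed point
  theorem on the complete type of such functions applicable for every \<open>n\<close> at
  once.\<close>

lemma picard_finite_system:
  fixes G :: "nat \<Rightarrow> (nat \<Rightarrow> real) \<Rightarrow> real" and \<Phi> :: "nat \<Rightarrow> real \<Rightarrow> real"
  assumes T: "0 \<le> T" and L: "0 < L"
    and \<Phi>: "\<And>k. k < n \<Longrightarrow> continuous_on {0..T} (\<Phi> k)"
    and lip: "\<And>k x y e. k < n \<Longrightarrow> (\<And>i. i < n \<Longrightarrow> \<bar>x i - y i\<bar> \<le> e) \<Longrightarrow> 0 \<le> e \<Longrightarrow> \<bar>G k x - G k y\<bar> \<le> L * e"
  obtains x :: "nat \<Rightarrow> real \<Rightarrow> real" where "\<And>k. continuous_on UNIV (x k)" "\<And>k t. n \<le> k \<Longrightarrow> x k t = 0"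
    "\<And>k t. k < n \<Longrightarrow> t \<in> {0..T} \<Longrightarrow> x k t = \<Phi> k t + integral {0..t} (\<lambda>s. G k (\<lambda>i. x i s))"
proof -
  \<comment> \<open>Times outside the interval are clamped to it, because the iterates must be
    continuous and bounded on the whole line.\<close>
  define cl where "cl t = max 0 (min t T)" for t
  have cl: "cl t \<in> {0..T}" for t using T by (auto simp: cl_def)
  have clid: "cl t = t" if "t \<in> {0..T}" for t using that by (auto simp: cl_def)
  have ccl: "continuous_on UNIV cl" unfolding cl_def by (intro continuous_intros)
  \<comment> \<open>The weight \<open>exp (2 L s)\<close> makes the Picard operator a contraction on the whole interval at once.\<close>
  define I where "I z k s = G k (\<lambda>i. exp (2 * L * s) * z (s, discrete i))" for z :: "real \<times> nat discrete \<Rightarrow> real" and k s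
  \<comment> \<open>Here \<open>z (s, discrete k)\<close> stands for component \<open>k\<close> at
    time \<open>s\<close> divided by \<open>exp (2 * L * s)\<close>. Components from
    \<open>n\<close> on are set to 0, so the fixed point vanishes there.\<close>
  define P where "P z = (\<lambda>(t, d). let k = of_discrete d in if k < n then exp (- 2 * L * cl t) * (\<Phi> k (cl t) + integral {0..cl t} (I z k)) else 0)"
    for z :: "real \<times> nat discrete \<Rightarrow> real"
  have Ic: "continuous_on S (I (apply_bcontfun z) k)" if "k < n" for z k S
    unfolding I_def using that
    by (intro continuous_on_finite_lipschitz[OF L lip[OF that], of n])
       (auto intro!: continuous_intros continuous_on_compose2[OF continuous_on_apply_bcontfun[of UNIV]])
  have J: "continuous_on {0..T} (\<lambda>t. exp (- 2 * L * t) * (\<Phi> k t + integral {0..t} (I (apply_bcontfun z) k)))" if "k < n" for z k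
    using that by (intro continuous_intros \<Phi> indefinite_integral_continuous_1 integrable_continuous_interval Ic)
  have Pk: "continuous_on UNIV (\<lambda>t. P (apply_bcontfun z) (t, discrete k))" for z k
  proof (cases "k < n")
    case True
    have "continuous_on UNIV ((\<lambda>t. exp (- 2 * L * t) * (\<Phi> k t + integral {0..t} (I (apply_bcontfun z) k))) \<circ> cl)"
      by (rule continuous_on_compose[OF ccl continuous_on_subset[OF J[OF True]]]) (use cl in auto)
    then show ?thesis using True by (simp add: P_def o_def discrete_inverse)
  qed (simp add: P_def discrete_inverse)
  have Pc: "continuous_on UNIV (P (apply_bcontfun z))" for z
  proof -
    \<comment> \<open>The slices with a fixed index are open, so continuity in time on each slice is
      enough.\<close>
    have "continuous_on (\<Union>k. UNIV \<times> {discrete k}) (P (apply_bcontfun z))"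
    proof (rule continuous_on_open_UN)
      fix k :: nat
      show "open (UNIV \<times> {discrete k} :: (real \<times> nat discrete) set)" by (intro open_Times) (auto simp: open_discrete)
      have "continuous_on (UNIV \<times> {discrete k}) ((\<lambda>t. P (apply_bcontfun z) (t, discrete k)) \<circ> fst)"
        by (rule continuous_on_compose) (auto intro!: continuous_intros continuous_on_subset[OF Pk])
      then show "continuous_on (UNIV \<times> {discrete k}) (P (apply_bcontfun z))"
        by (rule continuous_on_eq) auto
    qed
    moreover have "(\<Union>k. UNIV \<times> {discrete k}) = (UNIV :: (real \<times> nat discrete) set)"
      by (auto intro: of_discrete_inverse[symmetric])
    ultimately show ?thesis by simp
  qed
  have Pb: "bounded (range (P (apply_bcontfun z)))" for z
  proof (rule bounded_subset)
    let ?B = "(\<Union>k\<in>{..<n}. (\<lambda>t. exp (- 2 * L * t) * (\<Phi> k t + integral {0..t} (I (apply_bcontfun z) k))) ` {0..T})"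
    show "bounded (insert 0 ?B)"
      by (simp only: bounded_insert, intro bounded_UN ballI compact_imp_bounded compact_continuous_image J) auto
    show "range (P (apply_bcontfun z)) \<subseteq> insert 0 ?B"
      using cl by (force simp: P_def Let_def split: if_splits)
  qed
  define Q where "Q z = Bcontfun (P (apply_bcontfun z))" for z
  have Qa: "apply_bcontfun (Q z) = P (apply_bcontfun z)" for z
    unfolding Q_def by (intro Bcontfun_inverse) (simp add: bcontfun_def Pc Pb)
  have "\<exists>!z. Q z = z"
  proof (rule banach_fix_type[of "1/2" Q])
    have "dist (Q z) (Q y) \<le> 1/2 * dist z y" for z y
    proof (rule dist_bound)
      fix p :: "real \<times> nat discrete"
      obtain t k where p: "p = (t, discrete k)" by (metis of_discrete_inverse surj_pair)
      show "dist (apply_bcontfun (Q z) p) (apply_bcontfun (Q y) p) \<le> 1/2 * dist z y"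
      proof (cases "k < n")
        case True
        let ?t = "cl t"
        have t0: "0 \<le> ?t" using cl[of t] by auto
        have iz: "I (apply_bcontfun z) k integrable_on {0..?t}" "I (apply_bcontfun y) k integrable_on {0..?t}"
          using True by (auto intro!: integrable_continuous_interval Ic)
        \<comment> \<open>Integrating \<open>L\<close> against the weight with rate
          \<open>2 * L\<close> leaves the factor \<open>1 / 2\<close>, which is the contraction
          constant.\<close>
        have hi: "((\<lambda>s. L * (exp (2 * L * s) * dist z y)) has_integral (exp (2*L*?t) * dist z y / 2 - exp (2*L*0) * dist z y / 2)) {0..?t}"
          by (rule fundamental_theorem_of_calculus[OF t0])
             (auto intro!: derivative_eq_intros simp flip: has_real_derivative_iff_has_vector_derivative)
        have "norm (integral {0..?t} (\<lambda>s. I (apply_bcontfun z) k s - I (apply_bcontfun y) k s))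
              \<le> integral {0..?t} (\<lambda>s. L * (exp (2 * L * s) * dist z y))"
        proof (rule integral_norm_bound_integral)
          fix s
          show "norm (I (apply_bcontfun z) k s - I (apply_bcontfun y) k s) \<le> L * (exp (2 * L * s) * dist z y)"
            unfolding I_def real_norm_def
          proof (rule lip[OF True])
            fix i
            have "\<bar>apply_bcontfun z (s, discrete i) - apply_bcontfun y (s, discrete i)\<bar> \<le> dist z y"
              using dist_bounded[of z "(s, discrete i)" y] by (simp add: dist_real_def)
            then show "\<bar>exp (2 * L * s) * apply_bcontfun z (s, discrete i) - exp (2 * L * s) * apply_bcontfun y (s, discrete i)\<bar> \<le> exp (2 * L * s) * dist z y"
              by (simp add: abs_mult flip: right_diff_distrib)
          qed auto
        qed (use iz hi in \<open>auto intro!: integrable_diff\<close>)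
        also have "\<dots> \<le> exp (2*L*?t) * dist z y / 2" using integral_unique[OF hi] by simp
        finally have b: "\<bar>integral {0..?t} (I (apply_bcontfun z) k) - integral {0..?t} (I (apply_bcontfun y) k)\<bar> \<le> exp (2*L*?t) * dist z y / 2"
          using iz by (simp add: Henstock_Kurzweil_Integration.integral_diff)
        have "dist (apply_bcontfun (Q z) p) (apply_bcontfun (Q y) p) =
            exp (- 2 * L * ?t) * \<bar>integral {0..?t} (I (apply_bcontfun z) k) - integral {0..?t} (I (apply_bcontfun y) k)\<bar>"
          using True by (simp add: Qa p P_def discrete_inverse dist_real_def abs_mult flip: right_diff_distrib)
        also have "\<dots> \<le> exp (- 2 * L * ?t) * (exp (2*L*?t) * dist z y / 2)"
          using b by (intro mult_left_mono) auto
        also have "\<dots> = dist z y / 2" by (simp add: exp_minus field_simps)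
        finally show ?thesis by simp
      qed (simp add: Qa p P_def discrete_inverse)
    qed
    then show "\<forall>x y. dist (Q x) (Q y) \<le> 1/2 * dist x y" by blast
  qed auto
  then obtain z where z: "Q z = z" by blast
  have zP: "apply_bcontfun z p = P (apply_bcontfun z) p" for p using Qa[of z] z by simp
  define x where "x k t = exp (2 * L * t) * apply_bcontfun z (t, discrete k)" for k t
  show ?thesis
  proof
    fix k show "continuous_on UNIV (x k)" unfolding x_def
      by (intro continuous_intros continuous_on_compose2[OF continuous_on_apply_bcontfun[of UNIV]]) auto
  next
    fix k t assume "n \<le> k" then show "x k t = 0" by (subst x_def, subst zP) (simp add: P_def discrete_inverse)
  next
    fix k t assume k: "k < n" and t: "t \<in> {0..T}"
    show "x k t = \<Phi> k t + integral {0..t} (\<lambda>s. G k (\<lambda>i. x i s))"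
    proof -
      have "I (apply_bcontfun z) k = (\<lambda>s. G k (\<lambda>i. x i s))" by (simp add: I_def x_def fun_eq_iff)
      then show ?thesis
        unfolding x_def[of k] by (subst zP) (simp add: P_def discrete_inverse k clid[OF t] exp_minus field_simps)
    qed
  qed
qed

section \<open>Radial retraction onto a ball\<close>

text \<open>With denominators \<open>a\<close> and \<open>b\<close>, the difference splits into
  \<open>(R / a) * (x i - y i)\<close> and a multiple of \<open>y i\<close> whose factor contains
  \<open>b - a\<close>. The first part is bounded by \<open>d\<close> because
  \<open>R \<le> a\<close>, the second because \<open>\<bar>b - a\<bar> \<le> d\<close> and
  \<open>L2_set y A \<le> b\<close>. The retraction serves to make a locally Lipschitz nonlinearity
  globally Lipschitz.\<close>

lemma L2_set_radial_retraction:
  fixes x y :: "nat \<Rightarrow> real"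
  assumes R: "0 < R"
  shows "L2_set (\<lambda>i. x i * (R / max R (L2_set x A)) - y i * (R / max R (L2_set y A))) A \<le> 2 * L2_set (\<lambda>i. x i - y i) A"
proof -
  define a b d where "a = max R (L2_set x A)" and "b = max R (L2_set y A)" and "d = L2_set (\<lambda>i. x i - y i) A"
  have ab: "R \<le> a" "R \<le> b" "0 < a" "0 < b" "L2_set y A \<le> b" using R by (auto simp: a_def b_def)
  have d0: "0 \<le> d" by (simp add: d_def)
  have "L2_set x A \<le> d + L2_set y A" 
    using L2_set_triangle_ineq[of "\<lambda>i. x i - y i" y A] by (simp add: d_def)
  moreover have "L2_set y A \<le> d + L2_set x A" 
    using L2_set_triangle_ineq[of "\<lambda>i. y i - x i" x A]
    by (simp add: d_def L2_set_def power2_commute)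
  ultimately have abd: "\<bar>b - a\<bar> \<le> d" unfolding a_def b_def by linarith
  have "x i * (R / a) - y i * (R / b) = (R / a) * (x i - y i) + (R * (b - a) / (a * b)) * y i" for i
    using ab by (simp add: field_simps)
  then have "L2_set (\<lambda>i. x i * (R / a) - y i * (R / b)) A \<le>
      L2_set (\<lambda>i. (R / a) * (x i - y i)) A + L2_set (\<lambda>i. (R * (b - a) / (a * b)) * y i) A"
    by (simp only: L2_set_triangle_ineq)
  also have "L2_set (\<lambda>i. (R / a) * (x i - y i)) A = (R / a) * d"
    using R ab unfolding d_def by (intro L2_set_right_distrib[symmetric]) auto
  also have "L2_set (\<lambda>i. (R * (b - a) / (a * b)) * y i) A = L2_set (\<lambda>i. \<bar>R * (b - a) / (a * b)\<bar> * y i) A"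
    unfolding L2_set_def power_mult_distrib power2_abs by (rule refl)
  also have "\<dots> = \<bar>R * (b - a) / (a * b)\<bar> * L2_set y A"
    by (intro L2_set_right_distrib[symmetric]) auto
  also have "(R / a) * d + \<bar>R * (b - a) / (a * b)\<bar> * L2_set y A \<le> 1 * d + d"
  proof (intro add_mono mult_right_mono)
    show "R / a \<le> 1" using ab by simp
    have "\<bar>R * (b - a) / (a * b)\<bar> * L2_set y A = (R / a) * \<bar>b - a\<bar> * (L2_set y A / b)"
      using ab R by (simp add: abs_mult)
    also have "\<dots> \<le> 1 * d * 1"
      using ab R abd d0 by (intro mult_mono) auto
    finally show "\<bar>R * (b - a) / (a * b)\<bar> * L2_set y A \<le> d" by simp
  qed (rule d0)
  finally show ?thesis by (simp add: a_def b_def d_def)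
qed

section \<open>Galerkin approximation in coefficient space\<close>

text \<open>The evolution problem in eigenbasis coordinates. \<open>f2\<close> dominates the squared
  dual norm of the force, which in coordinates is the sum of \<open>(F k s)\<^sup>2 / lam k\<close>.
  The weight \<open>lam\<close> in the premises of \<open>q_lip\<close> marks coefficient sequences
  of elements of \<open>V\<close>, where \<open>q\<close> has a meaning; the bound itself contains
  unweighted sums only, and this is what makes strong convergence in \<open>l^2\<close> sufficient
  for the limit.\<close>

locale galerkin_data =
  fixes lam :: "nat \<Rightarrow> real" and q :: "nat \<Rightarrow> (nat \<Rightarrow> real) \<Rightarrow> real" and C :: "nat \<Rightarrow> real"
    and F :: "nat \<Rightarrow> real \<Rightarrow> real" and f2 :: "real \<Rightarrow> real" and c0 :: "nat \<Rightarrow> real" and \<nu> T :: real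
  assumes T: "0 < T" and \<nu>: "0 < \<nu>" and lam_pos: "\<And>k. 0 < lam k" and lam_lim: "filterlim lam at_top sequentially"
    and c0: "summable (\<lambda>k. (c0 k)\<^sup>2)"
    and F_int: "\<And>k. F k absolutely_integrable_on {0..T}"
    and f2_int: "f2 absolutely_integrable_on {0..T}"
    and F_le: "\<And>n s. s \<in> {0..T} \<Longrightarrow> (\<Sum>k<n. (F k s)\<^sup>2 / lam k) \<le> f2 s"
    and C_nonneg: "\<And>k. 0 \<le> C k"
    and q_zero: "\<And>k. q k (\<lambda>i. 0) = 0"
    and q_lip: "\<And>k c d. summable (\<lambda>i. lam i * (c i)\<^sup>2) \<Longrightarrow> summable (\<lambda>i. lam i * (d i)\<^sup>2) \<Longrightarrow>
      \<bar>q k c - q k d\<bar> \<le> C k * sqrt (\<Sum>i. (c i - d i)\<^sup>2) * (sqrt (\<Sum>i. (c i)\<^sup>2) + sqrt (\<Sum>i. (d i)\<^sup>2))"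
    and q_cancel: "\<And>n c. (\<And>k. n \<le> k \<Longrightarrow> c k = 0) \<Longrightarrow> (\<Sum>k<n. c k * q k c) = 0"
begin

text \<open>Upper bound for the energy at every time and for \<open>\<nu>\<close> times the
  accumulated dissipation: initial energy plus the integral left over from Young's inequality
  applied to the work of the force.\<close>

definition K :: real where "K = (\<Sum>k. (c0 k)\<^sup>2) + integral {0..T} f2 / \<nu>"

lemma f2_nonneg: "s \<in> {0..T} \<Longrightarrow> 0 \<le> f2 s"
  using F_le[of s 0] by simp

lemma f2_on: "f2 integrable_on {0..T}" and F_on: "F k integrable_on {0..T}"
  using f2_int F_int by (auto intro: set_lebesgue_integral_eq_integral(1))

lemma K_nonneg: "0 \<le> K"
  unfolding K_def using \<nu> f2_on
  by (intro add_nonneg_nonneg suminf_nonneg c0 divide_nonneg_pos integral_nonneg) (auto intro!: f2_nonneg)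

lemma suminf_finite_support:
  assumes "\<And>k. n \<le> k \<Longrightarrow> h k = (0::real)"
  shows "suminf h = (\<Sum>k<n. h k)" "summable h"
  using assms by (auto intro!: suminf_finite summable_finite[of "{..<n}"] simp: linorder_not_less[symmetric])

lemma sqrt_suminf_L2_set:
  assumes "\<And>k. n \<le> k \<Longrightarrow> h k = (0::real)"
  shows "sqrt (\<Sum>i. (h i)\<^sup>2) = L2_set h {..<n}"
  unfolding L2_set_def using suminf_finite_support(1)[of n "\<lambda>i. (h i)\<^sup>2"] assms by simp

lemma q_lip_finite:
  assumes "\<And>k. n \<le> k \<Longrightarrow> c k = 0" "\<And>k. n \<le> k \<Longrightarrow> d k = 0"
  shows "\<bar>q k c - q k d\<bar> \<le> C k * L2_set (\<lambda>i. c i - d i) {..<n} * (L2_set c {..<n} + L2_set d {..<n})"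
  using q_lip[of c d k] sqrt_suminf_L2_set[of n c] sqrt_suminf_L2_set[of n d] sqrt_suminf_L2_set[of n "\<lambda>i. c i - d i"]
    suminf_finite_support(2)[of n "\<lambda>i. lam i * (c i)\<^sup>2"] suminf_finite_support(2)[of n "\<lambda>i. lam i * (d i)\<^sup>2"] assms
  by simp

text \<open>The quadratic term is evaluated at the retraction of the state to a ball, which makes
  the system globally Lipschitz. The cancellation survives this change, because retracting only
  multiplies the state by a positive number. The energy bound then keeps the solution inside the
  ball, where the retraction is the identity, so the original truncated system is solved.\<close>

lemma galerkin_finite:
  obtains x :: "nat \<Rightarrow> real \<Rightarrow> real" where "\<And>k. continuous_on UNIV (x k)" "\<And>k t. n \<le> k \<Longrightarrow> x k t = 0"
    "\<And>t. t \<in> {0..T} \<Longrightarrow> (\<Sum>k<n. (x k t)\<^sup>2) + \<nu> * integral {0..t} (\<lambda>s. \<Sum>k<n. lam k * (x k s)\<^sup>2) \<le> K"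
    "\<And>k t. k < n \<Longrightarrow> t \<in> {0..T} \<Longrightarrow>
       x k t = c0 k + integral {0..t} (\<lambda>s. F k s - \<nu> * lam k * x k s + q k (\<lambda>i. x i s))"
    "\<And>k. k < n \<Longrightarrow> continuous_on {0..T} (\<lambda>s. q k (\<lambda>i. x i s))"
proof -
  \<comment> \<open>Exceeds the radius allowed by the energy bound, and is positive even for
    \<open>K = 0\<close>.\<close>
  define R where "R = sqrt K + 1"
  have R: "0 < R" using K_nonneg by (simp add: R_def add_nonneg_pos)
  define P where "P x = (\<lambda>i. if i < n then x i * (R / max R (L2_set x {..<n})) else 0)" for x :: "nat \<Rightarrow> real"
  have P0: "P x k = 0" if "n \<le> k" for x k using that by (simp add: P_def)
  have Pn: "L2_set (P x) {..<n} \<le> R" for x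
  proof -
    have "L2_set (P x) {..<n} = L2_set (\<lambda>i. (R / max R (L2_set x {..<n})) * x i) {..<n}"
      by (intro L2_set_cong) (auto simp: P_def)
    also have "\<dots> = (R / max R (L2_set x {..<n})) * L2_set x {..<n}"
      using R by (intro L2_set_right_distrib[symmetric]) auto
    also have "\<dots> \<le> R" using R by (simp add: field_simps mult_left_mono)
    finally show ?thesis .
  qed
  have Pd: "L2_set (\<lambda>i. P x i - P y i) {..<n} \<le> 2 * L2_set (\<lambda>i. x i - y i) {..<n}" for x y
  proof -
    have "L2_set (\<lambda>i. P x i - P y i) {..<n} =
       L2_set (\<lambda>i. x i * (R / max R (L2_set x {..<n})) - y i * (R / max R (L2_set y {..<n}))) {..<n}"
      by (intro L2_set_cong) (auto simp: P_def)
    then show ?thesis using L2_set_radial_retraction[OF R, of x "{..<n}" y] by simp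
  qed
  define G where "G k x = - \<nu> * lam k * x k + q k (P x)" for k and x :: "nat \<Rightarrow> real"
  \<comment> \<open>Summing over \<open>k\<close> gives one constant for all components, and the 1
    keeps it positive for \<open>n = 0\<close>. The factor \<open>2 * real n\<close> combines the
    retraction constant with the passage from the maximum to the Euclidean norm;
    \<open>2 * R\<close> bounds the sum of the norms of the two retracted states.\<close>
  define L where "L = (\<Sum>k<n. \<nu> * lam k + C k * (2 * real n) * (2 * R)) + 1"
  have term0: "0 \<le> \<nu> * lam k + C k * (2 * real n) * (2 * R)" for k
    using \<nu> lam_pos[of k] C_nonneg[of k] R by simp
  have L: "0 < L" unfolding L_def by (intro add_nonneg_pos sum_nonneg term0) auto
  have qP: "\<bar>q k (P x) - q k (P y)\<bar> \<le> C k * (2 * real n) * (2 * R) * e"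
    if xy: "\<And>i. i < n \<Longrightarrow> \<bar>x i - y i\<bar> \<le> e" and e: "0 \<le> e" for k x y e
  proof -
    have "L2_set (\<lambda>i. x i - y i) {..<n} \<le> (\<Sum>i<n. \<bar>x i - y i\<bar>)" by (rule L2_set_le_sum_abs)
    also have "\<dots> \<le> (\<Sum>i<n. e)" using xy by (intro sum_mono) auto
    finally have 1: "L2_set (\<lambda>i. x i - y i) {..<n} \<le> real n * e" by simp
    have "\<bar>q k (P x) - q k (P y)\<bar> \<le> C k * L2_set (\<lambda>i. P x i - P y i) {..<n} * (L2_set (P x) {..<n} + L2_set (P y) {..<n})"
      by (intro q_lip_finite P0)
    also have "\<dots> \<le> C k * (2 * (real n * e)) * (R + R)"
      using C_nonneg[of k] Pd[of x y] 1 Pn[of x] Pn[of y] e by (intro mult_mono add_mono) auto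
    finally show ?thesis by (simp add: algebra_simps)
  qed
  have lip: "\<bar>G k x - G k y\<bar> \<le> L * e"
    if k: "k < n" and xy: "\<And>i. i < n \<Longrightarrow> \<bar>x i - y i\<bar> \<le> e" and e: "0 \<le> e" for k x y e
  proof -
    have "G k x - G k y = - (\<nu> * lam k * (x k - y k)) + (q k (P x) - q k (P y))" by (simp add: G_def algebra_simps)
    then have "\<bar>G k x - G k y\<bar> \<le> \<bar>\<nu> * lam k * (x k - y k)\<bar> + \<bar>q k (P x) - q k (P y)\<bar>" by linarith
    also have "\<dots> \<le> \<nu> * lam k * e + C k * (2 * real n) * (2 * R) * e"
      using \<nu> lam_pos[of k] xy[OF k] by (intro add_mono qP xy e) (auto simp: abs_mult)
    also have "\<dots> = (\<nu> * lam k + C k * (2 * real n) * (2 * R)) * e" by (simp add: algebra_simps)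
    also have "\<dots> \<le> L * e"
      using member_le_sum[of k "{..<n}" "\<lambda>k. \<nu> * lam k + C k * (2 * real n) * (2 * R)"] k term0 e
      by (intro mult_right_mono) (auto simp: L_def)
    finally show ?thesis .
  qed
  obtain x where xc: "\<And>k. continuous_on UNIV (x k)" and x0: "\<And>k t. n \<le> k \<Longrightarrow> x k t = 0"
    and xe: "\<And>k t. k < n \<Longrightarrow> t \<in> {0..T} \<Longrightarrow> x k t = (c0 k + integral {0..t} (F k)) + integral {0..t} (\<lambda>s. G k (\<lambda>i. x i s))"
  proof (rule picard_finite_system[of T L n "\<lambda>k t. c0 k + integral {0..t} (F k)" G])
    show "0 \<le> T" using T by simp
    show "continuous_on {0..T} (\<lambda>t. c0 k + integral {0..t} (F k))" for k
      by (intro continuous_intros indefinite_integral_continuous_1 F_on)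
  qed (use L lip in \<open>auto\<close>)
  have xcS: "continuous_on S (x k)" for k S using xc continuous_on_subset by blast
  have Gc: "continuous_on S (\<lambda>s. G k (\<lambda>i. x i s))" if "k < n" for k S
    by (rule continuous_on_finite_lipschitz[OF L lip[OF that]]) (auto intro: xcS)
  define g where "g k s = F k s + G k (\<lambda>i. x i s)" for k s
  have xg: "x k t = c0 k + integral {0..t} (g k)" if "k < n" "t \<in> {0..T}" for k t
  proof -
    have "F k integrable_on {0..t}" using that by (intro integrable_on_subinterval[OF F_on]) auto
    moreover have "(\<lambda>s. G k (\<lambda>i. x i s)) integrable_on {0..t}" 
      by (intro integrable_continuous_interval Gc that)
    ultimately show ?thesis using xe[OF that] unfolding g_def
      by (simp add: Henstock_Kurzweil_Integration.integral_add)
  qed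
  have g_int: "g k absolutely_integrable_on {0..t}" if "k < n" "t \<in> {0..T}" for k t
    unfolding g_def using that
    by (intro set_integral_add absolutely_integrable_on_subinterval[OF F_int] absolutely_integrable_continuous_real Gc) auto
  have energy: "(\<Sum>k<n. (x k t)\<^sup>2) + \<nu> * integral {0..t} (\<lambda>s. \<Sum>k<n. lam k * (x k s)\<^sup>2) \<le> K" if t: "t \<in> {0..T}" for t
  proof -
    \<comment> \<open>The product rule with both factors equal to \<open>x k\<close>: twice the
      integral of \<open>x k * g k\<close> is the growth of the energy of one mode.\<close>
    have 1: "(\<lambda>s. g k s * x k s + x k s * g k s) absolutely_integrable_on {0..t}"
        "integral {0..t} (\<lambda>s. g k s * x k s + x k s * g k s) = (x k t)\<^sup>2 - (c0 k)\<^sup>2" if k: "k < n" for k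
    proof -
      have *: "\<And>s. s \<in> {0..t} \<Longrightarrow> x k s = c0 k + integral {0..s} (g k)" using xg[OF k] t by auto
      have "x k 0 = c0 k" using *[of 0] t by simp
      then show "(\<lambda>s. g k s * x k s + x k s * g k s) absolutely_integrable_on {0..t}"
        "integral {0..t} (\<lambda>s. g k s * x k s + x k s * g k s) = (x k t)\<^sup>2 - (c0 k)\<^sup>2"
        using ac_product[OF _ g_int[OF k t] g_int[OF k t] * *] t by (auto simp: power2_eq_square)
    qed
    have gi: "(\<lambda>s. g k s * x k s + x k s * g k s) integrable_on {0..t}" if "k < n" for k
      using 1(1)[OF that] by (rule set_lebesgue_integral_eq_integral(1))
    have "(\<Sum>k<n. (x k t)\<^sup>2) - (\<Sum>k<n. (c0 k)\<^sup>2) = (\<Sum>k<n. integral {0..t} (\<lambda>s. g k s * x k s + x k s * g k s))"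
      using 1(2) by (simp add: sum_subtractf)
    also have "\<dots> = integral {0..t} (\<lambda>s. \<Sum>k<n. g k s * x k s + x k s * g k s)"
      using gi by (subst Henstock_Kurzweil_Integration.integral_sum) auto
    also have "\<dots> \<le> integral {0..t} (\<lambda>s. f2 s / \<nu> - \<nu> * (\<Sum>k<n. lam k * (x k s)\<^sup>2))"
    proof (rule integral_le)
      show "(\<lambda>s. \<Sum>k<n. g k s * x k s + x k s * g k s) integrable_on {0..t}"
        using gi by (intro integrable_sum) auto
      show "(\<lambda>s. f2 s / \<nu> - \<nu> * (\<Sum>k<n. lam k * (x k s)\<^sup>2)) integrable_on {0..t}"
        using integrable_on_subinterval[OF f2_on, of 0 t] t
        by (intro integrable_diff integrable_on_divide integrable_continuous_interval[of _ _ "\<lambda>s. \<nu> * _ s"]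
              continuous_intros xcS) auto
      fix s assume s: "s \<in> {0..t}"
      define X where "X = (\<lambda>i. x i s)"
      have X0: "X k = 0" if "n \<le> k" for k using x0 that by (simp add: X_def)
      \<comment> \<open>A single positive factor for all modes, so the cancellation at
        \<open>P X\<close> can be divided by it and gives the cancellation of \<open>X\<close>
        against \<open>q k (P X)\<close>.\<close>
      define r where "r = R / max R (L2_set X {..<n})"
      have r: "r > 0" using R by (simp add: r_def)
      have "P X k = r * X k" if "k < n" for k using that by (simp add: P_def r_def)
      then have "(\<Sum>k<n. P X k * q k (P X)) = r * (\<Sum>k<n. X k * q k (P X))"
        by (simp add: sum_distrib_left mult.assoc)
      then have can: "(\<Sum>k<n. X k * q k (P X)) = 0" using q_cancel[of n "P X"] P0 r by simp
      have "(\<Sum>k<n. g k s * x k s + x k s * g k s) = (\<Sum>k<n. 2 * (F k s * X k) - 2 * \<nu> * (lam k * (X k)\<^sup>2) + 2 * (X k * q k (P X)))"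
        by (intro sum.cong refl) (simp add: g_def G_def X_def power2_eq_square algebra_simps)
      also have "\<dots> = (\<Sum>k<n. 2 * (F k s * X k)) - 2 * \<nu> * (\<Sum>k<n. lam k * (X k)\<^sup>2)"
        using can by (simp add: sum.distrib sum_subtractf flip: sum_distrib_left)
      \<comment> \<open>Young's inequality with weight \<open>lam k * \<nu>\<close>. It consumes
        half of the dissipation \<open>2 * \<nu> * lam k * (X k)\<^sup>2\<close>; the other half
        stays in the energy bound.\<close>
      also have "(\<Sum>k<n. 2 * (F k s * X k)) \<le> (\<Sum>k<n. ((F k s)\<^sup>2 / lam k) / \<nu> + \<nu> * (lam k * (X k)\<^sup>2))"
      proof (rule sum_mono)
        fix k
        have p: "0 < lam k * \<nu>" using lam_pos \<nu> by simp
        have "0 \<le> (F k s - (lam k * \<nu>) * X k)\<^sup>2 / (lam k * \<nu>)" using p by simp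
        also have "\<dots> = ((F k s)\<^sup>2 / lam k) / \<nu> + \<nu> * (lam k * (X k)\<^sup>2) - 2 * (F k s * X k)"
          using lam_pos[of k] \<nu> by (simp add: power2_eq_square field_simps)
        finally show "2 * (F k s * X k) \<le> ((F k s)\<^sup>2 / lam k) / \<nu> + \<nu> * (lam k * (X k)\<^sup>2)" by simp
      qed
      also have "\<dots> = (\<Sum>k<n. (F k s)\<^sup>2 / lam k) / \<nu> + \<nu> * (\<Sum>k<n. lam k * (X k)\<^sup>2)"
        by (simp add: sum.distrib sum_distrib_left sum_divide_distrib)
      also have "(\<Sum>k<n. (F k s)\<^sup>2 / lam k) / \<nu> \<le> f2 s / \<nu>"
        using F_le[of s n] s t \<nu> by (intro divide_right_mono) auto
      finally show "(\<Sum>k<n. g k s * x k s + x k s * g k s) \<le> f2 s / \<nu> - \<nu> * (\<Sum>k<n. lam k * (x k s)\<^sup>2)"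
        by (simp add: X_def)
    qed
    also have "\<dots> = integral {0..t} f2 / \<nu> - \<nu> * integral {0..t} (\<lambda>s. \<Sum>k<n. lam k * (x k s)\<^sup>2)"
    proof -
      have a: "(\<lambda>s. f2 s / \<nu>) integrable_on {0..t}"
        using integrable_on_subinterval[OF f2_on, of 0 t] t by (intro integrable_on_divide) auto
      have b: "(\<lambda>s. \<nu> * (\<Sum>k<n. lam k * (x k s)\<^sup>2)) integrable_on {0..t}"
        by (intro integrable_continuous_interval continuous_intros xcS)
      show ?thesis using Henstock_Kurzweil_Integration.integral_diff[OF a b] by simp
    qed
    finally have A: "(\<Sum>k<n. (x k t)\<^sup>2) - (\<Sum>k<n. (c0 k)\<^sup>2) \<le> integral {0..t} f2 / \<nu> - \<nu> * integral {0..t} (\<lambda>s. \<Sum>k<n. lam k * (x k s)\<^sup>2)" .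
    have "integral {0..t} f2 \<le> integral {0..T} f2"
      using t f2_on by (intro integral_subset_le integrable_on_subinterval[OF f2_on]) (auto intro!: f2_nonneg)
    then have "integral {0..t} f2 / \<nu> \<le> integral {0..T} f2 / \<nu>" using \<nu> by (intro divide_right_mono) auto
    moreover have "(\<Sum>k<n. (c0 k)\<^sup>2) \<le> (\<Sum>k. (c0 k)\<^sup>2)"
      by (intro sum_le_suminf c0) auto
    ultimately show ?thesis using A unfolding K_def by linarith
  qed
  \<comment> \<open>The energy bound puts the state into the ball of radius \<open>R\<close>, so the
    retraction has been inactive all along.\<close>
  have PX: "P (\<lambda>i. x i t) = (\<lambda>i. x i t)" if t: "t \<in> {0..T}" for t
  proof -
    have "0 \<le> integral {0..t} (\<lambda>s. \<Sum>k<n. lam k * (x k s)\<^sup>2)"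
      using lam_pos by (intro integral_nonneg integrable_continuous_interval continuous_intros xcS sum_nonneg mult_nonneg_nonneg)
         (simp_all add: less_imp_le)
    then have "0 \<le> \<nu> * integral {0..t} (\<lambda>s. \<Sum>k<n. lam k * (x k s)\<^sup>2)" using \<nu> by simp
    then have "(\<Sum>k<n. (x k t)\<^sup>2) \<le> K" using energy[OF t] by linarith
    then have "L2_set (\<lambda>i. x i t) {..<n} \<le> R"
      unfolding L2_set_def R_def using real_sqrt_le_mono[of "\<Sum>k<n. (x k t)\<^sup>2" K] by linarith
    then show ?thesis using R x0 by (auto simp: P_def max_def fun_eq_iff)
  qed
  show ?thesis
  proof (rule that[of x])
    fix k t assume k: "k < n" and t: "t \<in> {0..T}"
    have "integral {0..t} (g k) = integral {0..t} (\<lambda>s. F k s - \<nu> * lam k * x k s + q k (\<lambda>i. x i s))"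
      using PX t by (intro Henstock_Kurzweil_Integration.integral_cong) (auto simp: g_def G_def)
    then show "x k t = c0 k + integral {0..t} (\<lambda>s. F k s - \<nu> * lam k * x k s + q k (\<lambda>i. x i s))"
      using xg[OF k t] by simp
  next
    fix k assume k: "k < n"
    have "continuous_on {0..T} (\<lambda>s. G k (\<lambda>i. x i s) + \<nu> * lam k * x k s)"
      by (intro continuous_intros Gc xcS k)
    then show "continuous_on {0..T} (\<lambda>s. q k (\<lambda>i. x i s))"
      by (rule continuous_on_eq) (simp add: G_def PX)
  qed (use xc x0 energy in auto)
qed

end

section \<open>Passage to the limit in the Galerkin scheme\<close>

lemma power2_diff_le: "(x - y)\<^sup>2 \<le> 2 * x\<^sup>2 + 2 * (y::real)\<^sup>2"
  using zero_le_power2[of "x + y"] by (simp add: power2_eq_square algebra_simps)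

text \<open>Lebesgue measure is complete, so changing a function on a null set preserves
  measurability; extension by zero carries this over to the restriction to \<open>S\<close>.\<close>

lemma borel_measurable_AE_lebesgue_on:
  fixes f :: "'a::euclidean_space \<Rightarrow> 'b::euclidean_space"
  assumes S: "S \<in> sets lebesgue" and f: "f \<in> borel_measurable (lebesgue_on S)"
    and ae: "AE x in lebesgue_on S. f x = g x"
  shows "g \<in> borel_measurable (lebesgue_on S)"
proof -
  have "(\<lambda>x. if x \<in> S then f x else 0) \<in> borel_measurable lebesgue"
    using f S by (simp add: borel_measurable_if)
  moreover have "AE x in lebesgue. (if x \<in> S then f x else 0) = (if x \<in> S then g x else 0)"
    using ae S by (auto simp: AE_restrict_space_iff)
  ultimately have "(\<lambda>x. if x \<in> S then g x else 0) \<in> borel_measurable lebesgue"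
    by (rule borel_measurable_AE)
  then show ?thesis using S by (simp add: borel_measurable_if)
qed

lemma borel_measurable_LIMSEQ_AE_lebesgue_on:
  fixes f :: "nat \<Rightarrow> 'a::euclidean_space \<Rightarrow> 'b::euclidean_space"
  assumes S: "S \<in> sets lebesgue" and f: "\<And>n. f n \<in> borel_measurable (lebesgue_on S)"
    and ae: "AE x in lebesgue_on S. (\<lambda>n. f n x) \<longlonglongrightarrow> g x"
  shows "g \<in> borel_measurable (lebesgue_on S)"
proof (rule borel_measurable_AE_lebesgue_on[OF S])
  show "(\<lambda>x. lim (\<lambda>n. f n x)) \<in> borel_measurable (lebesgue_on S)"
    using f by (rule borel_measurable_lim_metric)
  show "AE x in lebesgue_on S. lim (\<lambda>n. f n x) = g x"
    using ae by eventually_elim (rule limI)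
qed

text \<open>For each mode the time derivatives of all approximations are dominated by one integrable
  function, so the mode is equicontinuous with a modulus independent of the truncation. The bounds
  on energy and dissipation are inherited by the limit. The remaining difficulty is the quadratic
  term, which involves all modes at once: it converges in \<open>L^1\<close> of time because the
  full \<open>l^2\<close> distance \<open>D\<close> does.\<close>

lemma (in galerkin_data) galerkin_limit:
  defines "M \<equiv> lebesgue_on {0..T}"
  obtains c :: "nat \<Rightarrow> real \<Rightarrow> real" where
    "\<And>k. continuous_on {0..T} (c k)"
    "\<And>t. t \<in> {0..T} \<Longrightarrow> summable (\<lambda>k. (c k t)\<^sup>2)"
    "\<And>t. t \<in> {0..T} \<Longrightarrow> (\<Sum>k. (c k t)\<^sup>2) \<le> K"
    "AE t in M. summable (\<lambda>k. lam k * (c k t)\<^sup>2)"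
    "integrable M (\<lambda>t. \<Sum>k. lam k * (c k t)\<^sup>2)"
    "\<And>k. (\<lambda>s. F k s - \<nu> * lam k * c k s + q k (\<lambda>i. c i s)) absolutely_integrable_on {0..T}"
    "\<And>k t. t \<in> {0..T} \<Longrightarrow> c k t = c0 k + integral {0..t} (\<lambda>s. F k s - \<nu> * lam k * c k s + q k (\<lambda>i. c i s))"
proof -
  define sol where "sol n x \<longleftrightarrow> (\<forall>k. continuous_on UNIV (x k)) \<and> (\<forall>k t. n \<le> k \<longrightarrow> x k t = 0) \<and>
    (\<forall>t\<in>{0..T}. (\<Sum>k<n. (x k t)\<^sup>2) + \<nu> * integral {0..t} (\<lambda>s. \<Sum>k<n. lam k * (x k s)\<^sup>2) \<le> K) \<and>
    (\<forall>k t. k < n \<longrightarrow> t \<in> {0..T} \<longrightarrow> x k t = c0 k + integral {0..t} (\<lambda>s. F k s - \<nu> * lam k * x k s + q k (\<lambda>i. x i s))) \<and>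
    (\<forall>k<n. continuous_on {0..T} (\<lambda>s. q k (\<lambda>i. x i s)))" for n and x :: "nat \<Rightarrow> real \<Rightarrow> real"
  have "\<exists>x. sol n x" for n
  proof (rule galerkin_finite[of n])
    fix x :: "nat \<Rightarrow> real \<Rightarrow> real"
    assume a: "\<And>k. continuous_on UNIV (x k)" "\<And>k t. n \<le> k \<Longrightarrow> x k t = 0"
    "\<And>t. t \<in> {0..T} \<Longrightarrow> (\<Sum>k<n. (x k t)\<^sup>2) + \<nu> * integral {0..t} (\<lambda>s. \<Sum>k<n. lam k * (x k s)\<^sup>2) \<le> K"
    "\<And>k t. k < n \<Longrightarrow> t \<in> {0..T} \<Longrightarrow>
       x k t = c0 k + integral {0..t} (\<lambda>s. F k s - \<nu> * lam k * x k s + q k (\<lambda>i. x i s))"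
    "\<And>k. k < n \<Longrightarrow> continuous_on {0..T} (\<lambda>s. q k (\<lambda>i. x i s))"
    show "\<exists>x. sol n x" unfolding sol_def by (intro exI[of _ x] conjI allI ballI impI a)
  qed
  then obtain X where X: "\<And>n. sol n (X n)" by metis
  note X' = X[unfolded sol_def]
  have Xc: "continuous_on UNIV (X n k)" for n k
    by (rule X'[THEN conjunct1, THEN spec])
  have X0: "X n k t = 0" if "n \<le> k" for n k t
    using that by (rule X'[THEN conjunct2, THEN conjunct1, rule_format])
  have XE: "(\<Sum>k<n. (X n k t)\<^sup>2) + \<nu> * integral {0..t} (\<lambda>s. \<Sum>k<n. lam k * (X n k s)\<^sup>2) \<le> K" if "t \<in> {0..T}" for n t
    using that by (rule X'[THEN conjunct2, THEN conjunct2, THEN conjunct1, rule_format])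
  have Xe: "X n k t = c0 k + integral {0..t} (\<lambda>s. F k s - \<nu> * lam k * X n k s + q k (\<lambda>i. X n i s))"
    if "k < n" "t \<in> {0..T}" for n k t
    using that by (rule X'[THEN conjunct2, THEN conjunct2, THEN conjunct2, THEN conjunct1, rule_format])
  have qXc: "continuous_on {0..T} (\<lambda>s. q k (\<lambda>i. X n i s))" if "k < n" for n k
    using that by (rule X'[THEN conjunct2, THEN conjunct2, THEN conjunct2, THEN conjunct2, rule_format])
  have XcS: "continuous_on S (X n k)" for n k S using Xc continuous_on_subset by blast
  have T0: "T \<in> {0..T}" "0 \<le> T" using T by auto
  have lam_nn: "0 \<le> lam k" for k using lam_pos[of k] by simp
  have cont_int: "integrable M h" if "continuous_on {0..T} h" for h :: "real \<Rightarrow> real"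
    using absolutely_integrable_continuous_real[OF that] unfolding M_def
    by (simp add: set_integrable_def integrable_restrict_space)
  have cont_meas: "h \<in> borel_measurable M" if "continuous_on {0..T} h" for h :: "real \<Rightarrow> real"
    using cont_int[OF that] by simp
  have int_eq: "LINT s|M. h s = integral {0..T} h" if "integrable M h" for h :: "real \<Rightarrow> real"
    using that unfolding M_def by (intro lebesgue_integral_eq_integral) auto
  have abs_iff: "h absolutely_integrable_on {0..T} \<longleftrightarrow> integrable M h" for h :: "real \<Rightarrow> real"
    unfolding M_def by (simp add: set_integrable_def integrable_restrict_space)
  interpret M: finite_measure M unfolding M_def by (rule finite_measure_lebesgue_on) auto
  have spM: "space M = {0..T}" by (simp add: M_def)
  \<comment> \<open>Since truncation \<open>n\<close> has no modes beyond \<open>n\<close>, sums of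
    any length \<open>m\<close> are bounded by the full one. The limit is taken with
    \<open>m\<close> fixed and \<open>n\<close> growing.\<close>
  have Xsum: "(\<Sum>k<m. w k * (X n k t)\<^sup>2) \<le> (\<Sum>k<n. w k * (X n k t)\<^sup>2)" if "\<And>k. 0 \<le> w k" for m n t w
  proof -
    have "(\<Sum>k<m. w k * (X n k t)\<^sup>2) = (\<Sum>k\<in>{..<m} \<inter> {..<n}. w k * (X n k t)\<^sup>2)"
    proof (rule sum.mono_neutral_right)
      have "X n i t = 0" if "i \<in> {..<m} - {..<m} \<inter> {..<n}" for i by (rule X0) (use that in auto)
      then show "\<forall>i\<in>{..<m} - {..<m} \<inter> {..<n}. w i * (X n i t)\<^sup>2 = 0" by simp
    qed auto
    also have "\<dots> \<le> (\<Sum>k<n. w k * (X n k t)\<^sup>2)" using that by (intro sum_mono2) auto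
    finally show ?thesis .
  qed
  have int_nn: "0 \<le> integral {0..t} (\<lambda>s. \<Sum>k<n. lam k * (X n k s)\<^sup>2)" for n t
    using lam_nn by (intro integral_nonneg integrable_continuous_interval continuous_intros XcS sum_nonneg) auto
  have XK: "(\<Sum>k<m. (X n k t)\<^sup>2) \<le> K" if "t \<in> {0..T}" for m n t
    using XE[OF that, of n] mult_nonneg_nonneg[OF less_imp_le[OF \<nu>] int_nn[of t n]] Xsum[of "\<lambda>_. 1" n t m] by simp
  have Xabs: "\<bar>X n k t\<bar> \<le> sqrt K" if t: "t \<in> {0..T}" for n k t
  proof -
    have "(X n k t)\<^sup>2 \<le> (\<Sum>j<Suc k. (X n j t)\<^sup>2)" by (rule member_le_sum) auto
    also have "\<dots> \<le> K" by (rule XK[OF t])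
    finally show ?thesis by (metis real_sqrt_abs real_sqrt_le_iff)
  qed
  have XV: "integral {0..T} (\<lambda>s. \<Sum>k<m. lam k * (X n k s)\<^sup>2) \<le> K / \<nu>" for m n
  proof -
    have "integral {0..T} (\<lambda>s. \<Sum>k<m. lam k * (X n k s)\<^sup>2) \<le> integral {0..T} (\<lambda>s. \<Sum>k<n. lam k * (X n k s)\<^sup>2)"
      by (intro integral_le integrable_continuous_interval continuous_intros XcS Xsum lam_nn)
    moreover have "\<nu> * integral {0..T} (\<lambda>s. \<Sum>k<n. lam k * (X n k s)\<^sup>2) \<le> K"
      using XE[OF T0(1), of n] sum_nonneg[of "{..<n}" "\<lambda>k. (X n k T)\<^sup>2"] by simp
    ultimately show ?thesis using \<nu> by (simp add: pos_le_divide_eq mult.commute[of _ \<nu>])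
      (rule order_trans[OF mult_left_mono], auto)
  qed
  have Xsq: "summable (\<lambda>k. w k * (X n k t)\<^sup>2)" "(\<Sum>k. w k * (X n k t)\<^sup>2) = (\<Sum>k<n. w k * (X n k t)\<^sup>2)" for w n t
    using suminf_finite_support[of n "\<lambda>k. w k * (X n k t)\<^sup>2"] X0 by auto
  have Xsq1: "summable (\<lambda>k. (X n k t)\<^sup>2)" "(\<Sum>k. (X n k t)\<^sup>2) = (\<Sum>k<n. (X n k t)\<^sup>2)" for n t
    using Xsq[of "\<lambda>_. 1" n t] by simp_all
  \<comment> \<open>Bounds the linear and the quadratic part of the derivative of mode
    \<open>k\<close>, using \<open>\<bar>x k\<bar> \<le> sqrt K\<close> and \<open>q_lip\<close>
    against the zero sequence.\<close>
  define B where "B k = \<nu> * lam k * sqrt K + C k * K" for k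
  define \<Psi> where "\<Psi> k t = integral {0..t} (\<lambda>s. \<bar>F k s\<bar> + B k)" for k t
  have B0: "0 \<le> B k" for k unfolding B_def using \<nu> lam_nn C_nonneg K_nonneg by simp
  have absF: "(\<lambda>s. \<bar>F k s\<bar> + B k) integrable_on {0..T}" for k
    using F_int[of k] by (intro integrable_add set_lebesgue_integral_eq_integral(1)) (auto simp: set_integrable_abs)
  have \<Psi>c: "continuous_on {0..T} (\<Psi> k)" for k unfolding \<Psi>_def by (intro indefinite_integral_continuous_1 absF)
  have qX: "\<bar>q k (\<lambda>i. X n i s)\<bar> \<le> C k * K" if s: "s \<in> {0..T}" for k n s
  proof -
    have "\<bar>q k (\<lambda>i. X n i s)\<bar> \<le> C k * sqrt (\<Sum>i. (X n i s)\<^sup>2) * sqrt (\<Sum>i. (X n i s)\<^sup>2)"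
      using q_lip[of "\<lambda>i. X n i s" "\<lambda>i. 0" k] Xsq(1)[of lam n s] by (simp add: q_zero)
    also have "\<dots> = C k * (\<Sum>i. (X n i s)\<^sup>2)" by (simp add: Xsq1 sum_nonneg)
    also have "\<dots> \<le> C k * K" using XK[OF s] C_nonneg by (intro mult_left_mono) (auto simp: Xsq1)
    finally show ?thesis .
  qed
  \<comment> \<open>The modulus of continuity is that of \<open>\<Psi> k\<close>, the integral of
    the dominating function. It does not depend on \<open>n\<close>; modes not contained in
    truncation \<open>n\<close> are constantly 0 and satisfy the bound trivially.\<close>
  have equi: "\<bar>X n k t - X n k s\<bar> \<le> \<Psi> k t - \<Psi> k s" if st: "0 \<le> s" "s \<le> t" "t \<le> T" for n k s t
  proof -
    have sub: "{s..t} \<subseteq> {0..T}" using st by auto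
    have \<Psi>st: "\<Psi> k t - \<Psi> k s = integral {s..t} (\<lambda>s. \<bar>F k s\<bar> + B k)"
      unfolding \<Psi>_def using st by (intro indefinite_integral_diff[OF absF])
    show ?thesis
    proof (cases "k < n")
      case True
      let ?g = "\<lambda>s. F k s - \<nu> * lam k * X n k s + q k (\<lambda>i. X n i s)"
      have gi: "?g integrable_on {0..T}"
        by (intro integrable_add integrable_diff F_on integrable_continuous_interval[of _ _ "\<lambda>s. \<nu> * lam k * X n k s"]
             integrable_continuous_interval[of _ _ "\<lambda>s. q k (\<lambda>i. X n i s)"] qXc True continuous_intros XcS)
      have "X n k t - X n k s = integral {s..t} ?g"
        using Xe[OF True, of t] Xe[OF True, of s] indefinite_integral_diff[OF gi st] st by simp
      also have "norm \<dots> \<le> integral {s..t} (\<lambda>s. \<bar>F k s\<bar> + B k)"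
      proof (rule integral_norm_bound_integral)
        show "?g integrable_on {s..t}" by (rule integrable_on_subinterval[OF gi sub])
        show "(\<lambda>s. \<bar>F k s\<bar> + B k) integrable_on {s..t}" by (rule integrable_on_subinterval[OF absF sub])
        fix r assume r: "r \<in> {s..t}"
        have "\<bar>\<nu> * lam k * X n k r\<bar> \<le> \<nu> * lam k * sqrt K"
          using Xabs[of r n k] r st \<nu> lam_pos[of k] by (simp add: abs_mult)
        then show "norm (?g r) \<le> \<bar>F k r\<bar> + B k"
          using qX[of r k n] r st unfolding B_def real_norm_def by (auto intro: order_trans)
      qed
      finally show ?thesis by (simp add: \<Psi>st)
    next
      case False
      have "0 \<le> integral {s..t} (\<lambda>s. \<bar>F k s\<bar> + B k)"
        using integrable_on_subinterval[OF absF sub] B0 by (intro integral_nonneg) auto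
      then show ?thesis using False X0 \<Psi>st by simp
    qed
  qed
  have equi': "\<bar>X n k t - X n k s\<bar> \<le> \<bar>\<Psi> k t - \<Psi> k s\<bar>" if "s \<in> {0..T}" "t \<in> {0..T}" for n k s t
    using equi[of s t n k] equi[of t s n k] that by (cases "s \<le> t") auto
  \<comment> \<open>A diagonal subsequence converges for all modes at all times of a countable dense
    set; equicontinuity then extends convergence to every time.\<close>
  obtain Q where Q: "countable Q" "Q \<subseteq> {0..T}" "{0..T} \<subseteq> closure Q" using separable[of "{0..T}"] by blast
  obtain \<phi> :: "nat \<Rightarrow> nat" where \<phi>: "strict_mono \<phi>"
     and \<phi>l: "\<And>p. p \<in> (UNIV :: nat set) \<times> Q \<Longrightarrow> \<exists>l. (\<lambda>n. X (\<phi> n) (fst p) (snd p)) \<longlonglongrightarrow> l"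
    by (rule function_convergent_subsequence[of "(UNIV :: nat set) \<times> Q" "\<lambda>n p. X n (fst p) (snd p)" "sqrt K"])
       (use Q Xabs in auto)
  have conv: "convergent (\<lambda>n. X (\<phi> n) k t)" if t: "t \<in> {0..T}" for k t
  proof (rule Cauchy_convergent, rule metric_CauchyI)
    fix e :: real assume e: "0 < e"
    obtain d where d: "d > 0" "\<And>s. s \<in> {0..T} \<Longrightarrow> dist s t < d \<Longrightarrow> dist (\<Psi> k s) (\<Psi> k t) < e/3"
      using \<Psi>c[of k, unfolded continuous_on_iff, rule_format, OF t, of "e/3"] e by auto
    have "t \<in> closure Q" using t Q(3) by blast
    then obtain r where r: "r \<in> Q" "dist r t < d" using d(1) by (auto simp: closure_approachable)
    have rT: "r \<in> {0..T}" using r Q by auto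
    have CX: "Cauchy (\<lambda>n. X (\<phi> n) k r)" using \<phi>l[of "(k, r)"] r by (auto intro: LIMSEQ_imp_Cauchy)
    then obtain N where N: "\<And>m n. m \<ge> N \<Longrightarrow> n \<ge> N \<Longrightarrow> dist (X (\<phi> m) k r) (X (\<phi> n) k r) < e/3"
      using metric_CauchyD[OF CX, of "e/3"] e by auto
    have "dist (X (\<phi> m) k t) (X (\<phi> n) k t) < e" if "m \<ge> N" "n \<ge> N" for m n
      using N[OF that] equi'[OF t rT, of "\<phi> m" k] equi'[OF t rT, of "\<phi> n" k] d(2)[OF rT r(2)]
      unfolding dist_real_def by linarith
    then show "\<exists>N. \<forall>m\<ge>N. \<forall>n\<ge>N. dist (X (\<phi> m) k t) (X (\<phi> n) k t) < e" by blast
  qed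
  define c where "c k t = lim (\<lambda>n. X (\<phi> n) k t)" for k t
  have lim: "(\<lambda>n. X (\<phi> n) k t) \<longlonglongrightarrow> c k t" if "t \<in> {0..T}" for k t
    using conv[OF that] by (simp add: c_def convergent_LIMSEQ_iff)
  have cequi: "\<bar>c k t - c k s\<bar> \<le> \<bar>\<Psi> k t - \<Psi> k s\<bar>" if "s \<in> {0..T}" "t \<in> {0..T}" for k s t
    by (rule LIMSEQ_le_const2[OF tendsto_rabs[OF tendsto_diff[OF lim[OF that(2)] lim[OF that(1)]]]])
       (use equi'[OF that] in auto)
  have cc: "continuous_on {0..T} (c k)" for k
    unfolding continuous_on_iff
  proof (intro ballI allI impI)
    fix t e :: real assume t: "t \<in> {0..T}" and e: "0 < e"
    obtain d where d: "d > 0" "\<And>s. s \<in> {0..T} \<Longrightarrow> dist s t < d \<Longrightarrow> dist (\<Psi> k s) (\<Psi> k t) < e"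
      using \<Psi>c[of k, unfolded continuous_on_iff, rule_format, OF t e] by auto
    show "\<exists>d>0. \<forall>x'\<in>{0..T}. dist x' t < d \<longrightarrow> dist (c k x') (c k t) < e"
    proof (intro exI[of _ d] conjI ballI impI d(1))
      fix s assume s: "s \<in> {0..T}" "dist s t < d"
      show "dist (c k s) (c k t) < e"
        using cequi[OF t s(1), of k] d(2)[OF s] unfolding dist_real_def by linarith
    qed
  qed
  have cK: "(\<Sum>k<m. (c k t)\<^sup>2) \<le> K" if t: "t \<in> {0..T}" for m t
    by (rule LIMSEQ_le_const2[OF tendsto_sum[OF tendsto_power[OF lim[OF t]]]]) (use XK[OF t] in auto)
  have csum: "summable (\<lambda>k. (c k t)\<^sup>2)" if t: "t \<in> {0..T}" for t
    by (rule summableI_nonneg_bounded[of _ K]) (use cK[OF t] in auto)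
  have csK: "(\<Sum>k. (c k t)\<^sup>2) \<le> K" if t: "t \<in> {0..T}" for t
    by (rule suminf_le_const[OF csum[OF t]]) (use cK[OF t] in auto)
  have cabs: "\<bar>c k t\<bar> \<le> sqrt K" if t: "t \<in> {0..T}" for k t
    by (rule LIMSEQ_le_const2[OF tendsto_rabs[OF lim[OF t]]]) (use Xabs[OF t] in auto)
  \<comment> \<open>The dissipation bound passes to the limit for finitely many modes by dominated
    convergence; the number of modes is sent to infinity only afterwards.\<close>
  have cV: "LINT s|M. (\<Sum>k<m. lam k * (c k s)\<^sup>2) \<le> K / \<nu>" for m
  proof (rule LIMSEQ_le_const2)
    show "(\<lambda>n. LINT s|M. (\<Sum>k<m. lam k * (X (\<phi> n) k s)\<^sup>2)) \<longlonglongrightarrow> (LINT s|M. (\<Sum>k<m. lam k * (c k s)\<^sup>2))"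
    proof (rule integral_dominated_convergence[where w = "\<lambda>_. \<Sum>k<m. lam k * K"])
      show "AE s in M. (\<lambda>n. \<Sum>k<m. lam k * (X (\<phi> n) k s)\<^sup>2) \<longlonglongrightarrow> (\<Sum>k<m. lam k * (c k s)\<^sup>2)"
        by (intro AE_I2 tendsto_intros lim) (simp add: spM)
      show "AE s in M. norm (\<Sum>k<m. lam k * (X (\<phi> n) k s)\<^sup>2) \<le> (\<Sum>k<m. lam k * K)" for n
      proof (intro AE_I2)
        fix s assume "s \<in> space M"
        then have s: "s \<in> {0..T}" by (simp add: spM)
        have "(X (\<phi> n) k s)\<^sup>2 \<le> K" for k using Xabs[OF s, of "\<phi> n" k] K_nonneg
          by (metis abs_le_square_iff abs_of_nonneg real_sqrt_ge_zero real_sqrt_pow2)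
        then show "norm (\<Sum>k<m. lam k * (X (\<phi> n) k s)\<^sup>2) \<le> (\<Sum>k<m. lam k * K)"
          using lam_nn by (simp add: sum_nonneg) (intro sum_mono mult_left_mono)
      qed
    qed (auto intro!: cont_meas continuous_intros XcS cc)
    show "\<exists>N. \<forall>n\<ge>N. LINT s|M. (\<Sum>k<m. lam k * (X (\<phi> n) k s)\<^sup>2) \<le> K / \<nu>"
      using XV by (subst int_eq) (auto intro!: cont_int continuous_intros XcS)
  qed
  have c_meas [measurable]: "c k \<in> borel_measurable M" and X_meas [measurable]: "X n k \<in> borel_measurable M" for k n
    using cont_meas cc XcS by auto
  \<comment> \<open>The finite bounds and the interchange of sum and integral make the weighted
    series finite at almost every time, so the limit state lies in \<open>V\<close> there.\<close>
  have nnV: "(\<integral>\<^sup>+s. (\<Sum>k. ennreal (lam k * (c k s)\<^sup>2)) \<partial>M) \<le> ennreal (K / \<nu>)"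
  proof -
    have "(\<integral>\<^sup>+s. (\<Sum>k. ennreal (lam k * (c k s)\<^sup>2)) \<partial>M) = (\<Sum>k. \<integral>\<^sup>+s. ennreal (lam k * (c k s)\<^sup>2) \<partial>M)"
      by (rule nn_integral_suminf) simp
    also have "\<dots> \<le> ennreal (K / \<nu>)"
    proof (rule suminf_le_const)
      fix m
      have "(\<Sum>k<m. \<integral>\<^sup>+s. ennreal (lam k * (c k s)\<^sup>2) \<partial>M) = (\<integral>\<^sup>+s. (\<Sum>k<m. ennreal (lam k * (c k s)\<^sup>2)) \<partial>M)"
        by (rule nn_integral_sum[symmetric]) simp
      also have "\<dots> = (\<integral>\<^sup>+s. ennreal (\<Sum>k<m. lam k * (c k s)\<^sup>2) \<partial>M)"
        using lam_nn by (intro nn_integral_cong sum_ennreal) simp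
      also have "\<dots> = ennreal (LINT s|M. (\<Sum>k<m. lam k * (c k s)\<^sup>2))"
        using lam_nn by (intro nn_integral_eq_integral cont_int continuous_intros cc AE_I2 sum_nonneg) auto
      also have "\<dots> \<le> ennreal (K / \<nu>)" by (intro ennreal_leI cV)
      finally show "(\<Sum>k<m. \<integral>\<^sup>+s. ennreal (lam k * (c k s)\<^sup>2) \<partial>M) \<le> ennreal (K / \<nu>)" .
    qed auto
    finally show ?thesis .
  qed
  have "AE s in M. (\<Sum>k. ennreal (lam k * (c k s)\<^sup>2)) \<noteq> \<infinity>"
    by (rule nn_integral_noteq_infinite) (use nnV in \<open>auto simp: top_unique\<close>)
  then have cVs: "AE s in M. summable (\<lambda>k. lam k * (c k s)\<^sup>2)"
    by (rule AE_mp, intro AE_I2 impI summable_suminf_not_top) (auto simp: lam_nn)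
  define V where "V s = (\<Sum>k. lam k * (c k s)\<^sup>2)" for s
  have V_meas[measurable]: "V \<in> borel_measurable M" unfolding V_def by simp
  have Vnn: "AE s in M. 0 \<le> V s" using cVs
    by eventually_elim (auto simp: V_def lam_nn intro!: suminf_nonneg)
  have nnV': "(\<integral>\<^sup>+s. ennreal (V s) \<partial>M) \<le> ennreal (K / \<nu>)"
  proof -
    have "AE s in M. ennreal (V s) = (\<Sum>k. ennreal (lam k * (c k s)\<^sup>2))"
      using cVs by eventually_elim (auto simp: V_def lam_nn intro!: suminf_ennreal2[symmetric])
    then show ?thesis using nnV by (subst nn_integral_cong_AE)
  qed
  have V_int: "integrable M V"
    by (rule integrableI_nonneg) (use nnV' Vnn in \<open>auto simp: top_unique less_top[symmetric]\<close>)
  have V_le: "LINT s|M. V s \<le> K / \<nu>"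
    using nnV' K_nonneg \<nu> by (subst (asm) nn_integral_eq_integral[OF V_int Vnn]) (auto simp: ennreal_le_iff)
  define D where "D n s = (\<Sum>i. (X (\<phi> n) i s - c i s)\<^sup>2)" for n s
  have Dsum: "summable (\<lambda>i. (X (\<phi> n) i s - c i s)\<^sup>2)" if s: "s \<in> {0..T}" for n s
  proof (rule summable_comparison_test')
    show "summable (\<lambda>i. 2 * (X (\<phi> n) i s)\<^sup>2 + 2 * (c i s)\<^sup>2)"
      by (intro summable_add summable_mult Xsq1 csum s)
    show "norm ((X (\<phi> n) i s - c i s)\<^sup>2) \<le> 2 * (X (\<phi> n) i s)\<^sup>2 + 2 * (c i s)\<^sup>2" for i
      using power2_diff_le[of "X (\<phi> n) i s" "c i s"] by simp
  qed
  have D_meas[measurable]: "D n \<in> borel_measurable M" for n unfolding D_def by simp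
  have Dnn: "0 \<le> D n s" if "s \<in> {0..T}" for n s unfolding D_def by (intro suminf_nonneg Dsum that) auto
  have D_le: "D n s \<le> 4 * K" if s: "s \<in> {0..T}" for n s
  proof -
    have "D n s \<le> (\<Sum>i. 2 * (X (\<phi> n) i s)\<^sup>2 + 2 * (c i s)\<^sup>2)" unfolding D_def
    proof (intro suminf_le Dsum s summable_add summable_mult Xsq1 csum)
      show "((X (\<phi> n) i s - c i s)\<^sup>2) \<le> 2 * (X (\<phi> n) i s)\<^sup>2 + 2 * (c i s)\<^sup>2" for i
        using zero_le_power2[of "X (\<phi> n) i s + c i s"] by (simp add: power2_eq_square algebra_simps)
    qed
    also have "\<dots> = 2 * (\<Sum>i. (X (\<phi> n) i s)\<^sup>2) + 2 * (\<Sum>i. (c i s)\<^sup>2)"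
      using Xsq1(1) csum[OF s] by (simp add: suminf_add[symmetric] suminf_mult[symmetric] summable_mult)
    also have "\<dots> \<le> 2 * K + 2 * K" using XK[OF s, where m = "\<phi> n" and n = "\<phi> n"] csK[OF s] by (simp add: Xsq1)
    finally show ?thesis by simp
  qed
  have D_int: "integrable M (D n)" for n
    by (rule M.integrable_const_bound[of _ "4 * K"]) (auto intro!: AE_I2 simp: spM D_le Dnn)
  have D_lim: "(\<lambda>n. LINT s|M. D n s) \<longlonglongrightarrow> 0"
  proof (rule LIMSEQ_I)
    fix e :: real assume e: "0 < e"
    \<comment> \<open>Chosen so that the modes with eigenvalue at least \<open>\<Lambda>\<close>
      contribute at most \<open>e / 2\<close> to the integral of \<open>D\<close>: approximation and
      limit each have dissipation integral at most \<open>K / \<nu>\<close>, and the prefactor is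
      \<open>2 / \<Lambda>\<close>.\<close>
    define \<Lambda> where "\<Lambda> = 8 * (K / \<nu> + 1) / e"
    have K1: "0 < K / \<nu> + 1" using K_nonneg \<nu> by (simp add: add_nonneg_pos)
    have \<Lambda>: "0 < \<Lambda>" using K1 e by (simp add: \<Lambda>_def)
    obtain m where m: "\<And>i. i \<ge> m \<Longrightarrow> \<Lambda> \<le> lam i"
      using lam_lim unfolding filterlim_at_top eventually_sequentially by blast
    define H where "H n s = (\<Sum>i<m. (X (\<phi> n) i s - c i s)\<^sup>2)" for n s
    have H_int: "integrable M (H n)" for n unfolding H_def
      by (intro cont_int continuous_intros XcS cc)
    have "(\<lambda>n. LINT s|M. H n s) \<longlonglongrightarrow> (LINT s|M. 0)"
    proof (rule integral_dominated_convergence[where w = "\<lambda>_. 4 * K"])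
      show "AE s in M. (\<lambda>n. H n s) \<longlonglongrightarrow> 0"
      proof (intro AE_I2)
        fix s assume "s \<in> space M"
        then have s: "s \<in> {0..T}" by (simp add: spM)
        have "(\<lambda>n. H n s) \<longlonglongrightarrow> (\<Sum>i<m. (c i s - c i s)\<^sup>2)" unfolding H_def
          by (intro tendsto_intros lim s)
        then show "(\<lambda>n. H n s) \<longlonglongrightarrow> 0" by simp
      qed
      show "AE s in M. norm (H n s) \<le> 4 * K" for n
      proof (intro AE_I2)
        fix s assume "s \<in> space M"
        then have s: "s \<in> {0..T}" by (simp add: spM)
        have "H n s \<le> D n s" unfolding H_def D_def by (intro sum_le_suminf Dsum s) auto
        then show "norm (H n s) \<le> 4 * K" using D_le[OF s, of n] by (simp add: H_def sum_nonneg)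
      qed
    qed (auto simp: H_def)
    then obtain N where N: "\<And>n. n \<ge> N \<Longrightarrow> \<bar>LINT s|M. H n s\<bar> < e / 2"
      using LIMSEQ_D[of "\<lambda>n. LINT s|M. H n s" 0 "e/2"] e by auto
    define VX where "VX n s = (\<Sum>k<\<phi> n. lam k * (X (\<phi> n) k s)\<^sup>2)" for n s
    have VX_int: "integrable M (VX n)" for n unfolding VX_def by (intro cont_int continuous_intros XcS)
    have VX_le: "LINT s|M. VX n s \<le> K / \<nu>" for n
      using int_eq[OF VX_int[of n]] XV[where n = "\<phi> n" and m = "\<phi> n"] by (simp add: VX_def[abs_def])
    \<comment> \<open>Beyond \<open>m\<close> the eigenvalues are at least \<open>\<Lambda>\<close>,
      so the unweighted squares are dominated by weighted ones divided by
      \<open>\<Lambda>\<close>.\<close>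
    have tail: "AE s in M. D n s \<le> H n s + (2 / \<Lambda>) * (VX n s + V s)" for n
      using cVs AE_space
    proof eventually_elim
      fix s assume sV: "summable (\<lambda>k. lam k * (c k s)\<^sup>2)" and "s \<in> space M"
      then have s: "s \<in> {0..T}" by (simp add: spM)
      show "D n s \<le> H n s + (2 / \<Lambda>) * (VX n s + V s)"
      proof -
        let ?d = "\<lambda>i. (X (\<phi> n) i s - c i s)\<^sup>2"
        let ?e = "\<lambda>i. (2 / \<Lambda>) * (lam i * (X (\<phi> n) i s)\<^sup>2 + lam i * (c i s)\<^sup>2)"
        have es: "summable ?e" by (intro summable_mult summable_add Xsq sV)
        have e0: "0 \<le> ?e i" for i using lam_nn \<Lambda> by simp
        have "D n s = (\<Sum>i. ?d (i + m)) + H n s"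
          unfolding D_def H_def by (rule suminf_split_initial_segment[OF Dsum[OF s]])
        also have "(\<Sum>i. ?d (i + m)) \<le> (\<Sum>i. ?e (i + m))"
        proof (rule suminf_le)
          fix i
          have "?d (i + m) \<le> 2 * ((X (\<phi> n) (i + m) s)\<^sup>2 + (c (i + m) s)\<^sup>2)"
            using zero_le_power2[of "X (\<phi> n) (i+m) s + c (i+m) s"] by (simp add: power2_eq_square algebra_simps)
          also have "\<dots> = (2 / \<Lambda>) * (\<Lambda> * ((X (\<phi> n) (i + m) s)\<^sup>2 + (c (i + m) s)\<^sup>2))" using \<Lambda> by simp
          also have "\<dots> \<le> (2 / \<Lambda>) * (lam (i + m) * ((X (\<phi> n) (i + m) s)\<^sup>2 + (c (i + m) s)\<^sup>2))"
            using m[of "i + m"] \<Lambda> by (intro mult_left_mono mult_right_mono) auto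
          finally show "?d (i + m) \<le> ?e (i + m)" by (simp add: distrib_left)
        qed (use summable_ignore_initial_segment[OF Dsum[OF s]] summable_ignore_initial_segment[OF es] in auto)
        also have "(\<Sum>i. ?e (i + m)) \<le> (\<Sum>i. ?e i)"
          using suminf_split_initial_segment[OF es, of m] sum_nonneg[of "{..<m}" ?e] e0 by simp
        also have "(\<Sum>i. ?e i) = (2 / \<Lambda>) * (VX n s + V s)"
          using Xsq[of lam "\<phi> n" s] sV
          by (subst suminf_mult) (auto simp: summable_add suminf_add[symmetric] VX_def V_def)
        finally show ?thesis by simp
      qed
    qed
    show "\<exists>no. \<forall>n\<ge>no. norm ((LINT s|M. D n s) - 0) < e"
    proof (intro exI[of _ N] allI impI)
      fix n assume n: "n \<ge> N"
      have "(LINT s|M. D n s) \<le> (LINT s|M. H n s + (2 / \<Lambda>) * (VX n s + V s))"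
        by (intro integral_mono_AE D_int tail) (intro Bochner_Integration.integrable_add H_int integrable_mult_right VX_int V_int)
      also have "\<dots> = (LINT s|M. H n s) + (2 / \<Lambda>) * ((LINT s|M. VX n s) + (LINT s|M. V s))"
        using H_int VX_int V_int by simp
      also have "(2 / \<Lambda>) * ((LINT s|M. VX n s) + (LINT s|M. V s)) \<le> (2 / \<Lambda>) * (2 * (K / \<nu> + 1))"
        using VX_le[of n] V_le \<Lambda> by (intro mult_left_mono) auto
      also have "(2 / \<Lambda>) * (2 * (K / \<nu> + 1)) = e / 2" using K1 e by (simp add: \<Lambda>_def field_simps)
      finally have "(LINT s|M. D n s) < e" using N[OF n] by linarith
      moreover have "0 \<le> (LINT s|M. D n s)" by (intro Bochner_Integration.integral_nonneg) (auto simp: Dnn spM)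
      ultimately show "norm ((LINT s|M. D n s) - 0) < e" by simp
    qed
  qed
  define qc where "qc k s = q k (\<lambda>i. c i s)" for k s
  have q_diff: "AE s in M. \<bar>q k (\<lambda>i. X (\<phi> n) i s) - qc k s\<bar> \<le> 2 * C k * sqrt K * sqrt (D n s)" for k n
    using cVs AE_space
  proof eventually_elim
    fix s assume sV: "summable (\<lambda>k. lam k * (c k s)\<^sup>2)" and "s \<in> space M"
    then have s: "s \<in> {0..T}" by (simp add: spM)
    have "\<bar>q k (\<lambda>i. X (\<phi> n) i s) - qc k s\<bar> \<le> C k * sqrt (D n s) * (sqrt (\<Sum>i. (X (\<phi> n) i s)\<^sup>2) + sqrt (\<Sum>i. (c i s)\<^sup>2))"
      unfolding qc_def D_def by (intro q_lip Xsq sV)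
    also have "\<dots> \<le> C k * sqrt (D n s) * (sqrt K + sqrt K)"
      using XK[OF s] csK[OF s] C_nonneg Dnn[OF s] by (intro mult_left_mono add_mono real_sqrt_le_mono) (auto simp: Xsq1)
    finally show "\<bar>q k (\<lambda>i. X (\<phi> n) i s) - qc k s\<bar> \<le> 2 * C k * sqrt K * sqrt (D n s)" by (simp add: algebra_simps)
  qed
  have qc_bound: "AE s in M. \<bar>qc k s\<bar> \<le> C k * K" for k
    using cVs AE_space
  proof eventually_elim
    fix s assume sV: "summable (\<lambda>k. lam k * (c k s)\<^sup>2)" and "s \<in> space M"
    then have s: "s \<in> {0..T}" by (simp add: spM)
    have nn: "0 \<le> (\<Sum>i. (c i s)\<^sup>2)" by (intro suminf_nonneg csum s) auto
    have "\<bar>qc k s\<bar> \<le> C k * sqrt (\<Sum>i. (c i s)\<^sup>2) * sqrt (\<Sum>i. (c i s)\<^sup>2)"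
      using q_lip[of "\<lambda>i. c i s" "\<lambda>i. 0" k] sV by (simp add: q_zero qc_def)
    also have "\<dots> = C k * (\<Sum>i. (c i s)\<^sup>2)" using nn by simp
    also have "\<dots> \<le> C k * K" using csK[OF s] C_nonneg by (intro mult_left_mono)
    finally show "\<bar>qc k s\<bar> \<le> C k * K" .
  qed
  have qc_meas[measurable]: "qc k \<in> borel_measurable M" for k
  proof -
    \<comment> \<open>About \<open>q\<close> only a Lipschitz estimate on sequences is known, so
      measurability of \<open>qc\<close> in time has to be derived: with finitely many modes kept,
      \<open>q k\<close> is continuous in time, and these functions converge to \<open>qc k\<close>
      almost everywhere.\<close>
    define Z where "Z m i s = (if i < m then c i s else 0)" for m i s
    have Zc: "continuous_on {0..T} (\<lambda>s. q k (\<lambda>i. Z m i s))" for m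
      unfolding continuous_on_def
    proof (intro ballI)
      fix s assume s: "s \<in> {0..T}"
      have "((\<lambda>r. C k * L2_set (\<lambda>i. Z m i r - Z m i s) {..<m} * (sqrt K + sqrt K)) \<longlongrightarrow> C k * L2_set (\<lambda>i. Z m i s - Z m i s) {..<m} * (sqrt K + sqrt K)) (at s within {0..T})"
        unfolding L2_set_def Z_def using cc s unfolding continuous_on_def
        by (intro tendsto_intros) auto
      then have l0: "((\<lambda>r. C k * L2_set (\<lambda>i. Z m i r - Z m i s) {..<m} * (sqrt K + sqrt K)) \<longlongrightarrow> 0) (at s within {0..T})"
        by (simp add: L2_set_def)
      have ZK: "L2_set (\<lambda>i. Z m i r) {..<m} \<le> sqrt K" if "r \<in> {0..T}" for r
        using cK[OF that, of m] by (auto simp: L2_set_def Z_def intro!: real_sqrt_le_mono)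
      have "((\<lambda>r. q k (\<lambda>i. Z m i r) - q k (\<lambda>i. Z m i s)) \<longlongrightarrow> 0) (at s within {0..T})"
      proof (rule Lim_null_comparison[OF _ l0])
        have "norm (q k (\<lambda>i. Z m i r) - q k (\<lambda>i. Z m i s)) \<le> C k * L2_set (\<lambda>i. Z m i r - Z m i s) {..<m} * (sqrt K + sqrt K)"
          if "r \<in> {0..T}" for r
        proof -
          have "\<bar>q k (\<lambda>i. Z m i r) - q k (\<lambda>i. Z m i s)\<bar> \<le> C k * L2_set (\<lambda>i. Z m i r - Z m i s) {..<m} * (L2_set (\<lambda>i. Z m i r) {..<m} + L2_set (\<lambda>i. Z m i s) {..<m})"
            by (rule q_lip_finite) (auto simp: Z_def)
          also have "\<dots> \<le> C k * L2_set (\<lambda>i. Z m i r - Z m i s) {..<m} * (sqrt K + sqrt K)"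
            using ZK[OF that] ZK[OF s] C_nonneg by (intro mult_left_mono add_mono) auto
          finally show ?thesis by simp
        qed
        then show "\<forall>\<^sub>F r in at s within {0..T}. norm (q k (\<lambda>i. Z m i r) - q k (\<lambda>i. Z m i s)) \<le> C k * L2_set (\<lambda>i. Z m i r - Z m i s) {..<m} * (sqrt K + sqrt K)"
          by (auto simp: eventually_at_filter)
      qed
      then show "((\<lambda>s. q k (\<lambda>i. Z m i s)) \<longlongrightarrow> q k (\<lambda>i. Z m i s)) (at s within {0..T})"
        by (rule LIM_zero_cancel)
    qed
    have "AE s in M. (\<lambda>m. q k (\<lambda>i. Z m i s)) \<longlonglongrightarrow> qc k s"
      using cVs AE_space
    proof eventually_elim
      fix s assume sV: "summable (\<lambda>k. lam k * (c k s)\<^sup>2)" and "s \<in> space M"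
      then have s: "s \<in> {0..T}" by (simp add: spM)
      have tl: "(\<lambda>m. \<Sum>i. (c (i + m) s)\<^sup>2) \<longlonglongrightarrow> 0"
        using suminf_exist_split2[OF csum[OF s]] .
      have eq: "(\<Sum>i. (Z m i s - c i s)\<^sup>2) = (\<Sum>i. (c (i + m) s)\<^sup>2)" for m
      proof -
        have "(\<lambda>i. (Z m i s - c i s)\<^sup>2) = (\<lambda>i. if i < m then 0 else (c i s)\<^sup>2)" by (auto simp: Z_def)
        moreover have "summable (\<lambda>i. if i < m then 0 else (c i s)\<^sup>2)"
          by (rule summable_comparison_test'[OF csum[OF s]]) auto
        ultimately show ?thesis
          using suminf_split_initial_segment[of "\<lambda>i. if i < m then 0 else (c i s)\<^sup>2" m] by simp
      qed
      have Zs: "summable (\<lambda>i. w i * (Z m i s)\<^sup>2)" "(\<Sum>i. (Z m i s)\<^sup>2) \<le> K" for w m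
        using suminf_finite_support[of m "\<lambda>i. w i * (Z m i s)\<^sup>2"] suminf_finite_support[of m "\<lambda>i. (Z m i s)\<^sup>2"] cK[OF s, of m]
        by (auto simp: Z_def)
      have l0: "(\<lambda>m. C k * sqrt (\<Sum>i. (c (i + m) s)\<^sup>2) * (sqrt K + sqrt K)) \<longlonglongrightarrow> C k * sqrt 0 * (sqrt K + sqrt K)"
        by (intro tendsto_intros tl)
      then have l0: "(\<lambda>m. C k * sqrt (\<Sum>i. (c (i + m) s)\<^sup>2) * (sqrt K + sqrt K)) \<longlonglongrightarrow> 0" by simp
      have "(\<lambda>m. q k (\<lambda>i. Z m i s) - qc k s) \<longlonglongrightarrow> 0"
      proof (rule Lim_null_comparison[OF _ l0], intro always_eventually allI)
        fix m
        have "norm (q k (\<lambda>i. Z m i s) - qc k s) \<le> C k * sqrt (\<Sum>i. (c (i + m) s)\<^sup>2) * (sqrt (\<Sum>i. (Z m i s)\<^sup>2) + sqrt (\<Sum>i. (c i s)\<^sup>2))"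
          using q_lip[of "\<lambda>i. Z m i s" "\<lambda>i. c i s" k] Zs(1) sV by (simp add: qc_def eq)
        also have "\<dots> \<le> C k * sqrt (\<Sum>i. (c (i + m) s)\<^sup>2) * (sqrt K + sqrt K)"
          using Zs(2)[of m] csK[OF s] C_nonneg summable_ignore_initial_segment[OF csum[OF s]]
          by (intro mult_left_mono add_mono real_sqrt_le_mono mult_nonneg_nonneg real_sqrt_ge_zero suminf_nonneg) auto
        finally show "norm (q k (\<lambda>i. Z m i s) - qc k s) \<le> C k * sqrt (\<Sum>i. (c (i + m) s)\<^sup>2) * (sqrt K + sqrt K)" .
      qed
      then show "(\<lambda>m. q k (\<lambda>i. Z m i s)) \<longlonglongrightarrow> qc k s" by (rule LIM_zero_cancel)
    qed
    from borel_measurable_LIMSEQ_AE_lebesgue_on[OF _ cont_meas[OF Zc, unfolded M_def] this[unfolded M_def]]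
    show ?thesis by (simp add: M_def)
  qed
  have qc_int: "integrable M (qc k)" for k
    by (rule M.integrable_const_bound[of "qc k" "C k * K"]) (use qc_bound in auto)
  have gc_int: "(\<lambda>s. F k s - \<nu> * lam k * c k s + q k (\<lambda>i. c i s)) absolutely_integrable_on {0..T}" for k
  proof -
    have "integrable M (\<lambda>s. F k s - \<nu> * lam k * c k s + qc k s)"
      using F_int[of k] unfolding abs_iff
      by (intro Bochner_Integration.integrable_add Bochner_Integration.integrable_diff qc_int cont_int[of "\<lambda>s. \<nu> * lam k * c k s"] continuous_intros cc)
    then show ?thesis by (simp add: abs_iff qc_def)
  qed
  have qX_int: "integrable M (\<lambda>s. q k (\<lambda>i. X (\<phi> n) i s))" if "k < n" for k n
    using that seq_suble[OF \<phi>, of n] by (intro cont_int qXc) simp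
  have qlim: "(\<lambda>n. LINT s|M. \<bar>q k (\<lambda>i. X (\<phi> n) i s) - qc k s\<bar>) \<longlonglongrightarrow> 0" for k
  proof (rule LIMSEQ_I)
    fix e :: real assume e: "0 < e"
    define C' where "C' = 2 * C k * sqrt K"
    have C': "0 \<le> C'" using C_nonneg K_nonneg by (simp add: C'_def)
    \<comment> \<open>The bound \<open>sqrt D \<le> \<delta> + D / \<delta>\<close> turns
      convergence of the integral of \<open>D\<close> into convergence of the integral of
      \<open>sqrt D\<close>. Once the integral of \<open>D\<close> is below
      \<open>\<delta> * \<delta>\<close>, the total is at most
      \<open>C' * (\<delta> * (T + 1))\<close>, which is less than \<open>e\<close>.\<close>
    define \<delta> where "\<delta> = e / ((C' + 1) * (T + 1))"
    have \<delta>: "0 < \<delta>" using e C' T by (simp add: \<delta>_def)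
    obtain N where N: "\<And>n. n \<ge> N \<Longrightarrow> \<bar>LINT s|M. D n s\<bar> < \<delta> * \<delta>"
      using LIMSEQ_D[OF D_lim, of "\<delta> * \<delta>"] \<delta> by auto
    show "\<exists>no. \<forall>n\<ge>no. norm ((LINT s|M. \<bar>q k (\<lambda>i. X (\<phi> n) i s) - qc k s\<bar>) - 0) < e"
    \<comment> \<open>From index \<open>Suc k\<close> on, mode \<open>k\<close> belongs to the
      truncated system with \<open>\<phi> n \<ge> n\<close> modes.\<close>
    proof (intro exI[of _ "max N (Suc k)"] allI impI)
      fix n assume n: "max N (Suc k) \<le> n"
      have "(LINT s|M. \<bar>q k (\<lambda>i. X (\<phi> n) i s) - qc k s\<bar>) \<le> (LINT s|M. C' * (\<delta> + D n s / \<delta>))"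
      proof (rule integral_mono_AE)
        show "integrable M (\<lambda>s. \<bar>q k (\<lambda>i. X (\<phi> n) i s) - qc k s\<bar>)"
          using n by (intro integrable_abs Bochner_Integration.integrable_diff qX_int qc_int) auto
        show "integrable M (\<lambda>s. C' * (\<delta> + D n s / \<delta>))"
          by (intro integrable_mult_right Bochner_Integration.integrable_add D_int integrable_divide M.integrable_const)
        show "AE s in M. \<bar>q k (\<lambda>i. X (\<phi> n) i s) - qc k s\<bar> \<le> C' * (\<delta> + D n s / \<delta>)"
          using q_diff[of k n] AE_space
        proof eventually_elim
          fix s assume a: "\<bar>q k (\<lambda>i. X (\<phi> n) i s) - qc k s\<bar> \<le> 2 * C k * sqrt K * sqrt (D n s)" and "s \<in> space M"
          then have d0: "0 \<le> D n s" by (intro Dnn) (simp add: spM)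
          have "sqrt (D n s) * \<delta> \<le> \<delta> * \<delta> + D n s"
          proof -
            have "0 \<le> (sqrt (D n s) - \<delta>) * (sqrt (D n s) - \<delta>)" by simp
            also have "\<dots> = D n s + \<delta> * \<delta> - 2 * (sqrt (D n s) * \<delta>)" using d0 by (simp add: algebra_simps)
            finally show ?thesis using mult_nonneg_nonneg[OF real_sqrt_ge_zero[OF d0] less_imp_le[OF \<delta>]] by linarith
          qed
          then have "sqrt (D n s) \<le> \<delta> + D n s / \<delta>" using \<delta> by (simp add: field_simps)
          with a C' show "\<bar>q k (\<lambda>i. X (\<phi> n) i s) - qc k s\<bar> \<le> C' * (\<delta> + D n s / \<delta>)"
            unfolding C'_def[symmetric] by (meson mult_left_mono order_trans)
        qed
      qed
      also have "\<dots> = C' * (\<delta> * T + (LINT s|M. D n s) / \<delta>)"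
        using D_int[of n] T by (simp add: M_def measure_restrict_space)
      also have "\<dots> \<le> C' * (\<delta> * T + (\<delta> * \<delta>) / \<delta>)"
        using N[of n] n \<delta> C' by (intro mult_left_mono add_left_mono divide_right_mono) auto
      also have "\<dots> = C' * (\<delta> * (T + 1))" using \<delta> by (simp add: field_simps)
      also have "\<dots> < (C' + 1) * (\<delta> * (T + 1))" using \<delta> T by (intro mult_strict_right_mono) auto
      also have "\<dots> = e" using C' T by (simp add: \<delta>_def)
      finally show "norm ((LINT s|M. \<bar>q k (\<lambda>i. X (\<phi> n) i s) - qc k s\<bar>) - 0) < e" by simp
    qed
  qed
  have Xlim1: "(\<lambda>n. LINT s|M. \<bar>X (\<phi> n) k s - c k s\<bar>) \<longlonglongrightarrow> 0" for k
  proof -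
    have "(\<lambda>n. LINT s|M. \<bar>X (\<phi> n) k s - c k s\<bar>) \<longlonglongrightarrow> (LINT s|M. 0)"
    proof (rule integral_dominated_convergence[where w = "\<lambda>_. 2 * sqrt K"])
      show "AE s in M. (\<lambda>n. \<bar>X (\<phi> n) k s - c k s\<bar>) \<longlonglongrightarrow> 0"
        by (intro AE_I2 tendsto_rabs_zero LIM_zero lim) (simp add: spM)
      show "AE s in M. norm \<bar>X (\<phi> n) k s - c k s\<bar> \<le> 2 * sqrt K" for n
      proof (intro AE_I2)
        fix s assume "s \<in> space M"
        then have "s \<in> {0..T}" by (simp add: spM)
        from Xabs[OF this, of "\<phi> n" k] cabs[OF this, of k]
        show "norm \<bar>X (\<phi> n) k s - c k s\<bar> \<le> 2 * sqrt K" by simp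
      qed
    qed auto
    then show ?thesis by simp
  qed
  have sub_le: "\<bar>integral {0..t} h\<bar> \<le> (LINT s|M. \<bar>h s\<bar>)" if h: "integrable M h" and t: "t \<in> {0..T}" for h :: "real \<Rightarrow> real" and t
  proof -
    have hT: "h absolutely_integrable_on {0..T}" using h by (simp add: abs_iff)
    have ht: "h absolutely_integrable_on {0..t}"
      by (rule absolutely_integrable_on_subinterval[OF hT]) (use t in auto)
    have "norm (integral {0..t} h) \<le> integral {0..t} (\<lambda>s. \<bar>h s\<bar>)"
      using ht by (intro integral_norm_bound_integral) (auto intro!: set_lebesgue_integral_eq_integral(1) simp: set_integrable_abs)
    also have "\<dots> \<le> integral {0..T} (\<lambda>s. \<bar>h s\<bar>)"
      using ht hT t by (intro integral_subset_le) (auto intro!: set_lebesgue_integral_eq_integral(1) simp: set_integrable_abs)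
    finally show ?thesis using int_eq[OF integrable_abs[OF h]] by simp
  qed
  have eq: "c k t = c0 k + integral {0..t} (\<lambda>s. F k s - \<nu> * lam k * c k s + q k (\<lambda>i. c i s))" if t: "t \<in> {0..T}" for k t
  proof (rule LIMSEQ_unique[OF lim[OF t]])
    let ?gX = "\<lambda>n s. F k s - \<nu> * lam k * X (\<phi> n) k s + q k (\<lambda>i. X (\<phi> n) i s)"
    let ?gc = "\<lambda>s. F k s - \<nu> * lam k * c k s + q k (\<lambda>i. c i s)"
    have gcM: "integrable M ?gc" using gc_int[of k] by (simp add: abs_iff)
    have gXM: "integrable M (?gX n)" if "k < n" for n
      using F_int[of k] qX_int[OF that] unfolding abs_iff
      by (intro Bochner_Integration.integrable_add Bochner_Integration.integrable_diff cont_int[of "\<lambda>s. \<nu> * lam k * X (\<phi> n) k s"] continuous_intros XcS)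
    have on: "h integrable_on {0..t}" if "integrable M h" for h :: "real \<Rightarrow> real"
    proof -
      have "h integrable_on {0..T}" using that set_lebesgue_integral_eq_integral(1)[of "{0..T}" h] by (simp add: abs_iff)
      then show ?thesis by (rule integrable_on_subinterval) (use t in auto)
    qed
    \<comment> \<open>The force is the same in both integrands and cancels; what remains are the
      linear and the quadratic differences, both tending to 0 in \<open>L^1\<close> of time.\<close>
    have bnd: "norm (X (\<phi> n) k t - (c0 k + integral {0..t} ?gc)) \<le>
        \<nu> * lam k * (LINT s|M. \<bar>X (\<phi> n) k s - c k s\<bar>) + (LINT s|M. \<bar>q k (\<lambda>i. X (\<phi> n) i s) - qc k s\<bar>)" if n: "k < n" for n
    proof -
      have kn: "k < \<phi> n" using n seq_suble[OF \<phi>, of n] by simp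
      have i1: "integrable M (\<lambda>s. \<bar>X (\<phi> n) k s - c k s\<bar>)" by (intro integrable_abs cont_int continuous_intros XcS cc)
      have i2: "integrable M (\<lambda>s. \<bar>q k (\<lambda>i. X (\<phi> n) i s) - qc k s\<bar>)"
        using n by (intro integrable_abs Bochner_Integration.integrable_diff qX_int qc_int)
      have e1: "X (\<phi> n) k t - (c0 k + integral {0..t} ?gc) = integral {0..t} (?gX n) - integral {0..t} ?gc"
        using Xe[OF kn t] by simp
      have e2: "integral {0..t} (?gX n) - integral {0..t} ?gc = integral {0..t} (\<lambda>s. ?gX n s - ?gc s)"
        using on[OF gXM[OF n]] on[OF gcM] by (rule Henstock_Kurzweil_Integration.integral_diff[symmetric])
      have e3: "\<bar>integral {0..t} (\<lambda>s. ?gX n s - ?gc s)\<bar> \<le> (LINT s|M. \<bar>?gX n s - ?gc s\<bar>)"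
        using gXM[OF n] gcM by (intro sub_le t Bochner_Integration.integrable_diff)
      have e4: "(LINT s|M. \<bar>?gX n s - ?gc s\<bar>) \<le> (LINT s|M. \<nu> * lam k * \<bar>X (\<phi> n) k s - c k s\<bar> + \<bar>q k (\<lambda>i. X (\<phi> n) i s) - qc k s\<bar>)"
      proof (rule integral_mono)
        show "integrable M (\<lambda>s. \<bar>?gX n s - ?gc s\<bar>)"
          using gXM[OF n] gcM by (intro integrable_abs Bochner_Integration.integrable_diff)
        show "integrable M (\<lambda>s. \<nu> * lam k * \<bar>X (\<phi> n) k s - c k s\<bar> + \<bar>q k (\<lambda>i. X (\<phi> n) i s) - qc k s\<bar>)"
          using i1 i2 by (intro Bochner_Integration.integrable_add integrable_mult_right)
        fix s
        have *: "?gX n s - ?gc s = (q k (\<lambda>i. X (\<phi> n) i s) - qc k s) - \<nu> * lam k * (X (\<phi> n) k s - c k s)"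
          by (simp add: qc_def algebra_simps)
        have "\<bar>\<nu> * lam k * (X (\<phi> n) k s - c k s)\<bar> = \<nu> * lam k * \<bar>X (\<phi> n) k s - c k s\<bar>"
          using \<nu> lam_nn[of k] by (simp add: abs_mult)
        then show "\<bar>?gX n s - ?gc s\<bar> \<le> \<nu> * lam k * \<bar>X (\<phi> n) k s - c k s\<bar> + \<bar>q k (\<lambda>i. X (\<phi> n) i s) - qc k s\<bar>"
          unfolding * by linarith
      qed
      have e5: "(LINT s|M. \<nu> * lam k * \<bar>X (\<phi> n) k s - c k s\<bar> + \<bar>q k (\<lambda>i. X (\<phi> n) i s) - qc k s\<bar>)
        = \<nu> * lam k * (LINT s|M. \<bar>X (\<phi> n) k s - c k s\<bar>) + (LINT s|M. \<bar>q k (\<lambda>i. X (\<phi> n) i s) - qc k s\<bar>)"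
        using i1 i2 by simp
      show ?thesis unfolding e1 e2 real_norm_def using e3 e4 e5 by linarith
    qed
    have l0: "(\<lambda>n. \<nu> * lam k * (LINT s|M. \<bar>X (\<phi> n) k s - c k s\<bar>) + (LINT s|M. \<bar>q k (\<lambda>i. X (\<phi> n) i s) - qc k s\<bar>)) \<longlonglongrightarrow> 0"
      using tendsto_add[OF tendsto_mult_left[OF Xlim1[of k], of "\<nu> * lam k"] qlim[of k]] by simp
    have "\<forall>\<^sub>F n in sequentially. norm (X (\<phi> n) k t - (c0 k + integral {0..t} ?gc)) \<le>
        \<nu> * lam k * (LINT s|M. \<bar>X (\<phi> n) k s - c k s\<bar>) + (LINT s|M. \<bar>q k (\<lambda>i. X (\<phi> n) i s) - qc k s\<bar>)"
      using eventually_gt_at_top[of k] by (rule eventually_mono) (rule bnd)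
    from Lim_null_comparison[OF this l0]
    show "(\<lambda>n. X (\<phi> n) k t) \<longlonglongrightarrow> c0 k + integral {0..t} ?gc" by (rule LIM_zero_cancel)
  qed
  show ?thesis
    by (rule that[OF cc csum csK cVs V_int[unfolded V_def[abs_def]] gc_int eq])
qed

section \<open>Calculus on the rectangle\<close>

lemma vec2_eqI: "x $ 1 = y $ 1 \<Longrightarrow> x $ 2 = y $ 2 \<Longrightarrow> x = (y :: 'a ^ 2)"
  by (simp add: vec_eq_iff forall_2)

lemma vector_axis2: "(vector [s, t] :: real ^ 2) = s *\<^sub>R axis 1 1 + t *\<^sub>R axis 2 1"
  by (rule vec2_eqI) (auto simp: axis_def)

lemma Basis_real2: "(Basis :: (real ^ 2) set) = {axis 1 1, axis 2 1}"
  unfolding Basis_vec_def by (auto simp: UNIV_2)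

lemma continuous_on_vector2 [continuous_intros]:
  "continuous_on S f \<Longrightarrow> continuous_on S g \<Longrightarrow> continuous_on S (\<lambda>x. vector [f x, g x] :: real ^ 2)"
  unfolding vector_axis2 by (intro continuous_intros)

lemma rect_eq_box: "rect a b = box 0 (vector [a, b])"
  by (auto simp: rect_def mem_box_cart forall_2)

lemma cbox_real2: "x \<in> cbox u (v :: real ^ 2) \<longleftrightarrow> u $ 1 \<le> x $ 1 \<and> x $ 1 \<le> v $ 1 \<and> u $ 2 \<le> x $ 2 \<and> x $ 2 \<le> v $ 2"
  by (auto simp: mem_box_cart forall_2)

lemma content_cbox_real2:
  "measure lborel (cbox u (v :: real ^ 2)) = measure lborel (cbox (u $ 1, u $ 2) (v $ 1, v $ 2))"
proof (cases "cbox u v = {}")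
  case True
  have "(p, q) \<notin> cbox (u $ 1, u $ 2) (v $ 1, v $ 2)" for p q
    using cbox_real2[of "vector [p, q]" u v] True by (simp add: cbox_Pair_eq)
  then have "cbox (u $ 1, u $ 2) (v $ 1, v $ 2) = {}" by auto
  with True show ?thesis by simp
next
  case False
  then have "u $ 1 \<le> v $ 1" "u $ 2 \<le> v $ 2" by (auto simp: cbox_real2 set_eq_iff)
  then show ?thesis using content_cbox_cart[OF False] by (simp add: content_Pair UNIV_2)
qed

text \<open>Iterated integrals are available on product types, while points here are vectors. The
  coordinate bijection maps boxes to boxes of the same content, so integrals can be transported
  along it.\<close>

lemma has_integral_real2:
  fixes f :: "real ^ 2 \<Rightarrow> real"
  assumes "((\<lambda>p. f (vector [fst p, snd p])) has_integral I) (cbox (u1, u2) (v1, v2))"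
  shows "(f has_integral I) (cbox (vector [u1, u2]) (vector [v1, v2]))"
proof -
  let ?g = "\<lambda>x :: real ^ 2. (x $ 1, x $ 2)" and ?h = "\<lambda>p :: real \<times> real. vector [fst p, snd p] :: real ^ 2"
  have hg: "?h (?g x) = x" for x by (rule vec2_eqI) auto
  have gh: "?g (?h p) = p" for p by (cases p) auto
  have gim: "?g ` cbox u v = cbox (u $ 1, u $ 2) (v $ 1, v $ 2)" for u v
  proof (rule set_eqI)
    fix p :: "real \<times> real"
    have "p \<in> ?g ` cbox u v \<longleftrightarrow> ?h p \<in> cbox u v" 
    proof
      assume "p \<in> ?g ` cbox u v"
      then obtain x where "x \<in> cbox u v" "p = ?g x" by auto
      then show "?h p \<in> cbox u v" using hg[of x] by simp
    next
      assume "?h p \<in> cbox u v"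
      then have "?g (?h p) \<in> ?g ` cbox u v" by (rule imageI)
      then show "p \<in> ?g ` cbox u v" by (simp only: gh)
    qed
    then show "p \<in> ?g ` cbox u v \<longleftrightarrow> p \<in> cbox (u $ 1, u $ 2) (v $ 1, v $ 2)"
      by (cases p) (auto simp: cbox_real2)
  qed
  have him: "?h ` cbox u v = cbox (vector [fst u, snd u]) (vector [fst v, snd v])" for u v
  proof (rule set_eqI)
    fix x :: "real ^ 2"
    have "x \<in> ?h ` cbox u v \<longleftrightarrow> ?g x \<in> cbox u v" 
    proof
      assume "x \<in> ?h ` cbox u v"
      then obtain p where "p \<in> cbox u v" "x = ?h p" by auto
      then show "?g x \<in> cbox u v" using gh[of p] by simp
    next
      assume "?g x \<in> cbox u v"
      then have "?h (?g x) \<in> ?h ` cbox u v" by (rule imageI)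
      then show "x \<in> ?h ` cbox u v" by (simp only: hg)
    qed
    then show "x \<in> ?h ` cbox u v \<longleftrightarrow> x \<in> cbox (vector [fst u, snd u]) (vector [fst v, snd v])"
      by (cases u; cases v) (auto simp: cbox_real2)
  qed
  have "((\<lambda>x. f (?h (?g x))) has_integral (1 / 1) *\<^sub>R I) (?h ` cbox (u1, u2) (v1, v2))"
  proof (rule has_integral_twiddle[where g = ?g and h = ?h and r = 1 and f = "\<lambda>p. f (?h p)"])
    show "?g (?h x) = x" for x by (rule gh)
    show "?h (?g x) = x" for x by (rule hg)
    show "continuous (at x) ?g" for x by (intro continuous_intros)
    show "\<exists>w z. ?g ` cbox u v = cbox w z" for u v using gim by blast
    show "\<exists>w z. ?h ` cbox u v = cbox w z" for u v using him by blast
    show "measure lborel (?g ` cbox u v) = 1 * measure lborel (cbox u v)" for u v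
      by (simp add: gim content_cbox_real2)
  qed (use assms in simp_all)
  then show ?thesis unfolding hg him by simp
qed

lemma continuous_imp_integrable_rect:
  fixes f :: "real ^ 2 \<Rightarrow> real"
  assumes "continuous_on UNIV f"
  shows "integrable (lebesgue_on (rect a b)) f"
proof -
  have "f absolutely_integrable_on cbox 0 (vector [a, b])"
    by (intro absolutely_integrable_continuous continuous_on_subset[OF assms]) auto
  then have "f absolutely_integrable_on rect a b"
    unfolding rect_eq_box by (rule set_integrable_subset) (auto simp: box_subset_cbox)
  then show ?thesis unfolding rect_eq_box by (simp add: set_integrable_def integrable_restrict_space)
qed

text \<open>Both orders of integration are recorded because integrating a derivative in direction
  \<open>i\<close> requires the integral in that direction to be the inner one.\<close>

lemma integral_rect:
  fixes f :: "real ^ 2 \<Rightarrow> real"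
  assumes f: "continuous_on UNIV f"
  shows "(LINT x|lebesgue_on (rect a b). f x) = integral {0..a} (\<lambda>s. integral {0..b} (\<lambda>t. f (vector [s, t])))"
    and "(LINT x|lebesgue_on (rect a b). f x) = integral {0..b} (\<lambda>t. integral {0..a} (\<lambda>s. f (vector [s, t])))"
proof -
  let ?F = "\<lambda>p :: real \<times> real. f (vector [fst p, snd p])"
  have F: "continuous_on S ?F" for S
    by (rule continuous_on_compose2[OF f]) (auto intro!: continuous_intros)
  have "(?F has_integral integral (cbox (0, 0) (a, b)) ?F) (cbox (0, 0) (a, b))"
    by (intro integrable_integral integrable_continuous F)
  from has_integral_real2[OF this]
  have "integral (cbox (vector [0, 0]) (vector [a, b])) f = integral (cbox (0, 0) (a, b)) ?F"
    by (rule integral_unique)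
  moreover have "(vector [0, 0] :: real ^ 2) = 0" by (rule vec2_eqI) auto
  moreover have "(LINT x|lebesgue_on (rect a b). f x) = integral (rect a b) f"
    by (intro lebesgue_integral_eq_integral continuous_imp_integrable_rect f) (simp add: rect_eq_box)
  ultimately have eq: "(LINT x|lebesgue_on (rect a b). f x) = integral (cbox (0, 0) (a, b)) ?F"
    by (simp add: rect_eq_box integral_open_interval)
  also have "\<dots> = integral (cbox 0 a) (\<lambda>s. integral (cbox 0 b) (\<lambda>t. ?F (s, t)))"
    by (rule integral_prod_continuous[OF F])
  finally show *: "(LINT x|lebesgue_on (rect a b). f x) = integral {0..a} (\<lambda>s. integral {0..b} (\<lambda>t. f (vector [s, t])))"
    by simp
  also have "\<dots> = integral {0..b} (\<lambda>t. integral {0..a} (\<lambda>s. f (vector [s, t])))"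
    using integral_swap_continuous[of 0 0 a b "\<lambda>s t. f (vector [s, t])"] F by (simp add: case_prod_unfold)
  finally show "(LINT x|lebesgue_on (rect a b). f x) = integral {0..b} (\<lambda>t. integral {0..a} (\<lambda>s. f (vector [s, t])))" .
qed

section \<open>Partial derivatives and integration by parts\<close>

lemma frechet_derivative_worksI:
  "f differentiable (at x) \<Longrightarrow> (f has_derivative frechet_derivative f (at x)) (at x)"
  by (simp add: frechet_derivative_works)

lemma partial_eq: "(f has_derivative f') (at x) \<Longrightarrow> partial i f x = f' (axis i 1)"
  unfolding partial_def by (simp add: frechet_derivative_at[symmetric])

text \<open>The regularity that integration by parts uses; it is weaker than \<open>smooth\<close>
  and is closed under products by the ordinary product rule alone.\<close>

definition C1 :: "(point \<Rightarrow> real) \<Rightarrow> bool" where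
  "C1 f \<longleftrightarrow> (\<forall>x. f differentiable (at x)) \<and> (\<forall>i. continuous_on UNIV (partial i f))"

lemma C1_D: "C1 f \<Longrightarrow> f differentiable (at x)" "C1 f \<Longrightarrow> continuous_on S (partial i f)"
  unfolding C1_def by (auto intro: continuous_on_subset)

lemma C1_continuous: "C1 f \<Longrightarrow> continuous_on S f"
  by (intro continuous_at_imp_continuous_on ballI differentiable_imp_continuous_within C1_D(1))

lemma C1_add: assumes "C1 f" "C1 g"
  shows "C1 (\<lambda>x. f x + g x)" "partial i (\<lambda>x. f x + g x) x = partial i f x + partial i g x"
proof -
  have p: "partial i (\<lambda>x. f x + g x) x = partial i f x + partial i g x" for i x
    using partial_eq[OF has_derivative_add[OF frechet_derivative_worksI[OF C1_D(1)[OF assms(1), of x]] frechet_derivative_worksI[OF C1_D(1)[OF assms(2), of x]]]]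
    by (simp add: partial_def)
  show "partial i (\<lambda>x. f x + g x) x = partial i f x + partial i g x" by (rule p)
  show "C1 (\<lambda>x. f x + g x)"
    using assms unfolding C1_def by (auto simp: p[abs_def] intro!: continuous_intros)
qed

lemma C1_mult: assumes "C1 f" "C1 g"
  shows "C1 (\<lambda>x. f x * g x)" "partial i (\<lambda>x. f x * g x) x = partial i f x * g x + f x * partial i g x"
proof -
  have p: "partial i (\<lambda>x. f x * g x) x = partial i f x * g x + f x * partial i g x" for i x
    using partial_eq[OF has_derivative_mult[OF frechet_derivative_worksI[OF C1_D(1)[OF assms(1), of x]] frechet_derivative_worksI[OF C1_D(1)[OF assms(2), of x]]]]
    by (simp add: partial_def)
  show "partial i (\<lambda>x. f x * g x) x = partial i f x * g x + f x * partial i g x" by (rule p)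
  show "C1 (\<lambda>x. f x * g x)"
    using assms C1_continuous[of f UNIV] C1_continuous[of g UNIV] unfolding C1_def
    by (auto simp: p[abs_def] intro!: continuous_intros)
qed

lemma C1_const: "C1 (\<lambda>x. c)" "partial i (\<lambda>x. c) x = 0"
proof -
  have p: "partial i (\<lambda>x. c) x = 0" for i x by (rule partial_eq[OF has_derivative_const])
  show "partial i (\<lambda>x. c) x = 0" by (rule p)
  show "C1 (\<lambda>x. c)" by (auto simp: C1_def p[abs_def])
qed

lemma C1_cmult: assumes "C1 f" shows "C1 (\<lambda>x. c * f x)" "partial i (\<lambda>x. c * f x) x = c * partial i f x"
  using C1_mult[OF C1_const(1)[of c] assms] by (auto simp: C1_const)

lemma C1_has_field_derivative:
  assumes "C1 f"
  shows "((\<lambda>s. f (vector [s, t])) has_real_derivative partial 1 f (vector [s, t])) (at s within S)"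
    and "((\<lambda>t. f (vector [s, t])) has_real_derivative partial 2 f (vector [s, t])) (at t within S)"
proof -
  have D: "(f has_derivative frechet_derivative f (at x)) (at x)" for x
    using C1_D(1)[OF assms] by (rule frechet_derivative_worksI)
  have lin: "linear (frechet_derivative f (at x))" for x
    using D has_derivative_linear by blast
  have "((\<lambda>s. vector [s, t] :: real ^ 2) has_derivative (\<lambda>h. h *\<^sub>R axis 1 1)) (at s within S)"
    unfolding vector_axis2 by (auto intro!: derivative_eq_intros)
  from has_derivative_compose[OF this D]
  show "((\<lambda>s. f (vector [s, t])) has_real_derivative partial 1 f (vector [s, t])) (at s within S)"
    unfolding has_field_derivative_def by (simp add: linear_scale[OF lin] partial_def mult.commute[of _ "frechet_derivative f _ _"])
  have "((\<lambda>t. vector [s, t] :: real ^ 2) has_derivative (\<lambda>h. h *\<^sub>R axis 2 1)) (at t within S)"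
    unfolding vector_axis2 by (auto intro!: derivative_eq_intros)
  from has_derivative_compose[OF this D]
  show "((\<lambda>t. f (vector [s, t])) has_real_derivative partial 2 f (vector [s, t])) (at t within S)"
    unfolding has_field_derivative_def by (simp add: linear_scale[OF lin] partial_def mult.commute[of _ "frechet_derivative f _ _"])
qed

text \<open>The two closed edges orthogonal to axis \<open>i\<close>, corners included: the only
  part of the boundary that a derivative in direction \<open>i\<close> sees.\<close>

definition side :: "real \<Rightarrow> real \<Rightarrow> 2 \<Rightarrow> point set" where
  "side a b i = {x \<in> cbox 0 (vector [a, b]). x $ i = 0 \<or> x $ i = vector [a, b] $ i}"

text \<open>Divergence theorem in a single direction: the inner integral along axis \<open>i\<close>
  is the difference of the values on the two edges orthogonal to it.\<close>

lemma integral_partial_eq_0: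
  assumes f: "C1 f" and ab: "0 < a" "0 < b" and zero: "\<And>x. x \<in> side a b i \<Longrightarrow> f x = 0"
  shows "(LINT x|lebesgue_on (rect a b). partial i f x) = 0"
proof -
  consider "i = 1" | "i = 2" using exhaust_2 by blast
  then show ?thesis
  proof cases
    case 1
    have "(LINT x|lebesgue_on (rect a b). partial i f x) = integral {0..b} (\<lambda>t. integral {0..a} (\<lambda>s. partial i f (vector [s, t])))"
      by (intro integral_rect C1_D f)
    also have "\<dots> = integral {0..b} (\<lambda>t. 0)"
    proof (intro Henstock_Kurzweil_Integration.integral_cong integral_unique)
      fix t assume t: "t \<in> {0..b}"
      have "((\<lambda>s. partial i f (vector [s, t])) has_integral (f (vector [a, t]) - f (vector [0, t]))) {0..a}"
        using C1_has_field_derivative(1)[OF f] ab 1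
        by (intro fundamental_theorem_of_calculus) (auto simp: has_real_derivative_iff_has_vector_derivative[symmetric])
      moreover have "f (vector [a, t]) = 0" "f (vector [0, t]) = 0"
        using t ab 1 by (auto intro!: zero simp: side_def cbox_real2)
      ultimately show "((\<lambda>s. partial i f (vector [s, t])) has_integral 0) {0..a}" by simp
    qed
    finally show ?thesis by simp
  next
    case 2
    have "(LINT x|lebesgue_on (rect a b). partial i f x) = integral {0..a} (\<lambda>s. integral {0..b} (\<lambda>t. partial i f (vector [s, t])))"
      by (intro integral_rect C1_D f)
    also have "\<dots> = integral {0..a} (\<lambda>s. 0)"
    proof (intro Henstock_Kurzweil_Integration.integral_cong integral_unique)
      fix s assume s: "s \<in> {0..a}"
      have "((\<lambda>t. partial i f (vector [s, t])) has_integral (f (vector [s, b]) - f (vector [s, 0]))) {0..b}"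
        using C1_has_field_derivative(2)[OF f] ab 2
        by (intro fundamental_theorem_of_calculus) (auto simp: has_real_derivative_iff_has_vector_derivative[symmetric])
      moreover have "f (vector [s, b]) = 0" "f (vector [s, 0]) = 0"
        using s ab 2 by (auto intro!: zero simp: side_def cbox_real2)
      ultimately show "((\<lambda>t. partial i f (vector [s, t])) has_integral 0) {0..b}" by simp
    qed
    finally show ?thesis by simp
  qed
qed

lemma integral_partial_mult:
  assumes "C1 f" "C1 g" "0 < a" "0 < b" "\<And>x. x \<in> side a b i \<Longrightarrow> f x * g x = 0"
  shows "(LINT x|lebesgue_on (rect a b). f x * partial i g x) = - (LINT x|lebesgue_on (rect a b). partial i f x * g x)"
proof -
  have "(LINT x|lebesgue_on (rect a b). partial i (\<lambda>x. f x * g x) x) = 0"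
    by (intro integral_partial_eq_0 C1_mult assms)
  moreover have "(LINT x|lebesgue_on (rect a b). partial i f x * g x + f x * partial i g x)
     = (LINT x|lebesgue_on (rect a b). partial i f x * g x) + (LINT x|lebesgue_on (rect a b). f x * partial i g x)"
    by (intro Bochner_Integration.integral_add continuous_imp_integrable_rect continuous_intros C1_D C1_continuous assms)
  ultimately show ?thesis using C1_mult(2)[OF assms(1,2)] by simp
qed

section \<open>Smooth functions\<close>

lemma Ck_linear:
  assumes "bounded_linear L" "Ck k f"
  shows "Ck k (\<lambda>x. L (f x))"
  using assms(2)
proof (induction k arbitrary: f)
  case 0
  then show ?case by (simp add: bounded_linear.continuous_on[OF assms(1)])
next
  case (Suc k)
  have "frechet_derivative (\<lambda>x. L (f x)) (at x) = (\<lambda>e. L (frechet_derivative f (at x) e))" for x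
    by (intro frechet_derivative_at[symmetric] bounded_linear.has_derivative[OF assms(1)] frechet_derivative_worksI)
       (use Suc.prems in auto)
  moreover have "(\<lambda>x. L (f x)) differentiable (at x)" for x
    using bounded_linear.has_derivative[OF assms(1) frechet_derivative_worksI, of f x] Suc.prems
    by (auto simp: differentiable_def)
  ultimately show ?case using Suc by simp
qed

lemma Ck_add: "Ck k f \<Longrightarrow> Ck k g \<Longrightarrow> Ck k (\<lambda>x. f x + g x)"
proof (induction k arbitrary: f g)
  case 0
  then show ?case by (auto intro: continuous_intros)
next
  case (Suc k)
  have "frechet_derivative (\<lambda>x. f x + g x) (at x) = (\<lambda>e. frechet_derivative f (at x) e + frechet_derivative g (at x) e)" for x
    using has_derivative_add[OF frechet_derivative_worksI frechet_derivative_worksI, of f x g] Suc.prems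
    by (simp add: frechet_derivative_at[symmetric])
  then show ?case using Suc by (auto intro: derivative_intros)
qed

lemma smooth_add: "smooth f \<Longrightarrow> smooth g \<Longrightarrow> smooth (\<lambda>x. f x + g x)"
  by (simp add: smooth_def Ck_add)

lemma smooth_linear: "bounded_linear L \<Longrightarrow> smooth f \<Longrightarrow> smooth (\<lambda>x. L (f x))"
  by (simp add: smooth_def Ck_linear)

lemma smooth_component: "smooth u \<Longrightarrow> smooth (\<lambda>x. u x $ j)"
  by (rule smooth_linear[OF bounded_linear_vec_nth])

lemma smooth_imp_C1: assumes "smooth (f :: point \<Rightarrow> real)" shows "C1 f" "smooth (partial i f)"
proof -
  have *: "Ck (Suc k) f" for k using assms by (auto simp: smooth_def)
  have p: "Ck k (partial i f)" for k i
    using *[of k] exhaust_2[of i] by (auto simp: partial_def[abs_def] Basis_real2)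
  show "smooth (partial i f)" using p by (simp add: smooth_def)
  show "C1 f" unfolding C1_def using *[of 0] p[of 0] by auto
qed

text \<open>Smoothness on the line is encoded by an explicit sequence of successive derivatives,
  since an induction can then differentiate by shifting the sequence.\<close>

definition smooth1 :: "(real \<Rightarrow> real) \<Rightarrow> bool" where
  "smooth1 f \<longleftrightarrow> (\<exists>D. D 0 = f \<and> (\<forall>n x. (D n has_real_derivative D (Suc n) x) (at x)))"

lemma tensor_has_derivative:
  assumes "\<And>s. (f has_real_derivative f' s) (at s)" "\<And>s. (g has_real_derivative g' s) (at s)"
  shows "((\<lambda>x. f (x $ 1) * g (x $ 2)) has_derivative (\<lambda>h :: point. h $ 1 * (f' (x $ 1) * g (x $ 2)) + h $ 2 * (f (x $ 1) * g' (x $ 2)))) (at x)"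
proof -
  have 1: "((\<lambda>x :: point. f (x $ 1)) has_derivative (\<lambda>h. h $ 1 * f' (x $ 1))) (at x)"
    using has_derivative_compose[OF bounded_linear_imp_has_derivative[OF bounded_linear_vec_nth[of 1]], of f "(*) (f' (x $ 1))" x UNIV] assms(1)[of "x $ 1"]
    by (simp add: has_field_derivative_def mult.commute)
  have 2: "((\<lambda>x :: point. g (x $ 2)) has_derivative (\<lambda>h. h $ 2 * g' (x $ 2))) (at x)"
    using has_derivative_compose[OF bounded_linear_imp_has_derivative[OF bounded_linear_vec_nth[of 2]], of g "(*) (g' (x $ 2))" x UNIV] assms(2)[of "x $ 2"]
    by (simp add: has_field_derivative_def mult.commute)
  from has_derivative_mult[OF 1 2] show ?thesis by (simp add: algebra_simps)
qed

text \<open>A partial derivative of a tensor product is again a tensor product, with one of the two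
  derivative sequences shifted. The induction therefore runs over all pairs of sequences
  simultaneously.\<close>

lemma smooth_tensor:
  assumes "smooth1 f" "smooth1 g"
  shows "smooth (\<lambda>x :: point. f (x $ 1) * g (x $ 2))"
proof -
  have "Ck k (\<lambda>x :: point. D 0 (x $ 1) * E 0 (x $ 2))"
    if "\<And>n x. (D n has_real_derivative D (Suc n) x) (at x)" "\<And>n x. (E n has_real_derivative E (Suc n) x) (at x)"
    for k and D E :: "nat \<Rightarrow> real \<Rightarrow> real"
    using that
  proof (induction k arbitrary: D E)
    case 0
    have "continuous_on UNIV (D 0)" "continuous_on UNIV (E 0)"
      using 0 DERIV_isCont by (auto simp: continuous_on_eq_continuous_at) blast+
    then show ?case
      by (auto intro!: continuous_intros continuous_on_compose2[of UNIV "D 0"] continuous_on_compose2[of UNIV "E 0"])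
  next
    case (Suc k)
    note d = tensor_has_derivative[OF Suc.prems(1)[of 0] Suc.prems(2)[of 0]]
    have fd: "frechet_derivative (\<lambda>x :: point. D 0 (x $ 1) * E 0 (x $ 2)) (at x) =
        (\<lambda>h. h $ 1 * (D (Suc 0) (x $ 1) * E 0 (x $ 2)) + h $ 2 * (D 0 (x $ 1) * E (Suc 0) (x $ 2)))" for x
      by (rule frechet_derivative_at[OF d, symmetric])
    have "Ck k (\<lambda>x :: point. D (Suc 0) (x $ 1) * E 0 (x $ 2))" "Ck k (\<lambda>x :: point. D 0 (x $ 1) * E (Suc 0) (x $ 2))"
      using Suc.IH[of "\<lambda>n. D (Suc n)" E] Suc.IH[of D "\<lambda>n. E (Suc n)"] Suc.prems by auto
    then show ?case using d
      by (auto simp: fd Basis_real2 axis_def differentiable_def)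
  qed
  note * = this
  obtain D where D: "D 0 = f" "\<And>n x. (D n has_real_derivative D (Suc n) x) (at x)" using assms(1) unfolding smooth1_def by auto
  obtain E where E: "E 0 = g" "\<And>n x. (E n has_real_derivative E (Suc n) x) (at x)" using assms(2) unfolding smooth1_def by auto
  show ?thesis using *[of D E, OF D(2) E(2)] D(1) E(1) by (simp add: smooth_def)
qed

section \<open>Square integrable functions\<close>

text \<open>The squared \<open>L^2\<close> norm. Convergence is always expressed through it, so that
  roots appear only in the Cauchy-Schwarz estimates.\<close>

definition nsq :: "point set \<Rightarrow> (point \<Rightarrow> real) \<Rightarrow> real" where
  "nsq S f = (LINT x|lebesgue_on S. (f x)\<^sup>2)"

lemma L2_real_iff: "(f :: point \<Rightarrow> real) \<in> L2 S \<longleftrightarrow>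
    f \<in> borel_measurable (lebesgue_on S) \<and> integrable (lebesgue_on S) (\<lambda>x. (f x)\<^sup>2)"
  by (simp add: L2_def)

lemma L2_measurable: "(f :: point \<Rightarrow> real) \<in> L2 S \<Longrightarrow> f \<in> borel_measurable (lebesgue_on S)"
  by (simp add: L2_real_iff)

lemma L2_integrable_mult:
  fixes f g :: "point \<Rightarrow> real"
  assumes "f \<in> L2 S" "g \<in> L2 S"
  shows "integrable (lebesgue_on S) (\<lambda>x. f x * g x)"
proof (rule Bochner_Integration.integrable_bound)
  show "integrable (lebesgue_on S) (\<lambda>x. (f x)\<^sup>2 + (g x)\<^sup>2)"
    using assms by (simp add: L2_real_iff)
  show "(\<lambda>x. f x * g x) \<in> borel_measurable (lebesgue_on S)"
    using assms by (auto simp: L2_real_iff)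
  have "norm (f x * g x) \<le> norm ((f x)\<^sup>2 + (g x)\<^sup>2)" for x
  proof -
    have "2 * \<bar>f x\<bar> * \<bar>g x\<bar> \<le> \<bar>f x\<bar>\<^sup>2 + \<bar>g x\<bar>\<^sup>2" by (rule sum_squares_bound)
    moreover have "0 \<le> \<bar>f x\<bar> * \<bar>g x\<bar>" by simp
    ultimately have "\<bar>f x\<bar> * \<bar>g x\<bar> \<le> (f x)\<^sup>2 + (g x)\<^sup>2" unfolding power2_abs mult.assoc by linarith
    then show ?thesis by (simp add: abs_mult)
  qed
  then show "AE x in lebesgue_on S. norm (f x * g x) \<le> norm ((f x)\<^sup>2 + (g x)\<^sup>2)" by simp
qed

lemma L2_cmult: "(f :: point \<Rightarrow> real) \<in> L2 S \<Longrightarrow> (\<lambda>x. c * f x) \<in> L2 S"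
  by (auto simp: L2_real_iff power_mult_distrib)

lemma L2_add:
  fixes f g :: "point \<Rightarrow> real"
  assumes "f \<in> L2 S" "g \<in> L2 S"
  shows "(\<lambda>x. f x + g x) \<in> L2 S"
  using assms L2_integrable_mult[OF assms]
  by (auto simp: L2_real_iff power2_sum mult.assoc)

lemma L2_diff: "(f :: point \<Rightarrow> real) \<in> L2 S \<Longrightarrow> g \<in> L2 S \<Longrightarrow> (\<lambda>x. f x - g x) \<in> L2 S"
  using L2_add[of f S "\<lambda>x. - 1 * g x"] L2_cmult[of g S "-1"] by simp

lemma L2_zero: "(\<lambda>x. 0 :: real) \<in> L2 S"
  by (simp add: L2_real_iff)

lemma nsq_nonneg: "0 \<le> nsq S f"
  by (simp add: nsq_def)

lemma nsq_cmult: "nsq S (\<lambda>x. c * f x) = c\<^sup>2 * nsq S f"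
  by (simp add: nsq_def power_mult_distrib)

lemma nsq_add:
  assumes "f \<in> L2 S" "g \<in> L2 S"
  shows "nsq S (\<lambda>x. f x + g x) = nsq S f + 2 * (LINT x|lebesgue_on S. f x * g x) + nsq S g"
  using assms L2_integrable_mult[OF assms] by (simp add: nsq_def L2_real_iff power2_sum mult.assoc)

lemma nsq_diff:
  assumes "f \<in> L2 S" "g \<in> L2 S"
  shows "nsq S (\<lambda>x. f x - g x) = nsq S f - 2 * (LINT x|lebesgue_on S. f x * g x) + nsq S g"
  using nsq_add[OF assms(1) L2_cmult[OF assms(2), of "-1"]] nsq_cmult[of S "-1" g] by simp

lemma nsq_add_le:
  assumes "f \<in> L2 S" "g \<in> L2 S"
  shows "nsq S (\<lambda>x. f x + g x) \<le> 2 * nsq S f + 2 * nsq S g"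
  using nsq_add[OF assms] nsq_diff[OF assms] nsq_nonneg[of S "\<lambda>x. f x - g x"] by linarith

lemma nsq_cong: "AE x in lebesgue_on S. f x = g x \<Longrightarrow> f \<in> L2 S \<Longrightarrow> g \<in> L2 S \<Longrightarrow> nsq S f = nsq S g"
  unfolding nsq_def by (intro integral_cong_AE) (auto simp: L2_real_iff)

text \<open>A nonnegative quadratic polynomial is evaluated at its minimum \<open>p / y\<close>. The
  form serves both Cauchy-Schwarz inequalities, where the second norm may be 0 because norms are
  only seminorms on representatives.\<close>

lemma discriminant_le:
  fixes p x y :: real
  assumes x: "0 \<le> x" and y: "0 \<le> y" and q: "\<And>t. 0 \<le> x - 2 * t * p + t\<^sup>2 * y"
  shows "p\<^sup>2 \<le> x * y"
proof (cases "y = 0")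
  case True
  have "p = 0"
  proof (rule ccontr)
    assume "p \<noteq> 0"
    \<comment> \<open>For \<open>y = 0\<close> the polynomial is affine in \<open>t\<close>, and at
      this point its value is \<open>- x - 2\<close>.\<close>
    then show False using q[of "(x + 1) / p"] True x by simp
  qed
  then show ?thesis using True by simp
next
  case False
  then have y0: "0 < y" using y by simp
  have "0 \<le> x - 2 * (p / y) * p + (p / y)\<^sup>2 * y" by (rule q)
  also have "\<dots> = x - p\<^sup>2 / y" using y0 by (simp add: power2_eq_square field_simps)
  finally show ?thesis using y0 by (simp add: field_simps)
qed

lemma L2_Cauchy_Schwarz:
  assumes f: "f \<in> L2 S" and g: "g \<in> L2 S"
  shows "\<bar>LINT x|lebesgue_on S. f x * g x\<bar> \<le> sqrt (nsq S f) * sqrt (nsq S g)"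
proof -
  define p where "p = (LINT x|lebesgue_on S. f x * g x)"
  have q: "0 \<le> nsq S f - 2 * t * p + t\<^sup>2 * nsq S g" for t
  proof -
    have "nsq S (\<lambda>x. f x - t * g x) = nsq S f - 2 * (LINT x|lebesgue_on S. f x * (t * g x)) + t\<^sup>2 * nsq S g"
      by (subst nsq_diff[OF f L2_cmult[OF g]]) (simp add: nsq_cmult)
    also have "(LINT x|lebesgue_on S. f x * (t * g x)) = t * p"
      by (simp add: p_def mult.left_commute)
    finally show ?thesis using nsq_nonneg[of S "\<lambda>x. f x - t * g x"] by simp
  qed
  have "p\<^sup>2 \<le> nsq S f * nsq S g"
    by (rule discriminant_le[OF nsq_nonneg nsq_nonneg q])
  then have "sqrt (p\<^sup>2) \<le> sqrt (nsq S f * nsq S g)" by (rule real_sqrt_le_mono)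
  then show ?thesis by (simp add: p_def real_sqrt_mult)
qed

text \<open>The difference of the products expands around the limits into three terms, each
  containing at least one factor that tends to 0 in \<open>L^2\<close>.\<close>

lemma integral_mult_tendsto:
  assumes f: "\<And>n. f n \<in> L2 S" "F \<in> L2 S" "(\<lambda>n. nsq S (\<lambda>x. f n x - F x)) \<longlonglongrightarrow> 0"
    and g: "\<And>n. g n \<in> L2 S" "G \<in> L2 S" "(\<lambda>n. nsq S (\<lambda>x. g n x - G x)) \<longlonglongrightarrow> 0"
  shows "(\<lambda>n. LINT x|lebesgue_on S. f n x * g n x) \<longlonglongrightarrow> (LINT x|lebesgue_on S. F x * G x)"
proof -
  let ?I = "\<lambda>f g. LINT x|lebesgue_on S. f x * g x"
  have eq: "?I (f n) (g n) - ?I F G = ?I (\<lambda>x. f n x - F x) (\<lambda>x. g n x - G x) + ?I F (\<lambda>x. g n x - G x) + ?I (\<lambda>x. f n x - F x) G" for n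
  proof -
    note [simp] = L2_integrable_mult[OF f(1)[of n] g(1)[of n]] L2_integrable_mult[OF f(2) g(1)[of n]]
      L2_integrable_mult[OF f(1)[of n] g(2)] L2_integrable_mult[OF f(2) g(2)]
    show ?thesis by (simp add: left_diff_distrib right_diff_distrib)
  qed
  have l: "(\<lambda>n. sqrt (nsq S (\<lambda>x. f n x - F x)) * sqrt (nsq S (\<lambda>x. g n x - G x)) + sqrt (nsq S F) * sqrt (nsq S (\<lambda>x. g n x - G x))
      + sqrt (nsq S (\<lambda>x. f n x - F x)) * sqrt (nsq S G)) \<longlonglongrightarrow> sqrt 0 * sqrt 0 + sqrt (nsq S F) * sqrt 0 + sqrt 0 * sqrt (nsq S G)"
    by (intro tendsto_intros f(3) g(3))
  have "(\<lambda>n. ?I (f n) (g n) - ?I F G) \<longlonglongrightarrow> 0"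
  proof (rule Lim_null_comparison[OF always_eventually[rule_format]])
    fix n
    show "norm (?I (f n) (g n) - ?I F G) \<le> sqrt (nsq S (\<lambda>x. f n x - F x)) * sqrt (nsq S (\<lambda>x. g n x - G x)) + sqrt (nsq S F) * sqrt (nsq S (\<lambda>x. g n x - G x))
      + sqrt (nsq S (\<lambda>x. f n x - F x)) * sqrt (nsq S G)"
      unfolding eq real_norm_def
      using L2_Cauchy_Schwarz[OF L2_diff[OF f(1)[of n] f(2)] L2_diff[OF g(1)[of n] g(2)]]
        L2_Cauchy_Schwarz[OF f(2) L2_diff[OF g(1)[of n] g(2)]] L2_Cauchy_Schwarz[OF L2_diff[OF f(1)[of n] f(2)] g(2)]
      by linarith
  qed (use l in simp)
  then show ?thesis by (rule LIM_zero_cancel)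
qed

section \<open>Almost everywhere limits and completeness\<close>

lemma integrable_Fatou:
  fixes u :: "nat \<Rightarrow> 'a \<Rightarrow> real"
  assumes u: "\<And>n. integrable M (u n)" "\<And>n x. 0 \<le> u n x" and B: "\<And>n. (LINT x|M. u n x) \<le> B"
    and v: "v \<in> borel_measurable M" and lim: "AE x in M. (\<lambda>n. u n x) \<longlonglongrightarrow> v x"
  shows "integrable M v" "(LINT x|M. v x) \<le> B"
proof -
  have B0: "0 \<le> B" using order_trans[OF _ B[of 0]] u(2) by (simp add: Bochner_Integration.integral_nonneg)
  have v0: "AE x in M. 0 \<le> v x" using lim
    by eventually_elim (rule LIMSEQ_le_const, auto intro: u(2))
  have "(\<integral>\<^sup>+x. ennreal (v x) \<partial>M) = (\<integral>\<^sup>+x. liminf (\<lambda>n. ennreal (u n x)) \<partial>M)"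
  proof (rule nn_integral_cong_AE, use lim in eventually_elim)
    fix x assume "(\<lambda>n. u n x) \<longlonglongrightarrow> v x"
    then have "(\<lambda>n. ennreal (u n x)) \<longlonglongrightarrow> ennreal (v x)" by (rule tendsto_ennrealI)
    then show "ennreal (v x) = liminf (\<lambda>n. ennreal (u n x))"
      by (intro lim_imp_Liminf[symmetric]) simp_all
  qed
  also have "\<dots> \<le> liminf (\<lambda>n. \<integral>\<^sup>+x. ennreal (u n x) \<partial>M)"
    by (rule nn_integral_liminf) (use u(1) in auto)
  also have "\<dots> \<le> liminf (\<lambda>n. ennreal B)"
  proof (rule Liminf_mono, intro always_eventually allI)
    fix n
    have "(\<integral>\<^sup>+x. ennreal (u n x) \<partial>M) = ennreal (LINT x|M. u n x)"
      by (rule nn_integral_eq_integral) (use u in auto)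
    then show "(\<integral>\<^sup>+x. ennreal (u n x) \<partial>M) \<le> ennreal B" using B by (simp add: ennreal_leI)
  qed
  also have "\<dots> = ennreal B" by (simp add: Liminf_const)
  finally have le: "(\<integral>\<^sup>+x. ennreal (v x) \<partial>M) \<le> ennreal B" .
  show vi: "integrable M v"
    by (rule integrableI_nonneg[OF v v0]) (use le in \<open>auto simp: top_unique less_top[symmetric]\<close>)
  show "(LINT x|M. v x) \<le> B"
    using le B0 by (subst (asm) nn_integral_eq_integral[OF vi v0]) simp
qed

lemma L2_AE_subseq:
  fixes f :: "nat \<Rightarrow> point \<Rightarrow> real"
  assumes "\<And>n. f n \<in> L2 S" "F \<in> L2 S" "(\<lambda>n. nsq S (\<lambda>x. f n x - F x)) \<longlonglongrightarrow> 0"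
  obtains r :: "nat \<Rightarrow> nat" where "strict_mono r" "AE x in lebesgue_on S. (\<lambda>n. f (r n) x) \<longlonglongrightarrow> F x"
proof -
  have "\<exists>r::nat\<Rightarrow>nat. strict_mono r \<and> (AE x in lebesgue_on S. (\<lambda>n. (f (r n) x - F x)\<^sup>2) \<longlonglongrightarrow> 0)"
    by (rule tendsto_L1_AE_subseq) (use assms(3) L2_diff[OF assms(1,2)] in \<open>auto simp: nsq_def L2_real_iff\<close>)
  then obtain r :: "nat \<Rightarrow> nat" where r: "strict_mono r" "AE x in lebesgue_on S. (\<lambda>n. (f (r n) x - F x)\<^sup>2) \<longlonglongrightarrow> 0" by blast
  have "AE x in lebesgue_on S. (\<lambda>n. f (r n) x) \<longlonglongrightarrow> F x"
    using r(2)
  proof eventually_elim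
    fix x assume "(\<lambda>n. (f (r n) x - F x)\<^sup>2) \<longlonglongrightarrow> 0"
    then have "(\<lambda>n. sqrt ((f (r n) x - F x)\<^sup>2)) \<longlonglongrightarrow> sqrt 0" by (rule tendsto_real_sqrt)
    then have "(\<lambda>n. f (r n) x - F x) \<longlonglongrightarrow> 0" by (simp add: tendsto_rabs_zero_iff)
    then show "(\<lambda>n. f (r n) x) \<longlonglongrightarrow> F x" by (rule LIM_zero_cancel)
  qed
  with r(1) show ?thesis by (rule that)
qed

text \<open>On a set of finite measure a Cauchy sequence in \<open>L^2\<close> is Cauchy in
  \<open>L^1\<close> and has a subsequence converging almost everywhere. Fatou's lemma, with the
  other index fixed, shows that this pointwise limit is also the limit in
  \<open>L^2\<close>.\<close>

lemma L2_complete: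
  fixes f :: "nat \<Rightarrow> point \<Rightarrow> real"
  assumes S: "S \<in> lmeasurable" and f: "\<And>n. f n \<in> L2 S"
    and C: "\<And>e. 0 < e \<Longrightarrow> \<exists>N. \<forall>i\<ge>N. \<forall>j\<ge>N. nsq S (\<lambda>x. f i x - f j x) < e"
  obtains g where "g \<in> L2 S" "(\<lambda>n. nsq S (\<lambda>x. f n x - g x)) \<longlonglongrightarrow> 0"
proof -
  let ?M = "lebesgue_on S"
  interpret M: finite_measure ?M by (rule finite_measure_lebesgue_on[OF S])
  have one: "(\<lambda>x. 1 :: real) \<in> L2 S" by (simp add: L2_real_iff)
  have absL2: "(\<lambda>x. \<bar>h x\<bar>) \<in> L2 S" if "h \<in> L2 S" for h :: "point \<Rightarrow> real"
    using that by (auto simp: L2_real_iff)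
  have L1: "integrable ?M (f n)" for n using L2_integrable_mult[OF f one] by simp
  obtain r where r: "strict_mono r" "AE x in ?M. Cauchy (\<lambda>i. f (r i) x)"
  proof (rule cauchy_L1_AE_cauchy_subseq[OF L1])
    fix e :: real assume e: "0 < e"
    define m where "m = nsq S (\<lambda>x. 1) + 1"
    have m: "0 < m" using nsq_nonneg[of S "\<lambda>x. 1"] by (simp add: m_def)
    obtain N where N: "\<And>i j. i \<ge> N \<Longrightarrow> j \<ge> N \<Longrightarrow> nsq S (\<lambda>x. f i x - f j x) < e\<^sup>2 / m"
      using C[of "e\<^sup>2 / m"] e m by auto
    have "(LINT x|?M. norm (f i x - f j x)) < e" if "i \<ge> N" "j \<ge> N" for i j
    proof -
      have "(LINT x|?M. norm (f i x - f j x)) \<le> \<bar>LINT x|?M. \<bar>f i x - f j x\<bar> * 1\<bar>" by simp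
      also have "\<dots> \<le> sqrt (nsq S (\<lambda>x. \<bar>f i x - f j x\<bar>)) * sqrt (nsq S (\<lambda>x. 1))"
        by (rule L2_Cauchy_Schwarz[OF absL2[OF L2_diff[OF f f]] one])
      also have "\<dots> = sqrt (nsq S (\<lambda>x. f i x - f j x)) * sqrt (nsq S (\<lambda>x. 1))" by (simp add: nsq_def)
      also have "\<dots> \<le> sqrt (nsq S (\<lambda>x. f i x - f j x)) * sqrt m" by (intro mult_left_mono) (auto simp: m_def nsq_nonneg)
      also have "\<dots> < sqrt (e\<^sup>2 / m) * sqrt m" using N[OF that] m by (intro mult_strict_right_mono) auto
      also have "\<dots> = e" using m e by (simp add: real_sqrt_divide)
      finally show ?thesis .
    qed
    then show "\<exists>N. \<forall>i\<ge>N. \<forall>j\<ge>N. (LINT x|?M. norm (f i x - f j x)) < e" by blast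
  qed blast
  define g where "g x = lim (\<lambda>i. f (r i) x)" for x
  have fm[measurable]: "f n \<in> borel_measurable ?M" for n using f by (rule L2_measurable)
  have gm[measurable]: "g \<in> borel_measurable ?M" unfolding g_def by simp
  have glim: "AE x in ?M. (\<lambda>i. f (r i) x) \<longlonglongrightarrow> g x"
    using r(2) by eventually_elim (auto simp: g_def Cauchy_convergent_iff convergent_LIMSEQ_iff)
  have main: "\<exists>N. \<forall>n\<ge>N. integrable ?M (\<lambda>x. (f n x - g x)\<^sup>2) \<and> nsq S (\<lambda>x. f n x - g x) \<le> e" if e: "0 < e" for e
  proof -
    obtain N where N: "\<And>i j. i \<ge> N \<Longrightarrow> j \<ge> N \<Longrightarrow> nsq S (\<lambda>x. f i x - f j x) < e" using C[OF e] by blast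
    have "integrable ?M (\<lambda>x. (f n x - g x)\<^sup>2) \<and> nsq S (\<lambda>x. f n x - g x) \<le> e" if n: "n \<ge> N" for n
    proof -
      let ?u = "\<lambda>i x. (f n x - f (r (i + N)) x)\<^sup>2"
      have 1: "integrable ?M (?u i)" for i using L2_diff[OF f f] by (simp add: L2_real_iff)
      have 2: "(LINT x|?M. ?u i x) \<le> e" for i
        using N[OF n, of "r (i + N)"] seq_suble[OF r(1), of "i + N"] by (simp add: nsq_def)
      have 3: "(\<lambda>x. (f n x - g x)\<^sup>2) \<in> borel_measurable ?M" by simp
      have 4: "AE x in ?M. (\<lambda>i. ?u i x) \<longlonglongrightarrow> (f n x - g x)\<^sup>2"
        using glim by eventually_elim (intro tendsto_intros LIMSEQ_ignore_initial_segment)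
      show ?thesis using integrable_Fatou[OF 1 _ 2 3 4] by (simp add: nsq_def)
    qed
    then show ?thesis by blast
  qed
  obtain N where "integrable ?M (\<lambda>x. (f N x - g x)\<^sup>2)" using main[of 1] by auto
  then have "(\<lambda>x. f N x - g x) \<in> L2 S" by (simp add: L2_real_iff)
  from L2_diff[OF f[of N] this] have gL: "g \<in> L2 S" by simp
  have "(\<lambda>n. nsq S (\<lambda>x. f n x - g x)) \<longlonglongrightarrow> 0"
  proof (rule LIMSEQ_I)
    fix e :: real assume e: "0 < e"
    obtain N where N: "\<And>n. n \<ge> N \<Longrightarrow> nsq S (\<lambda>x. f n x - g x) \<le> e / 2" using main[of "e/2"] e by auto
    show "\<exists>no. \<forall>n\<ge>no. norm (nsq S (\<lambda>x. f n x - g x) - 0) < e"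
    proof (intro exI[of _ N] allI impI)
      fix n assume "N \<le> n"
      from N[OF this] e show "norm (nsq S (\<lambda>x. f n x - g x) - 0) < e" by (simp add: nsq_nonneg)
    qed
  qed
  with gL show ?thesis by (rule that)
qed

section \<open>Bump functions\<close>

definition bump_poly :: "real \<Rightarrow> real \<Rightarrow> real poly" where
  "bump_poly \<alpha> \<beta> = [:- \<alpha> * \<beta>, \<alpha> + \<beta>, - 1:]"

lemma poly_bump_poly: "poly (bump_poly \<alpha> \<beta>) s = (s - \<alpha>) * (\<beta> - s)"
  by (simp add: bump_poly_def algebra_simps)

text \<open>The functions \<open>P / w^m * exp (- 1 / (n w))\<close> with \<open>w = (s - \<alpha>) (\<beta> - s)\<close>, extended by zero, are closed
  under differentiation.\<close>

definition bump :: "real \<Rightarrow> real \<Rightarrow> real \<Rightarrow> real poly \<Rightarrow> nat \<Rightarrow> real \<Rightarrow> real" where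
  "bump n \<alpha> \<beta> P m s = (if \<alpha> < s \<and> s < \<beta> then
     poly P s / poly (bump_poly \<alpha> \<beta>) s ^ m * exp (- 1 / (n * poly (bump_poly \<alpha> \<beta>) s)) else 0)"

text \<open>Numerator of the derivative over the denominator \<open>w^(m + 2)\<close>. The exponent
  rises by 2 because differentiating \<open>- 1 / (n * w)\<close> produces
  \<open>w' / (n * w^2)\<close>.\<close>

definition bump_step :: "real \<Rightarrow> real \<Rightarrow> real \<Rightarrow> real poly \<Rightarrow> nat \<Rightarrow> real poly" where
  "bump_step n \<alpha> \<beta> P m = pderiv P * (bump_poly \<alpha> \<beta>)\<^sup>2 - smult (real m) (P * pderiv (bump_poly \<alpha> \<beta>) * bump_poly \<alpha> \<beta>)
     + smult (1 / n) (P * pderiv (bump_poly \<alpha> \<beta>))"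

text \<open>The exponential beats every negative power of \<open>w\<close>: the exponential series
  at \<open>1 / (n * w)\<close> is at least its \<open>k\<close>-th term.\<close>

lemma exp_minus_inverse_le:
  fixes w n :: real
  assumes "0 < w" "0 < n"
  shows "exp (- 1 / (n * w)) \<le> fact k * n ^ k * w ^ k"
proof -
  define y where "y = 1 / (n * w)"
  have y: "0 < y" using assms by (simp add: y_def)
  have "y ^ k / fact k \<le> exp y"
  proof -
    have "(\<Sum>i\<in>{k}. y ^ i /\<^sub>R fact i) \<le> (\<Sum>i. y ^ i /\<^sub>R fact i)"
      using y by (intro sum_le_suminf summable_exp_generic) auto
    then show ?thesis by (simp add: exp_def field_simps)
  qed
  then have "exp (- y) \<le> fact k / y ^ k"
    using y by (simp add: exp_minus field_simps)
  also have "fact k / y ^ k = fact k * n ^ k * w ^ k"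
    using assms by (simp add: y_def power_divide power_mult_distrib)
  finally show ?thesis by (simp add: y_def)
qed

lemma has_derivative_0_if_quadratic:
  fixes f :: "real \<Rightarrow> real"
  assumes "\<And>y. \<bar>f y\<bar> \<le> C * (y - x)\<^sup>2"
  shows "(f has_real_derivative 0) (at x)"
proof -
  have f0: "f x = 0" using assms[of x] by simp
  have "((\<lambda>y. \<bar>C\<bar> * \<bar>y - x\<bar>) \<longlongrightarrow> \<bar>C\<bar> * \<bar>x - x\<bar>) (at x)" by (intro tendsto_intros)
  then have l: "((\<lambda>y. \<bar>C\<bar> * \<bar>y - x\<bar>) \<longlongrightarrow> 0) (at x)" by simp
  have "((\<lambda>y. (f y - f x) / (y - x)) \<longlongrightarrow> 0) (at x)"
  proof (rule Lim_null_comparison[OF _ l], rule eventually_at_filter[THEN iffD2], intro always_eventually allI impI)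
    fix y assume y: "y \<noteq> x"
    have "\<bar>f y\<bar> \<le> \<bar>C\<bar> * (y - x)\<^sup>2"
      using assms[of y] mult_right_mono[OF abs_ge_self zero_le_power2, of C "y - x"] by (rule order_trans)
    then show "norm ((f y - f x) / (y - x)) \<le> \<bar>C\<bar> * \<bar>y - x\<bar>"
      using y by (simp add: f0 pos_divide_le_eq mult.assoc power2_eq_square abs_mult_self_eq)
  qed
  then show ?thesis by (simp add: has_field_derivative_iff)
qed

text \<open>Inside the interval this is the quotient rule, outside everything is 0. At an endpoint
  the exponential absorbs the denominator and leaves two further powers of \<open>w\<close>. As
  \<open>w\<close> vanishes linearly there, the function is bounded by a multiple of the squared
  distance to the endpoint, and the derivative is 0.\<close>

lemma bump_has_derivative:
  assumes n: "0 < n" and ab: "\<alpha> < \<beta>"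
  shows "(bump n \<alpha> \<beta> P m has_real_derivative bump n \<alpha> \<beta> (bump_step n \<alpha> \<beta> P m) (m + 2) s) (at s)"
proof -
  let ?W = "bump_poly \<alpha> \<beta>"
  obtain A where A: "\<And>s. s \<in> {\<alpha>..\<beta>} \<Longrightarrow> \<bar>poly P s\<bar> \<le> A"
  proof -
    have "compact (poly P ` {\<alpha>..\<beta>})" by (intro compact_continuous_image continuous_intros) auto
    then obtain A where "\<forall>x\<in>poly P ` {\<alpha>..\<beta>}. norm x \<le> A" using compact_imp_bounded bounded_iff by metis
    then show ?thesis by (intro that[of A]) auto
  qed
  have A0: "0 \<le> A" using A[of \<alpha>] ab by simp
  \<comment> \<open>\<open>A\<close> bounds \<open>P\<close>, the next factor is the exponential
    estimate with \<open>k = m + 2\<close>, and \<open>(\<beta> - \<alpha>)\<^sup>2\<close> bounds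
    whichever of the two linear factors of \<open>w\<close> is given up.\<close>
  define C where "C = A * (fact (m + 2) * n ^ (m + 2)) * (\<beta> - \<alpha>)\<^sup>2"
  have key: "\<bar>bump n \<alpha> \<beta> P m y\<bar> \<le> A * (fact (m + 2) * n ^ (m + 2)) * (poly ?W y)\<^sup>2" if y: "\<alpha> < y" "y < \<beta>" for y
  proof -
    have w: "0 < poly ?W y" using y by (simp add: poly_bump_poly)
    have "\<bar>bump n \<alpha> \<beta> P m y\<bar> = \<bar>poly P y\<bar> * (exp (- 1 / (n * poly ?W y)) / poly ?W y ^ m)"
      using y w by (simp add: bump_def abs_mult)
    also have "\<dots> \<le> A * (fact (m + 2) * n ^ (m + 2) * poly ?W y ^ (m + 2) / poly ?W y ^ m)"
      using A[of y] y w A0 n exp_minus_inverse_le[OF w n, of "m + 2"] by (intro mult_mono divide_right_mono) auto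
    also have "\<dots> = A * (fact (m + 2) * n ^ (m + 2)) * (poly ?W y)\<^sup>2"
      using w by (simp add: power_add power2_eq_square)
    finally show ?thesis .
  qed
  have bnd: "\<bar>bump n \<alpha> \<beta> P m y\<bar> \<le> C * (y - \<alpha>)\<^sup>2" "\<bar>bump n \<alpha> \<beta> P m y\<bar> \<le> C * (y - \<beta>)\<^sup>2" for y
  proof -
    have C0: "0 \<le> C" unfolding C_def using A0 n by simp
    have "\<bar>bump n \<alpha> \<beta> P m y\<bar> \<le> C * (y - \<alpha>)\<^sup>2 \<and> \<bar>bump n \<alpha> \<beta> P m y\<bar> \<le> C * (y - \<beta>)\<^sup>2"
    proof (cases "\<alpha> < y \<and> y < \<beta>")
      case True
      have 1: "(poly ?W y)\<^sup>2 \<le> (\<beta> - \<alpha>)\<^sup>2 * (y - \<alpha>)\<^sup>2" "(poly ?W y)\<^sup>2 \<le> (\<beta> - \<alpha>)\<^sup>2 * (y - \<beta>)\<^sup>2"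
        using True unfolding poly_bump_poly power_mult_distrib[symmetric] power2_commute[of y \<beta>]
        by (auto intro!: power_mono mult_mono simp: mult.commute[of "y - \<alpha>"] power_mult_distrib[symmetric])
      have K: "0 \<le> A * (fact (m + 2) * n ^ (m + 2))" using A0 n by simp
      from key True mult_left_mono[OF 1(1) K] mult_left_mono[OF 1(2) K] show ?thesis
        unfolding C_def by (auto simp: mult.assoc intro: order_trans)
    qed (use C0 in \<open>auto simp: bump_def\<close>)
    then show "\<bar>bump n \<alpha> \<beta> P m y\<bar> \<le> C * (y - \<alpha>)\<^sup>2" "\<bar>bump n \<alpha> \<beta> P m y\<bar> \<le> C * (y - \<beta>)\<^sup>2" by auto
  qed
  consider "\<alpha> < s" "s < \<beta>" | "s = \<alpha>" | "s = \<beta>" | "s < \<alpha>" | "\<beta> < s" by linarith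
  then show ?thesis
  proof cases
    case 1
    let ?f = "\<lambda>s. poly P s / poly ?W s ^ m * exp (- 1 / (n * poly ?W s))"
    have w: "0 < poly ?W s" using 1 by (simp add: poly_bump_poly)
    define w p w' p' e where "w = poly ?W s" and "p = poly P s" and "w' = poly (pderiv ?W) s" and "p' = poly (pderiv P) s"
      and "e = exp (- 1 / (n * poly ?W s))"
    have wp: "0 < w" using w by (simp add: w_def)
    have "(?f has_real_derivative (((p' * w ^ m - p * (real m * w ^ (m - 1) * w')) / (w ^ m * w ^ m)) * e + p / w ^ m * (e * (1 / (n * w\<^sup>2) * w')))) (at s)"
      unfolding w_def w'_def p_def p'_def e_def using w n
      by (auto intro!: derivative_eq_intros poly_DERIV simp: power2_eq_square field_simps)
    moreover have "((p' * w ^ m - p * (real m * w ^ (m - 1) * w')) / (w ^ m * w ^ m)) * e + p / w ^ m * (e * (1 / (n * w\<^sup>2) * w'))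
      = (p' * w\<^sup>2 - real m * (p * w' * w) + 1 / n * (p * w')) / w ^ (m + 2) * e"
    proof -
      have "w * w ^ (m - 1) * real m = w ^ m * real m" by (cases m) auto
      then have a: "real m * w ^ (m - 1) = real m * w ^ m / w" using wp by (simp add: field_simps)
      show ?thesis unfolding a using wp n by (simp add: field_simps power2_eq_square power_add)
    qed
    moreover have "bump n \<alpha> \<beta> (bump_step n \<alpha> \<beta> P m) (m + 2) s = (p' * w\<^sup>2 - real m * (p * w' * w) + 1 / n * (p * w')) / w ^ (m + 2) * e"
      using 1 by (simp add: bump_def bump_step_def w_def p_def w'_def p'_def e_def)
    ultimately have D: "(?f has_real_derivative bump n \<alpha> \<beta> (bump_step n \<alpha> \<beta> P m) (m + 2) s) (at s)" by simp
    show ?thesis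
      by (rule has_field_derivative_transform_within_open[OF D, of "{\<alpha><..<\<beta>}"]) (use 1 in \<open>auto simp: bump_def\<close>)
  next
    case 2
    have "bump n \<alpha> \<beta> (bump_step n \<alpha> \<beta> P m) (m + 2) \<alpha> = 0" by (simp add: bump_def)
    then show ?thesis using has_derivative_0_if_quadratic[OF bnd(1)] 2 by simp
  next
    case 3
    have "bump n \<alpha> \<beta> (bump_step n \<alpha> \<beta> P m) (m + 2) \<beta> = 0" by (simp add: bump_def)
    then show ?thesis using has_derivative_0_if_quadratic[OF bnd(2)] 3 by simp
  next
    case 4
    have "((\<lambda>_. 0) has_real_derivative 0) (at s)" by simp
    then have "(bump n \<alpha> \<beta> P m has_real_derivative 0) (at s)"
      by (rule has_field_derivative_transform_within_open[of _ _ _ "{..<\<alpha>}"]) (use 4 in \<open>auto simp: bump_def\<close>)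
    then show ?thesis using 4 by (simp add: bump_def)
  next
    case 5
    have "((\<lambda>_. 0) has_real_derivative 0) (at s)" by simp
    then have "(bump n \<alpha> \<beta> P m has_real_derivative 0) (at s)"
      by (rule has_field_derivative_transform_within_open[of _ _ _ "{\<beta><..}"]) (use 5 in \<open>auto simp: bump_def\<close>)
    then show ?thesis using 5 by (simp add: bump_def)
  qed
qed

lemma bump_derivatives:
  assumes "0 < n" "\<alpha> < \<beta>"
  shows "\<exists>D. D 0 = bump n \<alpha> \<beta> 1 0 \<and> (\<forall>k x. (D k has_real_derivative D (Suc k) x) (at x))"
proof -
  define P where "P = rec_nat (1 :: real poly) (\<lambda>k p. bump_step n \<alpha> \<beta> p (2 * k))"
  have "P 0 = 1" and Suc: "P (Suc k) = bump_step n \<alpha> \<beta> (P k) (2 * k)" for k by (auto simp: P_def)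
  then show ?thesis
    using bump_has_derivative[OF assms]
    by (intro exI[of _ "\<lambda>k. bump n \<alpha> \<beta> (P k) (2 * k)"]) (auto simp: Suc)
qed

lemma bump_1_0:
  assumes "0 < n"
  shows "bump n \<alpha> \<beta> 1 0 s \<in> {0..1}" "bump n \<alpha> \<beta> 1 0 s \<noteq> 0 \<Longrightarrow> \<alpha> < s \<and> s < \<beta>"
proof -
  have "0 < poly (bump_poly \<alpha> \<beta>) s" if "\<alpha> < s" "s < \<beta>" using that by (simp add: poly_bump_poly)
  then show "bump n \<alpha> \<beta> 1 0 s \<in> {0..1}" using assms by (auto simp: bump_def)
  show "bump n \<alpha> \<beta> 1 0 s \<noteq> 0 \<Longrightarrow> \<alpha> < s \<and> s < \<beta>" by (auto simp: bump_def split: if_splits)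
qed

lemma bump_tendsto: "(\<lambda>n. bump (real (Suc n)) \<alpha> \<beta> 1 0 s) \<longlonglongrightarrow> indicator {\<alpha><..<\<beta>} s"
proof (cases "\<alpha> < s \<and> s < \<beta>")
  case True
  have "(\<lambda>n. - (1 / poly (bump_poly \<alpha> \<beta>) s) * inverse (real (Suc n))) \<longlonglongrightarrow> - (1 / poly (bump_poly \<alpha> \<beta>) s) * 0"
    by (intro tendsto_intros LIMSEQ_inverse_real_of_nat)
  then have "(\<lambda>n. exp (- (1 / poly (bump_poly \<alpha> \<beta>) s) * inverse (real (Suc n)))) \<longlonglongrightarrow> exp (- (1 / poly (bump_poly \<alpha> \<beta>) s) * 0)"
    by (rule tendsto_exp)
  then show ?thesis using True by (simp add: bump_def divide_inverse mult.commute del: of_nat_Suc)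
qed (auto simp: bump_def)

lemma smooth1_bump: "0 < n \<Longrightarrow> \<alpha> < \<beta> \<Longrightarrow> smooth1 (bump n \<alpha> \<beta> 1 0)"
  unfolding smooth1_def by (rule bump_derivatives)

lemma test_functionD:
  fixes \<phi> :: "point \<Rightarrow> real"
  assumes "\<phi> \<in> test_functions S"
  shows "C1 \<phi>" "\<And>x. x \<notin> S \<Longrightarrow> \<phi> x = 0" "continuous_on A \<phi>"
proof -
  show "C1 \<phi>" using assms by (auto simp: test_functions_def intro: smooth_imp_C1)
  then show "continuous_on A \<phi>" by (rule C1_continuous)
  show "\<phi> x = 0" if "x \<notin> S" for x
  proof (rule ccontr)
    assume "\<phi> x \<noteq> 0"
    then have "x \<in> closure {x. \<phi> x \<noteq> 0}" by (intro closure_subset[THEN subsetD]) simp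
    moreover have "closure {x. \<phi> x \<noteq> 0} \<subseteq> S" using assms by (simp add: test_functions_def)
    ultimately show False using that by (simp add: subset_iff)
  qed
qed

lemma bump_tensor_test_function:
  assumes n: "0 < n" and "0 < u1" "u1 < v1" "v1 < a" "0 < u2" "u2 < v2" "v2 < b"
  shows "(\<lambda>x. bump n u1 v1 1 0 (x $ 1) * bump n u2 v2 1 0 (x $ 2)) \<in> test_functions (rect a b)"
proof -
  let ?f = "\<lambda>x :: point. bump n u1 v1 1 0 (x $ 1) * bump n u2 v2 1 0 (x $ 2)"
  have "{x. ?f x \<noteq> 0} \<subseteq> cbox (vector [u1, u2]) (vector [v1, v2])"
  proof
    fix x assume "x \<in> {x. ?f x \<noteq> 0}"
    then have "bump n u1 v1 1 0 (x $ 1) \<noteq> 0" "bump n u2 v2 1 0 (x $ 2) \<noteq> 0" by auto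
    from this[THEN bump_1_0(2)[OF n]] show "x \<in> cbox (vector [u1, u2]) (vector [v1, v2])"
      by (simp add: cbox_real2)
  qed
  then have 1: "closure {x. ?f x \<noteq> 0} \<subseteq> cbox (vector [u1, u2]) (vector [v1, v2])"
    by (intro closure_minimal) auto
  then have "compact (closure {x. ?f x \<noteq> 0})"
    using bounded_subset[OF bounded_cbox 1] by (simp only: compact_eq_bounded_closed closed_closure simp_thms)
  moreover have "closure {x. ?f x \<noteq> 0} \<subseteq> rect a b"
    using 1 assms by (fastforce simp: cbox_real2 rect_def)
  ultimately show ?thesis
    using assms by (auto simp: test_functions_def intro!: smooth_tensor smooth1_bump)
qed

lemma lmeasurable_rect: "rect a b \<in> lmeasurable" "rect a b \<in> sets lebesgue"
  by (simp_all add: rect_eq_box)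

section \<open>Weak derivatives on the rectangle\<close>

locale rectangle =
  fixes a b :: real
  assumes a: "0 < a" and b: "0 < b"
begin

abbreviation "R \<equiv> rect a b"
abbreviation "M \<equiv> lebesgue_on (rect a b)"

sublocale M: finite_measure M
  by (rule finite_measure_lebesgue_on[OF lmeasurable_rect(1)])

lemma continuous_L2: "continuous_on UNIV f \<Longrightarrow> f \<in> L2 R" for f :: "point \<Rightarrow> real"
  using continuous_imp_integrable_rect[of f a b] continuous_imp_integrable_rect[of "\<lambda>x. (f x)\<^sup>2" a b]
  by (auto simp: L2_real_iff intro!: continuous_intros)

lemma L2_integrable: "f \<in> L2 R \<Longrightarrow> integrable M f" for f :: "point \<Rightarrow> real"
  using L2_integrable_mult[of f R "\<lambda>x. 1"] continuous_L2[of "\<lambda>x. 1"] by simp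

lemma test_L2: "\<phi> \<in> test_functions R \<Longrightarrow> \<phi> \<in> L2 R"
  by (intro continuous_L2 test_functionD)

section \<open>The fundamental lemma of the calculus of variations\<close>

text \<open>Tensor products of bumps are test functions as long as the box stays away from the
  boundary of \<open>R\<close>. They converge to the indicator of the box and are bounded by 1, so
  \<open>\<bar>g\<bar>\<close> is an integrable majorant.\<close>

lemma integral_inner_box_eq_0:
  assumes g: "integrable M g" and 0: "\<And>\<phi>. \<phi> \<in> test_functions R \<Longrightarrow> (LINT x|M. g x * \<phi> x) = 0"
    and uv: "0 < u1" "u1 < v1" "v1 < a" "0 < u2" "u2 < v2" "v2 < b"
  shows "(LINT x|M. indicator (box (vector [u1, u2]) (vector [v1, v2])) x * g x) = 0"
proof -
  let ?\<phi> = "\<lambda>n x. bump (real (Suc n)) u1 v1 1 0 (x $ 1) * bump (real (Suc n)) u2 v2 1 0 (x $ 2)"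
  let ?B = "box (vector [u1, u2]) (vector [v1, v2]) :: point set"
  have t: "?\<phi> n \<in> test_functions R" for n
    by (rule bump_tensor_test_function) (use uv in auto)
  have [measurable]: "?\<phi> n \<in> borel_measurable M" for n
    using test_L2[OF t] by (rule L2_measurable)
  have [measurable]: "g \<in> borel_measurable M" using g by simp
  have Bm: "?B \<in> sets lebesgue" by simp
  have [measurable]: "(indicator ?B :: point \<Rightarrow> real) \<in> borel_measurable M"
    by (intro measurable_restrict_space1 borel_measurable_indicator) simp
  have "(\<lambda>n. LINT x|M. g x * ?\<phi> n x) \<longlonglongrightarrow> (LINT x|M. g x * indicator ?B x)"
  proof (rule integral_dominated_convergence[where w = "\<lambda>x. \<bar>g x\<bar>"])
    show "AE x in M. (\<lambda>n. g x * ?\<phi> n x) \<longlonglongrightarrow> g x * indicator ?B x"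
    proof (intro AE_I2 tendsto_mult_left)
      fix x :: point
      have "(\<lambda>n. ?\<phi> n x) \<longlonglongrightarrow> indicator {u1<..<v1} (x $ 1) * indicator {u2<..<v2} (x $ 2)"
        by (intro tendsto_mult bump_tendsto)
      moreover have "indicator {u1<..<v1} (x $ 1) * indicator {u2<..<v2} (x $ 2) = (indicator ?B x :: real)"
        by (auto simp: indicator_def mem_box_cart forall_2)
      ultimately show "(\<lambda>n. ?\<phi> n x) \<longlonglongrightarrow> indicator ?B x" by simp
    qed
    show "AE x in M. norm (g x * ?\<phi> n x) \<le> \<bar>g x\<bar>" for n
    proof (intro AE_I2)
      fix x :: point
      have "\<bar>?\<phi> n x\<bar> \<le> 1"
        using bump_1_0(1)[of "real (Suc n)" u1 v1 "x $ 1"] bump_1_0(1)[of "real (Suc n)" u2 v2 "x $ 2"]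
        by (simp add: abs_mult mult_le_one del: of_nat_Suc)
      then show "norm (g x * ?\<phi> n x) \<le> \<bar>g x\<bar>" by (simp add: abs_mult mult_left_le del: of_nat_Suc)
    qed
  qed (use g in \<open>auto simp del: of_nat_Suc\<close>)
  then have "(\<lambda>n. 0 :: real) \<longlonglongrightarrow> (LINT x|M. g x * indicator ?B x)" by (simp only: 0[OF t])
  then show ?thesis by (simp add: LIMSEQ_const_iff mult.commute)
qed

text \<open>The box is cut down to its intersection with \<open>R\<close> and exhausted from inside
  by boxes with a positive distance to the boundary.\<close>

lemma integral_box_eq_0:
  assumes g: "integrable M g" and 0: "\<And>\<phi>. \<phi> \<in> test_functions R \<Longrightarrow> (LINT x|M. g x * \<phi> x) = 0"
  shows "(LINT x|M. indicator (box c d) x * g x) = 0"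
proof -
  define c1 c2 d1 d2 where "c1 = max (c $ 1) 0" and "c2 = max (c $ 2) 0" and "d1 = min (d $ 1) a" and "d2 = min (d $ 2) b"
  let ?B = "box (vector [c1, c2]) (vector [d1, d2]) :: point set"
  have ind: "indicator (box c d) x = (indicator ?B x :: real)" if "x \<in> R" for x
    using that by (auto simp: indicator_def mem_box_cart forall_2 rect_def c1_def c2_def d1_def d2_def)
  have eq: "(LINT x|M. indicator (box c d) x * g x) = (LINT x|M. indicator ?B x * g x)"
    by (intro Bochner_Integration.integral_cong refl) (simp add: ind)
  show ?thesis
  proof (cases "c1 < d1 \<and> c2 < d2")
    case False
    then have "?B = {}" by (auto simp: mem_box_cart forall_2)
    then show ?thesis using eq by simp
  next
    case True
    define \<delta> where "\<delta> = min (d1 - c1) (d2 - c2)"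
    have \<delta>: "0 < \<delta>" "\<delta> \<le> d1 - c1" "\<delta> \<le> d2 - c2" using True by (auto simp: \<delta>_def)
    \<comment> \<open>At most a third of the shorter side length, so that shrinking from both ends
      leaves a nonempty box for every \<open>n\<close>.\<close>
    define \<epsilon> where "\<epsilon> n = (\<delta> / 3) * inverse (real (Suc n))" for n
    have \<epsilon>: "0 < \<epsilon> n" "2 * \<epsilon> n < \<delta>" for n
    proof -
      have "inverse (real (Suc n)) \<le> 1" by (simp add: field_simps)
      then have "\<epsilon> n \<le> (\<delta> / 3) * 1" unfolding \<epsilon>_def using \<delta> by (intro mult_left_mono) auto
      then show "0 < \<epsilon> n" "2 * \<epsilon> n < \<delta>" using \<delta> by (auto simp: \<epsilon>_def)
    qed
    have \<epsilon>l: "\<epsilon> \<longlonglongrightarrow> 0"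
      using tendsto_mult_left[OF LIMSEQ_inverse_real_of_nat, of "\<delta> / 3"] by (simp add: \<epsilon>_def[abs_def])
    let ?Bn = "\<lambda>n. box (vector [c1 + \<epsilon> n, c2 + \<epsilon> n]) (vector [d1 - \<epsilon> n, d2 - \<epsilon> n]) :: point set"
    have z: "(LINT x|M. indicator (?Bn n) x * g x) = 0" for n
    proof (rule integral_inner_box_eq_0[OF g 0])
      have "0 \<le> c1" "0 \<le> c2" "d1 \<le> a" "d2 \<le> b" by (auto simp: c1_def c2_def d1_def d2_def)
      then show "0 < c1 + \<epsilon> n" "c1 + \<epsilon> n < d1 - \<epsilon> n" "d1 - \<epsilon> n < a" "0 < c2 + \<epsilon> n" "c2 + \<epsilon> n < d2 - \<epsilon> n" "d2 - \<epsilon> n < b"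
        using \<epsilon>[of n] \<delta> by linarith+
    qed
    have im: "(indicator (box u v) :: point \<Rightarrow> real) \<in> borel_measurable M" for u v :: point
      by (intro measurable_restrict_space1 borel_measurable_indicator) simp
    have gm: "g \<in> borel_measurable M" using g by simp
    have "(\<lambda>n. LINT x|M. indicator (?Bn n) x * g x) \<longlonglongrightarrow> (LINT x|M. indicator ?B x * g x)"
    proof (rule integral_dominated_convergence[where w = "\<lambda>x. \<bar>g x\<bar>"])
      show "AE x in M. (\<lambda>n. indicator (?Bn n) x * g x) \<longlonglongrightarrow> indicator ?B x * g x"
      proof (intro AE_I2 tendsto_mult_right)
        fix x :: point
        show "(\<lambda>n. indicator (?Bn n) x :: real) \<longlonglongrightarrow> indicator ?B x"
        proof (cases "x \<in> ?B")
          case True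
          then have "0 < min (min (x $ 1 - c1) (x $ 2 - c2)) (min (d1 - x $ 1) (d2 - x $ 2))"
            by (auto simp: mem_box_cart forall_2)
          from order_tendstoD(2)[OF \<epsilon>l this]
          have "eventually (\<lambda>n. indicator (?Bn n) x = (indicator ?B x :: real)) sequentially"
            by eventually_elim (use True in \<open>auto simp: indicator_def mem_box_cart forall_2\<close>)
          then show ?thesis by (rule tendsto_eventually)
        next
          case False
          then have "x \<notin> ?Bn n" for n using \<epsilon>(1)[of n] by (auto simp: mem_box_cart forall_2)
          then show ?thesis using False by simp
        qed
      qed
      show "(\<lambda>x. indicator ?B x * g x) \<in> borel_measurable M" "\<And>n. (\<lambda>x. indicator (?Bn n) x * g x) \<in> borel_measurable M"
        by (intro borel_measurable_times im gm)+
      show "AE x in M. norm (indicator (?Bn n) x * g x) \<le> \<bar>g x\<bar>" for n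
        by (intro AE_I2) (auto simp: indicator_def)
    qed (use g in auto)
    then have "(\<lambda>n. 0 :: real) \<longlonglongrightarrow> (LINT x|M. indicator ?B x * g x)" by (simp only: z)
    then show ?thesis using eq by (simp add: LIMSEQ_const_iff)
  qed
qed

text \<open>Open boxes generate the Borel sets and are closed under intersection, so vanishing
  integrals over boxes propagate to all Borel sets by Dynkin's argument, and a density whose
  integrals all vanish is 0. The argument uses a Borel representative \<open>G'\<close> of the
  extension of \<open>g\<close> by zero.\<close>

lemma AE_eq_0_if_test:
  assumes g: "integrable M g" and 0: "\<And>\<phi>. \<phi> \<in> test_functions R \<Longrightarrow> (LINT x|M. g x * \<phi> x) = 0"
  shows "AE x in M. g x = 0"
proof -
  define G where "G x = indicator R x * g x" for x
  have Gi: "integrable lebesgue G"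
    using g by (simp add: G_def[abs_def] integrable_restrict_space lmeasurable_rect)
  obtain G' where G': "G' \<in> borel_measurable lborel" "AE x in lborel. G x = G' x"
    using completion_ex_borel_measurable_real[of G lborel] Gi by auto
  have AEl: "AE x in lebesgue. G x = G' x" using G'(2) by (rule AE_completion)
  have G'm: "G' \<in> borel_measurable lebesgue" using G'(1) by (rule measurable_completion)
  have "integrable lebesgue G'"
    by (rule integrable_cong_AE_imp[OF Gi G'm]) (use AEl in auto)
  then have G'i: "integrable lborel G'" using G'(1) by (simp add: integrable_completion)
  have box0: "(LINT x|lborel. indicator (box c d) x * G' x) = 0" for c d
  proof -
    have "(LINT x|lborel. indicator (box c d) x * G' x) = (LINT x|lebesgue. indicator (box c d) x * G' x)"
      using G'(1) by (intro integral_completion[symmetric]) auto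
    also have "\<dots> = (LINT x|lebesgue. indicator (box c d) x * G x)"
      using AEl G'm Gi by (intro integral_cong_AE borel_measurable_times borel_measurable_indicator) auto
    also have "\<dots> = (LINT x|lebesgue. indicator R x *\<^sub>R (indicator (box c d) x * g x))"
      by (intro Bochner_Integration.integral_cong refl) (simp add: G_def)
    also have "\<dots> = (LINT x|M. indicator (box c d) x * g x)"
      by (rule integral_restrict_space[symmetric]) (simp add: lmeasurable_rect)
    finally show ?thesis using integral_box_eq_0[OF g 0] by simp
  qed
  \<comment> \<open>The complement step of the induction needs the integral over the plane, which is
    not itself a box; as \<open>G\<close> lives on \<open>R\<close>, integrating over the box
    \<open>R\<close> gives the same value.\<close>
  have UN0: "(LINT x|lborel. G' x) = 0"
  proof -
    have "(LINT x|lborel. G' x) = (LINT x|lebesgue. G' x)"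
      using G'(1) by (intro integral_completion[symmetric]) auto
    also have "\<dots> = (LINT x|lebesgue. G x)"
      using AEl G'm Gi by (intro integral_cong_AE) auto
    also have "\<dots> = (LINT x|lebesgue. indicator R x * G x)"
      by (intro Bochner_Integration.integral_cong refl) (simp add: G_def indicator_def)
    also have "\<dots> = (LINT x|lebesgue. indicator R x * G' x)"
      using AEl G'm Gi lmeasurable_rect by (intro integral_cong_AE) auto
    also have "\<dots> = (LINT x|lborel. indicator R x * G' x)"
      using G'(1) by (intro integral_completion) (auto simp: rect_eq_box)
    finally show ?thesis using box0 by (simp add: rect_eq_box)
  qed
  have all: "(LINT x|lborel. indicator A x * G' x) = 0" if A: "A \<in> sets borel" for A
  proof -
    let ?G = "range (\<lambda>(a, b). box a b :: point set)"
    have "Int_stable ?G" by (auto simp: Int_stable_def box_Int_box)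
    moreover have "?G \<subseteq> Pow UNIV" by simp
    moreover have "A \<in> sigma_sets UNIV ?G" using A by (subst (asm) borel_eq_box) (simp add: sets_measure_of)
    ultimately show ?thesis
    proof (induction rule: sigma_sets_induct_disjoint)
      case (basic A) then show ?case using box0 by auto
    next
      case empty show ?case by simp
    next
      case (compl A)
      then have Am: "A \<in> sets borel" by (subst borel_eq_box) (simp add: sets_measure_of)
      have i: "integrable lborel (\<lambda>x. indicator A x * G' x)"
        using integrable_mult_indicator[OF _ G'i, of A] Am by simp
      have "(LINT x|lborel. indicator (UNIV - A) x * G' x) = (LINT x|lborel. G' x - indicator A x * G' x)"
        by (intro Bochner_Integration.integral_cong refl) (simp add: indicator_def)
      also have "\<dots> = 0" using i G'i UN0 compl by simp
      finally show ?case .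
    next
      case (union A)
      then have Am: "A i \<in> sets borel" for i by (subst borel_eq_box) (auto simp: sets_measure_of)
      have si: "set_integrable lborel (\<Union>i. A i) G'"
        using integrable_mult_indicator[OF _ G'i, of "\<Union>i. A i"] Am by (auto simp: set_integrable_def)
      have "(LINT x:(\<Union>i. A i)|lborel. G' x) = (\<Sum>i. (LINT x:A i|lborel. G' x))"
        using union Am by (intro lebesgue_integral_countable_add si) (auto simp: disjoint_family_on_def)
      then show ?case using union by (simp add: set_lebesgue_integral_def)
    qed
  qed
  have "AE x in lborel. G' x = 0"
    by (rule sigma_finite_measure.density_zero[OF lborel.sigma_finite_measure_axioms G'i]) (use all in \<open>auto simp: set_lebesgue_integral_def\<close>)
  then have "AE x in lebesgue. G' x = 0" by (rule AE_completion)
  with AEl have "AE x in lebesgue. G x = 0" by eventually_elim simp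
  then show ?thesis
    by (auto simp: AE_restrict_space_iff lmeasurable_rect G_def elim!: eventually_mono split: split_indicator_asm)
qed

lemma is_weak_partial_unique:
  assumes "g \<in> L2 R" "h \<in> L2 R" "is_weak_partial R i f g" "is_weak_partial R i f h"
  shows "AE x in M. g x = h x"
proof -
  have "AE x in M. g x - h x = 0"
  proof (rule AE_eq_0_if_test)
    show "integrable M (\<lambda>x. g x - h x)" using assms by (intro L2_integrable L2_diff)
    fix \<phi> assume \<phi>: "\<phi> \<in> test_functions R"
    note [simp] = L2_integrable_mult[OF assms(1) test_L2[OF \<phi>]] L2_integrable_mult[OF assms(2) test_L2[OF \<phi>]]
    show "(LINT x|M. (g x - h x) * \<phi> x) = 0"
      using assms(3,4) \<phi> by (simp add: left_diff_distrib is_weak_partial_def)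
  qed
  then show ?thesis by eventually_elim simp
qed

text \<open>\<open>weak_partial\<close> is an arbitrary choice among weak derivatives. Once one
  square integrable candidate is known, the choice is legitimate and agrees with the candidate
  almost everywhere; every computation with \<open>weak_partial\<close> goes through this
  fact.\<close>

lemma weak_partial_AE:
  assumes "g \<in> L2 R" "is_weak_partial R i f g"
  shows "weak_partial R i f \<in> L2 R" "is_weak_partial R i f (weak_partial R i f)" "AE x in M. weak_partial R i f x = g x"
proof -
  have "weak_partial R i f \<in> L2 R \<and> is_weak_partial R i f (weak_partial R i f)"
    unfolding weak_partial_def by (rule someI[of _ g]) (use assms in simp)
  then show 1: "weak_partial R i f \<in> L2 R" and 2: "is_weak_partial R i f (weak_partial R i f)" by auto
  show "AE x in M. weak_partial R i f x = g x"
    by (rule is_weak_partial_unique[OF 1 assms(1) 2 assms(2)])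
qed

lemma H1_weak_partial:
  assumes "f \<in> H1 R"
  shows "f \<in> L2 R" "weak_partial R i f \<in> L2 R" "is_weak_partial R i f (weak_partial R i f)"
proof -
  show "f \<in> L2 R" using assms by (simp add: H1_def)
  obtain g where "g \<in> L2 R" "is_weak_partial R i f g" using assms by (auto simp: H1_def)
  from weak_partial_AE[OF this] show "weak_partial R i f \<in> L2 R" "is_weak_partial R i f (weak_partial R i f)" by auto
qed

lemma partial_test_L2: "\<phi> \<in> test_functions R \<Longrightarrow> partial i \<phi> \<in> L2 R"
  by (intro continuous_L2 C1_D test_functionD)

lemma is_weak_partial_add:
  assumes "f \<in> L2 R" "g \<in> L2 R" "f' \<in> L2 R" "g' \<in> L2 R" "is_weak_partial R i f f'" "is_weak_partial R i g g'"
  shows "is_weak_partial R i (\<lambda>x. f x + g x) (\<lambda>x. f' x + g' x)"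
  unfolding is_weak_partial_def
proof
  fix \<phi> assume \<phi>: "\<phi> \<in> test_functions R"
  note [simp] = L2_integrable_mult[OF assms(1) partial_test_L2[OF \<phi>]] L2_integrable_mult[OF assms(2) partial_test_L2[OF \<phi>]]
    L2_integrable_mult[OF assms(3) test_L2[OF \<phi>]] L2_integrable_mult[OF assms(4) test_L2[OF \<phi>]]
  show "(LINT x|M. (f x + g x) * partial i \<phi> x) = - (LINT x|M. (f' x + g' x) * \<phi> x)"
    using assms(5,6) \<phi> by (simp add: distrib_right is_weak_partial_def)
qed

lemma is_weak_partial_cmult:
  assumes "is_weak_partial R i f f'"
  shows "is_weak_partial R i (\<lambda>x. c * f x) (\<lambda>x. c * f' x)"
  using assms by (simp add: is_weak_partial_def mult.assoc)

lemma H1_add: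
  assumes "f \<in> H1 R" "g \<in> H1 R"
  shows "(\<lambda>x. f x + g x) \<in> H1 R"
    "AE x in M. weak_partial R i (\<lambda>x. f x + g x) x = weak_partial R i f x + weak_partial R i g x"
proof -
  note f = H1_weak_partial[OF assms(1)] and g = H1_weak_partial[OF assms(2)]
  have w: "is_weak_partial R i (\<lambda>x. f x + g x) (\<lambda>x. weak_partial R i f x + weak_partial R i g x)" for i
    by (rule is_weak_partial_add[OF f(1) g(1) f(2) g(2) f(3) g(3)])
  have L: "(\<lambda>x. weak_partial R i f x + weak_partial R i g x) \<in> L2 R" for i by (rule L2_add[OF f(2) g(2)])
  show "(\<lambda>x. f x + g x) \<in> H1 R" unfolding H1_def using w L L2_add[OF f(1) g(1)] by blast
  show "AE x in M. weak_partial R i (\<lambda>x. f x + g x) x = weak_partial R i f x + weak_partial R i g x"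
    by (rule weak_partial_AE(3)[OF L w])
qed

lemma H1_cmult:
  assumes "f \<in> H1 R"
  shows "(\<lambda>x. c * f x) \<in> H1 R" "AE x in M. weak_partial R i (\<lambda>x. c * f x) x = c * weak_partial R i f x"
proof -
  note f = H1_weak_partial[OF assms(1)]
  have w: "is_weak_partial R i (\<lambda>x. c * f x) (\<lambda>x. c * weak_partial R i f x)" for i
    by (rule is_weak_partial_cmult[OF f(3)])
  have L: "(\<lambda>x. c * weak_partial R i f x) \<in> L2 R" for i by (rule L2_cmult[OF f(2)])
  show "(\<lambda>x. c * f x) \<in> H1 R" unfolding H1_def using w L L2_cmult[OF f(1)] by blast
  show "AE x in M. weak_partial R i (\<lambda>x. c * f x) x = c * weak_partial R i f x"
    by (rule weak_partial_AE(3)[OF L w])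
qed

lemma H1_diff:
  assumes "f \<in> H1 R" "g \<in> H1 R"
  shows "(\<lambda>x. f x - g x) \<in> H1 R"
    "AE x in M. weak_partial R i (\<lambda>x. f x - g x) x = weak_partial R i f x - weak_partial R i g x"
proof -
  note c = H1_cmult[OF assms(2), where c = "-1"]
  show "(\<lambda>x. f x - g x) \<in> H1 R" using H1_add(1)[OF assms(1) c(1)] by simp
  show "AE x in M. weak_partial R i (\<lambda>x. f x - g x) x = weak_partial R i f x - weak_partial R i g x"
    using H1_add(2)[OF assms(1) c(1), where i = i] c(2)[where i = i] by eventually_elim simp
qed

text \<open>Closedness of weak differentiation: both sides of the defining identity are continuous
  in \<open>L^2\<close> for a fixed test function.\<close>

lemma is_weak_partial_limit:
  assumes f: "\<And>n. f n \<in> L2 R" "F \<in> L2 R" "(\<lambda>n. nsq R (\<lambda>x. f n x - F x)) \<longlonglongrightarrow> 0"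
    and g: "\<And>n. g n \<in> L2 R" "G \<in> L2 R" "(\<lambda>n. nsq R (\<lambda>x. g n x - G x)) \<longlonglongrightarrow> 0"
    and w: "\<And>n. is_weak_partial R i (f n) (g n)"
  shows "is_weak_partial R i F G"
  unfolding is_weak_partial_def
proof
  fix \<phi> assume \<phi>: "\<phi> \<in> test_functions R"
  have z: "(\<lambda>n. nsq R (\<lambda>x. h x - h x)) \<longlonglongrightarrow> 0" for h by (simp add: nsq_def)
  have "(\<lambda>n. LINT x|M. f n x * partial i \<phi> x) \<longlonglongrightarrow> (LINT x|M. F x * partial i \<phi> x)"
    by (rule integral_mult_tendsto[OF f partial_test_L2[OF \<phi>] partial_test_L2[OF \<phi>] z])
  moreover have "(\<lambda>n. - (LINT x|M. g n x * \<phi> x)) \<longlonglongrightarrow> - (LINT x|M. G x * \<phi> x)"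
    by (rule tendsto_minus[OF integral_mult_tendsto[OF g test_L2[OF \<phi>] test_L2[OF \<phi>] z]])
  moreover have "(LINT x|M. f n x * partial i \<phi> x) = - (LINT x|M. g n x * \<phi> x)" for n
    using w \<phi> by (simp add: is_weak_partial_def)
  ultimately show "(LINT x|M. F x * partial i \<phi> x) = - (LINT x|M. G x * \<phi> x)"
    using LIMSEQ_unique by simp
qed

lemma C1_weak_partial:
  assumes "C1 f"
  shows "f \<in> H1 R" "partial i f \<in> L2 R" "is_weak_partial R i f (partial i f)" "AE x in M. weak_partial R i f x = partial i f x"
proof -
  have L: "f \<in> L2 R" "partial i f \<in> L2 R" for i using assms by (auto intro: continuous_L2 C1_D C1_continuous)
  have w: "is_weak_partial R i f (partial i f)" for i
    unfolding is_weak_partial_def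
  proof
    fix \<phi> assume \<phi>: "\<phi> \<in> test_functions R"
    have z: "f x * \<phi> x = 0" if "x \<in> side a b i" for x
      using that exhaust_2[of i] by (auto intro!: test_functionD(2)[OF \<phi>] simp: side_def rect_def cbox_real2)
    show "(LINT x|M. f x * partial i \<phi> x) = - (LINT x|M. partial i f x * \<phi> x)"
      by (rule integral_partial_mult[OF assms test_functionD(1)[OF \<phi>] a b z])
  qed
  show "partial i f \<in> L2 R" "is_weak_partial R i f (partial i f)" by (rule L, rule w)
  show "f \<in> H1 R" unfolding H1_def using L w by blast
  show "AE x in M. weak_partial R i f x = partial i f x" using weak_partial_AE[OF L(2) w] by simp
qed

section \<open>Cosine polynomials and their completeness\<close>

definition cosprod :: "nat \<Rightarrow> nat \<Rightarrow> point \<Rightarrow> real" where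
  "cosprod m n x = cos (real m * (pi / a) * x $ 1) * cos (real n * (pi / b) * x $ 2)"

text \<open>The linear span of the products of cosines. With the coefficient built into the base
  rule, no separate rule for scalar multiples is needed. Product-to-sum formulas make the span an
  algebra.\<close>

inductive_set cospoly :: "(point \<Rightarrow> real) set" where
  base: "(\<lambda>x. c * cosprod m n x) \<in> cospoly"
| add: "p \<in> cospoly \<Longrightarrow> q \<in> cospoly \<Longrightarrow> (\<lambda>x. p x + q x) \<in> cospoly"

text \<open>The case distinction writes the absolute difference of two natural frequencies as a
  natural number, so that the result stays inside the family.\<close>

lemma cos_mult_cos: "cos (real m * t) * cos (real n * t) = (cos (real (m + n) * t) + cos (real (if m \<le> n then n - m else m - n) * t)) / 2"
proof -
  have "cos (real (if m \<le> n then n - m else m - n) * t) = cos ((real m - real n) * t)"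
    using cos_minus[of "(real m - real n) * t"] by (simp add: of_nat_diff algebra_simps)
  then show ?thesis by (simp add: cos_times_cos algebra_simps)
qed

lemma cosprod_mult: "(\<lambda>x. (c * cosprod m n x) * (d * cosprod k l x)) \<in> cospoly"
proof -
  let ?m = "if m \<le> k then k - m else m - k" and ?n = "if n \<le> l then l - n else n - l"
  have eq: "(c * cosprod m n x) * (d * cosprod k l x) =
     ((c * d / 4) * cosprod (m + k) (n + l) x + (c * d / 4) * cosprod (m + k) ?n x)
     + ((c * d / 4) * cosprod ?m (n + l) x + (c * d / 4) * cosprod ?m ?n x)" for x
  proof -
    have "cosprod m n x * cosprod k l x = (cos (real m * ((pi / a) * x $ 1)) * cos (real k * ((pi / a) * x $ 1)))
       * (cos (real n * ((pi / b) * x $ 2)) * cos (real l * ((pi / b) * x $ 2)))"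
      by (simp add: cosprod_def mult.assoc mult.left_commute)
    also have "\<dots> = ((cos (real (m + k) * ((pi / a) * x $ 1)) + cos (real ?m * ((pi / a) * x $ 1))) / 2)
       * ((cos (real (n + l) * ((pi / b) * x $ 2)) + cos (real ?n * ((pi / b) * x $ 2))) / 2)"
      by (simp only: cos_mult_cos)
    finally have "cosprod m n x * cosprod k l x = (cosprod (m + k) (n + l) x + cosprod (m + k) ?n x + cosprod ?m (n + l) x + cosprod ?m ?n x) / 4"
      by (simp add: cosprod_def mult.assoc algebra_simps del: of_nat_add)
    then have "(c * d) * (cosprod m n x * cosprod k l x) = (c * d) * ((cosprod (m + k) (n + l) x + cosprod (m + k) ?n x + cosprod ?m (n + l) x + cosprod ?m ?n x) / 4)"
      by simp
    then show ?thesis by (simp only: distrib_left add_divide_distrib times_divide_eq_right times_divide_eq_left mult_ac add_ac)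
  qed
  show ?thesis unfolding eq by (intro cospoly.intros)
qed

lemma cospoly_mult: "p \<in> cospoly \<Longrightarrow> q \<in> cospoly \<Longrightarrow> (\<lambda>x. p x * q x) \<in> cospoly"
proof (induction p rule: cospoly.induct)
  case (base c m n)
  from base show ?case
  proof (induction q rule: cospoly.induct)
    case (base d k l) show ?case by (rule cosprod_mult)
  next
    case (add p q)
    from cospoly.add[OF add.IH] show ?case by (simp add: distrib_left)
  qed
next
  case (add p q')
  from cospoly.add[OF add.IH(1)[OF add.prems] add.IH(2)[OF add.prems]] show ?case by (simp add: distrib_right)
qed

lemma cosprod_continuous: "continuous_on S (cosprod m n)"
  unfolding cosprod_def by (intro continuous_intros)

lemma cospoly_continuous: "p \<in> cospoly \<Longrightarrow> continuous_on S p"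
proof (induction rule: cospoly.induct)
  case (base c m n)
  show ?case by (intro continuous_on_mult continuous_on_const cosprod_continuous)
next
  case (add p q)
  then show ?case by (intro continuous_on_add)
qed

lemma cospoly_const: "(\<lambda>_. c) \<in> cospoly"
  using cospoly.base[of c 0 0] by (simp add: cosprod_def)

lemma cos_scaled_inj:
  assumes "0 < c" "s \<in> {0..c}" "t \<in> {0..c}" "cos (pi / c * s) = cos (pi / c * t)"
  shows "s = (t :: real)"
proof -
  have c: "0 \<le> pi / c" using assms(1) by simp
  have 1: "pi / c * s \<le> pi / c * c" using assms c by (intro mult_left_mono) auto
  have 2: "pi / c * t \<le> pi / c * c" using assms c by (intro mult_left_mono) auto
  have 3: "0 \<le> pi / c * s" using assms c by (intro mult_nonneg_nonneg) auto
  have 4: "0 \<le> pi / c * t" using assms c by (intro mult_nonneg_nonneg) auto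
  have "pi / c * c = pi" using assms(1) by simp
  then have "pi / c * s = pi / c * t"
    using 1 2 3 4 by (intro cos_inj_pi[OF _ _ _ _ assms(4)]) simp_all
  then show ?thesis using assms(1) by simp
qed

text \<open>The two lowest nonconstant products already separate points, because cosine is injective
  on a half period and the frequencies are scaled so that each side of the closed rectangle is
  exactly one half period.\<close>

lemma cospoly_separates:
  assumes x: "x \<in> cbox 0 (vector [a, b])" and y: "y \<in> cbox 0 (vector [a, b])" and xy: "x \<noteq> y"
  shows "\<exists>f\<in>cospoly. f x \<noteq> f y"
proof (rule ccontr)
  assume c: "\<not> (\<exists>f\<in>cospoly. f x \<noteq> f y)"
  have "cosprod m n \<in> cospoly" for m n using cospoly.base[of 1 m n] by simp
  then have e: "cosprod m n x = cosprod m n y" for m n using c by blast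
  have "x $ 1 = y $ 1"
    by (rule cos_scaled_inj[OF a]) (use x y e[of 1 0] in \<open>simp_all add: cbox_real2 cosprod_def\<close>)
  moreover have "x $ 2 = y $ 2"
    by (rule cos_scaled_inj[OF b]) (use x y e[of 0 1] in \<open>simp_all add: cbox_real2 cosprod_def\<close>)
  ultimately show False using xy vec2_eqI[of x y] by simp
qed

lemma cospoly_function_ring: "function_ring_on cospoly (cbox 0 (vector [a, b]))"
  by (rule function_ring_on.intro, rule compact_cbox, erule cospoly_continuous, erule (1) cospoly.add,
      erule (1) cospoly_mult, rule cospoly_const, erule (2) cospoly_separates)

text \<open>A test function is uniformly approximated on the closed rectangle by cosine polynomials,
  by Stone-Weierstrass. As \<open>h\<close> is integrable, its integral against the test function is
  arbitrarily small, and the fundamental lemma applies. Cosines are used because their span contains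
  the constants.\<close>

lemma cosprod_complete:
  assumes h: "h \<in> L2 R" and 0: "\<And>m n. (LINT x|M. h x * cosprod m n x) = 0"
  shows "AE x in M. h x = 0"
proof (rule AE_eq_0_if_test[OF L2_integrable[OF h]])
  interpret function_ring_on cospoly "cbox 0 (vector [a, b])" by (rule cospoly_function_ring)
  have hp: "integrable M (\<lambda>x. h x * p x)" if "continuous_on UNIV p" for p
    by (intro L2_integrable_mult h continuous_L2 that)
  have p0: "(LINT x|M. h x * p x) = 0" if "p \<in> cospoly" for p
    using that
  proof induction
    case (base c m n)
    have "(LINT x|M. h x * (c * cosprod m n x)) = c * (LINT x|M. h x * cosprod m n x)"
      by (simp add: mult.left_commute)
    then show ?case by (simp add: 0)
  next
    case (add p q)
    then show ?case using hp[OF cospoly_continuous[OF add(1)]] hp[OF cospoly_continuous[OF add(2)]]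
      by (simp add: distrib_left)
  qed
  fix \<phi> assume \<phi>: "\<phi> \<in> test_functions R"
  have "\<bar>LINT x|M. h x * \<phi> x\<bar> \<le> 0"
  proof (rule field_le_epsilon)
    fix e :: real assume e: "0 < e"
    \<comment> \<open>The 1 makes the divisor in \<open>e / A\<close> positive even if
      \<open>h\<close> vanishes.\<close>
    define A where "A = (LINT x|M. \<bar>h x\<bar>) + 1"
    have A: "0 < A" by (simp add: A_def add_nonneg_pos)
    obtain p where p: "p \<in> cospoly" "\<And>x. x \<in> cbox 0 (vector [a, b]) \<Longrightarrow> \<bar>\<phi> x - p x\<bar> < e / A"
      using Stone_Weierstrass_basic[OF test_functionD(3)[OF \<phi>], of "e / A"] e A by auto
    note i = hp[OF test_functionD(3)[OF \<phi>]] hp[OF cospoly_continuous[OF p(1)]]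
    have "(LINT x|M. h x * \<phi> x) = (LINT x|M. h x * \<phi> x - h x * p x)"
      using i p0[OF p(1)] by simp
    also have "\<bar>\<dots>\<bar> \<le> (LINT x|M. \<bar>h x * \<phi> x - h x * p x\<bar>)"
      by (rule integral_abs_bound)
    also have "\<dots> \<le> (LINT x|M. \<bar>h x\<bar> * (e / A))"
    proof (rule integral_mono)
      fix x assume "x \<in> space M"
      then have "x \<in> cbox 0 (vector [a, b])" by (auto simp: rect_def cbox_real2)
      from p(2)[OF this] show "\<bar>h x * \<phi> x - h x * p x\<bar> \<le> \<bar>h x\<bar> * (e / A)"
        unfolding right_diff_distrib[symmetric] abs_mult by (intro mult_left_mono) auto
    qed (use i L2_integrable[OF h] in auto)
    also have "\<dots> = (LINT x|M. \<bar>h x\<bar>) * (e / A)" by simp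
    also have "\<dots> \<le> A * (e / A)" using e A by (intro mult_right_mono) (auto simp: A_def)
    also have "\<dots> = e" using A by simp
    finally show "\<bar>LINT x|M. h x * \<phi> x\<bar> \<le> 0 + e" by simp
  qed
  then show "(LINT x|M. h x * \<phi> x) = 0" by simp
qed

end

section \<open>The eigenfields\<close>

definition ss :: "real \<Rightarrow> real \<Rightarrow> point \<Rightarrow> real" where "ss p r x = sin (p * x $ 1) * sin (r * x $ 2)"
definition sc :: "real \<Rightarrow> real \<Rightarrow> point \<Rightarrow> real" where "sc p r x = sin (p * x $ 1) * cos (r * x $ 2)"
definition cs :: "real \<Rightarrow> real \<Rightarrow> point \<Rightarrow> real" where "cs p r x = cos (p * x $ 1) * sin (r * x $ 2)"
definition cc :: "real \<Rightarrow> real \<Rightarrow> point \<Rightarrow> real" where "cc p r x = cos (p * x $ 1) * cos (r * x $ 2)"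

text \<open>Differentiating a sine shifts its phase by a quarter period, so all derivatives have one
  closed formula; the phase \<open>d\<close> covers the cosine as well.\<close>

lemma smooth1_sin_shift: "smooth1 (\<lambda>s. sin (p * s + d))"
  unfolding smooth1_def
proof (intro exI[of _ "\<lambda>n s. p ^ n * sin (p * s + d + real n * (pi / 2))"] conjI allI)
  show "(\<lambda>s. p ^ 0 * sin (p * s + d + real 0 * (pi / 2))) = (\<lambda>s. sin (p * s + d))" by simp
  fix n s
  have "sin (p * s + d + real (Suc n) * (pi / 2)) = cos (p * s + d + real n * (pi / 2))"
  proof -
    have "p * s + d + real (Suc n) * (pi / 2) = (p * s + d + real n * (pi / 2)) + pi / 2" by (simp add: algebra_simps)
    then show ?thesis by (simp only: sin_add) simp
  qed
  then show "((\<lambda>s. p ^ n * sin (p * s + d + real n * (pi / 2))) has_real_derivative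
      p ^ Suc n * sin (p * s + d + real (Suc n) * (pi / 2))) (at s)"
    by (auto intro!: derivative_eq_intros)
qed

lemma smooth1_sin: "smooth1 (\<lambda>s. sin (p * s))" and smooth1_cos: "smooth1 (\<lambda>s. cos (p * s))"
proof -
  show "smooth1 (\<lambda>s. sin (p * s))" using smooth1_sin_shift[of p 0] by simp
  have "cos (p * s) = sin (p * s + pi / 2)" for s by (simp add: sin_add)
  then show "smooth1 (\<lambda>s. cos (p * s))" using smooth1_sin_shift[of p "pi / 2"] by simp
qed

lemma smooth_trig: "smooth (ss p r)" "smooth (sc p r)" "smooth (cs p r)" "smooth (cc p r)"
  unfolding ss_def[abs_def] sc_def[abs_def] cs_def[abs_def] cc_def[abs_def]
  by (intro smooth_tensor smooth1_sin smooth1_cos)+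

lemmas C1_trig = smooth_trig[THEN smooth_imp_C1(1)]

lemma partial_tensor:
  assumes "\<And>s. (f has_real_derivative f' s) (at s)" "\<And>s. (g has_real_derivative g' s) (at s)"
  shows "partial 1 (\<lambda>x. f (x $ 1) * g (x $ 2)) x = f' (x $ 1) * g (x $ 2)"
    and "partial 2 (\<lambda>x. f (x $ 1) * g (x $ 2)) x = f (x $ 1) * g' (x $ 2)"
  using partial_eq[OF tensor_has_derivative[OF assms]] by (auto simp: axis_def)

lemma has_derivative_sin_cos:
  "((\<lambda>s. sin (p * s)) has_real_derivative p * cos (p * s)) (at s)"
  "((\<lambda>s. cos (p * s)) has_real_derivative - p * sin (p * s)) (at s)"
  by (auto intro!: derivative_eq_intros)

lemma partial_trig:
  "partial 1 (ss p r) = (\<lambda>x. p * cs p r x)" "partial 2 (ss p r) = (\<lambda>x. r * sc p r x)"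
  "partial 1 (sc p r) = (\<lambda>x. p * cc p r x)" "partial 2 (sc p r) = (\<lambda>x. - r * ss p r x)"
  "partial 1 (cs p r) = (\<lambda>x. - p * ss p r x)" "partial 2 (cs p r) = (\<lambda>x. r * cc p r x)"
  "partial 1 (cc p r) = (\<lambda>x. - p * sc p r x)" "partial 2 (cc p r) = (\<lambda>x. - r * cs p r x)"
  unfolding ss_def[abs_def] sc_def[abs_def] cs_def[abs_def] cc_def[abs_def]
  by (auto simp: fun_eq_iff partial_tensor[OF has_derivative_sin_cos(1)[of p] has_derivative_sin_cos(1)[of r]]
      partial_tensor[OF has_derivative_sin_cos(1)[of p] has_derivative_sin_cos(2)[of r]]
      partial_tensor[OF has_derivative_sin_cos(2)[of p] has_derivative_sin_cos(1)[of r]]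
      partial_tensor[OF has_derivative_sin_cos(2)[of p] has_derivative_sin_cos(2)[of r]])

lemma partial_cmult: "C1 f \<Longrightarrow> partial i (\<lambda>x. c * f x) = (\<lambda>x. c * partial i f x)"
  using C1_cmult(2) by blast

lemma integral_cos_0:
  assumes "0 < c" "k \<noteq> (0 :: int)"
  shows "((\<lambda>s. cos (real_of_int k * (pi / c) * s)) has_integral 0) {0..c}"
proof -
  let ?p = "real_of_int k * (pi / c)"
  have p: "?p \<noteq> 0" using assms by simp
  have "((\<lambda>s. cos (?p * s)) has_integral (sin (?p * c) / ?p - sin (?p * 0) / ?p)) {0..c}"
    using assms p by (intro fundamental_theorem_of_calculus)
      (auto intro!: derivative_eq_intros simp: has_real_derivative_iff_has_vector_derivative[symmetric])
  moreover have "?p * c = real_of_int k * pi" using assms by simp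
  moreover have "sin (real_of_int k * pi) = 0" by (auto simp: sin_zero_iff_int2)
  ultimately show ?thesis by simp
qed

lemma integral_sin_sin:
  assumes c: "0 < c"
  shows "integral {0..c} (\<lambda>s. sin (real (Suc i) * (pi / c) * s) * sin (real (Suc j) * (pi / c) * s)) = (if i = j then c / 2 else 0)"
    and "integral {0..c} (\<lambda>s. cos (real (Suc i) * (pi / c) * s) * cos (real (Suc j) * (pi / c) * s)) = (if i = j then c / 2 else 0)"
proof -
  let ?m = "int i - int j" and ?p = "int (Suc i) + int (Suc j)"
  have s: "sin (real (Suc i) * (pi / c) * s) * sin (real (Suc j) * (pi / c) * s) =
     (1 / 2) * (cos (real_of_int ?m * (pi / c) * s) - cos (real_of_int ?p * (pi / c) * s))" for s
    by (simp add: sin_times_sin algebra_simps add_divide_distrib diff_divide_distrib)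
  have cs: "cos (real (Suc i) * (pi / c) * s) * cos (real (Suc j) * (pi / c) * s) =
     (1 / 2) * (cos (real_of_int ?m * (pi / c) * s) + cos (real_of_int ?p * (pi / c) * s))" for s
    by (simp add: cos_times_cos algebra_simps add_divide_distrib diff_divide_distrib)
  have hp: "((\<lambda>s. cos (real_of_int ?p * (pi / c) * s)) has_integral 0) {0..c}"
    by (rule integral_cos_0[OF c]) simp
  have hm: "((\<lambda>s. cos (real_of_int ?m * (pi / c) * s)) has_integral (if i = j then c else 0)) {0..c}"
  proof (cases "i = j")
    case True
    have "((\<lambda>s. 1 :: real) has_integral c) {0..c}" using has_integral_const_real[of "1::real" 0 c] c by simp
    then show ?thesis using True by simp
  next
    case False
    then show ?thesis using integral_cos_0[OF c, of ?m] by simp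
  qed
  have "((\<lambda>s. (1 / 2) * (cos (real_of_int ?m * (pi / c) * s) - cos (real_of_int ?p * (pi / c) * s))) has_integral (1 / 2) * ((if i = j then c else 0) - 0)) {0..c}"
    by (intro has_integral_mult_right has_integral_diff hm hp)
  then show "integral {0..c} (\<lambda>s. sin (real (Suc i) * (pi / c) * s) * sin (real (Suc j) * (pi / c) * s)) = (if i = j then c / 2 else 0)"
    unfolding s by (subst integral_unique) auto
  have "((\<lambda>s. (1 / 2) * (cos (real_of_int ?m * (pi / c) * s) + cos (real_of_int ?p * (pi / c) * s))) has_integral (1 / 2) * ((if i = j then c else 0) + 0)) {0..c}"
    by (intro has_integral_mult_right has_integral_add hm hp)
  then show "integral {0..c} (\<lambda>s. cos (real (Suc i) * (pi / c) * s) * cos (real (Suc j) * (pi / c) * s)) = (if i = j then c / 2 else 0)"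
    unfolding cs by (subst integral_unique) auto
qed

lemma integral_tensor:
  fixes f g :: "real \<Rightarrow> real"
  assumes "continuous_on UNIV f" "continuous_on UNIV g"
  shows "(LINT x|lebesgue_on (rect a b). f (x $ 1) * g (x $ 2)) = integral {0..a} f * integral {0..b} g"
proof -
  have "continuous_on UNIV (\<lambda>x :: point. f (x $ 1) * g (x $ 2))"
    by (intro continuous_on_mult continuous_on_compose2[OF assms(1)] continuous_on_compose2[OF assms(2)]) (auto intro!: continuous_intros)
  from integral_rect(1)[OF this, of a b] show ?thesis by simp
qed

context rectangle
begin

text \<open>Modes are enumerated through the pairing bijection of the natural numbers.
  \<open>Suc\<close> makes both frequencies positive, as a zero frequency would give the zero stream
  function.\<close>

definition freq1 :: "nat \<Rightarrow> real" where "freq1 n = real (Suc (fst (prod_decode n))) * (pi / a)"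
definition freq2 :: "nat \<Rightarrow> real" where "freq2 n = real (Suc (snd (prod_decode n))) * (pi / b)"
definition lam :: "nat \<Rightarrow> real" where "lam n = (freq1 n)\<^sup>2 + (freq2 n)\<^sup>2"
text \<open>Each mixed sine-cosine product has squared \<open>L^2\<close> norm
  \<open>a * b / 4\<close>, so the unnormalized eigenfield has squared norm
  \<open>lam n * a * b / 4\<close>.\<close>

definition nrm :: "nat \<Rightarrow> real" where "nrm n = 2 / sqrt (a * b * lam n)"

definition wf :: "nat \<Rightarrow> field" where
  "wf n x = vector [- (nrm n * freq2 n) * sc (freq1 n) (freq2 n) x, (nrm n * freq1 n) * cs (freq1 n) (freq2 n) x]"

lemma freq_pos: "0 < freq1 n" "0 < freq2 n"
  using a b by (auto simp: freq1_def freq2_def)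

lemma lam_pos: "0 < lam n"
  using freq_pos[of n] by (simp add: lam_def add_pos_pos)

lemma nrm_sq: "(nrm n)\<^sup>2 * lam n * (a * b / 4) = 1"
  using a b lam_pos[of n] by (simp add: nrm_def power_divide)

lemma w_1: "wf n x $ 1 = - (nrm n * freq2 n) * sc (freq1 n) (freq2 n) x"
  and w_2: "wf n x $ 2 = (nrm n * freq1 n) * cs (freq1 n) (freq2 n) x"
  by (auto simp: wf_def)

lemma smooth_w: "smooth (wf n)"
proof -
  have s1: "smooth (\<lambda>x. sc (freq1 n) (freq2 n) x *\<^sub>R axis 1 (- (nrm n * freq2 n)) :: real ^ 2)"
    by (rule smooth_linear[OF bounded_linear_scaleR_left smooth_trig(2)])
  have s2: "smooth (\<lambda>x. cs (freq1 n) (freq2 n) x *\<^sub>R axis 2 (nrm n * freq1 n) :: real ^ 2)"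
    by (rule smooth_linear[OF bounded_linear_scaleR_left smooth_trig(3)])
  have "wf n = (\<lambda>x. sc (freq1 n) (freq2 n) x *\<^sub>R axis 1 (- (nrm n * freq2 n)) + cs (freq1 n) (freq2 n) x *\<^sub>R axis 2 (nrm n * freq1 n))"
    by (rule ext, rule vec2_eqI) (auto simp: wf_def axis_def)
  then show ?thesis using smooth_add[OF s1 s2] by simp
qed

lemma partial_w:
  "partial 1 (\<lambda>x. wf n x $ 1) = (\<lambda>x. - (nrm n * freq2 n) * freq1 n * cc (freq1 n) (freq2 n) x)"
  "partial 2 (\<lambda>x. wf n x $ 1) = (\<lambda>x. (nrm n * freq2 n) * freq2 n * ss (freq1 n) (freq2 n) x)"
  "partial 1 (\<lambda>x. wf n x $ 2) = (\<lambda>x. - (nrm n * freq1 n) * freq1 n * ss (freq1 n) (freq2 n) x)"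
  "partial 2 (\<lambda>x. wf n x $ 2) = (\<lambda>x. (nrm n * freq1 n) * freq2 n * cc (freq1 n) (freq2 n) x)"
  unfolding w_1 w_2 partial_cmult[OF C1_trig(2)] partial_cmult[OF C1_trig(3)] partial_trig by (simp_all add: mult_ac)

lemma partial2_w:
  "partial 1 (partial 1 (\<lambda>x. wf n x $ j)) = (\<lambda>x. - (freq1 n)\<^sup>2 * wf n x $ j)"
  "partial 2 (partial 2 (\<lambda>x. wf n x $ j)) = (\<lambda>x. - (freq2 n)\<^sup>2 * wf n x $ j)"
proof -
  consider "j = 1" | "j = 2" using exhaust_2 by blast
  then have "partial 1 (partial 1 (\<lambda>x. wf n x $ j)) = (\<lambda>x. - (freq1 n)\<^sup>2 * wf n x $ j) \<and>
    partial 2 (partial 2 (\<lambda>x. wf n x $ j)) = (\<lambda>x. - (freq2 n)\<^sup>2 * wf n x $ j)"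
  proof cases
    case 1
    show ?thesis unfolding 1 partial_w unfolding w_1 partial_cmult[OF C1_trig(1)] partial_cmult[OF C1_trig(4)] partial_trig
      by (simp add: power2_eq_square mult_ac)
  next
    case 2
    show ?thesis unfolding 2 partial_w unfolding w_2 partial_cmult[OF C1_trig(1)] partial_cmult[OF C1_trig(4)] partial_trig
      by (simp add: power2_eq_square mult_ac)
  qed
  then show "partial 1 (partial 1 (\<lambda>x. wf n x $ j)) = (\<lambda>x. - (freq1 n)\<^sup>2 * wf n x $ j)"
    "partial 2 (partial 2 (\<lambda>x. wf n x $ j)) = (\<lambda>x. - (freq2 n)\<^sup>2 * wf n x $ j)" by auto
qed

lemma sin_freq: "sin (freq1 n * a) = 0" "sin (freq2 n * b) = 0"
proof -
  have "freq1 n * a = real (Suc (fst (prod_decode n))) * pi" "freq2 n * b = real (Suc (snd (prod_decode n))) * pi"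
    using a b by (auto simp: freq1_def freq2_def)
  then show "sin (freq1 n * a) = 0" "sin (freq2 n * b) = 0" by (simp_all only: sin_npi)
qed

lemma frontier_rect: "frontier R = {x \<in> cbox 0 (vector [a, b]). x $ 1 = 0 \<or> x $ 1 = a \<or> x $ 2 = 0 \<or> x $ 2 = b}"
proof -
  have "box 0 (vector [a, b]) \<noteq> ({} :: point set)"
  proof -
    have "vector [a / 2, b / 2] \<in> box 0 (vector [a, b] :: point)" using a b by (simp add: mem_box_cart forall_2)
    then show ?thesis by blast
  qed
  then have "frontier R = cbox 0 (vector [a, b]) - box 0 (vector [a, b])"
    unfolding rect_eq_box by (simp add: frontier_box)
  then show ?thesis by (intro set_eqI) (simp add: cbox_real2 mem_box_cart forall_2, arith)
qed

text \<open>On an edge the normal component contains the sine in the direction orthogonal to that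
  edge, and the curl is a multiple of \<open>ss\<close>, which vanishes on all four edges. The
  divergence vanishes as a mixed second derivative of the stream function counted twice with
  opposite signs.\<close>

lemma w_D1: "wf n \<in> D1 a b"
  unfolding D1_def
proof (intro CollectI conjI ballI)
  show "smooth (wf n)" by (rule smooth_w)
  show "divergence (wf n) x = 0" for x by (simp add: divergence_def partial_w)
  fix x assume x: "x \<in> frontier R"
  show "wf n x \<bullet> m = 0" if "m \<in> unit_normals a b x" for m
    using that unfolding unit_normals_def mem_Collect_eq
    by (elim disjE conjE) (simp_all add: inner_axis w_1 w_2 sc_def cs_def sin_freq)
  show "curl (wf n) x = 0"
  proof -
    have "x $ 1 = 0 \<or> x $ 1 = a \<or> x $ 2 = 0 \<or> x $ 2 = b" using x by (simp add: frontier_rect)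
    then show ?thesis by (elim disjE) (simp_all add: curl_def partial_w ss_def sin_freq)
  qed
qed

section \<open>Seminorms and inner products of fields\<close>

definition H1sq :: "field \<Rightarrow> real" where
  "H1sq u = (\<Sum>j\<in>UNIV. nsq R (\<lambda>x. u x $ j) + (\<Sum>i\<in>UNIV. nsq R (weak_partial R i (\<lambda>y. u y $ j))))"

lemma H1_norm_eq: "H1_norm R u = sqrt (H1sq u)"
  by (simp add: H1_norm_def H1sq_def nsq_def)

lemma H1sq_nonneg: "0 \<le> H1sq u"
  unfolding H1sq_def by (intro sum_nonneg add_nonneg_nonneg nsq_nonneg)

lemma H1sq_ge: "nsq R (\<lambda>x. u x $ j) \<le> H1sq u" "nsq R (weak_partial R i (\<lambda>y. u y $ j)) \<le> H1sq u"
proof -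
  have "nsq R (\<lambda>x. u x $ j) + (\<Sum>i\<in>UNIV. nsq R (weak_partial R i (\<lambda>y. u y $ j))) \<le> H1sq u"
    unfolding H1sq_def by (rule member_le_sum) (auto intro!: sum_nonneg add_nonneg_nonneg nsq_nonneg)
  moreover have "nsq R (weak_partial R i (\<lambda>y. u y $ j)) \<le> (\<Sum>i\<in>UNIV. nsq R (weak_partial R i (\<lambda>y. u y $ j)))"
    by (rule member_le_sum) (auto intro: nsq_nonneg)
  moreover have "0 \<le> (\<Sum>i\<in>UNIV. nsq R (weak_partial R i (\<lambda>y. u y $ j)))" by (intro sum_nonneg nsq_nonneg)
  moreover have "0 \<le> nsq R (\<lambda>x. u x $ j)" by (rule nsq_nonneg)
  ultimately show "nsq R (\<lambda>x. u x $ j) \<le> H1sq u" "nsq R (weak_partial R i (\<lambda>y. u y $ j)) \<le> H1sq u" by linarith+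
qed

lemma H1_fieldD:
  assumes "u \<in> H1_field R"
  shows "(\<lambda>x. u x $ j) \<in> H1 R" "(\<lambda>x. u x $ j) \<in> L2 R" "weak_partial R i (\<lambda>x. u x $ j) \<in> L2 R"
    "is_weak_partial R i (\<lambda>x. u x $ j) (weak_partial R i (\<lambda>x. u x $ j))"
  using assms H1_weak_partial by (auto simp: H1_field_def)

lemma H1_field_add:
  assumes "u \<in> H1_field R" "v \<in> H1_field R"
  shows "(\<lambda>x. u x + v x) \<in> H1_field R"
    "AE x in M. weak_partial R i (\<lambda>x. (u x + v x) $ j) x = weak_partial R i (\<lambda>x. u x $ j) x + weak_partial R i (\<lambda>x. v x $ j) x"
  using H1_add[OF H1_fieldD(1)[OF assms(1)] H1_fieldD(1)[OF assms(2)]] by (auto simp: H1_field_def)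

lemma H1_field_diff:
  assumes "u \<in> H1_field R" "v \<in> H1_field R"
  shows "(\<lambda>x. u x - v x) \<in> H1_field R"
    "AE x in M. weak_partial R i (\<lambda>x. (u x - v x) $ j) x = weak_partial R i (\<lambda>x. u x $ j) x - weak_partial R i (\<lambda>x. v x $ j) x"
  using H1_diff[OF H1_fieldD(1)[OF assms(1)] H1_fieldD(1)[OF assms(2)]] by (auto simp: H1_field_def)

lemma H1_field_scale:
  assumes "u \<in> H1_field R"
  shows "(\<lambda>x. c *\<^sub>R u x) \<in> H1_field R"
    "AE x in M. weak_partial R i (\<lambda>x. (c *\<^sub>R u x) $ j) x = c * weak_partial R i (\<lambda>x. u x $ j) x"
  using H1_cmult[OF H1_fieldD(1)[OF assms]] by (auto simp: H1_field_def)

lemma H1sq_add_le: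
  assumes "u \<in> H1_field R" "v \<in> H1_field R"
  shows "H1sq (\<lambda>x. u x + v x) \<le> 2 * H1sq u + 2 * H1sq v"
proof -
  have 1: "nsq R (\<lambda>x. (u x + v x) $ j) \<le> 2 * nsq R (\<lambda>x. u x $ j) + 2 * nsq R (\<lambda>x. v x $ j)" for j
    using nsq_add_le[OF H1_fieldD(2)[OF assms(1), of j] H1_fieldD(2)[OF assms(2), of j]] by simp
  have 2: "nsq R (weak_partial R i (\<lambda>x. (u x + v x) $ j)) \<le> 2 * nsq R (weak_partial R i (\<lambda>x. u x $ j)) + 2 * nsq R (weak_partial R i (\<lambda>x. v x $ j))" for i j
    using nsq_add_le[OF H1_fieldD(3)[OF assms(1), of i j] H1_fieldD(3)[OF assms(2), of i j]]
      nsq_cong[OF H1_field_add(2)[OF assms, of i j] H1_fieldD(3)[OF H1_field_add(1)[OF assms]] L2_add[OF H1_fieldD(3)[OF assms(1), of i j] H1_fieldD(3)[OF assms(2), of i j]]]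
    by simp
  have "H1sq (\<lambda>x. u x + v x) \<le> (\<Sum>j\<in>UNIV. (2 * nsq R (\<lambda>x. u x $ j) + 2 * nsq R (\<lambda>x. v x $ j)) +
     (\<Sum>i\<in>UNIV. 2 * nsq R (weak_partial R i (\<lambda>x. u x $ j)) + 2 * nsq R (weak_partial R i (\<lambda>x. v x $ j))))"
    unfolding H1sq_def by (intro sum_mono add_mono 1 2)
  also have "\<dots> = 2 * H1sq u + 2 * H1sq v"
    by (simp add: H1sq_def sum_2)
  finally show ?thesis .
qed

lemma H1sq_scale:
  assumes "u \<in> H1_field R"
  shows "H1sq (\<lambda>x. c *\<^sub>R u x) = c\<^sup>2 * H1sq u"
proof -
  have "nsq R (weak_partial R i (\<lambda>x. (c *\<^sub>R u x) $ j)) = c\<^sup>2 * nsq R (weak_partial R i (\<lambda>x. u x $ j))" for i j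
    using nsq_cong[OF H1_field_scale(2)[OF assms, where c = c and i = i and j = j] H1_fieldD(3)[OF H1_field_scale(1)[OF assms]] L2_cmult[OF H1_fieldD(3)[OF assms, of i j]]]
    by (simp add: nsq_cmult)
  then show ?thesis unfolding H1sq_def by (simp add: nsq_cmult sum_2 algebra_simps)
qed

text \<open>\<open>fin\<close> and \<open>vin\<close> are the scalar products of \<open>H\<close>
  and \<open>V\<close> with the finite sums outside the integrals. In this form linearity reduces to
  scalar integrals of products of square integrable functions.\<close>

definition fin :: "field \<Rightarrow> field \<Rightarrow> real" where
  "fin u v = (\<Sum>j\<in>UNIV. LINT x|M. u x $ j * v x $ j)"

definition vin :: "field \<Rightarrow> field \<Rightarrow> real" where
  "vin u v = (\<Sum>j\<in>UNIV. \<Sum>i\<in>UNIV. LINT x|M. weak_partial R i (\<lambda>x. u x $ j) x * weak_partial R i (\<lambda>x. v x $ j) x)"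

lemma V_inner_eq:
  assumes "u \<in> H1_field R" "v \<in> H1_field R"
  shows "V_inner a b u v = vin u v"
  unfolding V_inner_def vin_def
  by (intro sum.cong refl Bochner_Integration.integral_sum L2_integrable_mult H1_fieldD assms)

lemma H_inner_eq:
  assumes "\<And>j. (\<lambda>x. u x $ j) \<in> L2 R" "\<And>j. (\<lambda>x. v x $ j) \<in> L2 R"
  shows "H_inner a b u v = fin u v"
  unfolding H_inner_def fin_def inner_vec_def
  by (subst Bochner_Integration.integral_sum) (auto intro: L2_integrable_mult assms)

lemma H1sq_eq: "H1sq u = fin u u + vin u u"
  by (simp add: H1sq_def fin_def vin_def nsq_def power2_eq_square sum.distrib)

lemma fin_vin_nonneg: "0 \<le> fin u u" "0 \<le> vin u u"
  by (auto simp: fin_def vin_def intro!: sum_nonneg Bochner_Integration.integral_nonneg)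

lemma fin_vin_commute: "fin u v = fin v u" "vin u v = vin v u"
  by (auto simp: fin_def vin_def mult.commute)

text \<open>Weak derivatives of sums and multiples are known only almost everywhere; this allows
  them to be replaced under the integral.\<close>

lemma vin_cong_L2:
  assumes "u \<in> H1_field R" "v \<in> H1_field R" "\<And>j i. f j i \<in> L2 R" "\<And>j i. AE x in M. weak_partial R i (\<lambda>x. u x $ j) x = f j i x"
  shows "vin u v = (\<Sum>j\<in>UNIV. \<Sum>i\<in>UNIV. LINT x|M. f j i x * weak_partial R i (\<lambda>x. v x $ j) x)"
  unfolding vin_def
proof (intro sum.cong refl integral_cong_AE)
  fix i j :: 2
  show "(\<lambda>x. weak_partial R i (\<lambda>x. u x $ j) x * weak_partial R i (\<lambda>x. v x $ j) x) \<in> borel_measurable M"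
    by (intro borel_measurable_times L2_measurable H1_fieldD assms)
  show "(\<lambda>x. f j i x * weak_partial R i (\<lambda>x. v x $ j) x) \<in> borel_measurable M"
    by (intro borel_measurable_times L2_measurable H1_fieldD assms)
  show "AE x in M. weak_partial R i (\<lambda>x. u x $ j) x * weak_partial R i (\<lambda>x. v x $ j) x = f j i x * weak_partial R i (\<lambda>x. v x $ j) x"
    using assms(4)[of i j] by eventually_elim simp
qed

lemma vin_add:
  assumes "u \<in> H1_field R" "u' \<in> H1_field R" "v \<in> H1_field R"
  shows "vin (\<lambda>x. u x + u' x) v = vin u v + vin u' v"
proof -
  note [simp] = L2_integrable_mult[OF H1_fieldD(3)[OF assms(1)] H1_fieldD(3)[OF assms(3)]] L2_integrable_mult[OF H1_fieldD(3)[OF assms(2)] H1_fieldD(3)[OF assms(3)]]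
  have "vin (\<lambda>x. u x + u' x) v = (\<Sum>j\<in>UNIV. \<Sum>i\<in>UNIV. LINT x|M. (weak_partial R i (\<lambda>x. u x $ j) x + weak_partial R i (\<lambda>x. u' x $ j) x) * weak_partial R i (\<lambda>x. v x $ j) x)"
    by (intro vin_cong_L2 H1_field_add assms L2_add H1_fieldD)
  then show ?thesis by (simp add: distrib_right sum.distrib vin_def)
qed

lemma vin_scale:
  assumes "u \<in> H1_field R" "v \<in> H1_field R"
  shows "vin (\<lambda>x. c *\<^sub>R u x) v = c * vin u v"
proof -
  have "vin (\<lambda>x. c *\<^sub>R u x) v = (\<Sum>j\<in>UNIV. \<Sum>i\<in>UNIV. LINT x|M. (c * weak_partial R i (\<lambda>x. u x $ j) x) * weak_partial R i (\<lambda>x. v x $ j) x)"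
    by (intro vin_cong_L2 H1_field_scale assms L2_cmult H1_fieldD)
  then show ?thesis by (simp add: mult.assoc sum_distrib_left vin_def)
qed

lemma fin_add:
  assumes "u \<in> H1_field R" "u' \<in> H1_field R" "v \<in> H1_field R"
  shows "fin (\<lambda>x. u x + u' x) v = fin u v + fin u' v"
proof -
  note [simp] = L2_integrable_mult[OF H1_fieldD(2)[OF assms(1)] H1_fieldD(2)[OF assms(3)]] L2_integrable_mult[OF H1_fieldD(2)[OF assms(2)] H1_fieldD(2)[OF assms(3)]]
  show ?thesis by (simp add: fin_def distrib_right sum.distrib)
qed

lemma fin_scale: "fin (\<lambda>x. c *\<^sub>R u x) v = c * fin u v"
  by (simp add: fin_def mult.assoc sum_distrib_left)

lemma fin_vin_diff:
  assumes "u \<in> H1_field R" "u' \<in> H1_field R" "v \<in> H1_field R"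
  shows "fin (\<lambda>x. u x - u' x) v = fin u v - fin u' v" "vin (\<lambda>x. u x - u' x) v = vin u v - vin u' v"
  using fin_add[OF assms(1) H1_field_scale(1)[OF assms(2), of "-1"] assms(3)] fin_scale[of "-1" u' v]
    vin_add[OF assms(1) H1_field_scale(1)[OF assms(2), of "-1"] assms(3)] vin_scale[OF assms(2,3), of "-1"]
  by simp_all

lemma H1_tendsto_components:
  assumes "\<And>n. u n \<in> H1_field R" "U \<in> H1_field R" "(\<lambda>n. H1sq (\<lambda>x. u n x - U x)) \<longlonglongrightarrow> 0"
  shows "(\<lambda>n. nsq R (\<lambda>x. u n x $ j - U x $ j)) \<longlonglongrightarrow> 0"
    "(\<lambda>n. nsq R (\<lambda>x. weak_partial R i (\<lambda>x. u n x $ j) x - weak_partial R i (\<lambda>x. U x $ j) x)) \<longlonglongrightarrow> 0"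
proof -
  show "(\<lambda>n. nsq R (\<lambda>x. u n x $ j - U x $ j)) \<longlonglongrightarrow> 0"
    using H1sq_ge(1)[where u = "\<lambda>x. u n x - U x" and j = j for n]
    by (intro tendsto_sandwich[OF _ _ tendsto_const assms(3)] always_eventually allI) (auto simp: nsq_nonneg)
  have eq: "nsq R (weak_partial R i (\<lambda>x. (u n x - U x) $ j)) = nsq R (\<lambda>x. weak_partial R i (\<lambda>x. u n x $ j) x - weak_partial R i (\<lambda>x. U x $ j) x)" for n
    by (intro nsq_cong H1_field_diff assms H1_fieldD L2_diff)
  show "(\<lambda>n. nsq R (\<lambda>x. weak_partial R i (\<lambda>x. u n x $ j) x - weak_partial R i (\<lambda>x. U x $ j) x)) \<longlonglongrightarrow> 0"
    unfolding eq[symmetric] using H1sq_ge(2)[where u = "\<lambda>x. u n x - U x" and i = i and j = j for n]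
    by (intro tendsto_sandwich[OF _ _ tendsto_const assms(3)] always_eventually allI) (auto simp: nsq_nonneg)
qed

lemma fin_vin_tendsto:
  assumes u: "\<And>n. u n \<in> H1_field R" "U \<in> H1_field R" "(\<lambda>n. H1sq (\<lambda>x. u n x - U x)) \<longlonglongrightarrow> 0"
    and v: "\<And>n. v n \<in> H1_field R" "V \<in> H1_field R" "(\<lambda>n. H1sq (\<lambda>x. v n x - V x)) \<longlonglongrightarrow> 0"
  shows "(\<lambda>n. fin (u n) (v n)) \<longlonglongrightarrow> fin U V" "(\<lambda>n. vin (u n) (v n)) \<longlonglongrightarrow> vin U V"
  unfolding fin_def vin_def
  by (intro tendsto_sum integral_mult_tendsto H1_fieldD u v H1_tendsto_components)+

lemma H1sq_const_tendsto: "U \<in> H1_field R \<Longrightarrow> (\<lambda>n :: nat. H1sq (\<lambda>x. U x - U x)) \<longlonglongrightarrow> 0"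
  using H1sq_scale[of U 0] by (simp only: scaleR_zero_left diff_self) simp

section \<open>Smooth fields against eigenfields and gradients\<close>

lemma D1_C1: "d \<in> D1 a b \<Longrightarrow> C1 (\<lambda>x. d x $ j)"
  by (auto simp: D1_def intro!: smooth_imp_C1 smooth_component)

lemma D1_H1_field: "d \<in> D1 a b \<Longrightarrow> d \<in> H1_field R"
  using C1_weak_partial(1)[OF D1_C1] by (auto simp: H1_field_def)

lemma D1_weak_partial: "d \<in> D1 a b \<Longrightarrow> AE x in M. weak_partial R i (\<lambda>x. d x $ j) x = partial i (\<lambda>x. d x $ j) x"
  by (intro C1_weak_partial D1_C1)

lemma D1_side: "d \<in> D1 a b \<Longrightarrow> x \<in> side a b i \<Longrightarrow> d x $ i = 0"
proof -
  assume d: "d \<in> D1 a b" and x: "x \<in> side a b i"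
  have f: "x \<in> frontier R" using x exhaust_2[of i] by (auto simp: side_def frontier_rect)
  have "x $ i = 0 \<or> x $ i = vector [a, b] $ i" using x by (simp add: side_def)
  then have "axis i 1 \<in> unit_normals a b x \<or> - axis i 1 \<in> unit_normals a b x"
    using exhaust_2[of i] by (auto simp: unit_normals_def)
  moreover have "\<forall>n\<in>unit_normals a b x. d x \<bullet> n = 0" using d f by (simp add: D1_def)
  ultimately have "d x \<bullet> axis i 1 = 0 \<or> d x \<bullet> (- axis i 1) = 0" by blast
  then show "d x $ i = 0" by (auto simp: inner_axis)
qed

lemma D1_add:
  assumes "d \<in> D1 a b" "e \<in> D1 a b"
  shows "(\<lambda>x. d x + e x) \<in> D1 a b"
proof -
  have p: "partial i (\<lambda>x. (d x + e x) $ j) x = partial i (\<lambda>x. d x $ j) x + partial i (\<lambda>x. e x $ j) x" for i j x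
    using C1_add(2)[OF D1_C1[OF assms(1)] D1_C1[OF assms(2)]] by simp
  have "divergence (\<lambda>x. d x + e x) x = divergence d x + divergence e x" "curl (\<lambda>x. d x + e x) x = curl d x + curl e x" for x
    unfolding divergence_def curl_def p by simp_all
  then show ?thesis using assms by (simp add: D1_def smooth_add inner_add_left)
qed

lemma D1_scale:
  assumes "d \<in> D1 a b"
  shows "(\<lambda>x. c *\<^sub>R d x) \<in> D1 a b"
proof -
  have p: "partial i (\<lambda>x. (c *\<^sub>R d x) $ j) x = c * partial i (\<lambda>x. d x $ j) x" for i j x
    using C1_cmult(2)[OF D1_C1[OF assms]] by simp
  have "divergence (\<lambda>x. c *\<^sub>R d x) x = c * divergence d x" "curl (\<lambda>x. c *\<^sub>R d x) x = c * curl d x" for x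
    unfolding divergence_def curl_def p by (simp_all add: algebra_simps)
  then show ?thesis using assms by (simp add: D1_def smooth_linear[OF bounded_linear_scaleR_right])
qed

lemma D1_zero: "(\<lambda>x. 0) \<in> D1 a b"
  using D1_scale[OF w_D1[of 0], of 0] by simp

lemma D1_sum: "finite A \<Longrightarrow> (\<And>k. k \<in> A \<Longrightarrow> d k \<in> D1 a b) \<Longrightarrow> (\<lambda>x. \<Sum>k\<in>A. d k x) \<in> D1 a b"
  by (induction A rule: finite_induct) (auto simp: D1_zero D1_add)

text \<open>Integration by parts moves the derivative from \<open>d\<close> to the eigenfield, each
  component of which is an eigenfunction of the Laplacian. The boundary term on the edges orthogonal
  to axis \<open>i\<close> vanishes for \<open>i = j\<close> because the normal component of
  \<open>d\<close> is 0, and for \<open>i \<noteq> j\<close> because the corresponding derivative of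
  the eigenfield is a multiple of \<open>ss\<close>.\<close>

lemma D1_vin_w:
  assumes d: "d \<in> D1 a b"
  shows "vin d (wf n) = lam n * fin d (wf n)"
proof -
  have C1p: "C1 (partial i (\<lambda>x. wf n x $ j))" for i j
    by (intro smooth_imp_C1(1) smooth_imp_C1(2) smooth_component smooth_w)
  have z: "partial i (\<lambda>x. wf n x $ j) x * d x $ j = 0" if "x \<in> side a b i" for i j x
  proof (cases "i = j")
    case True then show ?thesis using D1_side[OF d that] by simp
  next
    case False
    then have "partial i (\<lambda>x. wf n x $ j) x = 0"
      using that exhaust_2[of i] exhaust_2[of j] by (auto simp: side_def partial_w ss_def sin_freq)
    then show ?thesis by simp
  qed
  have ij: "(LINT x|M. weak_partial R i (\<lambda>x. d x $ j) x * weak_partial R i (\<lambda>x. wf n x $ j) x) =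
      - (LINT x|M. partial i (partial i (\<lambda>x. wf n x $ j)) x * d x $ j)" for i j
  proof -
    have "(LINT x|M. weak_partial R i (\<lambda>x. d x $ j) x * weak_partial R i (\<lambda>x. wf n x $ j) x) =
       (LINT x|M. partial i (\<lambda>x. wf n x $ j) x * partial i (\<lambda>x. d x $ j) x)"
    proof (intro integral_cong_AE borel_measurable_times L2_measurable H1_fieldD D1_H1_field d w_D1 C1_weak_partial D1_C1)
      show "AE x in M. weak_partial R i (\<lambda>x. d x $ j) x * weak_partial R i (\<lambda>x. wf n x $ j) x =
         partial i (\<lambda>x. wf n x $ j) x * partial i (\<lambda>x. d x $ j) x"
        using D1_weak_partial[OF d, of i j] D1_weak_partial[OF w_D1, of i n j] by eventually_elim simp
    qed
    also have "\<dots> = - (LINT x|M. partial i (partial i (\<lambda>x. wf n x $ j)) x * d x $ j)"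
      by (rule integral_partial_mult[OF C1p D1_C1[OF d] a b z])
    finally show ?thesis .
  qed
  have "(\<Sum>i\<in>UNIV. LINT x|M. weak_partial R i (\<lambda>x. d x $ j) x * weak_partial R i (\<lambda>x. wf n x $ j) x) = lam n * (LINT x|M. d x $ j * wf n x $ j)" for j
  proof -
    have 1: "(LINT x|M. partial 1 (partial 1 (\<lambda>x. wf n x $ j)) x * d x $ j) = - (freq1 n)\<^sup>2 * (LINT x|M. d x $ j * wf n x $ j)"
      unfolding partial2_w integral_mult_right_zero[symmetric] by (intro Bochner_Integration.integral_cong refl) simp
    have 2: "(LINT x|M. partial 2 (partial 2 (\<lambda>x. wf n x $ j)) x * d x $ j) = - (freq2 n)\<^sup>2 * (LINT x|M. d x $ j * wf n x $ j)"
      unfolding partial2_w integral_mult_right_zero[symmetric] by (intro Bochner_Integration.integral_cong refl) simp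
    show ?thesis unfolding sum_2 ij 1 2 lam_def by (simp add: algebra_simps)
  qed
  then show ?thesis by (simp add: vin_def fin_def sum_distrib_left)
qed

text \<open>A vanishing divergence removes the interior term and a vanishing normal component the
  boundary term. This orthogonality is used twice: for the completeness of the eigenfields and for
  the antisymmetry of the trilinear form.\<close>

lemma D1_orthogonal_gradient:
  assumes d: "d \<in> D1 a b" and q: "C1 q"
  shows "(\<Sum>i\<in>UNIV. LINT x|M. d x $ i * partial i q x) = 0"
proof -
  have "(\<Sum>i\<in>UNIV. LINT x|M. d x $ i * partial i q x) = (\<Sum>i\<in>UNIV. - (LINT x|M. partial i (\<lambda>x. d x $ i) x * q x))"
    by (intro sum.cong refl integral_partial_mult D1_C1 d q a b) (simp add: D1_side[OF d])
  also have "\<dots> = - (LINT x|M. (\<Sum>i\<in>UNIV. partial i (\<lambda>x. d x $ i) x * q x))"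
    by (subst Bochner_Integration.integral_sum)
       (auto simp: sum_negf intro!: continuous_imp_integrable_rect continuous_on_mult C1_D(2)[OF D1_C1[OF d]] C1_continuous[OF q])
  also have "(LINT x|M. (\<Sum>i\<in>UNIV. partial i (\<lambda>x. d x $ i) x * q x)) = (LINT x|M. 0)"
  proof (intro Bochner_Integration.integral_cong refl)
    fix x assume "x \<in> space M"
    then have "divergence d x = 0" using d by (simp add: D1_def)
    then show "(\<Sum>i\<in>UNIV. partial i (\<lambda>x. d x $ i) x * q x) = 0"
      by (simp add: sum_2 divergence_def flip: distrib_right)
  qed
  finally show ?thesis by simp
qed

lemma integral_sc_cs:
  "(LINT x|M. sc (freq1 m) (freq2 m) x * sc (freq1 n) (freq2 n) x) = (if m = n then a * b / 4 else 0)"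
  "(LINT x|M. cs (freq1 m) (freq2 m) x * cs (freq1 n) (freq2 n) x) = (if m = n then a * b / 4 else 0)"
proof -
  have mn: "m = n \<longleftrightarrow> fst (prod_decode m) = fst (prod_decode n) \<and> snd (prod_decode m) = snd (prod_decode n)"
    by (metis prod_decode_inverse prod_eqI)
  have "(LINT x|M. sc (freq1 m) (freq2 m) x * sc (freq1 n) (freq2 n) x) =
     (LINT x|M. (\<lambda>s. sin (freq1 m * s) * sin (freq1 n * s)) (x $ 1) * (\<lambda>s. cos (freq2 m * s) * cos (freq2 n * s)) (x $ 2))"
    by (simp add: sc_def mult_ac)
  also have "\<dots> = integral {0..a} (\<lambda>s. sin (freq1 m * s) * sin (freq1 n * s)) * integral {0..b} (\<lambda>s. cos (freq2 m * s) * cos (freq2 n * s))"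
    by (rule integral_tensor) (auto intro!: continuous_intros)
  finally show "(LINT x|M. sc (freq1 m) (freq2 m) x * sc (freq1 n) (freq2 n) x) = (if m = n then a * b / 4 else 0)"
    unfolding freq1_def freq2_def integral_sin_sin[OF a] integral_sin_sin[OF b] mn by simp
  have "(LINT x|M. cs (freq1 m) (freq2 m) x * cs (freq1 n) (freq2 n) x) =
     (LINT x|M. (\<lambda>s. cos (freq1 m * s) * cos (freq1 n * s)) (x $ 1) * (\<lambda>s. sin (freq2 m * s) * sin (freq2 n * s)) (x $ 2))"
    by (simp add: cs_def mult_ac)
  also have "\<dots> = integral {0..a} (\<lambda>s. cos (freq1 m * s) * cos (freq1 n * s)) * integral {0..b} (\<lambda>s. sin (freq2 m * s) * sin (freq2 n * s))"
    by (rule integral_tensor) (auto intro!: continuous_intros)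
  finally show "(LINT x|M. cs (freq1 m) (freq2 m) x * cs (freq1 n) (freq2 n) x) = (if m = n then a * b / 4 else 0)"
    unfolding freq1_def freq2_def integral_sin_sin[OF a] integral_sin_sin[OF b] mn by simp
qed

lemma fin_w_w: "fin (wf m) (wf n) = (if m = n then 1 else 0)"
proof -
  have "fin (wf m) (wf n) = (LINT x|M. (nrm m * freq2 m) * (nrm n * freq2 n) * (sc (freq1 m) (freq2 m) x * sc (freq1 n) (freq2 n) x))
     + (LINT x|M. (nrm m * freq1 m) * (nrm n * freq1 n) * (cs (freq1 m) (freq2 m) x * cs (freq1 n) (freq2 n) x))"
    unfolding fin_def sum_2 w_1 w_2 by (simp add: mult_ac)
  also have "\<dots> = (nrm m * freq2 m) * (nrm n * freq2 n) * (if m = n then a * b / 4 else 0) + (nrm m * freq1 m) * (nrm n * freq1 n) * (if m = n then a * b / 4 else 0)"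
    by (simp only: integral_mult_right_zero integral_sc_cs)
  also have "\<dots> = (if m = n then (nrm n)\<^sup>2 * lam n * (a * b / 4) else 0)"
    by (simp add: lam_def power2_eq_square algebra_simps)
  finally show ?thesis by (simp only: nrm_sq)
qed

section \<open>Eigenfunction expansions\<close>

lemma H1sq_commute:
  assumes "u \<in> H1_field R" "v \<in> H1_field R"
  shows "H1sq (\<lambda>x. u x - v x) = H1sq (\<lambda>x. v x - u x)"
  using H1sq_scale[OF H1_field_diff(1)[OF assms], of "-1"] by simp

lemma V_H1_field: "v \<in> V_space a b \<Longrightarrow> v \<in> H1_field R"
  by (simp add: V_space_def)

lemma V_I:
  assumes v: "v \<in> H1_field R" and d: "\<And>n. d n \<in> D1 a b" and l: "(\<lambda>n. H1sq (\<lambda>x. d n x - v x)) \<longlonglongrightarrow> 0"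
  shows "v \<in> V_space a b"
  unfolding V_space_def
proof (intro CollectI conjI allI impI v)
  fix e :: real assume e: "0 < e"
  obtain n where "H1sq (\<lambda>x. d n x - v x) < e\<^sup>2"
    using order_tendstoD(2)[OF l, of "e\<^sup>2"] e by (auto simp: eventually_sequentially)
  then have "H1_norm R (\<lambda>x. v x - d n x) < e"
    using e H1sq_commute[OF v D1_H1_field[OF d[of n]]] by (simp add: H1_norm_eq real_less_lsqrt)
  then show "\<exists>wf\<in>D1 a b. H1_norm R (\<lambda>x. v x - wf x) < e" using d by blast
qed

text \<open>The closure in sequential form with squared norms; identities on \<open>D1\<close> pass
  to \<open>V\<close> along such sequences.\<close>

lemma V_E:
  assumes v: "v \<in> V_space a b"
  obtains d where "\<And>n :: nat. d n \<in> D1 a b" "(\<lambda>n. H1sq (\<lambda>x. d n x - v x)) \<longlonglongrightarrow> 0"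
proof -
  have "\<exists>d\<in>D1 a b. H1_norm R (\<lambda>x. v x - d x) < inverse (real (Suc n))" for n
    using v unfolding V_space_def by simp
  then obtain d where d: "\<And>n. d n \<in> D1 a b" "\<And>n. H1_norm R (\<lambda>x. v x - d n x) < inverse (real (Suc n))" by metis
  have "(\<lambda>n. sqrt (H1sq (\<lambda>x. d n x - v x))) \<longlonglongrightarrow> 0"
  proof (rule tendsto_sandwich[OF _ _ tendsto_const LIMSEQ_inverse_real_of_nat], intro always_eventually allI)
    show "0 \<le> sqrt (H1sq (\<lambda>x. d n x - v x))" for n by (simp add: H1sq_nonneg)
    show "\<forall>\<^sub>F n in sequentially. sqrt (H1sq (\<lambda>x. d n x - v x)) \<le> inverse (real (Suc n))"
    proof (intro always_eventually allI)
      fix n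
      show "sqrt (H1sq (\<lambda>x. d n x - v x)) \<le> inverse (real (Suc n))"
        using d(2)[of n] H1sq_commute[OF V_H1_field[OF v] D1_H1_field[OF d(1)[of n]]] by (simp add: H1_norm_eq)
    qed
  qed
  from tendsto_power[OF this, of 2] have "(\<lambda>n. H1sq (\<lambda>x. d n x - v x)) \<longlonglongrightarrow> 0"
    by (simp add: H1sq_nonneg)
  with d(1) show ?thesis by (rule that)
qed

lemma D1_V: "d \<in> D1 a b \<Longrightarrow> d \<in> V_space a b"
  using V_I[of d "\<lambda>_. d"] H1sq_const_tendsto D1_H1_field by blast

lemma V_add:
  assumes "u \<in> V_space a b" "v \<in> V_space a b"
  shows "(\<lambda>x. u x + v x) \<in> V_space a b"
proof -
  obtain d where d: "\<And>n :: nat. d n \<in> D1 a b" "(\<lambda>n. H1sq (\<lambda>x. d n x - u x)) \<longlonglongrightarrow> 0" by (rule V_E[OF assms(1)]) blast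
  obtain e where e: "\<And>n :: nat. e n \<in> D1 a b" "(\<lambda>n. H1sq (\<lambda>x. e n x - v x)) \<longlonglongrightarrow> 0" by (rule V_E[OF assms(2)]) blast
  note h = V_H1_field[OF assms(1)] V_H1_field[OF assms(2)]
  have "(\<lambda>n. 2 * H1sq (\<lambda>x. d n x - u x) + 2 * H1sq (\<lambda>x. e n x - v x)) \<longlonglongrightarrow> 2 * 0 + 2 * 0"
    by (intro tendsto_intros d e)
  then have l: "(\<lambda>n. 2 * H1sq (\<lambda>x. d n x - u x) + 2 * H1sq (\<lambda>x. e n x - v x)) \<longlonglongrightarrow> 0" by simp
  show ?thesis
  proof (rule V_I[OF H1_field_add(1)[OF h] D1_add[OF d(1) e(1)]])
    show "(\<lambda>n. H1sq (\<lambda>x. (d n x + e n x) - (u x + v x))) \<longlonglongrightarrow> 0"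
    proof (rule tendsto_sandwich[OF _ _ tendsto_const l]; intro always_eventually allI H1sq_nonneg)
      fix n
      show "H1sq (\<lambda>x. (d n x + e n x) - (u x + v x)) \<le> 2 * H1sq (\<lambda>x. d n x - u x) + 2 * H1sq (\<lambda>x. e n x - v x)"
        using H1sq_add_le[OF H1_field_diff(1)[OF D1_H1_field[OF d(1)[of n]] h(1)] H1_field_diff(1)[OF D1_H1_field[OF e(1)[of n]] h(2)]]
        by (simp add: algebra_simps)
    qed
  qed
qed

lemma V_scale:
  assumes "u \<in> V_space a b"
  shows "(\<lambda>x. c *\<^sub>R u x) \<in> V_space a b"
proof -
  obtain d where d: "\<And>n :: nat. d n \<in> D1 a b" "(\<lambda>n. H1sq (\<lambda>x. d n x - u x)) \<longlonglongrightarrow> 0" by (rule V_E[OF assms(1)]) blast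
  note h = V_H1_field[OF assms(1)]
  have "(\<lambda>n. H1sq (\<lambda>x. c *\<^sub>R d n x - c *\<^sub>R u x)) = (\<lambda>n. c\<^sup>2 * H1sq (\<lambda>x. d n x - u x))"
    using H1sq_scale[OF H1_field_diff(1)[OF D1_H1_field[OF d(1)] h], of c] by (simp add: scaleR_diff_right)
  then have "(\<lambda>n. H1sq (\<lambda>x. c *\<^sub>R d n x - c *\<^sub>R u x)) \<longlonglongrightarrow> 0"
    using tendsto_mult_left[OF d(2), of "c\<^sup>2"] by simp
  then show ?thesis by (rule V_I[OF H1_field_scale(1)[OF h] D1_scale[OF d(1)]])
qed

lemma V_diff:
  assumes "u \<in> V_space a b" "v \<in> V_space a b"
  shows "(\<lambda>x. u x - v x) \<in> V_space a b"
  using V_add[OF assms(1) V_scale[OF assms(2), of "-1"]] by simp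

lemma w_V: "wf n \<in> V_space a b"
  by (intro D1_V w_D1)

lemmas w_H1 = V_H1_field[OF w_V]

lemma V_vin_w:
  assumes v: "v \<in> V_space a b"
  shows "vin v (wf n) = lam n * fin v (wf n)"
proof -
  obtain d where d: "\<And>n :: nat. d n \<in> D1 a b" "(\<lambda>n. H1sq (\<lambda>x. d n x - v x)) \<longlonglongrightarrow> 0" by (rule V_E[OF v]) blast
  note l = fin_vin_tendsto[OF D1_H1_field[OF d(1)] V_H1_field[OF v] d(2) w_H1 w_H1 H1sq_const_tendsto[OF w_H1]]
  show ?thesis using LIMSEQ_unique[OF l(2)] tendsto_mult_left[OF l(1), of "lam n"] by (simp add: D1_vin_w[OF d(1)])
qed

lemma V_orthogonal_gradient:
  assumes v: "v \<in> V_space a b" and q: "C1 q"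
  shows "(\<Sum>i\<in>UNIV. LINT x|M. v x $ i * partial i q x) = 0"
proof -
  obtain d where d: "\<And>n :: nat. d n \<in> D1 a b" "(\<lambda>n. H1sq (\<lambda>x. d n x - v x)) \<longlonglongrightarrow> 0" by (rule V_E[OF v]) blast
  have z: "(\<lambda>n :: nat. nsq R (\<lambda>x. h x - h x)) \<longlonglongrightarrow> 0" for h :: "point \<Rightarrow> real" by (simp add: nsq_def)
  have "(\<lambda>n. \<Sum>i\<in>UNIV. LINT x|M. d n x $ i * partial i q x) \<longlonglongrightarrow> (\<Sum>i\<in>UNIV. LINT x|M. v x $ i * partial i q x)"
    by (intro tendsto_sum integral_mult_tendsto H1_fieldD D1_H1_field d V_H1_field v H1_tendsto_components C1_weak_partial q z)
  then show ?thesis by (simp add: D1_orthogonal_gradient[OF d(1) q] LIMSEQ_const_iff)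
qed

definition coef :: "field \<Rightarrow> nat \<Rightarrow> real" where "coef v n = fin v (wf n)"

definition expand :: "nat \<Rightarrow> (nat \<Rightarrow> real) \<Rightarrow> field" where
  "expand N c = (\<lambda>x. \<Sum>n<N. c n *\<^sub>R wf n x)"

lemma expand_D1: "expand N c \<in> D1 a b"
  unfolding expand_def by (intro D1_sum D1_scale w_D1) auto

lemmas expand_V = D1_V[OF expand_D1]
lemmas expand_H1 = D1_H1_field[OF expand_D1]

lemma expand_Suc: "expand (Suc N) c = (\<lambda>x. expand N c x + c N *\<^sub>R wf N x)"
  by (simp add: expand_def)

lemma fin_zero:
  assumes "u \<in> H1_field R"
  shows "fin (\<lambda>x. 0) u = 0" "vin (\<lambda>x. 0) u = 0"
  using fin_scale[of 0 u u] vin_scale[OF assms assms, of 0] by simp_all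

lemma fin_expand:
  assumes u: "u \<in> H1_field R"
  shows "fin (expand N c) u = (\<Sum>n<N. c n * fin (wf n) u)" "vin (expand N c) u = (\<Sum>n<N. c n * vin (wf n) u)"
proof (induction N)
  case 0
  { case 1 show ?case using fin_zero(1)[OF u] by (simp add: expand_def) }
  { case 2 show ?case using fin_zero(2)[OF u] by (simp add: expand_def) }
next
  case (Suc N)
  note s = H1_field_scale(1)[OF w_H1[of N], of "c N"]
  { case 1 show ?case using Suc.IH(1) by (simp add: expand_Suc fin_add[OF expand_H1 s u] fin_scale) }
  { case 2 show ?case using Suc.IH(2) by (simp add: expand_Suc vin_add[OF expand_H1 s u] vin_scale[OF w_H1 u]) }
qed

lemma coef_expand: "coef (expand N c) k = (if k < N then c k else 0)"
proof -
  have "coef (expand N c) k = (\<Sum>n<N. if n = k then c n else 0)"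
    unfolding coef_def fin_expand(1)[OF w_H1] fin_w_w by (intro sum.cong) auto
  then show ?thesis by (simp add: sum.delta')
qed

lemma vin_w_coef: "v \<in> V_space a b \<Longrightarrow> vin (wf n) v = lam n * coef v n" "fin (wf n) v = coef v n"
  using V_vin_w[of v n] by (simp_all add: coef_def fin_vin_commute[of "wf n" v])

lemma fin_expand_V:
  assumes v: "v \<in> V_space a b"
  shows "fin (expand N c) v = (\<Sum>n<N. c n * coef v n)" "vin (expand N c) v = (\<Sum>n<N. lam n * (c n * coef v n))"
  by (simp_all add: fin_expand[OF V_H1_field[OF v]] vin_w_coef(1)[OF v] vin_w_coef(2) mult.left_commute)

lemma expand_norms:
  "fin (expand N c) (expand N c) = (\<Sum>n<N. (c n)\<^sup>2)" "vin (expand N c) (expand N c) = (\<Sum>n<N. lam n * (c n)\<^sup>2)"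
  unfolding fin_expand_V[OF expand_V] coef_expand by (simp_all add: power2_eq_square)

lemma coef_add: "u \<in> V_space a b \<Longrightarrow> v \<in> V_space a b \<Longrightarrow> coef (\<lambda>x. u x + v x) n = coef u n + coef v n"
  unfolding coef_def by (intro fin_add V_H1_field w_V)

lemma coef_diff: "u \<in> V_space a b \<Longrightarrow> v \<in> V_space a b \<Longrightarrow> coef (\<lambda>x. u x - v x) n = coef u n - coef v n"
  unfolding coef_def by (intro fin_vin_diff(1) V_H1_field w_V)

lemma coef_scale: "coef (\<lambda>x. c *\<^sub>R u x) n = c * coef u n"
  unfolding coef_def by (rule fin_scale)

text \<open>The eigenfields are also orthogonal for \<open>vin\<close>, with squares
  \<open>lam n\<close>. Expanding the nonnegative square of \<open>v\<close> minus its partial sum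
  gives the bound.\<close>

lemma Bessel_V:
  assumes v: "v \<in> V_space a b"
  shows "(\<Sum>n<N. lam n * (coef v n)\<^sup>2) \<le> vin v v"
proof -
  let ?S = "expand N (coef v)"
  note h = V_H1_field[OF v] expand_H1[of N "coef v"]
  have d: "(\<lambda>x. v x - ?S x) \<in> H1_field R" by (rule H1_field_diff(1)[OF h])
  have "0 \<le> vin (\<lambda>x. v x - ?S x) (\<lambda>x. v x - ?S x)" by (rule fin_vin_nonneg)
  also have "\<dots> = vin v (\<lambda>x. v x - ?S x) - vin ?S (\<lambda>x. v x - ?S x)"
    by (rule fin_vin_diff(2)[OF h d])
  also have "vin v (\<lambda>x. v x - ?S x) = vin v v - vin ?S v"
    using fin_vin_diff(2)[OF h h(1)] by (simp add: fin_vin_commute)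
  also have "vin ?S (\<lambda>x. v x - ?S x) = vin ?S v - vin ?S ?S"
    using fin_vin_diff(2)[OF h h(2)] by (simp add: fin_vin_commute)
  finally show ?thesis by (simp add: fin_expand_V[OF v] expand_norms power2_eq_square)
qed

text \<open>The same expansion for a field that is only square integrable. It makes the coefficients
  of the initial value square summable.\<close>

lemma Bessel_L2:
  assumes v: "\<And>j. (\<lambda>x. v x $ j) \<in> L2 R"
  shows "(\<Sum>n<N. (fin v (wf n))\<^sup>2) \<le> fin v v"
proof -
  let ?c = "\<lambda>n. fin v (wf n)"
  let ?S = "expand N ?c"
  have S: "(\<lambda>x. ?S x $ j) \<in> L2 R" for j by (rule H1_fieldD(2)[OF expand_H1])
  have wL: "(\<lambda>x. wf n x $ j) \<in> L2 R" for n j by (rule H1_fieldD(2)[OF w_H1])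
  have lin: "fin v (expand N c) = (\<Sum>n<N. c n * fin v (wf n))" for c
  proof -
    have "fin v (expand N c) = (\<Sum>j\<in>UNIV. LINT x|M. (\<Sum>n<N. c n * (v x $ j * wf n x $ j)))"
      unfolding fin_def by (intro sum.cong refl Bochner_Integration.integral_cong) (simp add: expand_def sum_distrib_left mult.left_commute)
    also have "\<dots> = (\<Sum>j\<in>UNIV. \<Sum>n<N. c n * (LINT x|M. (v x $ j * wf n x $ j)))"
      by (subst Bochner_Integration.integral_sum) (auto intro!: L2_integrable_mult v wL)
    also have "\<dots> = (\<Sum>n<N. c n * fin v (wf n))"
      unfolding fin_def sum_distrib_left by (rule sum.swap)
    finally show ?thesis .
  qed
  have "0 \<le> (\<Sum>j\<in>UNIV. nsq R (\<lambda>x. v x $ j - ?S x $ j))" by (intro sum_nonneg nsq_nonneg)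
  also have "\<dots> = (\<Sum>j\<in>UNIV. nsq R (\<lambda>x. v x $ j) - 2 * (LINT x|M. v x $ j * ?S x $ j) + nsq R (\<lambda>x. ?S x $ j))"
    by (intro sum.cong refl nsq_diff v S)
  also have "\<dots> = fin v v - 2 * fin v ?S + fin ?S ?S"
    by (simp add: fin_def nsq_def sum_2 power2_eq_square)
  finally show ?thesis unfolding lin expand_norms by (simp add: power2_eq_square)
qed

lemma H1sq_expand_diff:
  assumes "N \<le> K"
  shows "H1sq (\<lambda>x. expand K c x - expand N c x) = (\<Sum>n\<in>{N..<K}. (1 + lam n) * (c n)\<^sup>2)"
proof -
  let ?c = "\<lambda>n. if n < N then 0 else c n"
  have "(\<lambda>x. expand K c x - expand N c x) = expand K ?c"
  proof
    fix x
    have "{..<K} = {..<N} \<union> {N..<K}" using assms by auto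
    moreover have "{..<N} \<inter> {N..<K} = {}" by auto
    ultimately have split: "(\<Sum>n<K. f n) = (\<Sum>n<N. f n) + (\<Sum>n\<in>{N..<K}. f n)" for f :: "nat \<Rightarrow> point"
      by (simp add: sum.union_disjoint)
    have "expand K c x = (\<Sum>n<N. c n *\<^sub>R wf n x) + (\<Sum>n\<in>{N..<K}. c n *\<^sub>R wf n x)"
      unfolding expand_def by (rule split)
    moreover have "expand K ?c x = (\<Sum>n<N. ?c n *\<^sub>R wf n x) + (\<Sum>n\<in>{N..<K}. ?c n *\<^sub>R wf n x)"
      unfolding expand_def by (rule split)
    ultimately show "expand K c x - expand N c x = expand K ?c x" by (simp add: expand_def)
  qed
  then have "H1sq (\<lambda>x. expand K c x - expand N c x) = (\<Sum>n<K. (1 + lam n) * (?c n)\<^sup>2)"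
    by (simp add: H1sq_eq expand_norms sum.distrib[symmetric] distrib_right)
  also have "\<dots> = (\<Sum>n\<in>{N..<K}. (1 + lam n) * (?c n)\<^sup>2)"
    by (rule sum.mono_neutral_right) auto
  finally show ?thesis by simp
qed

text \<open>The eigenvalue with both frequencies lowest, a lower bound for all others and hence the
  constant in the Poincare inequality.\<close>

definition lam0 :: real where "lam0 = (pi / a)\<^sup>2 + (pi / b)\<^sup>2"

lemma lam0: "0 < lam0" "lam0 \<le> lam n"
proof -
  show "0 < lam0" unfolding lam0_def using a b by (intro add_pos_pos) auto
  have "pi / a \<le> freq1 n" "pi / b \<le> freq2 n"
    using mult_right_mono[of 1 "real (Suc (fst (prod_decode n)))" "pi / a"]
      mult_right_mono[of 1 "real (Suc (snd (prod_decode n)))" "pi / b"] a b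
    by (simp_all add: freq1_def freq2_def del: of_nat_Suc)
  then show "lam0 \<le> lam n" unfolding lam0_def lam_def using a b by (intro add_mono power_mono) auto
qed

lemma one_plus_lam_le: "1 + lam n \<le> (1 + 1 / lam0) * lam n"
  using lam0(2)[of n] lam0(1) by (simp add: field_simps)

text \<open>Below any level there are only finitely many pairs of indices, since
  \<open>real i * C\<close> and \<open>real j * C\<close> are at most the eigenvalue. This settles
  the limit for any enumeration of the pairs, although \<open>lam\<close> is not monotone along the
  pairing.\<close>

lemma lam_tendsto: "filterlim lam at_top sequentially"
proof -
  define C where "C = min ((pi / a)\<^sup>2) ((pi / b)\<^sup>2)"
  have C: "0 < C" using a b by (simp add: C_def)
  have fin: "finite {n. lam n \<le> K}" for K
  proof -
    have "{n. lam n \<le> K} \<subseteq> prod_encode ` ({..nat \<lceil>K / C\<rceil>} \<times> {..nat \<lceil>K / C\<rceil>})"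
    proof
      fix n assume "n \<in> {n. lam n \<le> K}"
      then have n: "lam n \<le> K" by simp
      obtain i j where ij: "prod_decode n = (i, j)" by (cases "prod_decode n")
      have "real i * C \<le> lam n" "real j * C \<le> lam n"
      proof -
        have 1: "real i * C \<le> (freq1 n)\<^sup>2"
        proof -
          have "real i * 1 \<le> real (Suc i) * real (Suc i)" by (intro mult_mono) auto
          then have "real i * C \<le> (real (Suc i) * real (Suc i)) * (pi / a)\<^sup>2" using C by (intro mult_mono) (auto simp: C_def)
          then show ?thesis by (simp add: freq1_def ij power2_eq_square mult_ac)
        qed
        have 2: "real j * C \<le> (freq2 n)\<^sup>2"
        proof -
          have "real j * 1 \<le> real (Suc j) * real (Suc j)" by (intro mult_mono) auto
          then have "real j * C \<le> (real (Suc j) * real (Suc j)) * (pi / b)\<^sup>2" using C by (intro mult_mono) (auto simp: C_def)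
          then show ?thesis by (simp add: freq2_def ij power2_eq_square mult_ac)
        qed
        show "real i * C \<le> lam n" "real j * C \<le> lam n" using 1 2 by (auto simp: lam_def intro: order_trans)
      qed
      then have "real i \<le> K / C" "real j \<le> K / C" using n C by (auto simp: field_simps)
      then have "i \<le> nat \<lceil>K / C\<rceil>" "j \<le> nat \<lceil>K / C\<rceil>" by linarith+
      moreover have "n = prod_encode (i, j)" using ij by (metis prod_decode_inverse)
      ultimately show "n \<in> prod_encode ` ({..nat \<lceil>K / C\<rceil>} \<times> {..nat \<lceil>K / C\<rceil>})" by auto
    qed
    then show ?thesis by (rule finite_subset) auto
  qed
  show ?thesis
    unfolding filterlim_at_top
  proof
    fix K
    have "eventually (\<lambda>n. n \<notin> {n. lam n \<le> K}) cofinite" using fin by (simp add: eventually_cofinite)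
    then show "\<forall>\<^sub>F n in sequentially. K \<le> lam n"
      unfolding cofinite_eq_sequentially by eventually_elim auto
  qed
qed

text \<open>Riesz-Fischer for \<open>V\<close>. The partial sums are Cauchy in \<open>H^1\<close>,
  so the components and their weak derivatives converge separately in \<open>L^2\<close>, and
  closedness of weak differentiation ties the limits together.\<close>

lemma realization:
  assumes c: "summable (\<lambda>n. lam n * (c n)\<^sup>2)"
  obtains U where "U \<in> V_space a b" "\<And>n. coef U n = c n" "(\<lambda>N. H1sq (\<lambda>x. expand N c x - U x)) \<longlonglongrightarrow> 0"
proof -
  have s: "summable (\<lambda>n. (1 + lam n) * (c n)\<^sup>2)"
  proof (rule summable_comparison_test')
    show "summable (\<lambda>n. (1 + 1 / lam0) * (lam n * (c n)\<^sup>2))" by (intro summable_mult c)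
    show "norm ((1 + lam n) * (c n)\<^sup>2) \<le> (1 + 1 / lam0) * (lam n * (c n)\<^sup>2)" for n
      using mult_right_mono[OF one_plus_lam_le[of n], of "(c n)\<^sup>2"] lam_pos[of n] by (simp add: mult.assoc)
  qed
  have Cau: "\<exists>N. \<forall>i\<ge>N. \<forall>j\<ge>N. H1sq (\<lambda>x. expand i c x - expand j c x) < e" if e: "0 < e" for e
  proof -
    obtain N where N: "\<And>m n. m \<ge> N \<Longrightarrow> norm (\<Sum>k\<in>{m..<n}. (1 + lam k) * (c k)\<^sup>2) < e"
      using s e unfolding summable_Cauchy by blast
    have "H1sq (\<lambda>x. expand i c x - expand j c x) < e" if "i \<ge> N" "j \<ge> N" for i j
    proof (cases "j \<le> i")
      case True
      then show ?thesis using H1sq_expand_diff[OF True] N[OF that(2), of i] by simp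
    next
      case False
      then have "i \<le> j" by simp
      then show ?thesis using H1sq_expand_diff[OF \<open>i \<le> j\<close>] N[OF that(1), of j] H1sq_commute[OF expand_H1 expand_H1] by simp
    qed
    then show ?thesis by blast
  qed
  have "\<exists>g. g \<in> L2 R \<and> (\<lambda>n. nsq R (\<lambda>x. expand n c x $ j - g x)) \<longlonglongrightarrow> 0" for j
  proof (rule L2_complete[OF lmeasurable_rect(1), of "\<lambda>n x. expand n c x $ j"])
    show "(\<lambda>x. expand n c x $ j) \<in> L2 R" for n by (rule H1_fieldD(2)[OF expand_H1])
    fix e :: real assume "0 < e"
    from Cau[OF this] obtain N where N: "\<And>i k. i \<ge> N \<Longrightarrow> k \<ge> N \<Longrightarrow> H1sq (\<lambda>x. expand i c x - expand k c x) < e" by auto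
    show "\<exists>N. \<forall>i\<ge>N. \<forall>k\<ge>N. nsq R (\<lambda>x. expand i c x $ j - expand k c x $ j) < e"
    proof (intro exI[of _ N] allI impI)
      fix i k assume "N \<le> i" "N \<le> k"
      from N[OF this] show "nsq R (\<lambda>x. expand i c x $ j - expand k c x $ j) < e"
        using H1sq_ge(1)[where u = "\<lambda>x. expand i c x - expand k c x" and j = j] by simp
    qed
  qed blast
  then have "\<forall>j. \<exists>g. g \<in> L2 R \<and> (\<lambda>n. nsq R (\<lambda>x. expand n c x $ j - g x)) \<longlonglongrightarrow> 0" by blast
  from choice[OF this] obtain g where g: "\<And>j. g j \<in> L2 R" "\<And>j. (\<lambda>n. nsq R (\<lambda>x. expand n c x $ j - g j x)) \<longlonglongrightarrow> 0" by blast
  let ?D = "\<lambda>n i j. weak_partial R i (\<lambda>x. expand n c x $ j)"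
  have D: "nsq R (\<lambda>x. ?D m i j x - ?D n i j x) \<le> H1sq (\<lambda>x. expand m c x - expand n c x)" for m n i j
  proof -
    have "nsq R (weak_partial R i (\<lambda>x. (expand m c x - expand n c x) $ j)) = nsq R (\<lambda>x. ?D m i j x - ?D n i j x)"
      by (intro nsq_cong H1_field_diff expand_H1 H1_fieldD L2_diff)
    then show ?thesis using H1sq_ge(2)[where u = "\<lambda>x. expand m c x - expand n c x" and i = i and j = j] by simp
  qed
  have "\<exists>h. h \<in> L2 R \<and> (\<lambda>n. nsq R (\<lambda>x. ?D n i j x - h x)) \<longlonglongrightarrow> 0" for i j
  proof (rule L2_complete[OF lmeasurable_rect(1), of "\<lambda>n. ?D n i j"])
    show "?D n i j \<in> L2 R" for n by (rule H1_fieldD(3)[OF expand_H1])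
    fix e :: real assume "0 < e"
    from Cau[OF this] obtain N where N: "\<And>i k. i \<ge> N \<Longrightarrow> k \<ge> N \<Longrightarrow> H1sq (\<lambda>x. expand i c x - expand k c x) < e" by auto
    show "\<exists>N. \<forall>m\<ge>N. \<forall>k\<ge>N. nsq R (\<lambda>x. ?D m i j x - ?D k i j x) < e"
      by (intro exI[of _ N] allI impI le_less_trans[OF D N])
  qed blast
  then have "\<forall>p. \<exists>h. h \<in> L2 R \<and> (\<lambda>n. nsq R (\<lambda>x. ?D n (fst p) (snd p) x - h x)) \<longlonglongrightarrow> 0" by blast
  from choice[OF this] obtain h' where h': "\<And>p. h' p \<in> L2 R" "\<And>p. (\<lambda>n. nsq R (\<lambda>x. ?D n (fst p) (snd p) x - h' p x)) \<longlonglongrightarrow> 0" by blast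
  define h where "h i j = h' (i, j)" for i j
  have h: "h i j \<in> L2 R" "(\<lambda>n. nsq R (\<lambda>x. ?D n i j x - h i j x)) \<longlonglongrightarrow> 0" for i j
    using h'(1)[of "(i, j)"] h'(2)[of "(i, j)"] by (simp_all add: h_def)
  define U :: field where "U x = (\<chi> j. g j x)" for x
  have U: "U x $ j = g j x" for x j by (simp add: U_def)
  have wU: "is_weak_partial R i (\<lambda>x. U x $ j) (h i j)" for i j
    unfolding U by (rule is_weak_partial_limit[OF H1_fieldD(2)[OF expand_H1] g(1) g(2) H1_fieldD(3)[OF expand_H1] h(1) h(2) H1_fieldD(4)[OF expand_H1]])
  have UH: "U \<in> H1_field R"
  proof -
    have "(\<lambda>x. U x $ j) \<in> L2 R" for j by (simp add: U g(1))
    then show ?thesis unfolding H1_field_def H1_def using wU h(1) by blast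
  qed
  have conv: "(\<lambda>N. H1sq (\<lambda>x. expand N c x - U x)) \<longlonglongrightarrow> 0"
  proof -
    have eq: "nsq R (weak_partial R i (\<lambda>x. (expand N c x - U x) $ j)) = nsq R (\<lambda>x. ?D N i j x - h i j x)" for N i j
    proof (intro nsq_cong)
      show "AE x in M. weak_partial R i (\<lambda>x. (expand N c x - U x) $ j) x = ?D N i j x - h i j x"
        using H1_field_diff(2)[OF expand_H1[of N c] UH, of i j] weak_partial_AE(3)[OF h(1) wU, of i j]
        by eventually_elim simp
    qed (intro H1_fieldD H1_field_diff expand_H1 UH L2_diff h)+
    have "(\<lambda>N. \<Sum>j\<in>UNIV. nsq R (\<lambda>x. expand N c x $ j - g j x) + (\<Sum>i\<in>UNIV. nsq R (\<lambda>x. ?D N i j x - h i j x))) \<longlonglongrightarrow> (\<Sum>j\<in>(UNIV::2 set). 0 + (\<Sum>i\<in>(UNIV::2 set). 0))"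
      by (intro tendsto_intros g h)
    then show ?thesis unfolding H1sq_def eq by (simp add: U)
  qed
  have UV: "U \<in> V_space a b" by (rule V_I[OF UH expand_D1 conv])
  have "coef U n = c n" for n
  \<comment> \<open>Coefficients are continuous along the convergent partial sums, and those of the
    partial sums are constant in \<open>N\<close> as soon as \<open>N > n\<close>.\<close>
  proof (rule LIMSEQ_unique)
    show "(\<lambda>N. coef (expand N c) n) \<longlonglongrightarrow> coef U n"
      unfolding coef_def by (rule fin_vin_tendsto(1)[OF expand_H1 UH conv w_H1 w_H1 H1sq_const_tendsto[OF w_H1]])
    show "(\<lambda>N. coef (expand N c) n) \<longlonglongrightarrow> c n"
      by (rule tendsto_eventually) (auto simp: coef_expand eventually_sequentially intro!: exI[of _ "Suc n"])
  qed
  with UV show ?thesis using conv by (rule that)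
qed

section \<open>Completeness of the eigenfields\<close>

text \<open>Completeness of the cosines is transferred by a multiplier: the first sine in
  \<open>x $ 1\<close> times a cosine is half a difference of two sines. Hence \<open>h\<close>
  times that sine is orthogonal to all cosine products and vanishes, and the sine is positive inside
  \<open>R\<close>.\<close>

lemma sc_complete:
  assumes h: "h \<in> L2 R" and 0: "\<And>m n. (LINT x|M. h x * sc (real m * (pi / a)) (real n * (pi / b)) x) = 0"
  shows "AE x in M. h x = 0"
proof -
  let ?s = "\<lambda>x :: point. sin (pi / a * x $ 1)"
  have sL: "?s \<in> L2 R" by (intro continuous_L2 continuous_intros)
  have hsL: "(\<lambda>x. h x * ?s x) \<in> L2 R"
    unfolding L2_real_iff
  proof
    show m: "(\<lambda>x. h x * ?s x) \<in> borel_measurable M" using L2_measurable[OF h] L2_measurable[OF sL] by simp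
    have "integrable M (\<lambda>x. (h x)\<^sup>2)" using h by (simp add: L2_real_iff)
    then show "integrable M (\<lambda>x. (h x * ?s x)\<^sup>2)"
    proof (rule Bochner_Integration.integrable_bound)
      show "AE x in M. norm ((h x * ?s x)\<^sup>2) \<le> norm ((h x)\<^sup>2)"
        by (intro AE_I2) (auto simp: power_mult_distrib intro!: mult_left_le abs_square_le_1[THEN iffD2] abs_sin_le_one)
    qed (use m in simp)
  qed
  have "AE x in M. h x * ?s x = 0"
  proof (rule cosprod_complete[OF hsL])
    fix m n
    have scL: "sc p r \<in> L2 R" for p r by (intro continuous_L2 C1_continuous C1_trig)
    note i = L2_integrable_mult[OF h scL]
    \<comment> \<open>For \<open>m = 0\<close> the multiplier itself is the sine in question;
      otherwise the natural subtraction in \<open>m - 1\<close> is exact.\<close>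
    have e: "h x * ?s x * cosprod m n x = (if m = 0 then h x * sc (real 1 * (pi / a)) (real n * (pi / b)) x else
        (h x * sc (real (Suc m) * (pi / a)) (real n * (pi / b)) x - h x * sc (real (m - 1) * (pi / a)) (real n * (pi / b)) x) / 2)" for x
    proof (cases m)
      case 0
      then show ?thesis by (simp add: cosprod_def sc_def)
    next
      case (Suc k)
      have "sin (pi / a * x $ 1) * cos (real m * (pi / a) * x $ 1) = (sin (real (Suc m) * (pi / a) * x $ 1) - sin (real k * (pi / a) * x $ 1)) / 2"
        using sin_add[of "real m * (pi / a) * x $ 1" "pi / a * x $ 1"] sin_diff[of "real m * (pi / a) * x $ 1" "pi / a * x $ 1"]
        by (simp add: Suc algebra_simps)
      then have "h x * cos (real n * (pi / b) * x $ 2) * (sin (pi / a * x $ 1) * cos (real m * (pi / a) * x $ 1)) =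
          h x * cos (real n * (pi / b) * x $ 2) * ((sin (real (Suc m) * (pi / a) * x $ 1) - sin (real k * (pi / a) * x $ 1)) / 2)" by simp
      then show ?thesis using Suc by (simp add: cosprod_def sc_def mult_ac right_diff_distrib diff_divide_distrib del: of_nat_Suc)
    qed
    show "(LINT x|M. h x * ?s x * cosprod m n x) = 0"
      unfolding e by (cases "m = 0") (use i 0[of 1 n] 0[of "Suc m" n] 0[of "m - 1" n] in \<open>simp_all del: of_nat_Suc\<close>)
  qed
  then show ?thesis
    using AE_space
  proof eventually_elim
    fix x assume z: "h x * ?s x = 0" and "x \<in> space M"
    then have "0 < pi / a * x $ 1" "pi / a * x $ 1 < pi" using a by (auto simp: rect_def field_simps)
    then have "0 < ?s x" by (intro sin_gt_zero) auto
    with z show "h x = 0" by simp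
  qed
qed

text \<open>The same multiplier argument with the two axes exchanged.\<close>

lemma cs_complete:
  assumes h: "h \<in> L2 R" and 0: "\<And>m n. (LINT x|M. h x * cs (real m * (pi / a)) (real n * (pi / b)) x) = 0"
  shows "AE x in M. h x = 0"
proof -
  let ?s = "\<lambda>x :: point. sin (pi / b * x $ 2)"
  have sL: "?s \<in> L2 R" by (intro continuous_L2 continuous_intros)
  have hsL: "(\<lambda>x. h x * ?s x) \<in> L2 R"
    unfolding L2_real_iff
  proof
    show m: "(\<lambda>x. h x * ?s x) \<in> borel_measurable M" using L2_measurable[OF h] L2_measurable[OF sL] by simp
    have "integrable M (\<lambda>x. (h x)\<^sup>2)" using h by (simp add: L2_real_iff)
    then show "integrable M (\<lambda>x. (h x * ?s x)\<^sup>2)"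
    proof (rule Bochner_Integration.integrable_bound)
      show "AE x in M. norm ((h x * ?s x)\<^sup>2) \<le> norm ((h x)\<^sup>2)"
        by (intro AE_I2) (auto simp: power_mult_distrib intro!: mult_left_le abs_square_le_1[THEN iffD2] abs_sin_le_one)
    qed (use m in simp)
  qed
  have "AE x in M. h x * ?s x = 0"
  proof (rule cosprod_complete[OF hsL])
    fix m n
    have scL: "cs p r \<in> L2 R" for p r by (intro continuous_L2 C1_continuous C1_trig)
    note i = L2_integrable_mult[OF h scL]
    have e: "h x * ?s x * cosprod m n x = (if n = 0 then h x * cs (real m * (pi / a)) (real 1 * (pi / b)) x else
        (h x * cs (real m * (pi / a)) (real (Suc n) * (pi / b)) x - h x * cs (real m * (pi / a)) (real (n - 1) * (pi / b)) x) / 2)" for x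
    proof (cases n)
      case 0
      then show ?thesis by (simp add: cosprod_def cs_def)
    next
      case (Suc k)
      have "sin (pi / b * x $ 2) * cos (real n * (pi / b) * x $ 2) = (sin (real (Suc n) * (pi / b) * x $ 2) - sin (real k * (pi / b) * x $ 2)) / 2"
        using sin_add[of "real n * (pi / b) * x $ 2" "pi / b * x $ 2"] sin_diff[of "real n * (pi / b) * x $ 2" "pi / b * x $ 2"]
        by (simp add: Suc algebra_simps)
      then have "h x * cos (real m * (pi / a) * x $ 1) * (sin (pi / b * x $ 2) * cos (real n * (pi / b) * x $ 2)) =
          h x * cos (real m * (pi / a) * x $ 1) * ((sin (real (Suc n) * (pi / b) * x $ 2) - sin (real k * (pi / b) * x $ 2)) / 2)" by simp
      then show ?thesis using Suc by (simp add: cosprod_def cs_def mult_ac right_diff_distrib diff_divide_distrib del: of_nat_Suc)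
    qed
    show "(LINT x|M. h x * ?s x * cosprod m n x) = 0"
      unfolding e by (cases "n = 0") (use i 0[of m 1] 0[of m "Suc n"] 0[of m "n - 1"] in \<open>simp_all del: of_nat_Suc\<close>)
  qed
  then show ?thesis
    using AE_space
  proof eventually_elim
    fix x assume z: "h x * ?s x = 0" and "x \<in> space M"
    then have "0 < pi / b * x $ 2" "pi / b * x $ 2 < pi" using b by (auto simp: rect_def field_simps)
    then have "0 < ?s x" by (intro sin_gt_zero) auto
    with z show "h x = 0" by simp
  qed
qed

text \<open>The eigenfields together with the gradients of the products of cosines span all sine-cosine
  fields, and an element of \<open>V\<close> is orthogonal to gradients.\<close>

lemma V_coef_0:
  assumes v: "v \<in> V_space a b" and 0: "\<And>n. coef v n = 0"
  shows "AE x in M. v x $ j = 0"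
proof -
  define A where "A p r = (LINT x|M. v x $ 1 * sc p r x)" for p r
  define B where "B p r = (LINT x|M. v x $ 2 * cs p r x)" for p r
  have vL: "(\<lambda>x. v x $ j) \<in> L2 R" for j by (rule H1_fieldD(2)[OF V_H1_field[OF v]])
  \<comment> \<open>Orthogonality to the gradient of the cosine product with frequencies
    \<open>p\<close> and \<open>r\<close>: one linear relation between the two sine-cosine
    coefficients of \<open>v\<close>.\<close>
  have grad: "p * A p r + r * B p r = 0" for p r
  proof -
    have "(\<Sum>i\<in>UNIV. LINT x|M. v x $ i * partial i (cc p r) x) = 0"
      by (rule V_orthogonal_gradient[OF v C1_trig(4)])
    then have "(LINT x|M. - p * (v x $ 1 * sc p r x)) + (LINT x|M. - r * (v x $ 2 * cs p r x)) = 0"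
      by (simp add: sum_2 partial_trig mult.left_commute)
    then show ?thesis unfolding integral_mult_right_zero A_def B_def by simp
  qed
  have eig: "- freq2 n * A (freq1 n) (freq2 n) + freq1 n * B (freq1 n) (freq2 n) = 0" for n
  proof -
    have "coef v n = (LINT x|M. (- nrm n * freq2 n) * (v x $ 1 * sc (freq1 n) (freq2 n) x)) + (LINT x|M. (nrm n * freq1 n) * (v x $ 2 * cs (freq1 n) (freq2 n) x))"
      unfolding coef_def fin_def sum_2 w_1 w_2 by (simp add: mult_ac)
    also have "\<dots> = nrm n * (- freq2 n * A (freq1 n) (freq2 n) + freq1 n * B (freq1 n) (freq2 n))"
      unfolding integral_mult_right_zero A_def B_def by (simp add: algebra_simps)
    finally have "nrm n * (- freq2 n * A (freq1 n) (freq2 n) + freq1 n * B (freq1 n) (freq2 n)) = 0"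
      using 0[of n] by simp
    moreover have "nrm n \<noteq> 0" using nrm_sq[of n] by auto
    ultimately show ?thesis by simp
  qed
  have AB: "A (real m * (pi / a)) (real n * (pi / b)) = 0 \<and> B (real m * (pi / a)) (real n * (pi / b)) = 0" for m n
  proof -
    let ?p = "real m * (pi / a)" and ?r = "real n * (pi / b)"
    \<comment> \<open>The eigenfields have positive frequencies in both directions. If a frequency
      is 0, the integral with the corresponding sine factor vanishes at once, and the gradient
      relation takes care of the other one when it does not vanish as well.\<close>
    consider "m = 0" "n = 0" | "m = 0" "n \<noteq> 0" | "m \<noteq> 0" "n = 0" | i j where "m = Suc i" "n = Suc j"
      by (metis not0_implies_Suc)
    then show ?thesis
    proof cases
      case 1 then show ?thesis by (simp add: A_def B_def sc_def cs_def)
    next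
      case 2 then show ?thesis using grad[of ?p ?r] b by (simp add: A_def sc_def)
    next
      case 3 then show ?thesis using grad[of ?p ?r] a by (simp add: B_def cs_def)
    next
      case (4 i j)
      define N where "N = prod_encode (i, j)"
      have f: "freq1 N = ?p" "freq2 N = ?r" using 4 by (simp_all add: freq1_def freq2_def N_def)
      have g1: "?p * A ?p ?r + ?r * B ?p ?r = 0" by (rule grad)
      have g2: "- ?r * A ?p ?r + ?p * B ?p ?r = 0" using eig[of N] unfolding f .
      \<comment> \<open>The determinant of the system formed by \<open>g1\<close> and
        \<open>g2\<close> in the two unknown coefficients.\<close>
      have pos: "0 < ?p * ?p + ?r * ?r" using 4 a b by (intro add_pos_pos mult_pos_pos) simp_all
      have "(?p * ?p + ?r * ?r) * A ?p ?r = ?p * (?p * A ?p ?r + ?r * B ?p ?r) - ?r * (- ?r * A ?p ?r + ?p * B ?p ?r)"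
        by (simp add: algebra_simps)
      then have A0: "A ?p ?r = 0" unfolding g1 g2 using pos by simp
      have "(?p * ?p + ?r * ?r) * B ?p ?r = ?r * (?p * A ?p ?r + ?r * B ?p ?r) + ?p * (- ?r * A ?p ?r + ?p * B ?p ?r)"
        by (simp add: algebra_simps)
      then have "B ?p ?r = 0" unfolding g1 g2 using pos by simp
      with A0 show ?thesis by simp
    qed
  qed
  have "AE x in M. v x $ 1 = 0" by (rule sc_complete[OF vL]) (use AB in \<open>simp add: A_def\<close>)
  moreover have "AE x in M. v x $ 2 = 0" by (rule cs_complete[OF vL]) (use AB in \<open>simp add: B_def\<close>)
  ultimately show ?thesis using exhaust_2[of j] by auto
qed

lemma H1sq_eq_0:
  assumes v: "v \<in> H1_field R" and 0: "\<And>j. AE x in M. v x $ j = 0"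
  shows "H1sq v = 0"
proof -
  have z: "nsq R (\<lambda>x. 0) = 0" by (simp add: nsq_def)
  have 1: "nsq R (\<lambda>x. v x $ j) = 0" for j
    using nsq_cong[OF 0 H1_fieldD(2)[OF v] L2_zero] z by simp
  have 2: "nsq R (weak_partial R i (\<lambda>x. v x $ j)) = 0" for i j
  proof -
    have "is_weak_partial R i (\<lambda>x. v x $ j) (\<lambda>x. 0)"
      unfolding is_weak_partial_def
    proof
      fix \<phi> assume \<phi>: "\<phi> \<in> test_functions R"
      have "(LINT x|M. v x $ j * partial i \<phi> x) = (LINT x|M. 0)"
      proof (rule integral_cong_AE)
        show "(\<lambda>x. v x $ j * partial i \<phi> x) \<in> borel_measurable M"
          by (intro borel_measurable_times L2_measurable[OF H1_fieldD(2)[OF v]] L2_measurable[OF partial_test_L2[OF \<phi>]])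
        show "AE x in M. v x $ j * partial i \<phi> x = 0" using 0[of j] by eventually_elim simp
      qed simp
      then show "(LINT x|M. v x $ j * partial i \<phi> x) = - (LINT x|M. 0 * \<phi> x)" by simp
    qed
    from nsq_cong[OF weak_partial_AE(3)[OF L2_zero this] H1_fieldD(3)[OF v] L2_zero] z show ?thesis by simp
  qed
  show ?thesis by (simp add: H1sq_def 1 2)
qed

text \<open>The coefficients of \<open>v\<close> are realized by some \<open>U\<close> in
  \<open>V\<close>; the difference \<open>U - v\<close> has all coefficients 0 and therefore
  vanishes almost everywhere. So the expansion converges to \<open>v\<close> itself in
  \<open>H^1\<close>, and the Parseval identities follow by continuity.\<close>

lemma V_expansion:
  assumes v: "v \<in> V_space a b"
  shows "summable (\<lambda>n. lam n * (coef v n)\<^sup>2)" "(\<lambda>N. H1sq (\<lambda>x. expand N (coef v) x - v x)) \<longlonglongrightarrow> 0"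
    "vin v v = (\<Sum>n. lam n * (coef v n)\<^sup>2)" "(\<lambda>n. (coef v n)\<^sup>2) sums fin v v"
proof -
  show s: "summable (\<lambda>n. lam n * (coef v n)\<^sup>2)"
    by (rule summableI_nonneg_bounded[OF _ Bessel_V[OF v]]) (use lam_pos in \<open>simp add: less_imp_le\<close>)
  obtain U where U: "U \<in> V_space a b" "\<And>n. coef U n = coef v n" "(\<lambda>N. H1sq (\<lambda>x. expand N (coef v) x - U x)) \<longlonglongrightarrow> 0"
    by (rule realization[OF s]) blast
  have d: "(\<lambda>x. U x - v x) \<in> V_space a b" by (rule V_diff[OF U(1) v])
  have "AE x in M. (U x - v x) $ j = 0" for j
    by (rule V_coef_0[OF d]) (simp add: coef_diff[OF U(1) v] U)
  then have h0: "H1sq (\<lambda>x. U x - v x) = 0" by (rule H1sq_eq_0[OF V_H1_field[OF d]])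
  have l2: "(\<lambda>N. 2 * H1sq (\<lambda>x. expand N (coef v) x - U x)) \<longlonglongrightarrow> 0"
    using tendsto_mult_left[OF U(3), of 2] by simp
  show l: "(\<lambda>N. H1sq (\<lambda>x. expand N (coef v) x - v x)) \<longlonglongrightarrow> 0"
  proof (rule tendsto_sandwich[OF _ _ tendsto_const l2]; intro always_eventually allI)
    show "0 \<le> H1sq (\<lambda>x. expand N (coef v) x - v x)" for N by (rule H1sq_nonneg)
    fix N
    show "H1sq (\<lambda>x. expand N (coef v) x - v x) \<le> 2 * H1sq (\<lambda>x. expand N (coef v) x - U x)"
      using H1sq_add_le[OF H1_field_diff(1)[OF expand_H1[of N "coef v"] V_H1_field[OF U(1)]] V_H1_field[OF d]] h0 by simp
  qed
  note t = fin_vin_tendsto[OF expand_H1 V_H1_field[OF v] l expand_H1 V_H1_field[OF v] l]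
  show "(\<lambda>n. (coef v n)\<^sup>2) sums fin v v" using t(1) unfolding expand_norms sums_def .
  have "(\<lambda>n. lam n * (coef v n)\<^sup>2) sums vin v v" using t(2) unfolding expand_norms sums_def .
  then show "vin v v = (\<Sum>n. lam n * (coef v n)\<^sup>2)" by (simp add: sums_iff)
qed

text \<open>Compares the two Parseval series term by term, with every eigenvalue at least
  \<open>lam0\<close>.\<close>

lemma Poincare:
  assumes v: "v \<in> V_space a b"
  shows "fin v v \<le> vin v v / lam0" "H1sq v \<le> (1 + 1 / lam0) * vin v v"
proof -
  have "fin v v = (\<Sum>n. (coef v n)\<^sup>2)" using V_expansion(4)[OF v] by (simp add: sums_iff)
  also have "\<dots> \<le> (\<Sum>n. lam n * (coef v n)\<^sup>2 / lam0)"
  proof (rule suminf_le)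
    show "(coef v n)\<^sup>2 \<le> lam n * (coef v n)\<^sup>2 / lam0" for n
      using mult_right_mono[OF lam0(2)[of n], of "(coef v n)\<^sup>2"] lam0(1) by (simp add: field_simps)
    show "summable (\<lambda>n. (coef v n)\<^sup>2)" using V_expansion(4)[OF v] by (simp add: sums_iff)
    show "summable (\<lambda>n. lam n * (coef v n)\<^sup>2 / lam0)" by (intro summable_divide V_expansion(1)[OF v])
  qed
  also have "\<dots> = vin v v / lam0" using V_expansion(1,3)[OF v] by (simp add: suminf_divide)
  finally show "fin v v \<le> vin v v / lam0" .
  then show "H1sq v \<le> (1 + 1 / lam0) * vin v v" by (simp add: H1sq_eq algebra_simps)
qed

lemma V_norm_eq: "v \<in> V_space a b \<Longrightarrow> V_norm a b v = sqrt (vin v v)"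
  by (simp add: V_norm_def V_inner_eq[OF V_H1_field V_H1_field])

text \<open>Only the second argument has a convergent expansion in \<open>V\<close>; the first needs
  no more than square integrability, so the formula covers the initial value.\<close>

lemma V_fin_sums:
  assumes u: "\<And>j. (\<lambda>x. u x $ j) \<in> L2 R" and v: "v \<in> V_space a b"
  shows "(\<lambda>n. coef v n * fin u (wf n)) sums fin u v"
proof -
  have z: "(\<lambda>n :: nat. nsq R (\<lambda>x. h x - h x)) \<longlonglongrightarrow> 0" for h :: "point \<Rightarrow> real" by (simp add: nsq_def)
  have wL: "(\<lambda>x. wf n x $ j) \<in> L2 R" for n j by (rule H1_fieldD(2)[OF w_H1])
  have lin: "fin u (expand N c) = (\<Sum>n<N. c n * fin u (wf n))" for c N
  proof -
    have "fin u (expand N c) = (\<Sum>j\<in>UNIV. LINT x|M. (\<Sum>n<N. c n * (u x $ j * wf n x $ j)))"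
      unfolding fin_def by (intro sum.cong refl Bochner_Integration.integral_cong) (simp add: expand_def sum_distrib_left mult.left_commute)
    also have "\<dots> = (\<Sum>j\<in>UNIV. \<Sum>n<N. c n * (LINT x|M. (u x $ j * wf n x $ j)))"
      by (subst Bochner_Integration.integral_sum) (auto intro!: L2_integrable_mult u wL)
    also have "\<dots> = (\<Sum>n<N. c n * fin u (wf n))"
      unfolding fin_def sum_distrib_left by (rule sum.swap)
    finally show ?thesis .
  qed
  have "(\<lambda>N. fin u (expand N (coef v))) \<longlonglongrightarrow> fin u v"
    unfolding fin_def
    by (intro tendsto_sum integral_mult_tendsto u z H1_fieldD expand_H1 V_H1_field v H1_tendsto_components V_expansion)
  then show ?thesis unfolding lin sums_def .
qed

end

section \<open>The trilinear form\<close>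

text \<open>A value exceeds the mean by at most the total variation. The continuous majorant
  \<open>\<psi>\<close> of the derivative stands in for the variation and makes the right-hand side
  an ordinary integral.\<close>

lemma sobolev_interval:
  fixes \<phi> \<phi>' \<psi> :: "real \<Rightarrow> real"
  assumes c: "0 < c" and d: "\<And>s. s \<in> {0..c} \<Longrightarrow> (\<phi> has_real_derivative \<phi>' s) (at s within {0..c})"
    and le: "\<And>s. s \<in> {0..c} \<Longrightarrow> \<bar>\<phi>' s\<bar> \<le> \<psi> s" and \<psi>: "continuous_on {0..c} \<psi>" and s: "s \<in> {0..c}"
  shows "\<phi> s \<le> integral {0..c} (\<lambda>r. \<phi> r / c + \<psi> r)"
proof -
  define I where "I = integral {0..c} \<psi>"
  have \<psi>i: "\<psi> integrable_on {0..c}" by (rule integrable_continuous_interval[OF \<psi>])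
  have \<psi>0: "0 \<le> \<psi> r" if "r \<in> {0..c}" for r using le[OF that] by simp
  have cont: "continuous_on {0..c} \<phi>" using d by (rule DERIV_continuous_on)
  have osc: "\<bar>\<phi> t - \<phi> r\<bar> \<le> I" if rt: "0 \<le> r" "r \<le> t" "t \<le> c" for r t
  proof -
    have sub: "{r..t} \<subseteq> {0..c}" using rt by auto
    have hi: "(\<phi>' has_integral (\<phi> t - \<phi> r)) {r..t}"
    proof (rule fundamental_theorem_of_calculus[OF rt(2)])
      fix x assume "x \<in> {r..t}"
      then show "(\<phi> has_vector_derivative \<phi>' x) (at x within {r..t})"
        using DERIV_subset[OF d sub, of x] sub by (auto simp: has_real_derivative_iff_has_vector_derivative)
    qed
    have si: "\<psi> integrable_on {r..t}" by (rule integrable_on_subinterval[OF \<psi>i sub])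
    have "norm (integral {r..t} \<phi>') \<le> integral {r..t} \<psi>"
    proof (rule integral_norm_bound_integral[OF _ si])
      show "\<phi>' integrable_on {r..t}" using hi by blast
      show "norm (\<phi>' x) \<le> \<psi> x" if "x \<in> {r..t}" for x using le[of x] sub that by auto
    qed
    also have "\<dots> \<le> I" unfolding I_def by (rule integral_subset_le[OF sub si \<psi>i]) (use \<psi>0 in auto)
    finally show ?thesis using integral_unique[OF hi] by simp
  qed
  have "\<phi> s - I \<le> \<phi> r" if "r \<in> {0..c}" for r
    using osc[of r s] osc[of s r] s that by (cases "r \<le> s") auto
  then have "integral {0..c} (\<lambda>r. \<phi> s - I) \<le> integral {0..c} \<phi>"
    by (intro integral_le integrable_continuous_interval cont) auto
  then have "c * (\<phi> s - I) \<le> integral {0..c} \<phi>" using c by simp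
  then have "\<phi> s \<le> integral {0..c} \<phi> / c + I" using c by (simp add: field_simps)
  also have "\<dots> = integral {0..c} (\<lambda>r. \<phi> r / c + \<psi> r)"
    unfolding I_def using \<psi>i integrable_continuous_interval[OF cont]
    by (subst Henstock_Kurzweil_Integration.integral_add) (auto intro: integrable_on_divide)
  finally show ?thesis .
qed

context rectangle
begin

definition q4 :: "(point \<Rightarrow> real) \<Rightarrow> real" where "q4 f = (LINT x|M. (f x) ^ 4)"

text \<open>One factor for each coordinate direction, from the mean value term and the variation
  term of the one-dimensional estimate.\<close>

definition K4 :: real where "K4 = (1 + 1 / a) * (1 + 1 / b)"

lemma K4_nonneg: "0 \<le> K4"
  using a b by (simp add: K4_def)

text \<open>Ladyzhenskaya's argument: the square of \<open>f\<close> is bounded by an integral along each of the two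
  coordinate lines, and the product of the two bounds is integrated with Fubini's theorem.\<close>

lemma q4_C1:
  assumes f: "C1 f"
  shows "q4 f \<le> K4 * (nsq R f + nsq R (partial 1 f) + nsq R (partial 2 f))\<^sup>2"
proof -
  define S where "S = nsq R f + nsq R (partial 1 f) + nsq R (partial 2 f)"
  \<comment> \<open>Integrand of the one-dimensional estimate for the square of \<open>f\<close>,
    whose derivative is bounded by
    \<open>2 * \<bar>f\<bar> * \<bar>partial 1 f\<bar>\<close>.\<close>
  define h1 where "h1 x = (f x)\<^sup>2 / a + 2 * \<bar>f x\<bar> * \<bar>partial 1 f x\<bar>" for x
  define h2 where "h2 x = (f x)\<^sup>2 / b + 2 * \<bar>f x\<bar> * \<bar>partial 2 f x\<bar>" for x
  note cf = C1_continuous[OF f, of UNIV] and cp = C1_D(2)[OF f, of UNIV]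
  have ch: "continuous_on UNIV h1" "continuous_on UNIV h2"
    unfolding h1_def h2_def using a b by (auto intro!: continuous_intros cf cp)
  have c4: "continuous_on UNIV (\<lambda>x. (f x) ^ 4)" by (intro continuous_intros cf)
  have hn: "0 \<le> h1 x" "0 \<le> h2 x" for x using a b by (auto simp: h1_def h2_def)
  define A where "A t = integral {0..a} (\<lambda>s. h1 (vector [s, t]))" for t
  define B where "B s = integral {0..b} (\<lambda>t. h2 (vector [s, t]))" for s
  have cv: "continuous_on X (\<lambda>p. g (vector [fst p, snd p]))" if "continuous_on UNIV g" for g :: "point \<Rightarrow> real" and X
    by (rule continuous_on_compose2[OF that]) (auto intro!: continuous_intros)
  have cA: "continuous_on {0..b} A" 
  proof -
    have "continuous_on ({0..b} \<times> cbox 0 a) (\<lambda>(t, s). h1 (vector [s, t]))"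
      unfolding case_prod_unfold by (intro continuous_on_compose2[OF ch(1)] continuous_intros) auto
    from integral_continuous_on_param[OF this] show ?thesis by (simp add: A_def[abs_def])
  qed
  have cB: "continuous_on {0..a} B" 
  proof -
    have "continuous_on ({0..a} \<times> cbox 0 b) (\<lambda>(s, t). h2 (vector [s, t]))"
      unfolding case_prod_unfold by (intro continuous_on_compose2[OF ch(2)] continuous_intros) auto
    from integral_continuous_on_param[OF this] show ?thesis by (simp add: B_def[abs_def])
  qed
  have line1: "(f (vector [s, t]))\<^sup>2 \<le> A t" if "s \<in> {0..a}" for s t
  proof -
    have "(f (vector [s, t]))\<^sup>2 \<le> integral {0..a} (\<lambda>r. (f (vector [r, t]))\<^sup>2 / a + 2 * \<bar>f (vector [r, t])\<bar> * \<bar>partial 1 f (vector [r, t])\<bar>)"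
    proof (rule sobolev_interval[OF a _ _ _ that, where \<phi> = "\<lambda>s. (f (vector [s, t]))\<^sup>2" and \<phi>' = "\<lambda>s. 2 * f (vector [s, t]) * partial 1 f (vector [s, t])"])
      show "((\<lambda>s. (f (vector [s, t]))\<^sup>2) has_real_derivative 2 * f (vector [s, t]) * partial 1 f (vector [s, t])) (at s within {0..a})" for s
        using DERIV_power[OF C1_has_field_derivative(1)[OF f, where s = s and t = t and S = "{0..a}"], of 2] by (simp add: mult_ac)
      show "continuous_on {0..a} (\<lambda>r. 2 * \<bar>f (vector [r, t])\<bar> * \<bar>partial 1 f (vector [r, t])\<bar>)"
        by (intro continuous_intros continuous_on_compose2[OF cf] continuous_on_compose2[OF cp]) auto
    qed (auto simp: abs_mult)
    then show ?thesis by (simp add: A_def h1_def)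
  qed
  have line2: "(f (vector [s, t]))\<^sup>2 \<le> B s" if "t \<in> {0..b}" for s t
  proof -
    have "(f (vector [s, t]))\<^sup>2 \<le> integral {0..b} (\<lambda>r. (f (vector [s, r]))\<^sup>2 / b + 2 * \<bar>f (vector [s, r])\<bar> * \<bar>partial 2 f (vector [s, r])\<bar>)"
    proof (rule sobolev_interval[OF b _ _ _ that, where \<phi> = "\<lambda>t. (f (vector [s, t]))\<^sup>2" and \<phi>' = "\<lambda>t. 2 * f (vector [s, t]) * partial 2 f (vector [s, t])"])
      show "((\<lambda>t. (f (vector [s, t]))\<^sup>2) has_real_derivative 2 * f (vector [s, t]) * partial 2 f (vector [s, t])) (at t within {0..b})" for t
        using DERIV_power[OF C1_has_field_derivative(2)[OF f, where s = s and t = t and S = "{0..b}"], of 2] by (simp add: mult_ac)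
      show "continuous_on {0..b} (\<lambda>r. 2 * \<bar>f (vector [s, r])\<bar> * \<bar>partial 2 f (vector [s, r])\<bar>)"
        by (intro continuous_intros continuous_on_compose2[OF cf] continuous_on_compose2[OF cp]) auto
    qed (auto simp: abs_mult)
    then show ?thesis by (simp add: B_def h2_def)
  qed
  have A0: "0 \<le> A t" for t using line1[of 0 t] a by (meson atLeastAtMost_iff less_imp_le order_refl order_trans zero_le_power2)
  have "q4 f = integral {0..a} (\<lambda>s. integral {0..b} (\<lambda>t. (f (vector [s, t])) ^ 4))"
    unfolding q4_def by (rule integral_rect(1)[OF c4])
  also have "\<dots> \<le> integral {0..a} (\<lambda>s. integral {0..b} (\<lambda>t. A t * B s))"
  proof (rule integral_le)
    show "(\<lambda>s. integral {0..b} (\<lambda>t. (f (vector [s, t])) ^ 4)) integrable_on {0..a}"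
    proof -
      have "continuous_on ({0..a} \<times> cbox 0 b) (\<lambda>(s, t). (f (vector [s, t])) ^ 4)"
        unfolding case_prod_unfold by (intro continuous_on_compose2[OF c4] continuous_intros) auto
      from integral_continuous_on_param[OF this] show ?thesis by (intro integrable_continuous_interval) simp
    qed
    show "(\<lambda>s. integral {0..b} (\<lambda>t. A t * B s)) integrable_on {0..a}"
      by (simp, intro integrable_continuous_interval continuous_intros cB)
    fix s assume s: "s \<in> {0..a}"
    show "integral {0..b} (\<lambda>t. (f (vector [s, t])) ^ 4) \<le> integral {0..b} (\<lambda>t. A t * B s)"
    proof (rule integral_le)
      show "(\<lambda>t. (f (vector [s, t])) ^ 4) integrable_on {0..b}"
        by (intro integrable_continuous_interval continuous_intros continuous_on_compose2[OF cf]) auto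
      show "(\<lambda>t. A t * B s) integrable_on {0..b}"
        by (intro integrable_continuous_interval continuous_intros cA)
      fix t assume t: "t \<in> {0..b}"
      have "(f (vector [s, t])) ^ 4 = (f (vector [s, t]))\<^sup>2 * (f (vector [s, t]))\<^sup>2" by (simp flip: power_add)
      also have "\<dots> \<le> A t * B s" by (intro mult_mono line1 line2 s t A0) auto
      finally show "(f (vector [s, t])) ^ 4 \<le> A t * B s" .
    qed
  qed
  \<comment> \<open>\<open>A\<close> depends only on the second coordinate and \<open>B\<close> only
    on the first, so the double integral factors.\<close>
  also have "\<dots> = integral {0..b} A * integral {0..a} B" by simp
  also have "integral {0..b} A = (LINT x|M. h1 x)" unfolding A_def by (rule integral_rect(2)[OF ch(1), symmetric])
  also have "integral {0..a} B = (LINT x|M. h2 x)" unfolding B_def by (rule integral_rect(1)[OF ch(2), symmetric])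
  also have "(LINT x|M. h1 x) * (LINT x|M. h2 x) \<le> ((1 + 1 / a) * S) * ((1 + 1 / b) * S)"
  proof (rule mult_mono)
    have L: "f \<in> L2 R" "partial i f \<in> L2 R" for i using cf cp by (auto intro: continuous_L2)
    have i: "integrable M (\<lambda>x. (f x)\<^sup>2)" "integrable M (\<lambda>x. (partial i f x)\<^sup>2)" for i
      using L by (auto simp: L2_real_iff)
    \<comment> \<open>The product \<open>2 * \<bar>f\<bar> * \<bar>partial i f\<bar>\<close> is
      split by the inequality of arithmetic and geometric means, which leaves squared
      \<open>L^2\<close> norms only.\<close>
    have bnd: "(LINT x|M. (f x)\<^sup>2 / c + 2 * \<bar>f x\<bar> * \<bar>partial i f x\<bar>) \<le> (1 + 1 / c) * S" if c: "0 < c" and ic: "integrable M (\<lambda>x. (f x)\<^sup>2 / c + 2 * \<bar>f x\<bar> * \<bar>partial i f x\<bar>)" for c i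
    proof -
      have "(LINT x|M. (f x)\<^sup>2 / c + 2 * \<bar>f x\<bar> * \<bar>partial i f x\<bar>) \<le> (LINT x|M. (f x)\<^sup>2 / c + ((f x)\<^sup>2 + (partial i f x)\<^sup>2))"
      proof (rule integral_mono[OF ic])
        show "integrable M (\<lambda>x. (f x)\<^sup>2 / c + ((f x)\<^sup>2 + (partial i f x)\<^sup>2))" using i by simp
        show "(f x)\<^sup>2 / c + 2 * \<bar>f x\<bar> * \<bar>partial i f x\<bar> \<le> (f x)\<^sup>2 / c + ((f x)\<^sup>2 + (partial i f x)\<^sup>2)" for x
          using sum_squares_bound[of "\<bar>f x\<bar>" "\<bar>partial i f x\<bar>"] by simp
      qed
      also have "\<dots> = nsq R f / c + (nsq R f + nsq R (partial i f))" using i by (simp add: nsq_def)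
      also have "\<dots> \<le> S / c + S"
      proof (intro add_mono divide_right_mono)
        have nn: "0 \<le> nsq R g" for g by (rule nsq_nonneg)
        show "nsq R f \<le> S" using nn[of "partial 1 f"] nn[of "partial 2 f"] by (simp add: S_def)
        have "i = 1 \<or> i = 2" by (rule exhaust_2)
        then show "nsq R f + nsq R (partial i f) \<le> S" using nn[of "partial 1 f"] nn[of "partial 2 f"] by (auto simp: S_def)
      qed (use c in auto)
      also have "\<dots> = (1 + 1 / c) * S" by (simp add: algebra_simps)
      finally show ?thesis .
    qed
    have hi: "integrable M h1" "integrable M h2" using ch by (auto intro: continuous_imp_integrable_rect)
    show "(LINT x|M. h1 x) \<le> (1 + 1 / a) * S" using bnd[OF a, of 1] hi(1) unfolding h1_def by simp
    show "(LINT x|M. h2 x) \<le> (1 + 1 / b) * S" using bnd[OF b, of 2] hi(2) unfolding h2_def by simp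
    show "0 \<le> (LINT x|M. h2 x)" using hn by (intro Bochner_Integration.integral_nonneg)
    have "0 \<le> S" unfolding S_def by (intro add_nonneg_nonneg nsq_nonneg)
    then show "0 \<le> (1 + 1 / a) * S" using a by simp
  qed
  also have "\<dots> = K4 * S\<^sup>2" by (simp add: K4_def power2_eq_square)
  finally show ?thesis by (simp add: S_def)
qed

text \<open>The partial sums of the expansion are smooth, and by Parseval their \<open>H^1\<close>
  norms do not exceed that of \<open>v\<close>. Along a subsequence converging almost everywhere,
  Fatou's lemma carries the estimate over to \<open>v\<close>.\<close>

lemma V_L4:
  assumes v: "v \<in> V_space a b"
  shows "integrable M (\<lambda>x. (v x $ j) ^ 4)" "q4 (\<lambda>x. v x $ j) \<le> K4 * (H1sq v)\<^sup>2"
proof -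
  let ?p = "\<lambda>N. expand N (coef v)"
  note l = V_expansion(2)[OF v]
  have C1p: "C1 (\<lambda>x. ?p N x $ j)" for N by (rule D1_C1[OF expand_D1])
  have pb: "q4 (\<lambda>x. ?p N x $ j) \<le> K4 * (H1sq (?p N))\<^sup>2" for N
  proof -
    have eq: "nsq R (partial i (\<lambda>x. ?p N x $ j)) = nsq R (weak_partial R i (\<lambda>x. ?p N x $ j))" for i
      by (intro nsq_cong AE_symmetric[OF D1_weak_partial[OF expand_D1]] C1_weak_partial C1p H1_fieldD expand_H1)
    have "nsq R (\<lambda>x. ?p N x $ j) + nsq R (partial 1 (\<lambda>x. ?p N x $ j)) + nsq R (partial 2 (\<lambda>x. ?p N x $ j)) \<le> H1sq (?p N)"
    proof -
      have "nsq R (\<lambda>x. ?p N x $ j) + (\<Sum>i\<in>UNIV. nsq R (weak_partial R i (\<lambda>x. ?p N x $ j))) \<le> H1sq (?p N)"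
        unfolding H1sq_def by (rule member_le_sum) (auto intro!: sum_nonneg add_nonneg_nonneg nsq_nonneg)
      then show ?thesis by (simp add: sum_2 eq)
    qed
    then have "(nsq R (\<lambda>x. ?p N x $ j) + nsq R (partial 1 (\<lambda>x. ?p N x $ j)) + nsq R (partial 2 (\<lambda>x. ?p N x $ j)))\<^sup>2 \<le> (H1sq (?p N))\<^sup>2"
      by (intro power_mono add_nonneg_nonneg nsq_nonneg)
    from mult_left_mono[OF this K4_nonneg] q4_C1[OF C1p, of N] show ?thesis by linarith
  qed
  have Hle: "H1sq (?p N) \<le> H1sq v" for N
  proof -
    have "H1sq (?p N) = (\<Sum>n<N. (coef v n)\<^sup>2) + (\<Sum>n<N. lam n * (coef v n)\<^sup>2)" by (simp add: H1sq_eq expand_norms)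
    also have "\<dots> \<le> (\<Sum>n. (coef v n)\<^sup>2) + (\<Sum>n. lam n * (coef v n)\<^sup>2)"
      using V_expansion(1,4)[OF v] lam_pos by (intro add_mono sum_le_suminf) (auto simp: sums_iff less_imp_le)
    also have "\<dots> = H1sq v" using V_expansion(3,4)[OF v] by (simp add: H1sq_eq sums_iff)
    finally show ?thesis .
  qed
  have b4: "(LINT x|M. (?p N x $ j) ^ 4) \<le> K4 * (H1sq v)\<^sup>2" for N
  proof -
    have "K4 * (H1sq (?p N))\<^sup>2 \<le> K4 * (H1sq v)\<^sup>2"
      by (intro mult_left_mono power_mono Hle H1sq_nonneg K4_nonneg)
    with pb[of N] show ?thesis by (simp add: q4_def)
  qed
  obtain r :: "nat \<Rightarrow> nat" where r: "strict_mono r" "AE x in M. (\<lambda>n. ?p (r n) x $ j) \<longlonglongrightarrow> v x $ j"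
    by (rule L2_AE_subseq[OF H1_fieldD(2)[OF expand_H1] H1_fieldD(2)[OF V_H1_field[OF v]] H1_tendsto_components(1)[OF expand_H1 V_H1_field[OF v] l]]) blast
  have i: "integrable M (\<lambda>x. (?p (r n) x $ j) ^ 4)" for n
    by (intro continuous_imp_integrable_rect continuous_intros C1_continuous[OF C1p])
  have m: "(\<lambda>x. (v x $ j) ^ 4) \<in> borel_measurable M"
    using L2_measurable[OF H1_fieldD(2)[OF V_H1_field[OF v]]] by simp
  have "AE x in M. (\<lambda>n. (?p (r n) x $ j) ^ 4) \<longlonglongrightarrow> (v x $ j) ^ 4"
    using r(2) by eventually_elim (intro tendsto_power)
  from integrable_Fatou[OF i _ b4 m this]
  show "integrable M (\<lambda>x. (v x $ j) ^ 4)" "q4 (\<lambda>x. v x $ j) \<le> K4 * (H1sq v)\<^sup>2" by (simp_all add: q4_def)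
qed

lemma V_product_L2:
  assumes u: "u \<in> V_space a b" and v: "v \<in> V_space a b"
  shows "(\<lambda>x. u x $ i * v x $ j) \<in> L2 R" "nsq R (\<lambda>x. u x $ i * v x $ j) \<le> K4 * H1sq u * H1sq v"
proof -
  have mu: "(\<lambda>x. u x $ i) \<in> borel_measurable M" "(\<lambda>x. v x $ j) \<in> borel_measurable M"
    using L2_measurable[OF H1_fieldD(2)[OF V_H1_field[OF u]]] L2_measurable[OF H1_fieldD(2)[OF V_H1_field[OF v]]] by auto
  have p4: "((y :: real)\<^sup>2)\<^sup>2 = y ^ 4" for y by (simp flip: power_mult)
  have uL: "(\<lambda>x. (u x $ i)\<^sup>2) \<in> L2 R" and vL: "(\<lambda>x. (v x $ j)\<^sup>2) \<in> L2 R"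
    using V_L4(1)[OF u, of i] V_L4(1)[OF v, of j] mu unfolding L2_real_iff p4 by auto
  show "(\<lambda>x. u x $ i * v x $ j) \<in> L2 R"
    unfolding L2_real_iff power_mult_distrib using L2_integrable_mult[OF uL vL] mu by auto
  have "nsq R (\<lambda>x. u x $ i * v x $ j) = (LINT x|M. (u x $ i)\<^sup>2 * (v x $ j)\<^sup>2)"
    by (simp add: nsq_def power_mult_distrib)
  also have "\<dots> \<le> \<bar>LINT x|M. (u x $ i)\<^sup>2 * (v x $ j)\<^sup>2\<bar>" by simp
  also have "\<dots> \<le> sqrt (nsq R (\<lambda>x. (u x $ i)\<^sup>2)) * sqrt (nsq R (\<lambda>x. (v x $ j)\<^sup>2))"
    by (rule L2_Cauchy_Schwarz[OF uL vL])
  also have "\<dots> = sqrt (q4 (\<lambda>x. u x $ i)) * sqrt (q4 (\<lambda>x. v x $ j))" by (simp add: nsq_def q4_def p4)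
  also have "\<dots> \<le> sqrt (K4 * (H1sq u)\<^sup>2) * sqrt (K4 * (H1sq v)\<^sup>2)"
    by (intro mult_mono real_sqrt_le_mono V_L4 u v) (auto simp: K4_nonneg q4_def intro!: Bochner_Integration.integral_nonneg)
  also have "\<dots> = K4 * H1sq u * H1sq v"
    using K4_nonneg H1sq_nonneg[of u] H1sq_nonneg[of v] by (simp add: real_sqrt_mult algebra_simps)
  finally show "nsq R (\<lambda>x. u x $ i * v x $ j) \<le> K4 * H1sq u * H1sq v" .
qed

section \<open>Continuity and antisymmetry of the trilinear form\<close>

text \<open>The derivative is paired in \<open>L^2\<close> with the product of the other two
  factors, which is square integrable by the fourth power estimate. Integrability of each term is
  what justifies the additivity rules for \<open>b_form\<close>.\<close>

lemma b_form_term: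
  assumes u: "u \<in> V_space a b" and v: "v \<in> V_space a b" and w: "w \<in> V_space a b"
  shows "integrable M (\<lambda>x. u x $ i * weak_partial R i (\<lambda>y. v y $ j) x * w x $ j)"
    "\<bar>LINT x|M. u x $ i * weak_partial R i (\<lambda>y. v y $ j) x * w x $ j\<bar> \<le> sqrt (H1sq v) * sqrt (K4 * H1sq u * H1sq w)"
proof -
  have e: "u x $ i * p * w x $ j = p * (u x $ i * w x $ j)" for x p by simp
  have pL: "weak_partial R i (\<lambda>y. v y $ j) \<in> L2 R" by (rule H1_fieldD(3)[OF V_H1_field[OF v]])
  note uw = V_product_L2[OF u w, of i j]
  show "integrable M (\<lambda>x. u x $ i * weak_partial R i (\<lambda>y. v y $ j) x * w x $ j)"
    unfolding e by (rule L2_integrable_mult[OF pL uw(1)])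
  have "\<bar>LINT x|M. u x $ i * weak_partial R i (\<lambda>y. v y $ j) x * w x $ j\<bar> \<le> sqrt (nsq R (weak_partial R i (\<lambda>y. v y $ j))) * sqrt (nsq R (\<lambda>x. u x $ i * w x $ j))"
    unfolding e by (rule L2_Cauchy_Schwarz[OF pL uw(1)])
  also have "\<dots> \<le> sqrt (H1sq v) * sqrt (K4 * H1sq u * H1sq w)"
    by (intro mult_mono real_sqrt_le_mono H1sq_ge uw) (auto simp: nsq_nonneg H1sq_nonneg)
  finally show "\<bar>LINT x|M. u x $ i * weak_partial R i (\<lambda>y. v y $ j) x * w x $ j\<bar> \<le> sqrt (H1sq v) * sqrt (K4 * H1sq u * H1sq w)" .
qed

lemma b_form_add:
  assumes u: "u \<in> V_space a b" and v: "v \<in> V_space a b" and w: "w \<in> V_space a b" and z: "z \<in> V_space a b"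
  shows "b_form a b (\<lambda>x. u x + z x) v w = b_form a b u v w + b_form a b z v w"
    "b_form a b u (\<lambda>x. v x + z x) w = b_form a b u v w + b_form a b u z w"
    "b_form a b u v (\<lambda>x. w x + z x) = b_form a b u v w + b_form a b u v z"
proof -
  show "b_form a b (\<lambda>x. u x + z x) v w = b_form a b u v w + b_form a b z v w"
    unfolding b_form_def using b_form_term(1)[OF u v w] b_form_term(1)[OF z v w]
    by (simp add: distrib_right sum.distrib)
  show "b_form a b u v (\<lambda>x. w x + z x) = b_form a b u v w + b_form a b u v z"
    unfolding b_form_def using b_form_term(1)[OF u v w] b_form_term(1)[OF u v z]
    by (simp add: distrib_left sum.distrib)
  \<comment> \<open>The middle argument enters through a chosen weak derivative, which is additive
    only almost everywhere; the outer arguments are additive pointwise.\<close>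
  have "(LINT x|M. u x $ i * weak_partial R i (\<lambda>y. (v y + z y) $ j) x * w x $ j) =
     (LINT x|M. u x $ i * weak_partial R i (\<lambda>y. v y $ j) x * w x $ j) + (LINT x|M. u x $ i * weak_partial R i (\<lambda>y. z y $ j) x * w x $ j)" for i j
  proof -
    note m = b_form_term(1)[OF u V_add[OF v z] w, of i j] b_form_term(1)[OF u v w, of i j] b_form_term(1)[OF u z w, of i j]
    have "(LINT x|M. u x $ i * weak_partial R i (\<lambda>y. (v y + z y) $ j) x * w x $ j) =
      (LINT x|M. u x $ i * weak_partial R i (\<lambda>y. v y $ j) x * w x $ j + u x $ i * weak_partial R i (\<lambda>y. z y $ j) x * w x $ j)"
    proof (rule integral_cong_AE)
      show "AE x in M. u x $ i * weak_partial R i (\<lambda>y. (v y + z y) $ j) x * w x $ j =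
         u x $ i * weak_partial R i (\<lambda>y. v y $ j) x * w x $ j + u x $ i * weak_partial R i (\<lambda>y. z y $ j) x * w x $ j"
        using H1_field_add(2)[OF V_H1_field[OF v] V_H1_field[OF z], of i j] by eventually_elim (simp add: algebra_simps)
    qed (use m in \<open>auto intro!: borel_measurable_add\<close>)
    also have "\<dots> = (LINT x|M. u x $ i * weak_partial R i (\<lambda>y. v y $ j) x * w x $ j) + (LINT x|M. u x $ i * weak_partial R i (\<lambda>y. z y $ j) x * w x $ j)"
      using m(2,3) by (rule Bochner_Integration.integral_add)
    finally show ?thesis .
  qed
  then show "b_form a b u (\<lambda>x. v x + z x) w = b_form a b u v w + b_form a b u z w"
    unfolding b_form_def by (simp only: sum.distrib)
qed

lemma b_form_scale:
  assumes u: "u \<in> V_space a b" and v: "v \<in> V_space a b" and w: "w \<in> V_space a b"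
  shows "b_form a b (\<lambda>x. c *\<^sub>R u x) v w = c * b_form a b u v w"
    "b_form a b u (\<lambda>x. c *\<^sub>R v x) w = c * b_form a b u v w"
    "b_form a b u v (\<lambda>x. c *\<^sub>R w x) = c * b_form a b u v w"
proof -
  show "b_form a b (\<lambda>x. c *\<^sub>R u x) v w = c * b_form a b u v w" "b_form a b u v (\<lambda>x. c *\<^sub>R w x) = c * b_form a b u v w"
    unfolding b_form_def by (simp_all add: sum_distrib_left mult.assoc mult.left_commute)
  have "(LINT x|M. u x $ i * weak_partial R i (\<lambda>y. (c *\<^sub>R v y) $ j) x * w x $ j) =
     c * (LINT x|M. u x $ i * weak_partial R i (\<lambda>y. v y $ j) x * w x $ j)" for i j
  proof -
    note m = b_form_term(1)[OF u V_scale[OF v, of c] w, of i j] b_form_term(1)[OF u v w, of i j]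
    have "(LINT x|M. u x $ i * weak_partial R i (\<lambda>y. (c *\<^sub>R v y) $ j) x * w x $ j) =
      (LINT x|M. c * (u x $ i * weak_partial R i (\<lambda>y. v y $ j) x * w x $ j))"
    proof (rule integral_cong_AE)
      show "AE x in M. u x $ i * weak_partial R i (\<lambda>y. (c *\<^sub>R v y) $ j) x * w x $ j =
         c * (u x $ i * weak_partial R i (\<lambda>y. v y $ j) x * w x $ j)"
        using H1_field_scale(2)[OF V_H1_field[OF v], where c = c and i = i and j = j] by eventually_elim simp
    qed (use m in auto)
    then show ?thesis by simp
  qed
  then show "b_form a b u (\<lambda>x. c *\<^sub>R v x) w = c * b_form a b u v w"
    unfolding b_form_def by (simp only: sum_distrib_left)
qed

lemma b_form_diff:
  assumes u: "u \<in> V_space a b" and v: "v \<in> V_space a b" and w: "w \<in> V_space a b" and z: "z \<in> V_space a b"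
  shows "b_form a b (\<lambda>x. u x - z x) v w = b_form a b u v w - b_form a b z v w"
    "b_form a b u (\<lambda>x. v x - z x) w = b_form a b u v w - b_form a b u z w"
    "b_form a b u v (\<lambda>x. w x - z x) = b_form a b u v w - b_form a b u v z"
  using b_form_add[OF u v w V_scale[OF z, of "-1"]] b_form_scale(1)[OF z v w, of "-1"]
    b_form_scale(2)[OF u z w, of "-1"] b_form_scale(3)[OF u v z, of "-1"] by simp_all

abbreviation "vnorm \<equiv> V_norm a b"

text \<open>Four pairs of indices, the constant for products of two components, and for each of the
  three arguments a factor \<open>sqrt (1 + 1 / lam0)\<close> from replacing the \<open>H^1\<close>
  norm by \<open>vnorm\<close>.\<close>

definition KB :: real where "KB = 4 * sqrt K4 * (sqrt (1 + 1 / lam0)) ^ 3"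

lemma KB_nonneg: "0 \<le> KB"
  using K4_nonneg lam0 by (simp add: KB_def)

lemma b_form_bound:
  assumes u: "u \<in> V_space a b" and v: "v \<in> V_space a b" and w: "w \<in> V_space a b"
  shows "\<bar>b_form a b u v w\<bar> \<le> KB * vnorm u * vnorm v * vnorm w"
proof -
  define P where "P = sqrt (1 + 1 / lam0)"
  have P: "0 \<le> P" using lam0 by (simp add: P_def)
  have h: "sqrt (H1sq z) \<le> P * vnorm z" if z: "z \<in> V_space a b" for z
    using Poincare(2)[OF z] by (simp add: V_norm_eq[OF z] P_def real_sqrt_mult[symmetric])
  have "\<bar>b_form a b u v w\<bar> \<le> (\<Sum>i\<in>(UNIV::2 set). \<Sum>j\<in>(UNIV::2 set). sqrt (H1sq v) * sqrt (K4 * H1sq u * H1sq w))"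
    unfolding b_form_def by (intro order_trans[OF sum_abs] sum_mono b_form_term u v w)
  also have "\<dots> = 4 * sqrt K4 * (sqrt (H1sq u) * sqrt (H1sq v) * sqrt (H1sq w))"
    by (simp add: real_sqrt_mult)
  also have "\<dots> \<le> 4 * sqrt K4 * ((P * vnorm u) * (P * vnorm v) * (P * vnorm w))"
    using K4_nonneg P by (intro mult_left_mono mult_mono h u v w mult_nonneg_nonneg)
      (auto simp: H1sq_nonneg V_norm_eq u v w fin_vin_nonneg)
  also have "\<dots> = KB * vnorm u * vnorm v * vnorm w" by (simp add: KB_def P_def power3_eq_cube)
  finally show ?thesis .
qed

lemma vnorm_nonneg: "u \<in> V_space a b \<Longrightarrow> 0 \<le> vnorm u"
  by (simp add: V_norm_eq fin_vin_nonneg)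

lemma V_expand_vnorm:
  assumes v: "v \<in> V_space a b"
  shows "(\<lambda>N. vnorm (\<lambda>x. expand N (coef v) x - v x)) \<longlonglongrightarrow> 0"
proof (rule tendsto_sandwich[OF _ _ tendsto_const])
  have d: "(\<lambda>x. expand N (coef v) x - v x) \<in> V_space a b" for N by (rule V_diff[OF expand_V v])
  show "(\<lambda>N. sqrt (H1sq (\<lambda>x. expand N (coef v) x - v x))) \<longlonglongrightarrow> 0"
    using tendsto_real_sqrt[OF V_expansion(2)[OF v]] by simp
  show "\<forall>\<^sub>F N in sequentially. 0 \<le> vnorm (\<lambda>x. expand N (coef v) x - v x)" using vnorm_nonneg[OF d] by simp
  show "\<forall>\<^sub>F N in sequentially. vnorm (\<lambda>x. expand N (coef v) x - v x) \<le> sqrt (H1sq (\<lambda>x. expand N (coef v) x - v x))"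
    using fin_vin_nonneg(1) by (intro always_eventually allI) (simp add: V_norm_eq[OF d] H1sq_eq)
qed

text \<open>The sum of the two forms is the integral of \<open>u\<close> against the gradient of the
  pointwise product \<open>v x \<bullet> w x\<close>, written here as \<open>q\<close>;
  divergence-free tangential fields are orthogonal to gradients.\<close>

lemma D1_b_form_antisym:
  assumes u: "u \<in> D1 a b" and v: "v \<in> D1 a b" and w: "w \<in> D1 a b"
  shows "b_form a b u v w + b_form a b u w v = 0"
proof -
  note V = D1_V[OF u] D1_V[OF v] D1_V[OF w]
  define q where "q x = v x $ 1 * w x $ 1 + v x $ 2 * w x $ 2" for x
  have C1q: "C1 q" unfolding q_def by (intro C1_add C1_mult D1_C1 v w)
  have pq: "partial i q x = (\<Sum>j\<in>UNIV. partial i (\<lambda>x. v x $ j) x * w x $ j + v x $ j * partial i (\<lambda>x. w x $ j) x)" for i x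
    unfolding q_def using C1_add(2)[OF C1_mult(1)[OF D1_C1[OF v] D1_C1[OF w]] C1_mult(1)[OF D1_C1[OF v] D1_C1[OF w]]]
    by (simp add: sum_2 C1_mult(2)[OF D1_C1[OF v] D1_C1[OF w]])
  have "b_form a b u v w + b_form a b u w v = (\<Sum>i\<in>UNIV. LINT x|M. u x $ i * partial i q x)"
  proof -
    have "(LINT x|M. u x $ i * weak_partial R i (\<lambda>y. v y $ j) x * w x $ j) + (LINT x|M. u x $ i * weak_partial R i (\<lambda>y. w y $ j) x * v x $ j)
       = (LINT x|M. u x $ i * (partial i (\<lambda>x. v x $ j) x * w x $ j + v x $ j * partial i (\<lambda>x. w x $ j) x))" for i j
    proof -
      note m = b_form_term(1)[OF V(1,2,3), of i j] b_form_term(1)[OF V(1,3,2), of i j]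
      have "(LINT x|M. u x $ i * weak_partial R i (\<lambda>y. v y $ j) x * w x $ j) + (LINT x|M. u x $ i * weak_partial R i (\<lambda>y. w y $ j) x * v x $ j)
        = (LINT x|M. u x $ i * weak_partial R i (\<lambda>y. v y $ j) x * w x $ j + u x $ i * weak_partial R i (\<lambda>y. w y $ j) x * v x $ j)"
        using m by (rule Bochner_Integration.integral_add[symmetric])
      also have "\<dots> = (LINT x|M. u x $ i * (partial i (\<lambda>x. v x $ j) x * w x $ j + v x $ j * partial i (\<lambda>x. w x $ j) x))"
      proof (rule integral_cong_AE)
        show "AE x in M. u x $ i * weak_partial R i (\<lambda>y. v y $ j) x * w x $ j + u x $ i * weak_partial R i (\<lambda>y. w y $ j) x * v x $ j =
          u x $ i * (partial i (\<lambda>x. v x $ j) x * w x $ j + v x $ j * partial i (\<lambda>x. w x $ j) x)"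
          using D1_weak_partial[OF v, of i j] D1_weak_partial[OF w, of i j] by eventually_elim (simp add: algebra_simps)
        show "(\<lambda>x. u x $ i * weak_partial R i (\<lambda>y. v y $ j) x * w x $ j + u x $ i * weak_partial R i (\<lambda>y. w y $ j) x * v x $ j) \<in> borel_measurable M"
          using m by (intro borel_measurable_add) auto
        show "(\<lambda>x. u x $ i * (partial i (\<lambda>x. v x $ j) x * w x $ j + v x $ j * partial i (\<lambda>x. w x $ j) x)) \<in> borel_measurable M"
          by (rule L2_measurable[OF continuous_L2[OF continuous_on_mult[OF C1_continuous[OF D1_C1[OF u]]
              continuous_on_add[OF continuous_on_mult[OF C1_D(2)[OF D1_C1[OF v]] C1_continuous[OF D1_C1[OF w]]]
                continuous_on_mult[OF C1_continuous[OF D1_C1[OF v]] C1_D(2)[OF D1_C1[OF w]]]]]]])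
      qed
      finally show ?thesis .
    qed
    moreover have "(LINT x|M. u x $ i * partial i q x) = (\<Sum>j\<in>UNIV. LINT x|M. u x $ i * (partial i (\<lambda>x. v x $ j) x * w x $ j + v x $ j * partial i (\<lambda>x. w x $ j) x))" for i
      unfolding pq sum_distrib_left
      by (intro Bochner_Integration.integral_sum continuous_imp_integrable_rect continuous_intros C1_continuous[OF D1_C1[OF u]]
          C1_continuous[OF D1_C1[OF v]] C1_continuous[OF D1_C1[OF w]] C1_D(2)[OF D1_C1[OF v]] C1_D(2)[OF D1_C1[OF w]])
    ultimately show ?thesis unfolding b_form_def by (simp add: sum.distrib[symmetric])
  qed
  then show ?thesis by (simp add: D1_orthogonal_gradient[OF u C1q])
qed

text \<open>Expanding around the limit gives seven terms, each with at least one factor that tends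
  to 0 in \<open>vnorm\<close>, so the trilinear bound applies.\<close>

lemma b_form_tendsto:
  assumes u: "\<And>n. u n \<in> V_space a b" "U \<in> V_space a b" "(\<lambda>n. vnorm (\<lambda>x. u n x - U x)) \<longlonglongrightarrow> 0"
    and v: "\<And>n. v n \<in> V_space a b" "V \<in> V_space a b" "(\<lambda>n. vnorm (\<lambda>x. v n x - V x)) \<longlonglongrightarrow> 0"
    and w: "\<And>n. w n \<in> V_space a b" "W \<in> V_space a b" "(\<lambda>n. vnorm (\<lambda>x. w n x - W x)) \<longlonglongrightarrow> 0"
  shows "(\<lambda>n. b_form a b (u n) (v n) (w n)) \<longlonglongrightarrow> b_form a b U V W"
proof -
  let ?du = "\<lambda>n x. u n x - U x" and ?dv = "\<lambda>n x. v n x - V x" and ?dw = "\<lambda>n x. w n x - W x"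
  note d = V_diff[OF u(1) u(2)] V_diff[OF v(1) v(2)] V_diff[OF w(1) w(2)]
  have e: "b_form a b (u n) (v n) (w n) - b_form a b U V W =
    b_form a b (?du n) (?dv n) (?dw n) + b_form a b (?du n) (?dv n) W + b_form a b (?du n) V (?dw n) + b_form a b (?du n) V W
    + b_form a b U (?dv n) (?dw n) + b_form a b U (?dv n) W + b_form a b U V (?dw n)" for n
    by (simp add: b_form_diff u v w d)
  have l: "(\<lambda>n. KB * vnorm (?du n) * vnorm (?dv n) * vnorm (?dw n) + KB * vnorm (?du n) * vnorm (?dv n) * vnorm W + KB * vnorm (?du n) * vnorm V * vnorm (?dw n) + KB * vnorm (?du n) * vnorm V * vnorm W
    + KB * vnorm U * vnorm (?dv n) * vnorm (?dw n) + KB * vnorm U * vnorm (?dv n) * vnorm W + KB * vnorm U * vnorm V * vnorm (?dw n)) \<longlonglongrightarrow>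
    KB * 0 * 0 * 0 + KB * 0 * 0 * vnorm W + KB * 0 * vnorm V * 0 + KB * 0 * vnorm V * vnorm W + KB * vnorm U * 0 * 0 + KB * vnorm U * 0 * vnorm W + KB * vnorm U * vnorm V * 0"
    by (intro tendsto_intros u v w)
  have "(\<lambda>n. b_form a b (u n) (v n) (w n) - b_form a b U V W) \<longlonglongrightarrow> 0"
  proof (rule Lim_null_comparison[OF always_eventually[rule_format]])
    fix n
    show "norm (b_form a b (u n) (v n) (w n) - b_form a b U V W) \<le> KB * vnorm (?du n) * vnorm (?dv n) * vnorm (?dw n) + KB * vnorm (?du n) * vnorm (?dv n) * vnorm W + KB * vnorm (?du n) * vnorm V * vnorm (?dw n) + KB * vnorm (?du n) * vnorm V * vnorm W
    + KB * vnorm U * vnorm (?dv n) * vnorm (?dw n) + KB * vnorm U * vnorm (?dv n) * vnorm W + KB * vnorm U * vnorm V * vnorm (?dw n)"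
      unfolding e real_norm_def
      by (intro order_trans[OF abs_triangle_ineq add_mono] b_form_bound d u(2) v(2) w(2))
  qed (use l in simp)
  then show ?thesis by (rule LIM_zero_cancel)
qed

lemma b_form_antisym:
  assumes u: "u \<in> V_space a b" and v: "v \<in> V_space a b" and w: "w \<in> V_space a b"
  shows "b_form a b u w v = - b_form a b u v w"
proof -
  note eu = expand_V[of _ "coef u"] u V_expand_vnorm[OF u] and ev = expand_V[of _ "coef v"] v V_expand_vnorm[OF v]
    and ew = expand_V[of _ "coef w"] w V_expand_vnorm[OF w]
  have "(\<lambda>n. b_form a b (expand n (coef u)) (expand n (coef v)) (expand n (coef w)) + b_form a b (expand n (coef u)) (expand n (coef w)) (expand n (coef v)))
     \<longlonglongrightarrow> b_form a b u v w + b_form a b u w v"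
    by (intro tendsto_add b_form_tendsto[OF eu ev ew] b_form_tendsto[OF eu ew ev])
  then have "b_form a b u v w + b_form a b u w v = 0"
    by (simp add: D1_b_form_antisym[OF expand_D1 expand_D1 expand_D1] LIMSEQ_const_iff)
  then show ?thesis by simp
qed

lemma b_form_self: "u \<in> V_space a b \<Longrightarrow> v \<in> V_space a b \<Longrightarrow> b_form a b u v v = 0"
  using b_form_antisym[of u v v] by simp

text \<open>The first derivatives of an eigenfield are bounded by
  \<open>\<bar>nrm n\<bar> * lam n\<close>, because products of two of its frequencies are at most
  \<open>lam n\<close>. Only the \<open>L^2\<close> norms of the other two arguments remain, and the
  four pairs of indices give the factor 4. This produces the constants of the Lipschitz estimate for
  the coefficient system.\<close>

lemma b_form_w_bound:
  assumes u: "u \<in> V_space a b" and v: "v \<in> V_space a b"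
  shows "\<bar>b_form a b u (wf n) v\<bar> \<le> 4 * (\<bar>nrm n\<bar> * lam n) * sqrt (fin u u) * sqrt (fin v v)"
proof -
  let ?W = "\<bar>nrm n\<bar> * lam n"
  have W: "0 \<le> ?W" using lam_pos[of n] by simp
  have f12: "freq1 n * freq2 n \<le> lam n" "freq2 n * freq1 n \<le> lam n" "freq1 n * freq1 n \<le> lam n" "freq2 n * freq2 n \<le> lam n"
  proof -
    have "2 * (freq1 n * freq2 n) \<le> lam n" using sum_squares_bound[of "freq1 n" "freq2 n"] by (simp add: lam_def mult.assoc)
    then show "freq1 n * freq2 n \<le> lam n" using mult_pos_pos[OF freq_pos[of n]] by linarith
    then show "freq2 n * freq1 n \<le> lam n" by (simp add: mult.commute)
    show "freq1 n * freq1 n \<le> lam n" "freq2 n * freq2 n \<le> lam n" by (simp_all add: lam_def power2_eq_square)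
  qed
  have t1: "\<bar>ss p r x\<bar> \<le> 1" "\<bar>cc p r x\<bar> \<le> 1" for p r x
    by (auto simp: ss_def cc_def abs_mult intro!: mult_le_one abs_sin_le_one abs_cos_le_one)
  have aux: "\<bar>nrm n * (f * g) * t\<bar> \<le> ?W" if "0 \<le> f * g" "f * g \<le> lam n" "\<bar>t\<bar> \<le> 1" for f g t
  proof -
    have "\<bar>nrm n\<bar> * (f * g) * \<bar>t\<bar> \<le> \<bar>nrm n\<bar> * lam n * 1" using that lam_pos[of n] by (intro mult_mono) auto
    then show ?thesis
      by (simp only: abs_mult[of "nrm n * (f * g)" t] abs_mult[of "nrm n" "f * g"] abs_of_nonneg[OF that(1)] mult_1_right)
  qed
  have fp: "0 < freq1 n" "0 < freq2 n" by (rule freq_pos)+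
  have aux': "\<bar>(nrm n * f) * g * t\<bar> \<le> ?W" "\<bar>- (nrm n * f) * g * t\<bar> \<le> ?W"
    if "0 \<le> f * g" "f * g \<le> lam n" "\<bar>t\<bar> \<le> 1" for f g t
    using aux[OF that] by (simp_all only: mult.assoc mult_minus_left abs_minus_cancel)
  have pw: "\<bar>partial i (\<lambda>x. wf n x $ j) x\<bar> \<le> ?W" for i j x
  proof -
    have nn: "0 \<le> freq1 n * freq2 n" "0 \<le> freq2 n * freq1 n" "0 \<le> freq1 n * freq1 n" "0 \<le> freq2 n * freq2 n"
      using fp by simp_all
    have "\<bar>partial 1 (\<lambda>x. wf n x $ 1) x\<bar> \<le> ?W" unfolding partial_w by (rule aux'(2)[OF nn(2) f12(2) t1(2)])
    moreover have "\<bar>partial 2 (\<lambda>x. wf n x $ 1) x\<bar> \<le> ?W" unfolding partial_w by (rule aux'(1)[OF nn(4) f12(4) t1(1)])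
    moreover have "\<bar>partial 1 (\<lambda>x. wf n x $ 2) x\<bar> \<le> ?W" unfolding partial_w by (rule aux'(2)[OF nn(3) f12(3) t1(1)])
    moreover have "\<bar>partial 2 (\<lambda>x. wf n x $ 2) x\<bar> \<le> ?W" unfolding partial_w by (rule aux'(1)[OF nn(1) f12(1) t1(2)])
    ultimately show ?thesis using exhaust_2[of i] exhaust_2[of j] by metis
  qed
  have uL: "(\<lambda>x. u x $ i) \<in> L2 R" and vL: "(\<lambda>x. v x $ i) \<in> L2 R" for i
    using H1_fieldD(2)[OF V_H1_field[OF u]] H1_fieldD(2)[OF V_H1_field[OF v]] by auto
  have absL2: "(\<lambda>x. \<bar>h x\<bar>) \<in> L2 R" if "h \<in> L2 R" for h :: "point \<Rightarrow> real"
    using that by (auto simp: L2_real_iff)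
  have nle: "nsq R (\<lambda>x. z x $ i) \<le> fin z z" for z i
    unfolding fin_def nsq_def power2_eq_square[symmetric] by (rule member_le_sum) auto
  have "\<bar>LINT x|M. u x $ i * weak_partial R i (\<lambda>y. wf n y $ j) x * v x $ j\<bar> \<le> ?W * (sqrt (fin u u) * sqrt (fin v v))" for i j
  proof -
    have "\<bar>LINT x|M. u x $ i * weak_partial R i (\<lambda>y. wf n y $ j) x * v x $ j\<bar> \<le> (LINT x|M. \<bar>u x $ i * weak_partial R i (\<lambda>y. wf n y $ j) x * v x $ j\<bar>)"
      by (rule integral_abs_bound)
    also have "\<dots> \<le> (LINT x|M. ?W * (\<bar>u x $ i\<bar> * \<bar>v x $ j\<bar>))"
    proof (rule integral_mono_AE)
      show "integrable M (\<lambda>x. \<bar>u x $ i * weak_partial R i (\<lambda>y. wf n y $ j) x * v x $ j\<bar>)"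
        by (intro integrable_abs b_form_term u v w_V)
      show "integrable M (\<lambda>x. ?W * (\<bar>u x $ i\<bar> * \<bar>v x $ j\<bar>))"
        by (intro integrable_mult_right L2_integrable_mult absL2 uL vL)
      show "AE x in M. \<bar>u x $ i * weak_partial R i (\<lambda>y. wf n y $ j) x * v x $ j\<bar> \<le> ?W * (\<bar>u x $ i\<bar> * \<bar>v x $ j\<bar>)"
        using D1_weak_partial[OF w_D1, of i n j]
      proof eventually_elim
        fix x assume "weak_partial R i (\<lambda>x. wf n x $ j) x = partial i (\<lambda>x. wf n x $ j) x"
        then have "\<bar>u x $ i * weak_partial R i (\<lambda>y. wf n y $ j) x * v x $ j\<bar> = \<bar>partial i (\<lambda>x. wf n x $ j) x\<bar> * (\<bar>u x $ i\<bar> * \<bar>v x $ j\<bar>)"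
          by (simp add: abs_mult mult_ac)
        also have "\<dots> \<le> ?W * (\<bar>u x $ i\<bar> * \<bar>v x $ j\<bar>)" by (intro mult_right_mono pw) simp
        finally show "\<bar>u x $ i * weak_partial R i (\<lambda>y. wf n y $ j) x * v x $ j\<bar> \<le> ?W * (\<bar>u x $ i\<bar> * \<bar>v x $ j\<bar>)" .
      qed
    qed
    also have "\<dots> = ?W * (LINT x|M. \<bar>u x $ i\<bar> * \<bar>v x $ j\<bar>)" by simp
    also have "\<dots> \<le> ?W * (sqrt (fin u u) * sqrt (fin v v))"
    proof (rule mult_left_mono[OF _ W])
      have "(LINT x|M. \<bar>u x $ i\<bar> * \<bar>v x $ j\<bar>) \<le> \<bar>LINT x|M. \<bar>u x $ i\<bar> * \<bar>v x $ j\<bar>\<bar>" by simp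
      also have "\<dots> \<le> sqrt (nsq R (\<lambda>x. \<bar>u x $ i\<bar>)) * sqrt (nsq R (\<lambda>x. \<bar>v x $ j\<bar>))"
        by (rule L2_Cauchy_Schwarz[OF absL2[OF uL] absL2[OF vL]])
      also have "\<dots> = sqrt (nsq R (\<lambda>x. u x $ i)) * sqrt (nsq R (\<lambda>x. v x $ j))" by (simp add: nsq_def)
      also have "\<dots> \<le> sqrt (fin u u) * sqrt (fin v v)"
        by (intro mult_mono real_sqrt_le_mono nle) (auto simp: nsq_nonneg fin_vin_nonneg)
      finally show "(LINT x|M. \<bar>u x $ i\<bar> * \<bar>v x $ j\<bar>) \<le> sqrt (fin u u) * sqrt (fin v v)" .
    qed
    finally show ?thesis .
  qed
  then have "\<bar>b_form a b u (wf n) v\<bar> \<le> (\<Sum>i\<in>(UNIV::2 set). \<Sum>j\<in>(UNIV::2 set). ?W * (sqrt (fin u u) * sqrt (fin v v)))"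
    unfolding b_form_def by (intro order_trans[OF sum_abs] sum_mono)
  then show ?thesis by (simp add: mult.assoc)
qed

end

section \<open>Strong measurability and functionals on V\<close>

text \<open>Links the finite sum that defines the integral of a simple function with ordinary real
  integrals. It is used with \<open>g\<close> an evaluation at a fixed field and with
  \<open>g\<close> the dual norm.\<close>

lemma integral_simple_function:
  fixes g :: "'y \<Rightarrow> real"
  assumes s: "simple_function M s" and M: "finite_measure M"
  shows "integrable M (\<lambda>t. g (s t))" "(LINT t|M. g (s t)) = (\<Sum>y\<in>s ` space M. measure M (s -` {y} \<inter> space M) * g y)"
proof -
  interpret finite_measure M by fact
  have fin: "finite (s ` space M)" and ms: "\<And>y. s -` {y} \<inter> space M \<in> sets M"
    using simple_functionD[OF s] by auto
  have eq: "g (s t) = (\<Sum>y\<in>s ` space M. indicator (s -` {y} \<inter> space M) t * g y)" if t: "t \<in> space M" for t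
  proof -
    have "(\<Sum>y\<in>s ` space M. indicator (s -` {y} \<inter> space M) t * g y) = (\<Sum>y\<in>s ` space M. if y = s t then g y else 0)"
      using t by (intro sum.cong) (auto simp: indicator_def)
    also have "\<dots> = g (s t)" using fin t by (simp add: sum.delta)
    finally show ?thesis by simp
  qed
  have i: "integrable M (\<lambda>t. indicator (s -` {y} \<inter> space M) t * g y)" for y
    using ms[of y] by (intro integrable_mult_left integrable_real_indicator) (auto simp: emeasure_eq_measure)
  have "integrable M (\<lambda>t. \<Sum>y\<in>s ` space M. indicator (s -` {y} \<inter> space M) t * g y)"
    by (intro Bochner_Integration.integrable_sum i)
  then show "integrable M (\<lambda>t. g (s t))"
    by (subst Bochner_Integration.integrable_cong[OF refl eq]) auto
  have "(LINT t|M. g (s t)) = (LINT t|M. (\<Sum>y\<in>s ` space M. indicator (s -` {y} \<inter> space M) t * g y))"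
    by (intro Bochner_Integration.integral_cong refl eq)
  also have "\<dots> = (\<Sum>y\<in>s ` space M. (LINT t|M. indicator (s -` {y} \<inter> space M) t * g y))"
    by (intro Bochner_Integration.integral_sum i)
  also have "\<dots> = (\<Sum>y\<in>s ` space M. measure M (s -` {y} \<inter> space M) * g y)"
    by (intro sum.cong refl) simp
  finally show "(LINT t|M. g (s t)) = (\<Sum>y\<in>s ` space M. measure M (s -` {y} \<inter> space M) * g y)" .
qed

text \<open>What strong measurability needs of a space of functions with pointwise operations. It is
  instantiated with \<open>V\<close> and with its dual, where \<open>N x = 0\<close> does not force
  \<open>x\<close> to be 0.\<close>

locale seminorm_space =
  fixes X :: "('p \<Rightarrow> 'q::real_vector) set" and N :: "('p \<Rightarrow> 'q) \<Rightarrow> real"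
  assumes zero: "(\<lambda>p. 0) \<in> X"
    and add: "x \<in> X \<Longrightarrow> y \<in> X \<Longrightarrow> (\<lambda>p. x p + y p) \<in> X"
    and scale: "x \<in> X \<Longrightarrow> (\<lambda>p. c *\<^sub>R x p) \<in> X"
    and nonneg: "x \<in> X \<Longrightarrow> 0 \<le> N x"
    and triangle: "x \<in> X \<Longrightarrow> y \<in> X \<Longrightarrow> N (\<lambda>p. x p + y p) \<le> N x + N y"
    and homogeneous: "x \<in> X \<Longrightarrow> N (\<lambda>p. c *\<^sub>R x p) = \<bar>c\<bar> * N x"
begin

lemma diff: "x \<in> X \<Longrightarrow> y \<in> X \<Longrightarrow> (\<lambda>p. x p - y p) \<in> X"
  using add[OF _ scale[of y "-1"], of x] by simp

lemma N_diff_le: "x \<in> X \<Longrightarrow> y \<in> X \<Longrightarrow> N (\<lambda>p. x p - y p) \<le> N x + N y"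
  using triangle[OF _ scale[of y "-1"], of x] homogeneous[of y "-1"] by simp

lemma N_commute: "x \<in> X \<Longrightarrow> y \<in> X \<Longrightarrow> N (\<lambda>p. x p - y p) = N (\<lambda>p. y p - x p)"
  using homogeneous[OF diff[of x y], of "-1"] by simp

lemma N_abs_diff_le: assumes "x \<in> X" "y \<in> X" shows "\<bar>N x - N y\<bar> \<le> N (\<lambda>p. x p - y p)"
  using triangle[OF diff[OF assms] assms(2)] triangle[OF diff[OF assms(2,1)] assms(1)] N_commute[OF assms] by simp

lemma N_zero: "N (\<lambda>p. 0) = 0"
  using homogeneous[OF zero, of 0] by simp

lemma N_self: "N (\<lambda>p. x p - x p) = 0"
  using N_zero by simp

lemma simple_in_D: "simple_in M X s \<Longrightarrow> t \<in> space M \<Longrightarrow> s t \<in> X"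
  by (auto simp: simple_in_def)

lemma strongly_measurableE:
  assumes "strongly_measurable M X N f"
  obtains s where "\<And>n. simple_in M X (s n)" "AE t in M. f t \<in> X \<and> (\<forall>n. s n t \<in> X) \<and> (\<lambda>n. N (\<lambda>p. s n t p - f t p)) \<longlonglongrightarrow> 0"
proof -
  obtain s where s: "\<And>n. simple_in M X (s n)" "AE t in M. (\<lambda>n. N (\<lambda>p. s n t p - f t p)) \<longlonglongrightarrow> 0" and f: "AE t in M. f t \<in> X"
    using assms unfolding strongly_measurable_def by blast
  have "AE t in M. f t \<in> X \<and> (\<forall>n. s n t \<in> X) \<and> (\<lambda>n. N (\<lambda>p. s n t p - f t p)) \<longlonglongrightarrow> 0"
    using f s(2) AE_space by eventually_elim (use simple_in_D[OF s(1)] in auto)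
  with s(1) show ?thesis by (rule that)
qed

lemma strongly_measurableI:
  assumes "\<And>n. simple_in M X (s n)" "AE t in M. f t \<in> X \<and> (\<lambda>n. N (\<lambda>p. s n t p - f t p)) \<longlonglongrightarrow> 0"
  shows "strongly_measurable M X N f"
  unfolding strongly_measurable_def using assms by auto

lemma strongly_measurable_add:
  assumes "strongly_measurable M X N f" "strongly_measurable M X N g"
  shows "strongly_measurable M X N (\<lambda>t p. f t p + g t p)"
proof -
  obtain s where s: "\<And>n. simple_in M X (s n)" "AE t in M. f t \<in> X \<and> (\<forall>n. s n t \<in> X) \<and> (\<lambda>n. N (\<lambda>p. s n t p - f t p)) \<longlonglongrightarrow> 0"
    by (rule strongly_measurableE[OF assms(1)]) blast
  obtain r where r: "\<And>n. simple_in M X (r n)" "AE t in M. g t \<in> X \<and> (\<forall>n. r n t \<in> X) \<and> (\<lambda>n. N (\<lambda>p. r n t p - g t p)) \<longlonglongrightarrow> 0"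
    by (rule strongly_measurableE[OF assms(2)]) blast
  show ?thesis
  proof (rule strongly_measurableI)
    show "simple_in M X (\<lambda>t p. s n t p + r n t p)" for n
      using s(1)[of n] r(1)[of n] simple_function_compose2[of M "s n" "r n" "\<lambda>x y p. x p + y p"]
      by (auto simp: simple_in_def image_subset_iff intro!: add)
    show "AE t in M. (\<lambda>p. f t p + g t p) \<in> X \<and> (\<lambda>n. N (\<lambda>p. s n t p + r n t p - (f t p + g t p))) \<longlonglongrightarrow> 0"
      using s(2) r(2)
    proof eventually_elim
      fix t assume a: "f t \<in> X \<and> (\<forall>n. s n t \<in> X) \<and> (\<lambda>n. N (\<lambda>p. s n t p - f t p)) \<longlonglongrightarrow> 0"
        and b: "g t \<in> X \<and> (\<forall>n. r n t \<in> X) \<and> (\<lambda>n. N (\<lambda>p. r n t p - g t p)) \<longlonglongrightarrow> 0"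
      have e: "(\<lambda>p. s n t p + r n t p - (f t p + g t p)) = (\<lambda>p. (s n t p - f t p) + (r n t p - g t p))" for n
        by (simp add: fun_eq_iff algebra_simps)
      have X: "(\<lambda>p. s n t p - f t p) \<in> X" "(\<lambda>p. r n t p - g t p) \<in> X" for n using a b by (auto intro: diff)
      have l: "(\<lambda>n. N (\<lambda>p. s n t p - f t p) + N (\<lambda>p. r n t p - g t p)) \<longlonglongrightarrow> 0"
        using tendsto_add[of _ 0 _ _ 0] a b by fastforce
      have "(\<lambda>n. N (\<lambda>p. s n t p + r n t p - (f t p + g t p))) \<longlonglongrightarrow> 0"
        unfolding e by (rule tendsto_sandwich[OF _ _ tendsto_const l])
          (auto intro!: always_eventually nonneg add X triangle)
      then show "(\<lambda>p. f t p + g t p) \<in> X \<and> (\<lambda>n. N (\<lambda>p. s n t p + r n t p - (f t p + g t p))) \<longlonglongrightarrow> 0"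
        using a b by (auto intro: add)
    qed
  qed
qed

lemma strongly_measurable_scale:
  assumes \<phi>: "\<phi> \<in> borel_measurable M" and f: "strongly_measurable M X N f"
  shows "strongly_measurable M X N (\<lambda>t p. \<phi> t *\<^sub>R f t p)"
proof -
  obtain s where s: "\<And>n. simple_in M X (s n)" "AE t in M. f t \<in> X \<and> (\<forall>n. s n t \<in> X) \<and> (\<lambda>n. N (\<lambda>p. s n t p - f t p)) \<longlonglongrightarrow> 0"
    by (rule strongly_measurableE[OF f]) blast
  obtain r where r: "\<And>n. simple_function M (r n)" "\<And>t. t \<in> space M \<Longrightarrow> (\<lambda>n. r n t) \<longlonglongrightarrow> (\<phi> t :: real)"
    using borel_measurable_implies_sequence_metric[OF \<phi>, of 0] by blast
  show ?thesis
  proof (rule strongly_measurableI)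
    show "simple_in M X (\<lambda>t p. r n t *\<^sub>R s n t p)" for n
      using s(1)[of n] r(1)[of n] simple_function_compose2[of M "r n" "s n" "\<lambda>c y p. c *\<^sub>R y p"]
      by (auto simp: simple_in_def image_subset_iff intro!: scale)
    show "AE t in M. (\<lambda>p. \<phi> t *\<^sub>R f t p) \<in> X \<and> (\<lambda>n. N (\<lambda>p. r n t *\<^sub>R s n t p - \<phi> t *\<^sub>R f t p)) \<longlonglongrightarrow> 0"
      using s(2) AE_space
    proof eventually_elim
      fix t assume a: "f t \<in> X \<and> (\<forall>n. s n t \<in> X) \<and> (\<lambda>n. N (\<lambda>p. s n t p - f t p)) \<longlonglongrightarrow> 0" and t: "t \<in> space M"
      have e: "(\<lambda>p. r n t *\<^sub>R s n t p - \<phi> t *\<^sub>R f t p) = (\<lambda>p. r n t *\<^sub>R (s n t p - f t p) + (r n t - \<phi> t) *\<^sub>R f t p)" for n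
        by (simp add: fun_eq_iff algebra_simps)
      have X: "(\<lambda>p. s n t p - f t p) \<in> X" "f t \<in> X" for n using a by (auto intro: diff)
      have le: "N (\<lambda>p. r n t *\<^sub>R (s n t p - f t p) + (r n t - \<phi> t) *\<^sub>R f t p) \<le> \<bar>r n t\<bar> * N (\<lambda>p. s n t p - f t p) + \<bar>r n t - \<phi> t\<bar> * N (f t)" for n
        using triangle[OF scale[OF X(1)[of n], of "r n t"] scale[OF X(2), of "r n t - \<phi> t"]] homogeneous[OF X(1)[of n], of "r n t"] homogeneous[OF X(2), of "r n t - \<phi> t"]
        by simp
      have "(\<lambda>n. \<bar>r n t\<bar> * N (\<lambda>p. s n t p - f t p) + \<bar>r n t - \<phi> t\<bar> * N (f t)) \<longlonglongrightarrow> \<bar>\<phi> t\<bar> * 0 + \<bar>\<phi> t - \<phi> t\<bar> * N (f t)"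
        using a by (intro tendsto_intros r(2)[OF t]) auto
      then have l: "(\<lambda>n. \<bar>r n t\<bar> * N (\<lambda>p. s n t p - f t p) + \<bar>r n t - \<phi> t\<bar> * N (f t)) \<longlonglongrightarrow> 0" by simp
      have "(\<lambda>n. N (\<lambda>p. r n t *\<^sub>R s n t p - \<phi> t *\<^sub>R f t p)) \<longlonglongrightarrow> 0"
        unfolding e by (rule tendsto_sandwich[OF _ _ tendsto_const l])
          (auto intro!: always_eventually nonneg add scale X le)
      then show "(\<lambda>p. \<phi> t *\<^sub>R f t p) \<in> X \<and> (\<lambda>n. N (\<lambda>p. r n t *\<^sub>R s n t p - \<phi> t *\<^sub>R f t p)) \<longlonglongrightarrow> 0"
        using a by (auto intro: scale)
    qed
  qed
qed

lemma N_measurable: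
  fixes S :: "real set"
  assumes S: "S \<in> sets lebesgue" and f: "strongly_measurable (lebesgue_on S) X N f"
  shows "(\<lambda>t. N (f t)) \<in> borel_measurable (lebesgue_on S)"
proof -
  obtain s where s: "\<And>n. simple_in (lebesgue_on S) X (s n)" "AE t in lebesgue_on S. f t \<in> X \<and> (\<forall>n. s n t \<in> X) \<and> (\<lambda>n. N (\<lambda>p. s n t p - f t p)) \<longlonglongrightarrow> 0"
    by (rule strongly_measurableE[OF f]) blast
  show ?thesis
  proof (rule borel_measurable_LIMSEQ_AE_lebesgue_on[OF S])
    show "(\<lambda>t. N (s n t)) \<in> borel_measurable (lebesgue_on S)" for n
      using s(1)[of n] simple_function_compose[of "lebesgue_on S" "s n" N]
      by (auto simp: simple_in_def comp_def intro: borel_measurable_simple_function)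
    show "AE t in lebesgue_on S. (\<lambda>n. N (s n t)) \<longlonglongrightarrow> N (f t)"
      using s(2)
    proof eventually_elim
      fix t assume a: "f t \<in> X \<and> (\<forall>n. s n t \<in> X) \<and> (\<lambda>n. N (\<lambda>p. s n t p - f t p)) \<longlonglongrightarrow> 0"
      have "(\<lambda>n. N (s n t) - N (f t)) \<longlonglongrightarrow> 0"
        by (rule Lim_null_comparison[of _ "\<lambda>n. N (\<lambda>p. s n t p - f t p)"]) (use a N_abs_diff_le in auto)
      then show "(\<lambda>n. N (s n t)) \<longlonglongrightarrow> N (f t)" by (rule LIM_zero_cancel)
    qed
  qed
qed

end

text \<open>The image of a simple function is simple, so sequential continuity of
  \<open>\<Psi>\<close> is enough. No linearity is required, which admits the quadratic operator
  \<open>B\<close>.\<close>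

lemma strongly_measurable_compose:
  assumes X: "seminorm_space X N" and f: "strongly_measurable M X N f" and \<Psi>: "\<And>x. x \<in> X \<Longrightarrow> \<Psi> x \<in> Y"
    and cont: "\<And>x y. x \<in> X \<Longrightarrow> (\<And>n :: nat. y n \<in> X) \<Longrightarrow> (\<lambda>n. N (\<lambda>p. y n p - x p)) \<longlonglongrightarrow> 0 \<Longrightarrow> (\<lambda>n. N' (\<lambda>p. \<Psi> (y n) p - \<Psi> x p)) \<longlonglongrightarrow> 0"
  shows "strongly_measurable M Y N' (\<lambda>t. \<Psi> (f t))"
proof -
  interpret seminorm_space X N by fact
  obtain s where s: "\<And>n. simple_in M X (s n)" "AE t in M. f t \<in> X \<and> (\<forall>n. s n t \<in> X) \<and> (\<lambda>n. N (\<lambda>p. s n t p - f t p)) \<longlonglongrightarrow> 0"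
    by (rule strongly_measurableE[OF f]) blast
  have 1: "simple_in M Y (\<lambda>t. \<Psi> (s n t))" for n
    using s(1)[of n] simple_function_compose[of M "s n" \<Psi>] \<Psi> by (auto simp: simple_in_def comp_def)
  have 2: "AE t in M. \<Psi> (f t) \<in> Y" using s(2) by eventually_elim (auto intro: \<Psi>)
  have 3: "AE t in M. (\<lambda>n. N' (\<lambda>p. \<Psi> (s n t) p - \<Psi> (f t) p)) \<longlonglongrightarrow> 0"
    using s(2) by eventually_elim (auto intro!: cont)
  show ?thesis unfolding strongly_measurable_def
    by (intro conjI exI[of _ "\<lambda>n t. \<Psi> (s n t)"] allI 1 2 3)
qed

section \<open>The dual of V\<close>

context rectangle
begin

abbreviation "V \<equiv> V_space a b"
abbreviation "Vd \<equiv> V_dual a b"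
abbreviation "dnorm \<equiv> V_dual_norm a b"

lemma vin_diff_self:
  assumes "u \<in> H1_field R" "w \<in> H1_field R"
  shows "vin (\<lambda>x. u x - w x) (\<lambda>x. u x - w x) = vin u u - 2 * vin u w + vin w w"
proof -
  note d = H1_field_diff(1)[OF assms]
  have "vin (\<lambda>x. u x - w x) (\<lambda>x. u x - w x) = vin (\<lambda>x. u x - w x) u - vin (\<lambda>x. u x - w x) w"
    using fin_vin_diff(2)[OF assms d] fin_vin_commute(2)[of u "\<lambda>x. u x - w x"] fin_vin_commute(2)[of w "\<lambda>x. u x - w x"] by linarith
  also have "\<dots> = vin u u - vin w u - (vin u w - vin w w)"
    by (simp only: fin_vin_diff(2)[OF assms assms(1)] fin_vin_diff(2)[OF assms assms(2)])
  finally show ?thesis using fin_vin_commute(2)[of w u] by linarith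
qed

lemma vin_scale_self:
  assumes "v \<in> H1_field R"
  shows "vin (\<lambda>x. c *\<^sub>R v x) (\<lambda>x. c *\<^sub>R v x) = c\<^sup>2 * vin v v"
proof -
  have "vin (\<lambda>x. c *\<^sub>R v x) (\<lambda>x. c *\<^sub>R v x) = c * vin (\<lambda>x. c *\<^sub>R v x) v"
    by (simp only: vin_scale[OF assms H1_field_scale(1)[OF assms]] fin_vin_commute(2)[of v "\<lambda>x. c *\<^sub>R v x"])
  then show ?thesis by (simp only: vin_scale[OF assms assms] power2_eq_square mult.assoc)
qed

lemma vin_CS:
  assumes u: "u \<in> V" and v: "v \<in> V"
  shows "\<bar>vin u v\<bar> \<le> vnorm u * vnorm v"
proof -
  note h = V_H1_field[OF u] V_H1_field[OF v]
  have "(vin u v)\<^sup>2 \<le> vin u u * vin v v"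
  proof (rule discriminant_le[OF fin_vin_nonneg(2) fin_vin_nonneg(2)])
    fix t
    note s = H1_field_scale(1)[OF h(2), of t]
    have "vin u (\<lambda>x. t *\<^sub>R v x) = t * vin u v"
      by (simp only: vin_scale[OF h(2,1)] fin_vin_commute(2)[of u "\<lambda>x. t *\<^sub>R v x"] fin_vin_commute(2)[of u v])
    then have "vin (\<lambda>x. u x - t *\<^sub>R v x) (\<lambda>x. u x - t *\<^sub>R v x) = vin u u - 2 * t * vin u v + t\<^sup>2 * vin v v"
      by (simp only: vin_diff_self[OF h(1) s] vin_scale_self[OF h(2)] mult.assoc)
    then show "0 \<le> vin u u - 2 * t * vin u v + t\<^sup>2 * vin v v" using fin_vin_nonneg(2)[of "\<lambda>x. u x - t *\<^sub>R v x"] by (simp only:)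
  qed
  then have "sqrt ((vin u v)\<^sup>2) \<le> sqrt (vin u u * vin v v)" by (rule real_sqrt_le_mono)
  then show ?thesis by (simp add: V_norm_eq u v real_sqrt_mult)
qed

lemma vnorm_sq: "v \<in> V \<Longrightarrow> (vnorm v)\<^sup>2 = vin v v"
  by (simp add: V_norm_eq fin_vin_nonneg)

lemma vnorm_scale: "v \<in> V \<Longrightarrow> vnorm (\<lambda>x. c *\<^sub>R v x) = \<bar>c\<bar> * vnorm v"
  by (simp only: V_norm_eq[OF V_scale] V_norm_eq vin_scale_self[OF V_H1_field] real_sqrt_mult real_sqrt_abs)

lemma vnorm_triangle: assumes u: "u \<in> V" and v: "v \<in> V" shows "vnorm (\<lambda>x. u x + v x) \<le> vnorm u + vnorm v"
proof (rule power2_le_imp_le)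
  let ?m = "\<lambda>x. (-1) *\<^sub>R v x"
  note h = V_H1_field[OF u] V_H1_field[OF v] and s = V_add[OF u v]
  have m: "vin u ?m = - vin u v"
    unfolding fin_vin_commute(2)[of u ?m] fin_vin_commute(2)[of u v] vin_scale[OF h(2,1)] by (rule mult_minus1)
  have mm: "vin ?m ?m = vin v v"
    unfolding vin_scale_self[OF h(2)] by (simp only: power2_minus one_power2 mult_1)
  have e: "(\<lambda>x. u x + v x) = (\<lambda>x. u x - ?m x)" by (rule ext) simp
  have "(vnorm (\<lambda>x. u x + v x))\<^sup>2 = vin u u + 2 * vin u v + vin v v"
    unfolding vnorm_sq[OF s] unfolding e vin_diff_self[OF h(1) H1_field_scale(1)[OF h(2)]] m mm by (simp only: mult_minus_right diff_minus_eq_add)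
  also have "\<dots> = (vnorm u)\<^sup>2 + 2 * vin u v + (vnorm v)\<^sup>2"
    unfolding vnorm_sq[OF u] vnorm_sq[OF v] ..
  also have "\<dots> \<le> (vnorm u + vnorm v)\<^sup>2"
    using vin_CS[OF u v] unfolding power2_sum by linarith
  finally show "(vnorm (\<lambda>x. u x + v x))\<^sup>2 \<le> (vnorm u + vnorm v)\<^sup>2" .
  show "0 \<le> vnorm u + vnorm v" using vnorm_nonneg[OF u] vnorm_nonneg[OF v] by (rule add_nonneg_nonneg)
qed

lemma V_zero: "(\<lambda>x. 0) \<in> V"
  by (rule D1_V[OF D1_zero])

sublocale V: seminorm_space V vnorm
  by unfold_locales (auto simp: V_zero V_add V_scale vnorm_nonneg vnorm_triangle vnorm_scale)

lemma Vd_add: "l \<in> Vd \<Longrightarrow> v \<in> V \<Longrightarrow> u \<in> V \<Longrightarrow> l (\<lambda>x. u x + v x) = l u + l v"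
  and Vd_scale: "l \<in> Vd \<Longrightarrow> v \<in> V \<Longrightarrow> l (\<lambda>x. c *\<^sub>R v x) = c * l v"
  by (simp_all add: V_dual_def)

lemma Vd_I:
  assumes "\<And>u v. u \<in> V \<Longrightarrow> v \<in> V \<Longrightarrow> l (\<lambda>x. u x + v x) = l u + l v"
    "\<And>c u. u \<in> V \<Longrightarrow> l (\<lambda>x. c *\<^sub>R u x) = c * l u" "\<And>v. v \<in> V \<Longrightarrow> \<bar>l v\<bar> \<le> C * vnorm v"
  shows "l \<in> Vd"
  using assms by (auto simp: V_dual_def intro: exI[of _ C])

lemma dnorm_le:
  assumes "\<And>v. v \<in> V \<Longrightarrow> \<bar>l v\<bar> \<le> C * vnorm v" "0 \<le> C"
  shows "dnorm l \<le> C"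
  unfolding V_dual_norm_def
proof (rule cSUP_least)
  have "(\<lambda>x. 0) \<in> {v \<in> V. vnorm v \<le> 1}" using V_zero V.N_zero by simp
  then show "{v \<in> V. vnorm v \<le> 1} \<noteq> {}" by blast
  fix v assume v: "v \<in> {v \<in> V. vnorm v \<le> 1}"
  then have "\<bar>l v\<bar> \<le> C * vnorm v" using assms(1) by simp
  also have "\<dots> \<le> C" using v assms(2) by (simp add: mult_left_le)
  finally show "\<bar>l v\<bar> \<le> C" .
qed

lemma dnorm_bdd:
  assumes "l \<in> Vd"
  shows "bdd_above ((\<lambda>v. \<bar>l v\<bar>) ` {v \<in> V. vnorm v \<le> 1})"
proof -
  obtain C where C: "\<And>u. u \<in> V \<Longrightarrow> \<bar>l u\<bar> \<le> C * vnorm u" using assms unfolding V_dual_def by blast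
  show ?thesis
  proof (rule bdd_aboveI2)
    fix v assume v: "v \<in> {v \<in> V. vnorm v \<le> 1}"
    then have "\<bar>l v\<bar> \<le> C * vnorm v" using C by simp
    also have "\<dots> \<le> \<bar>C\<bar> * 1" using v vnorm_nonneg by (intro mult_mono) auto
    finally show "\<bar>l v\<bar> \<le> \<bar>C\<bar>" by simp
  qed
qed

lemma dnorm_nonneg:
  assumes "l \<in> Vd"
  shows "0 \<le> dnorm l"
proof -
  have "\<bar>l (\<lambda>x. 0)\<bar> \<le> dnorm l"
    unfolding V_dual_norm_def by (rule cSUP_upper[OF _ dnorm_bdd[OF assms]]) (simp add: V_zero V.N_zero)
  then show ?thesis by linarith
qed

lemma dnorm_bound:
  assumes l: "l \<in> Vd" and v: "v \<in> V"
  shows "\<bar>l v\<bar> \<le> dnorm l * vnorm v"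
proof (cases "vnorm v = 0")
  case True
  \<comment> \<open>A field of seminorm 0 cannot be normalized; here boundedness of \<open>l\<close>
    directly forces \<open>l v = 0\<close>.\<close>
  obtain C where "\<And>u. u \<in> V \<Longrightarrow> \<bar>l u\<bar> \<le> C * vnorm u" using l unfolding V_dual_def by blast
  from this[OF v] True show ?thesis by simp
next
  case False
  then have p: "0 < vnorm v" using vnorm_nonneg[OF v] by simp
  let ?v = "\<lambda>x. (1 / vnorm v) *\<^sub>R v x"
  have V: "?v \<in> V" by (rule V_scale[OF v])
  moreover have "vnorm ?v = 1" using p by (simp only: vnorm_scale[OF v]) simp
  ultimately have "\<bar>l ?v\<bar> \<le> dnorm l"
    unfolding V_dual_norm_def by (intro cSUP_upper dnorm_bdd l) simp
  moreover have "l ?v = (1 / vnorm v) * l v" by (rule Vd_scale[OF l v])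
  ultimately have "\<bar>l v\<bar> / vnorm v \<le> dnorm l" using p by (simp add: abs_mult)
  then show ?thesis using p by (simp add: field_simps)
qed

lemma dnorm_eq_0: "(\<And>v. v \<in> V \<Longrightarrow> l v = 0) \<Longrightarrow> dnorm l = 0"
proof -
  assume 0: "\<And>v. v \<in> V \<Longrightarrow> l v = 0"
  have "l \<in> Vd" by (rule Vd_I[of _ 0]) (auto simp: 0 V_add V_scale)
  then show "dnorm l = 0" using dnorm_nonneg dnorm_le[of l 0] 0 by (intro antisym) auto
qed

sublocale Vd: seminorm_space Vd dnorm
proof
  show z: "(\<lambda>p. 0) \<in> Vd" by (rule Vd_I[of _ 0]) auto
  show add: "(\<lambda>p. x p + y p) \<in> Vd" if "x \<in> Vd" "y \<in> Vd" for x y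
  proof (rule Vd_I[of _ "dnorm x + dnorm y"])
    show "\<bar>x v + y v\<bar> \<le> (dnorm x + dnorm y) * vnorm v" if "v \<in> V" for v
      using dnorm_bound[OF \<open>x \<in> Vd\<close> that] dnorm_bound[OF \<open>y \<in> Vd\<close> that] by (simp add: distrib_right)
  qed (auto simp: Vd_add[OF that(1)] Vd_add[OF that(2)] Vd_scale[OF that(1)] Vd_scale[OF that(2)] algebra_simps)
  show scale: "(\<lambda>p. c *\<^sub>R x p) \<in> Vd" if "x \<in> Vd" for x c
  proof (rule Vd_I[of _ "\<bar>c\<bar> * dnorm x"])
    show "\<bar>c *\<^sub>R x v\<bar> \<le> (\<bar>c\<bar> * dnorm x) * vnorm v" if "v \<in> V" for v
      using mult_left_mono[OF dnorm_bound[OF \<open>x \<in> Vd\<close> that], of "\<bar>c\<bar>"] by (simp add: abs_mult mult.assoc)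
  qed (auto simp: Vd_add[OF that(1)] Vd_scale[OF that(1)] algebra_simps)
  show "0 \<le> dnorm x" if "x \<in> Vd" for x by (rule dnorm_nonneg[OF that])
  show "dnorm (\<lambda>p. x p + y p) \<le> dnorm x + dnorm y" if "x \<in> Vd" "y \<in> Vd" for x y
  proof (rule dnorm_le)
    show "\<bar>x v + y v\<bar> \<le> (dnorm x + dnorm y) * vnorm v" if "v \<in> V" for v
      using dnorm_bound[OF \<open>x \<in> Vd\<close> that] dnorm_bound[OF \<open>y \<in> Vd\<close> that] by (simp add: distrib_right)
  qed (use dnorm_nonneg that in auto)
  \<comment> \<open>One inequality suffices: applied to \<open>1 / c\<close> and the scaled
    functional, it returns the reverse one.\<close>
  have sc: "dnorm (\<lambda>p. c *\<^sub>R x p) \<le> \<bar>c\<bar> * dnorm x" if "x \<in> Vd" for x c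
  proof (rule dnorm_le)
    show "\<bar>c *\<^sub>R x v\<bar> \<le> (\<bar>c\<bar> * dnorm x) * vnorm v" if "v \<in> V" for v
      using mult_left_mono[OF dnorm_bound[OF \<open>x \<in> Vd\<close> that], of "\<bar>c\<bar>"] by (simp add: abs_mult mult.assoc)
  qed (use dnorm_nonneg that in auto)
  show "dnorm (\<lambda>p. c *\<^sub>R x p) = \<bar>c\<bar> * dnorm x" if "x \<in> Vd" for x c
  proof (cases "c = 0")
    case True
    then show ?thesis using dnorm_eq_0[of "\<lambda>p. 0"] by simp
  next
    case False
    have "dnorm x \<le> \<bar>1 / c\<bar> * dnorm (\<lambda>p. c *\<^sub>R x p)" using sc[OF scale[OF that, of c], of "1 / c"] False by simp
    then have "\<bar>c\<bar> * dnorm x \<le> dnorm (\<lambda>p. c *\<^sub>R x p)" using False by (simp add: field_simps)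
    with sc[OF that, of c] show ?thesis by simp
  qed
qed

lemma Vd_expand:
  assumes l: "l \<in> Vd"
  shows "l (expand N c) = (\<Sum>n<N. c n * l (wf n))"
proof (induction N)
  case 0
  show ?case using Vd_scale[OF l V_zero, of 0] by (simp add: expand_def)
next
  case (Suc N)
  then show ?case by (simp add: expand_Suc Vd_add[OF l V_scale[OF w_V] expand_V] Vd_scale[OF l w_V])
qed

text \<open>Finite expansions are dense in \<open>V\<close> for \<open>vnorm\<close>, and
  \<open>l\<close> is bounded. Consequently an identity in the dual of \<open>V\<close> can be
  verified on eigenfields.\<close>

lemma Vd_eq_0_if_basis:
  assumes l: "l \<in> Vd" and 0: "\<And>n. l (wf n) = 0" and v: "v \<in> V"
  shows "l v = 0"
proof -
  have e: "l (expand N c) = 0" for N c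
    by (simp add: Vd_expand[OF l] 0)
  have "\<bar>l v\<bar> \<le> dnorm l * vnorm (\<lambda>x. expand N (coef v) x - v x)" for N
  proof -
    have "l (\<lambda>x. expand N (coef v) x + (-1) *\<^sub>R v x) = l (expand N (coef v)) + (-1) * l v"
      by (simp only: Vd_add[OF l V_scale[OF v] expand_V] Vd_scale[OF l v])
    then have "l (\<lambda>x. expand N (coef v) x - v x) = - l v" by (simp add: e)
    then show ?thesis using dnorm_bound[OF l V_diff[OF expand_V v], of N "coef v"] by simp
  qed
  moreover have "(\<lambda>N. dnorm l * vnorm (\<lambda>x. expand N (coef v) x - v x)) \<longlonglongrightarrow> dnorm l * 0"
    by (intro tendsto_intros V_expand_vnorm v)
  ultimately have "\<bar>l v\<bar> \<le> dnorm l * 0" by (intro LIMSEQ_le_const) auto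
  then show ?thesis by simp
qed

section \<open>The operators as maps into the dual\<close>

lemma A_op_Vd:
  assumes u: "u \<in> V"
  shows "A_op a b u \<in> Vd" "dnorm (A_op a b u) \<le> vnorm u" "v \<in> V \<Longrightarrow> A_op a b u v = vin u v"
proof -
  have e: "A_op a b u v = vin u v" if "v \<in> V" for v
    unfolding A_op_def by (rule V_inner_eq[OF V_H1_field[OF u] V_H1_field[OF that]])
  show "v \<in> V \<Longrightarrow> A_op a b u v = vin u v" by (rule e)
  show "A_op a b u \<in> Vd"
  proof (rule Vd_I[of _ "vnorm u"])
    fix v z assume v: "v \<in> V" and z: "z \<in> V"
    show "A_op a b u (\<lambda>x. v x + z x) = A_op a b u v + A_op a b u z"
      using vin_add[OF V_H1_field[OF v] V_H1_field[OF z] V_H1_field[OF u]]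
      by (simp only: e[OF v] e[OF z] e[OF V_add[OF v z]] fin_vin_commute(2)[of u "\<lambda>x. v x + z x"] fin_vin_commute(2)[of u v] fin_vin_commute(2)[of u z])
  next
    fix c v assume v: "v \<in> V"
    show "A_op a b u (\<lambda>x. c *\<^sub>R v x) = c * A_op a b u v"
      by (simp only: e[OF v] e[OF V_scale[OF v]] vin_scale[OF V_H1_field[OF v] V_H1_field[OF u]] fin_vin_commute(2)[of u "\<lambda>x. c *\<^sub>R v x"] fin_vin_commute(2)[of u v])
  next
    fix v assume v: "v \<in> V"
    show "\<bar>A_op a b u v\<bar> \<le> vnorm u * vnorm v" using vin_CS[OF u v] by (simp add: e v)
  qed
  show "dnorm (A_op a b u) \<le> vnorm u"
    by (rule dnorm_le) (use vin_CS[OF u] vnorm_nonneg[OF u] in \<open>auto simp: e\<close>)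
qed

text \<open>Cauchy-Schwarz in \<open>L^2\<close>, with a Poincare inequality for each factor; the
  two roots combine to \<open>1 / lam0\<close>.\<close>

lemma fin_CS:
  assumes "u \<in> V" "v \<in> V"
  shows "\<bar>fin u v\<bar> \<le> vnorm u / lam0 * vnorm v"
proof -
  note h = V_H1_field[OF assms(1)] V_H1_field[OF assms(2)]
  have "\<bar>fin u v\<bar> \<le> (\<Sum>j\<in>UNIV. sqrt (nsq R (\<lambda>x. u x $ j)) * sqrt (nsq R (\<lambda>x. v x $ j)))"
    unfolding fin_def by (intro order_trans[OF sum_abs] sum_mono L2_Cauchy_Schwarz H1_fieldD(2) h)
  also have "\<dots> \<le> L2_set (\<lambda>j. sqrt (nsq R (\<lambda>x. u x $ j))) UNIV * L2_set (\<lambda>j. sqrt (nsq R (\<lambda>x. v x $ j))) UNIV"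
    using L2_set_mult_ineq[of "\<lambda>j. sqrt (nsq R (\<lambda>x. u x $ j))" "\<lambda>j. sqrt (nsq R (\<lambda>x. v x $ j))" UNIV] by (simp add: nsq_nonneg)
  also have "\<dots> = sqrt (fin u u) * sqrt (fin v v)"
    by (simp add: L2_set_def nsq_nonneg fin_def) (simp add: nsq_def power2_eq_square)
  also have "\<dots> \<le> sqrt (vin u u / lam0) * sqrt (vin v v / lam0)"
    by (intro mult_mono real_sqrt_le_mono Poincare assms) (auto simp: fin_vin_nonneg less_imp_le[OF lam0(1)])
  also have "\<dots> = vnorm u / lam0 * vnorm v"
    using lam0(1) by (simp add: V_norm_eq assms real_sqrt_divide)
  finally show ?thesis .
qed

lemma emb_eq: "u \<in> V \<Longrightarrow> v \<in> V \<Longrightarrow> emb a b u v = fin u v"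
  unfolding emb_def by (intro H_inner_eq H1_fieldD(2) V_H1_field)

lemma emb_Vd:
  assumes u: "u \<in> V"
  shows "emb a b u \<in> Vd" "dnorm (emb a b u) \<le> vnorm u / lam0"
proof -
  show "emb a b u \<in> Vd"
  proof (rule Vd_I[of _ "vnorm u / lam0"])
    fix v z assume v: "v \<in> V" and z: "z \<in> V"
    show "emb a b u (\<lambda>x. v x + z x) = emb a b u v + emb a b u z"
      using fin_add[OF V_H1_field[OF v] V_H1_field[OF z] V_H1_field[OF u]]
      by (simp only: emb_eq[OF u v] emb_eq[OF u z] emb_eq[OF u V_add[OF v z]] fin_vin_commute(1)[of u "\<lambda>x. v x + z x"] fin_vin_commute(1)[of u v] fin_vin_commute(1)[of u z])
  next
    fix c v assume v: "v \<in> V"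
    show "emb a b u (\<lambda>x. c *\<^sub>R v x) = c * emb a b u v"
      by (simp only: emb_eq[OF u v] emb_eq[OF u V_scale[OF v]] fin_scale fin_vin_commute(1)[of u "\<lambda>x. c *\<^sub>R v x"] fin_vin_commute(1)[of u v])
  next
    fix v assume v: "v \<in> V"
    show "\<bar>emb a b u v\<bar> \<le> vnorm u / lam0 * vnorm v" using fin_CS[OF u v] by (simp add: emb_eq u v)
  qed
  show "dnorm (emb a b u) \<le> vnorm u / lam0"
    by (rule dnorm_le) (use fin_CS[OF u] vnorm_nonneg[OF u] lam0(1) in \<open>auto simp: emb_eq u\<close>)
qed

text \<open>The trilinear bound with two equal arguments. The growth is quadratic, so a square
  integrable \<open>u\<close> with values in \<open>V\<close> gives a \<open>B u\<close> that is
  integrable in time.\<close>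

lemma B_op_Vd:
  assumes u: "u \<in> V"
  shows "B_op a b u \<in> Vd" "dnorm (B_op a b u) \<le> KB * (vnorm u)\<^sup>2"
proof -
  have bnd: "\<bar>B_op a b u v\<bar> \<le> KB * (vnorm u)\<^sup>2 * vnorm v" if "v \<in> V" for v
    using b_form_bound[OF u u that] by (simp add: B_op_def power2_eq_square mult.assoc)
  show "B_op a b u \<in> Vd"
    by (rule Vd_I[OF _ _ bnd]) (auto simp: B_op_def b_form_add(3)[OF u u] b_form_scale(3)[OF u u] u)
  show "dnorm (B_op a b u) \<le> KB * (vnorm u)\<^sup>2" by (rule dnorm_le[OF bnd]) (auto simp: KB_nonneg)
qed

lemma A_op_diff: "u \<in> V \<Longrightarrow> z \<in> V \<Longrightarrow> v \<in> V \<Longrightarrow> A_op a b u v - A_op a b z v = A_op a b (\<lambda>x. u x - z x) v"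
  by (simp add: A_op_Vd(3) V_diff fin_vin_diff(2)[OF V_H1_field V_H1_field V_H1_field])

lemma emb_diff: "u \<in> V \<Longrightarrow> z \<in> V \<Longrightarrow> v \<in> V \<Longrightarrow> emb a b u v - emb a b z v = emb a b (\<lambda>x. u x - z x) v"
  by (simp add: emb_eq V_diff fin_vin_diff(1)[OF V_H1_field V_H1_field V_H1_field])

lemma strongly_measurable_A_op:
  assumes "strongly_measurable L V vnorm f"
  shows "strongly_measurable L Vd dnorm (\<lambda>t. A_op a b (f t))"
proof (rule strongly_measurable_compose[OF V.seminorm_space_axioms assms A_op_Vd(1)])
  fix x y assume x: "x \<in> V" and y: "\<And>n :: nat. y n \<in> V" and l: "(\<lambda>n. vnorm (\<lambda>p. y n p - x p)) \<longlonglongrightarrow> 0"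
  have le: "dnorm (\<lambda>p. A_op a b (y n) p - A_op a b x p) \<le> vnorm (\<lambda>p. y n p - x p)" for n
  proof (rule dnorm_le)
    fix v assume v: "v \<in> V"
    have d: "(\<lambda>p. y n p - x p) \<in> V" by (rule V_diff[OF y x])
    show "\<bar>A_op a b (y n) v - A_op a b x v\<bar> \<le> vnorm (\<lambda>p. y n p - x p) * vnorm v"
      unfolding A_op_diff[OF y x v] A_op_Vd(3)[OF d v] by (rule vin_CS[OF d v])
  qed (rule vnorm_nonneg[OF V_diff[OF y x]])
  show "(\<lambda>n. dnorm (\<lambda>p. A_op a b (y n) p - A_op a b x p)) \<longlonglongrightarrow> 0"
    by (rule tendsto_sandwich[OF _ _ tendsto_const l])
      (auto intro!: always_eventually dnorm_nonneg Vd.diff A_op_Vd x y le)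
qed

lemma strongly_measurable_emb:
  assumes "strongly_measurable L V vnorm f"
  shows "strongly_measurable L Vd dnorm (\<lambda>t. emb a b (f t))"
proof (rule strongly_measurable_compose[OF V.seminorm_space_axioms assms emb_Vd(1)])
  fix x y assume x: "x \<in> V" and y: "\<And>n :: nat. y n \<in> V" and l: "(\<lambda>n. vnorm (\<lambda>p. y n p - x p)) \<longlonglongrightarrow> 0"
  have le: "dnorm (\<lambda>p. emb a b (y n) p - emb a b x p) \<le> vnorm (\<lambda>p. y n p - x p) / lam0" for n
  proof (rule dnorm_le)
    fix v assume v: "v \<in> V"
    have d: "(\<lambda>p. y n p - x p) \<in> V" by (rule V_diff[OF y x])
    show "\<bar>emb a b (y n) v - emb a b x v\<bar> \<le> vnorm (\<lambda>p. y n p - x p) / lam0 * vnorm v"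
      unfolding emb_diff[OF y x v] emb_eq[OF d v] by (rule fin_CS[OF d v])
  qed (simp add: vnorm_nonneg[OF V_diff[OF y x]] lam0(1) less_imp_le)
  have l': "(\<lambda>n. vnorm (\<lambda>p. y n p - x p) / lam0) \<longlonglongrightarrow> 0" using tendsto_divide[OF l tendsto_const, of lam0] lam0(1) by simp
  show "(\<lambda>n. dnorm (\<lambda>p. emb a b (y n) p - emb a b x p)) \<longlonglongrightarrow> 0"
    by (rule tendsto_sandwich[OF _ _ tendsto_const l'])
      (auto intro!: always_eventually dnorm_nonneg Vd.diff emb_Vd x y le)
qed

lemma strongly_measurable_B_op:
  assumes "strongly_measurable L V vnorm f"
  shows "strongly_measurable L Vd dnorm (\<lambda>t. B_op a b (f t))"
proof (rule strongly_measurable_compose[OF V.seminorm_space_axioms assms B_op_Vd(1)])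
  fix x y assume x: "x \<in> V" and y: "\<And>n :: nat. y n \<in> V" and l: "(\<lambda>n. vnorm (\<lambda>p. y n p - x p)) \<longlonglongrightarrow> 0"
  let ?d = "\<lambda>n p. y n p - x p"
  have d: "?d n \<in> V" for n by (rule V_diff[OF y x])
  have le: "dnorm (\<lambda>p. B_op a b (y n) p - B_op a b x p) \<le> KB * (vnorm (?d n) * vnorm (?d n) + 2 * vnorm x * vnorm (?d n))" for n
  proof (rule dnorm_le)
    fix v assume v: "v \<in> V"
    \<comment> \<open>The quadratic map expanded around \<open>x\<close>, with \<open>?d n\<close>
      in place of the increment.\<close>
    have e: "B_op a b (y n) v - B_op a b x v = b_form a b (?d n) (?d n) v + b_form a b (?d n) x v + b_form a b x (?d n) v"
      unfolding B_op_def b_form_diff(1)[OF y d v x] b_form_diff(2)[OF y y v x] b_form_diff(1)[OF y x v x] b_form_diff(2)[OF x y v x]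
      by linarith
    have "\<bar>b_form a b (?d n) (?d n) v + b_form a b (?d n) x v + b_form a b x (?d n) v\<bar> \<le> KB * vnorm (?d n) * vnorm (?d n) * vnorm v + KB * vnorm (?d n) * vnorm x * vnorm v + KB * vnorm x * vnorm (?d n) * vnorm v"
      by (intro order_trans[OF abs_triangle_ineq add_mono] b_form_bound d x v)
    also have "\<dots> = KB * (vnorm (?d n) * vnorm (?d n) + 2 * vnorm x * vnorm (?d n)) * vnorm v"
      by algebra
    finally show "\<bar>B_op a b (y n) v - B_op a b x v\<bar> \<le> KB * (vnorm (?d n) * vnorm (?d n) + 2 * vnorm x * vnorm (?d n)) * vnorm v"
      unfolding e .
  qed (intro mult_nonneg_nonneg add_nonneg_nonneg KB_nonneg vnorm_nonneg d x, simp)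
  have "(\<lambda>n. KB * (vnorm (?d n) * vnorm (?d n) + 2 * vnorm x * vnorm (?d n))) \<longlonglongrightarrow> KB * (0 * 0 + 2 * vnorm x * 0)"
    by (intro tendsto_intros l)
  then have l': "(\<lambda>n. KB * (vnorm (?d n) * vnorm (?d n) + 2 * vnorm x * vnorm (?d n))) \<longlonglongrightarrow> 0"
    by (simp only: mult_zero_right add_0)
  show "(\<lambda>n. dnorm (\<lambda>p. B_op a b (y n) p - B_op a b x p)) \<longlonglongrightarrow> 0"
  proof (rule tendsto_sandwich[OF _ _ tendsto_const l'])
    show "\<forall>\<^sub>F n in sequentially. 0 \<le> dnorm (\<lambda>p. B_op a b (y n) p - B_op a b x p)"
      by (intro always_eventually allI dnorm_nonneg Vd.diff B_op_Vd(1) x y)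
  qed (intro always_eventually allI le)
qed

section \<open>Integrals of functionals\<close>

lemma Vd_apply_measurable:
  fixes S :: "real set"
  assumes S: "S \<in> sets lebesgue" and f: "strongly_measurable (lebesgue_on S) Vd dnorm f" and v: "v \<in> V"
  shows "(\<lambda>t. f t v) \<in> borel_measurable (lebesgue_on S)"
proof -
  obtain s where s: "\<And>n. simple_in (lebesgue_on S) Vd (s n)" "AE t in lebesgue_on S. f t \<in> Vd \<and> (\<forall>n. s n t \<in> Vd) \<and> (\<lambda>n. dnorm (\<lambda>p. s n t p - f t p)) \<longlonglongrightarrow> 0"
    by (rule Vd.strongly_measurableE[OF f]) blast
  show ?thesis
  proof (rule borel_measurable_LIMSEQ_AE_lebesgue_on[OF S])
    show "(\<lambda>t. s n t v) \<in> borel_measurable (lebesgue_on S)" for n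
      using s(1)[of n] simple_function_compose[of "lebesgue_on S" "s n" "\<lambda>l. l v"]
      by (auto simp: simple_in_def comp_def intro: borel_measurable_simple_function)
    show "AE t in lebesgue_on S. (\<lambda>n. s n t v) \<longlonglongrightarrow> f t v"
      using s(2)
    proof eventually_elim
      fix t assume a: "f t \<in> Vd \<and> (\<forall>n. s n t \<in> Vd) \<and> (\<lambda>n. dnorm (\<lambda>p. s n t p - f t p)) \<longlonglongrightarrow> 0"
      have "(\<lambda>n. dnorm (\<lambda>p. s n t p - f t p) * vnorm v) \<longlonglongrightarrow> 0"
        using tendsto_mult_right[of _ 0 _ "vnorm v"] a by fastforce
      then have "(\<lambda>n. s n t v - f t v) \<longlonglongrightarrow> 0"
        by (rule Lim_null_comparison[rotated]) (use a in \<open>auto intro!: always_eventually dnorm_bound[OF Vd.diff v]\<close>)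
      then show "(\<lambda>n. s n t v) \<longlonglongrightarrow> f t v" by (rule LIM_zero_cancel)
    qed
  qed
qed

lemma Vd_apply_integrable:
  fixes S :: "real set"
  assumes S: "S \<in> sets lebesgue" and f: "strongly_measurable (lebesgue_on S) Vd dnorm f"
    and i: "integrable (lebesgue_on S) (\<lambda>t. dnorm (f t))" and v: "v \<in> V"
  shows "integrable (lebesgue_on S) (\<lambda>t. f t v)"
proof (rule Bochner_Integration.integrable_bound)
  show "integrable (lebesgue_on S) (\<lambda>t. dnorm (f t) * vnorm v)" using i by simp
  show "(\<lambda>t. f t v) \<in> borel_measurable (lebesgue_on S)" by (rule Vd_apply_measurable[OF S f v])
  have "AE t in lebesgue_on S. f t \<in> Vd" using f by (simp add: strongly_measurable_def)
  then show "AE t in lebesgue_on S. norm (f t v) \<le> norm (dnorm (f t) * vnorm v)"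
  proof eventually_elim
    fix t assume "f t \<in> Vd"
    from dnorm_bound[OF this v] dnorm_nonneg[OF this] vnorm_nonneg[OF v] show "norm (f t v) \<le> norm (dnorm (f t) * vnorm v)" by simp
  qed
qed

text \<open>The integral taken separately at each field; it supplies the candidate for the Bochner
  integral in the dual.\<close>

lemma integral_Vd:
  fixes S :: "real set"
  assumes S: "S \<in> sets lebesgue" and f: "strongly_measurable (lebesgue_on S) Vd dnorm f"
    and i: "integrable (lebesgue_on S) (\<lambda>t. dnorm (f t))"
  shows "(\<lambda>v. LINT t|lebesgue_on S. f t v) \<in> Vd"
proof (rule Vd_I[of _ "LINT t|lebesgue_on S. dnorm (f t)"])
  have AEf: "AE t in lebesgue_on S. f t \<in> Vd" using f by (simp add: strongly_measurable_def)
  note m = Vd_apply_measurable[OF S f] and int = Vd_apply_integrable[OF S f i]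
  fix u v assume u: "u \<in> V" and v: "v \<in> V"
  have "(LINT t|lebesgue_on S. f t (\<lambda>x. u x + v x)) = (LINT t|lebesgue_on S. f t u + f t v)"
  proof (rule integral_cong_AE)
    show "AE t in lebesgue_on S. f t (\<lambda>x. u x + v x) = f t u + f t v"
      using AEf by eventually_elim (rule Vd_add[OF _ v u])
  qed (use m V_add u v in auto)
  then show "(LINT t|lebesgue_on S. f t (\<lambda>x. u x + v x)) = (LINT t|lebesgue_on S. f t u) + (LINT t|lebesgue_on S. f t v)"
    using int[OF u] int[OF v] by simp
next
  have AEf: "AE t in lebesgue_on S. f t \<in> Vd" using f by (simp add: strongly_measurable_def)
  note m = Vd_apply_measurable[OF S f]
  fix c u assume u: "u \<in> V"
  have "(LINT t|lebesgue_on S. f t (\<lambda>x. c *\<^sub>R u x)) = (LINT t|lebesgue_on S. c * f t u)"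
  proof (rule integral_cong_AE)
    show "AE t in lebesgue_on S. f t (\<lambda>x. c *\<^sub>R u x) = c * f t u"
      using AEf by eventually_elim (rule Vd_scale[OF _ u])
  qed (use m V_scale u in auto)
  then show "(LINT t|lebesgue_on S. f t (\<lambda>x. c *\<^sub>R u x)) = c * (LINT t|lebesgue_on S. f t u)" by simp
next
  have AEf: "AE t in lebesgue_on S. f t \<in> Vd" using f by (simp add: strongly_measurable_def)
  fix v assume v: "v \<in> V"
  have "\<bar>LINT t|lebesgue_on S. f t v\<bar> \<le> (LINT t|lebesgue_on S. \<bar>f t v\<bar>)" by (rule integral_abs_bound)
  also have "\<dots> \<le> (LINT t|lebesgue_on S. dnorm (f t) * vnorm v)"
  proof (rule integral_mono_AE)
    show "AE t in lebesgue_on S. \<bar>f t v\<bar> \<le> dnorm (f t) * vnorm v"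
      using AEf by eventually_elim (rule dnorm_bound[OF _ v])
  qed (use i Vd_apply_integrable[OF S f i v] in auto)
  finally show "\<bar>LINT t|lebesgue_on S. f t v\<bar> \<le> (LINT t|lebesgue_on S. dnorm (f t)) * vnorm v" by simp
qed

text \<open>Identifies the pointwise integral as the Bochner integral. Approximating simple
  functions are cut off where they exceed \<open>dnorm (f t) + 1\<close>, which gives an integrable
  majorant and convergence in \<open>L^1\<close>. The integrals then converge in the dual norm,
  since tested on \<open>v\<close> their error is at most the \<open>L^1\<close> distance times
  \<open>vnorm v\<close>.\<close>

lemma has_bochner_integral_Vd:
  fixes S :: "real set"
  assumes S: "S \<in> lmeasurable" and f: "strongly_measurable (lebesgue_on S) Vd dnorm f"
    and i: "integrable (lebesgue_on S) (\<lambda>t. dnorm (f t))"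
    and I: "I \<in> Vd" "\<And>v. v \<in> V \<Longrightarrow> I v = (LINT t|lebesgue_on S. f t v)"
  shows "has_bochner_integral_in (lebesgue_on S) Vd dnorm f I"
proof -
  let ?L = "lebesgue_on S"
  have Sl: "S \<in> sets lebesgue" using S by (simp add: fmeasurableD)
  interpret L: finite_measure ?L by (rule finite_measure_lebesgue_on[OF S])
  obtain s where s: "\<And>n. simple_in ?L Vd (s n)" "AE t in ?L. f t \<in> Vd \<and> (\<forall>n. s n t \<in> Vd) \<and> (\<lambda>n. dnorm (\<lambda>p. s n t p - f t p)) \<longlonglongrightarrow> 0"
    by (rule Vd.strongly_measurableE[OF f]) blast
  \<comment> \<open>The margin 1 makes the cut-off inactive for large \<open>n\<close> at almost
    every \<open>t\<close>, also where \<open>dnorm (f t) = 0\<close>.\<close>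
  define r where "r n t = (if dnorm (s n t) \<le> dnorm (f t) + 1 then s n t else (\<lambda>p. 0))" for n t
  have Nf[measurable]: "(\<lambda>t. dnorm (f t)) \<in> borel_measurable ?L" by (rule Vd.N_measurable[OF Sl f])
  have Ns[measurable]: "(\<lambda>t. dnorm (s n t)) \<in> borel_measurable ?L" for n
    using s(1)[of n] simple_function_compose[of ?L "s n" dnorm]
    by (auto simp: simple_in_def comp_def intro: borel_measurable_simple_function)
  have r: "simple_in ?L Vd (r n)" for n
  proof -
    have "{t \<in> space ?L. dnorm (s n t) \<le> dnorm (f t) + 1} \<in> sets ?L" by measurable
    then have "simple_function ?L (r n)"
      unfolding r_def using s(1)[of n] by (intro simple_function_If) (auto simp: simple_in_def)
    then show ?thesis using s(1)[of n] Vd.zero by (auto simp: simple_in_def r_def)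
  qed
  have AEr: "AE t in ?L. f t \<in> Vd \<and> (\<forall>n. r n t \<in> Vd) \<and> (\<forall>n. dnorm (\<lambda>p. r n t p - f t p) \<le> 2 * dnorm (f t) + 1) \<and> (\<lambda>n. dnorm (\<lambda>p. r n t p - f t p)) \<longlonglongrightarrow> 0"
    using s(2)
  proof eventually_elim
    fix t assume a: "f t \<in> Vd \<and> (\<forall>n. s n t \<in> Vd) \<and> (\<lambda>n. dnorm (\<lambda>p. s n t p - f t p)) \<longlonglongrightarrow> 0"
    then have ft: "f t \<in> Vd" and st: "s n t \<in> Vd" and l: "(\<lambda>n. dnorm (\<lambda>p. s n t p - f t p)) \<longlonglongrightarrow> 0" for n by auto
    have rt: "r n t \<in> Vd" for n using st Vd.zero by (simp add: r_def)
    have 1: "dnorm (\<lambda>p. r n t p - f t p) \<le> 2 * dnorm (f t) + 1" for n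
    proof -
      have "dnorm (r n t) \<le> dnorm (f t) + 1" using Vd.N_zero dnorm_nonneg[OF ft] by (simp add: r_def)
      with Vd.N_diff_le[OF rt[of n] ft] show ?thesis by simp
    qed
    have "eventually (\<lambda>n. dnorm (\<lambda>p. s n t p - f t p) < 1) sequentially"
      using order_tendstoD(2)[OF l, of 1] by simp
    then have "eventually (\<lambda>n. dnorm (\<lambda>p. r n t p - f t p) = dnorm (\<lambda>p. s n t p - f t p)) sequentially"
    proof eventually_elim
      fix n assume "dnorm (\<lambda>p. s n t p - f t p) < 1"
      then have "dnorm (s n t) \<le> dnorm (f t) + 1" using Vd.N_abs_diff_le[OF st[of n] ft] by linarith
      then show "dnorm (\<lambda>p. r n t p - f t p) = dnorm (\<lambda>p. s n t p - f t p)" by (simp add: r_def)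
    qed
    then have "(\<lambda>n. dnorm (\<lambda>p. r n t p - f t p)) \<longlonglongrightarrow> 0" using l by (simp add: tendsto_cong)
    then show "f t \<in> Vd \<and> (\<forall>n. r n t \<in> Vd) \<and> (\<forall>n. dnorm (\<lambda>p. r n t p - f t p) \<le> 2 * dnorm (f t) + 1) \<and> (\<lambda>n. dnorm (\<lambda>p. r n t p - f t p)) \<longlonglongrightarrow> 0"
      using ft rt 1 by blast
  qed
  have SMr: "strongly_measurable ?L Vd dnorm (r n)" for n
    unfolding strongly_measurable_def using r[of n] AEr Vd.N_self
    by (auto simp: simple_in_def intro!: AE_I2 exI[of _ "\<lambda>_. r n"])
  have SMd: "strongly_measurable ?L Vd dnorm (\<lambda>t p. r n t p - f t p)" for n
    using Vd.strongly_measurable_add[OF SMr[of n] Vd.strongly_measurable_scale[OF _ f, of "\<lambda>_. -1"]] by simp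
  have Nd[measurable]: "(\<lambda>t. dnorm (\<lambda>p. r n t p - f t p)) \<in> borel_measurable ?L" for n
    by (rule Vd.N_measurable[OF Sl SMd])
  have bi: "integrable ?L (\<lambda>t. 2 * dnorm (f t) + 1)" using i by simp
  have nn: "AE t in ?L. 0 \<le> dnorm (\<lambda>p. r n t p - f t p)" for n
    using AEr by eventually_elim (auto intro!: dnorm_nonneg Vd.diff)
  have Ni: "integrable ?L (\<lambda>t. dnorm (\<lambda>p. r n t p - f t p))" for n
  proof (rule Bochner_Integration.integrable_bound[OF bi Nd])
    show "AE t in ?L. norm (dnorm (\<lambda>p. r n t p - f t p)) \<le> norm (2 * dnorm (f t) + 1)"
      using AEr nn[of n] by eventually_elim (auto intro: order_trans[OF _ abs_ge_self])
  qed
  have "(\<lambda>n. LINT t|?L. dnorm (\<lambda>p. r n t p - f t p)) \<longlonglongrightarrow> (LINT t|?L. 0)"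
  proof (rule integral_dominated_convergence[OF _ _ bi])
    show "AE t in ?L. (\<lambda>n. dnorm (\<lambda>p. r n t p - f t p)) \<longlonglongrightarrow> 0" using AEr by eventually_elim auto
    show "AE t in ?L. norm (dnorm (\<lambda>p. r n t p - f t p)) \<le> 2 * dnorm (f t) + 1" for n
      using AEr nn[of n] by eventually_elim auto
  qed auto
  then have lim: "(\<lambda>n. LINT t|?L. dnorm (\<lambda>p. r n t p - f t p)) \<longlonglongrightarrow> 0" by simp
  have int_r: "simple_integral_in ?L (r n) v = (LINT t|?L. r n t v)" for n v
    unfolding simple_integral_in_def
    using integral_simple_function(2)[of ?L "r n" "\<lambda>l. l v"] r[of n] L.finite_measure_axioms
    by (simp add: simple_in_def)
  have rvi: "integrable ?L (\<lambda>t. r n t v)" for n v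
    using integral_simple_function(1)[of ?L "r n" "\<lambda>l. l v"] r[of n] L.finite_measure_axioms
    by (simp add: simple_in_def)
  have dle: "\<bar>simple_integral_in ?L (r n) v - I v\<bar> \<le> (LINT t|?L. dnorm (\<lambda>p. r n t p - f t p)) * vnorm v" if v: "v \<in> V" for n v
  proof -
    have fvi: "integrable ?L (\<lambda>t. f t v)" by (rule Vd_apply_integrable[OF Sl f i v])
    have "simple_integral_in ?L (r n) v - I v = (LINT t|?L. r n t v - f t v)"
      using rvi[of n v] fvi by (simp add: int_r I(2)[OF v])
    also have "\<bar>\<dots>\<bar> \<le> (LINT t|?L. \<bar>r n t v - f t v\<bar>)" by (rule integral_abs_bound)
    also have "\<dots> \<le> (LINT t|?L. dnorm (\<lambda>p. r n t p - f t p) * vnorm v)"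
    proof (rule integral_mono_AE)
      show "AE t in ?L. \<bar>r n t v - f t v\<bar> \<le> dnorm (\<lambda>p. r n t p - f t p) * vnorm v"
        using AEr by eventually_elim (use dnorm_bound[OF Vd.diff v] in blast)
    qed (use rvi[of n v] fvi Ni[of n] in auto)
    finally show ?thesis by simp
  qed
  have dn_nn: "0 \<le> (LINT t|?L. dnorm (\<lambda>p. r n t p - f t p))" for n
    by (rule integral_nonneg_AE[OF nn])
  have JVd: "(\<lambda>v. simple_integral_in ?L (r n) v - I v) \<in> Vd" for n
  proof -
    have "(\<lambda>v. LINT t|?L. r n t v) \<in> Vd"
      by (rule integral_Vd[OF Sl SMr]) (use integral_simple_function(1)[of ?L "r n" dnorm] r[of n] L.finite_measure_axioms in \<open>simp add: simple_in_def\<close>)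
    from Vd.diff[OF this I(1)] show ?thesis by (simp add: int_r)
  qed
  show ?thesis
    unfolding has_bochner_integral_in_def
  proof (intro conjI f I(1) exI[of _ r] allI r)
    have "(\<integral>\<^sup>+ t. ennreal (dnorm (\<lambda>p. r n t p - f t p)) \<partial>?L) = ennreal (LINT t|?L. dnorm (\<lambda>p. r n t p - f t p))" for n
      by (rule nn_integral_eq_integral[OF Ni nn])
    then show "(\<lambda>n. \<integral>\<^sup>+ t. ennreal (dnorm (\<lambda>p. r n t p - f t p)) \<partial>?L) \<longlonglongrightarrow> 0"
      using tendsto_ennrealI[OF lim] by simp
    show "(\<lambda>n. dnorm (\<lambda>p. simple_integral_in ?L (r n) p - I p)) \<longlonglongrightarrow> 0"
      by (rule tendsto_sandwich[OF _ _ tendsto_const lim])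
        (auto intro!: always_eventually dnorm_nonneg JVd dnorm_le dle dn_nn)
  qed
qed

end

section \<open>Construction of the solution\<close>

text \<open>The coefficient system lives on the closed time interval and the Bochner spaces on the
  open one; the endpoints do not affect integrals.\<close>

lemma integrable_Ioo_if_Icc:
  fixes f :: "real \<Rightarrow> real"
  assumes "f absolutely_integrable_on {a..b}"
  shows "integrable (lebesgue_on {a<..<b}) f" "(LINT t|lebesgue_on {a<..<b}. f t) = integral {a..b} f"
proof -
  have "set_integrable lebesgue {a<..<b} f"
    by (rule set_integrable_subset[OF assms]) auto
  then show i: "integrable (lebesgue_on {a<..<b}) f"
    by (simp add: set_integrable_def integrable_restrict_space)
  have "(LINT t|lebesgue_on {a<..<b}. f t) = integral {a<..<b} f"
    by (rule lebesgue_integral_eq_integral[OF i]) simp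
  then show "(LINT t|lebesgue_on {a<..<b}. f t) = integral {a..b} f"
    by (simp add: integral_open_interval_real)
qed

lemma absolutely_integrable_Icc_if_Ioo:
  fixes f :: "real \<Rightarrow> real"
  assumes "integrable (lebesgue_on {a<..<b}) f"
  shows "(\<lambda>t. if t \<in> {a<..<b} then f t else 0) absolutely_integrable_on {a..b}"
proof -
  have "integrable lebesgue (\<lambda>t. indicator {a<..<b} t *\<^sub>R f t)"
    using assms by (simp add: integrable_restrict_space)
  then show ?thesis
    unfolding set_integrable_def
    by (rule back_subst[of "integrable lebesgue"]) (auto simp: indicator_def fun_eq_iff)
qed

lemma AE_Ioo_if_Icc:
  fixes a b :: real
  assumes "AE t in lebesgue_on {a..b}. P t"
  shows "AE t in lebesgue_on {a<..<b}. P t"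
  using assms by (simp add: AE_restrict_space_iff) (auto elim: eventually_mono)

lemma suminf_tail_tendsto_0:
  fixes h :: "nat \<Rightarrow> real"
  assumes "summable h"
  shows "(\<lambda>n. \<Sum>k. h (k + n)) \<longlonglongrightarrow> 0"
proof -
  have "(\<lambda>n. suminf h - (\<Sum>k<n. h k)) \<longlonglongrightarrow> suminf h - suminf h"
    by (intro tendsto_diff tendsto_const summable_LIMSEQ[OF assms])
  then show ?thesis by (simp add: suminf_minus_initial_segment[OF assms])
qed

lemma test_function_real:
  fixes \<phi> :: "real \<Rightarrow> real"
  assumes "\<phi> \<in> test_functions {0<..<T}"
  shows "(\<phi> has_real_derivative deriv \<phi> t) (at t)" "continuous_on UNIV \<phi>" "continuous_on UNIV (deriv \<phi>)"
    "\<phi> 0 = 0" "\<phi> T = 0"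
proof -
  have s: "Ck (Suc 0) \<phi>" and supp: "closure {x. \<phi> x \<noteq> 0} \<subseteq> {0<..<T}"
    using assms by (auto simp: test_functions_def smooth_def simp del: Ck.simps)
  have d: "\<phi> differentiable (at x)" for x using s by simp
  then have fd: "(\<phi> has_real_derivative deriv \<phi> x) (at x)" for x
    using DERIV_deriv_iff_real_differentiable by blast
  then show "(\<phi> has_real_derivative deriv \<phi> t) (at t)" .
  then show "continuous_on UNIV \<phi>"
    using fd by (meson DERIV_isCont continuous_at_imp_continuous_on)
  have "frechet_derivative \<phi> (at x) 1 = deriv \<phi> x" for x
    unfolding frechet_derivative_at[OF fd[of x, unfolded has_field_derivative_def], symmetric] by simp
  then show "continuous_on UNIV (deriv \<phi>)" using s by simp
  have "x \<in> {0<..<T}" if "\<phi> x \<noteq> 0" for x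
    by (rule subsetD[OF supp subsetD[OF closure_subset]]) (simp add: that)
  then show "\<phi> 0 = 0" "\<phi> T = 0" by fastforce+
qed

context rectangle
begin

section \<open>The coefficient system of the fluid problem\<close>

text \<open>Coefficients determine a field only up to a null set. Fixing one representative per
  sequence makes the solution a function of its coefficients.\<close>

definition synth :: "(nat \<Rightarrow> real) \<Rightarrow> field" where
  "synth c = (SOME U. U \<in> V \<and> (\<forall>n. coef U n = c n))"

lemma synth:
  assumes "summable (\<lambda>n. lam n * (c n)\<^sup>2)"
  shows "synth c \<in> V" "coef (synth c) n = c n"
proof -
  obtain U where "U \<in> V" "\<And>n. coef U n = c n" by (rule realization[OF assms]) blast
  then have "\<exists>U. U \<in> V \<and> (\<forall>n. coef U n = c n)" by blast
  from someI_ex[OF this] show "synth c \<in> V" "coef (synth c) n = c n" unfolding synth_def by auto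
qed

lemma b_form_expand:
  assumes u: "u \<in> V" and w: "w \<in> V"
  shows "b_form a b u (expand n c) w = (\<Sum>k<n. c k * b_form a b u (wf k) w)"
proof (induction n)
  case 0
  show ?case using b_form_scale(2)[OF u w w, of 0] by (simp add: expand_def)
next
  case (Suc n)
  then show ?case
    by (simp add: expand_Suc b_form_add(2)[OF u expand_V w V_scale[OF w_V]] b_form_scale(2)[OF u w_V w])
qed

text \<open>Coefficient \<open>k\<close> of \<open>- B u\<close>: antisymmetry turns
  \<open>- b(u, u, w)\<close> into \<open>b(u, w, u)\<close> with \<open>w\<close> the eigenfield of
  index \<open>k\<close>. The value 0 is a default for sequences that do not come from
  \<open>V\<close>.\<close>

definition nonlin :: "nat \<Rightarrow> (nat \<Rightarrow> real) \<Rightarrow> real" where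
  "nonlin k c = (if summable (\<lambda>n. lam n * (c n)\<^sup>2) then b_form a b (synth c) (wf k) (synth c) else 0)"

lemma fin_eq_suminf:
  assumes "v \<in> V" "\<And>n. coef v n = c n"
  shows "fin v v = (\<Sum>n. (c n)\<^sup>2)"
  using V_expansion(4)[OF assms(1)] unfolding assms(2) by (rule sums_unique)

text \<open>With \<open>D\<close> the difference of the two fields, the quadratic expressions differ
  by \<open>b(D, w, U) + b(W, w, D)\<close>. Both terms are estimated with the derivative on the
  eigenfield, and Parseval turns the \<open>L^2\<close> norms into sums of squares.\<close>

lemma nonlin_lip:
  assumes c: "summable (\<lambda>n. lam n * (c n)\<^sup>2)" and d: "summable (\<lambda>n. lam n * (d n)\<^sup>2)"
  shows "\<bar>nonlin k c - nonlin k d\<bar> \<le> 4 * (\<bar>nrm k\<bar> * lam k) * sqrt (\<Sum>i. (c i - d i)\<^sup>2) * (sqrt (\<Sum>i. (c i)\<^sup>2) + sqrt (\<Sum>i. (d i)\<^sup>2))"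
proof -
  let ?U = "synth c" and ?W = "synth d" and ?C = "4 * (\<bar>nrm k\<bar> * lam k)"
  let ?D = "\<lambda>x. ?U x - ?W x"
  note U = synth(1)[OF c] and W = synth(1)[OF d]
  have D: "?D \<in> V" by (rule V_diff[OF U W])
  have f: "fin ?U ?U = (\<Sum>i. (c i)\<^sup>2)" "fin ?W ?W = (\<Sum>i. (d i)\<^sup>2)" "fin ?D ?D = (\<Sum>i. (c i - d i)\<^sup>2)"
    by (intro fin_eq_suminf U W D synth(2) c d, intro fin_eq_suminf U W D synth(2) c d)
      (rule fin_eq_suminf[OF D], simp add: coef_diff U W synth(2)[OF c] synth(2)[OF d])
  have e: "nonlin k c - nonlin k d = b_form a b ?D (wf k) ?U + b_form a b ?W (wf k) ?D"
    using c d by (simp add: nonlin_def b_form_diff(1)[OF U w_V U W] b_form_diff(3)[OF W w_V U W])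
  have "\<bar>b_form a b ?D (wf k) ?U + b_form a b ?W (wf k) ?D\<bar>
      \<le> ?C * sqrt (fin ?D ?D) * sqrt (fin ?U ?U) + ?C * sqrt (fin ?W ?W) * sqrt (fin ?D ?D)"
    by (intro order_trans[OF abs_triangle_ineq add_mono] b_form_w_bound D U W)
  then show ?thesis unfolding e f by (simp only: distrib_left mult.assoc mult.commute[of "sqrt (\<Sum>i. (d i)\<^sup>2)"])
qed

lemma nonlin_zero: "nonlin k (\<lambda>i. 0) = 0"
proof -
  have s: "summable (\<lambda>n. lam n * (0::real)\<^sup>2)" by simp
  note U = synth(1)[OF s]
  have "fin (synth (\<lambda>i. 0)) (synth (\<lambda>i. 0)) = 0"
    using fin_eq_suminf[OF U synth(2)[OF s]] by simp
  then show ?thesis using b_form_w_bound[OF U U, of k] by (simp add: nonlin_def)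
qed

text \<open>The sum is \<open>b(U, E, U)\<close>, where \<open>E\<close> is the finite expansion and
  \<open>U\<close> the chosen field with the same coefficients. They differ by a field of seminorm
  0, and \<open>b(U, U, U)\<close> vanishes by antisymmetry.\<close>

lemma nonlin_cancel:
  assumes c: "\<And>k. n \<le> k \<Longrightarrow> c k = 0"
  shows "(\<Sum>k<n. c k * nonlin k c) = 0"
proof -
  have s: "summable (\<lambda>k. lam k * (c k)\<^sup>2)"
    by (rule summable_finite[of "{..<n}"]) (use c in auto)
  let ?U = "synth c" and ?E = "expand n c"
  note U = synth(1)[OF s]
  have D: "(\<lambda>x. ?E x - ?U x) \<in> V" by (rule V_diff[OF expand_V U])
  have "coef (\<lambda>x. ?E x - ?U x) k = 0" for k
    using c by (simp add: coef_diff[OF expand_V U] synth(2)[OF s] coef_expand)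
  then have "vnorm (\<lambda>x. ?E x - ?U x) = 0"
    by (simp add: V_norm_eq[OF D] V_expansion(3)[OF D])
  then have "\<bar>b_form a b ?U (\<lambda>x. ?E x - ?U x) ?U\<bar> \<le> 0"
    using b_form_bound[OF U D U] by simp
  then have "b_form a b ?U ?E ?U = 0"
    by (simp add: b_form_diff(2)[OF U expand_V U U] b_form_self[OF U U])
  then show ?thesis by (simp add: b_form_expand[OF U U] nonlin_def s)
qed

text \<open>The field with coefficients \<open>l (wf k) / lam k\<close> is the truncated Riesz
  representative of \<open>l\<close>: both the value of \<open>l\<close> on it and its squared norm
  in \<open>V\<close> equal the sum \<open>S\<close>. Hence
  \<open>S \<le> dnorm l * sqrt S\<close>.\<close>

lemma Vd_Bessel:
  assumes l: "l \<in> Vd"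
  shows "(\<Sum>k<n. (l (wf k))\<^sup>2 / lam k) \<le> (dnorm l)\<^sup>2"
proof -
  define S where "S = (\<Sum>k<n. (l (wf k))\<^sup>2 / lam k)"
  let ?v = "expand n (\<lambda>k. l (wf k) / lam k)"
  have S0: "0 \<le> S" unfolding S_def by (intro sum_nonneg divide_nonneg_nonneg) (auto simp: less_imp_le[OF lam_pos])
  have "l ?v = S" unfolding Vd_expand[OF l] S_def by (simp add: power2_eq_square)
  moreover have "vin ?v ?v = S"
    unfolding expand_norms S_def using lam_pos by (intro sum.cong refl) (simp add: power_divide power2_eq_square less_imp_neq[symmetric])
  ultimately have "S \<le> dnorm l * sqrt S"
    using dnorm_bound[OF l expand_V, of n "\<lambda>k. l (wf k) / lam k"] S0 by (simp add: V_norm_eq[OF expand_V])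
  then have "sqrt S * sqrt S \<le> dnorm l * sqrt S" using S0 by simp
  then have "sqrt S \<le> dnorm l" 
    using dnorm_nonneg[OF l] S0 by (cases "S = 0") (auto simp only: mult_le_cancel_right real_sqrt_zero real_sqrt_gt_0_iff)
  then have "(sqrt S)\<^sup>2 \<le> (dnorm l)\<^sup>2" using S0 by (intro power_mono) auto
  then show ?thesis using S0 by (simp add: S_def)
qed

text \<open>Approximants must take finitely many values in \<open>V\<close>. Finitely many modes are
  kept and their coefficients rounded, and the uniform bound \<open>B\<close> leaves only finitely
  many rounded values. The discarded modes are the tail of a convergent weighted series.\<close>

lemma strongly_measurable_synth:
  fixes S :: "real set"
  assumes S: "S \<in> sets lebesgue" and c: "\<And>k. c k \<in> borel_measurable (lebesgue_on S)"
    and bdd: "\<And>k t. t \<in> S \<Longrightarrow> \<bar>c k t\<bar> \<le> B"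
    and s: "AE t in lebesgue_on S. summable (\<lambda>k. lam k * (c k t)\<^sup>2)"
  shows "strongly_measurable (lebesgue_on S) V vnorm (\<lambda>t. synth (\<lambda>k. c k t))"
proof -
  \<comment> \<open>Rounding the first \<open>n\<close> coefficients to multiples of \<open>1 / L n\<close> costs at most \<open>1 / (n + 1)\<close> in the squared norm.\<close>
  define L where "L n = real (Suc n) * (1 + (\<Sum>k<n. lam k))" for n
  define r where "r n k t = real_of_int \<lfloor>c k t * L n\<rfloor> / L n" for n k t
  have lsum: "0 \<le> (\<Sum>k<n. lam k)" for n by (intro sum_nonneg) (simp add: less_imp_le[OF lam_pos])
  have L: "0 < L n" for n unfolding L_def using lsum[of n] by (intro mult_pos_pos) auto
  have simple_r: "simple_function (lebesgue_on S) (r n k)" for n k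
  proof (rule simple_function_borel_measurable)
    show "r n k \<in> borel_measurable (lebesgue_on S)" unfolding r_def using c[of k] by measurable
    have "r n k ` S \<subseteq> (\<lambda>z. real_of_int z / L n) ` {- \<lceil>B * L n\<rceil> - 1 .. \<lceil>B * L n\<rceil>}"
    proof (rule image_subsetI)
      fix t assume "t \<in> S"
      then have "\<bar>c k t * L n\<bar> \<le> B * L n" using bdd[of t k] L[of n] by (simp add: abs_mult mult_right_mono)
      then have "\<lfloor>c k t * L n\<rfloor> \<in> {- \<lceil>B * L n\<rceil> - 1 .. \<lceil>B * L n\<rceil>}" by (simp add: abs_le_iff) linarith
      then show "r n k t \<in> (\<lambda>z. real_of_int z / L n) ` {- \<lceil>B * L n\<rceil> - 1 .. \<lceil>B * L n\<rceil>}"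
        unfolding r_def by blast
    qed
    then show "finite (r n k ` space (lebesgue_on S))" by (simp add: finite_subset)
  qed
  have "simple_function (lebesgue_on S) (\<lambda>t. expand m (\<lambda>k. r n k t))" for n m
  proof (induction m)
    case 0
    show ?case by (simp add: expand_def)
  next
    case (Suc m)
    from simple_function_compose2[OF this simple_r[of n m], of "\<lambda>u z x. u x + z *\<^sub>R wf m x"]
    show ?case by (simp add: expand_Suc)
  qed
  then have simp_in: "simple_in (lebesgue_on S) V (\<lambda>t. expand n (\<lambda>k. r n k t))" for n
    by (auto simp: simple_in_def expand_V)
  show ?thesis
  proof (rule V.strongly_measurableI[OF simp_in])
    show "AE t in lebesgue_on S. synth (\<lambda>k. c k t) \<in> V \<and> (\<lambda>n. vnorm (\<lambda>p. expand n (\<lambda>k. r n k t) p - synth (\<lambda>k. c k t) p)) \<longlonglongrightarrow> 0"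
      using s
    proof eventually_elim
      fix t assume s: "summable (\<lambda>k. lam k * (c k t)\<^sup>2)"
      let ?U = "synth (\<lambda>k. c k t)"
      note U = synth(1)[OF s]
      define h where "h k = lam k * (c k t)\<^sup>2" for k
      have h: "summable h" unfolding h_def by (rule s)
      have le: "vin (\<lambda>p. expand n (\<lambda>k. r n k t) p - ?U p) (\<lambda>p. expand n (\<lambda>k. r n k t) p - ?U p) \<le> 1 / real (Suc n) + (\<Sum>k. h (k + n))" for n
      proof -
        let ?D = "\<lambda>p. expand n (\<lambda>k. r n k t) p - ?U p"
        have D: "?D \<in> V" by (rule V_diff[OF expand_V U])
        have cd: "coef ?D k = (if k < n then r n k t else 0) - c k t" for k
          by (simp add: coef_diff[OF expand_V U] synth(2)[OF s] coef_expand)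
        have tail: "(\<Sum>k. lam (k + n) * (coef ?D (k + n))\<^sup>2) = (\<Sum>k. h (k + n))"
          by (simp add: cd h_def)
        have rc: "\<bar>r n k t - c k t\<bar> \<le> 1 / L n" for k
        proof -
          have "\<bar>real_of_int \<lfloor>c k t * L n\<rfloor> - c k t * L n\<bar> \<le> 1" by linarith
          then have "\<bar>real_of_int \<lfloor>c k t * L n\<rfloor> - c k t * L n\<bar> / L n \<le> 1 / L n" using L[of n] by (intro divide_right_mono) auto
          also have "\<bar>real_of_int \<lfloor>c k t * L n\<rfloor> - c k t * L n\<bar> / L n = \<bar>r n k t - c k t\<bar>"
            using L[of n] by (subst abs_div_pos) (auto simp: r_def diff_divide_distrib)
          finally show ?thesis .
        qed
        have "(\<Sum>k<n. lam k * (coef ?D k)\<^sup>2) \<le> (\<Sum>k<n. lam k * (1 / L n)\<^sup>2)"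
        proof (intro sum_mono mult_left_mono)
          fix k assume "k \<in> {..<n}"
          then have "(coef ?D k)\<^sup>2 = \<bar>r n k t - c k t\<bar>\<^sup>2" by (simp add: cd)
          also have "\<dots> \<le> (1 / L n)\<^sup>2" by (intro power_mono rc) simp
          finally show "(coef ?D k)\<^sup>2 \<le> (1 / L n)\<^sup>2" .
        qed (simp add: less_imp_le[OF lam_pos])
        also have "\<dots> = ((\<Sum>k<n. lam k) / L n) * (1 / L n)"
          by (simp add: sum_distrib_right[symmetric] sum_divide_distrib[symmetric] power2_eq_square)
        also have "\<dots> \<le> 1 * (1 / real (Suc n))"
        proof (intro mult_mono)
          have "1 * (\<Sum>k<n. lam k) \<le> L n" unfolding L_def using lsum[of n] by (intro mult_mono) auto
          then show "(\<Sum>k<n. lam k) / L n \<le> 1" using L[of n] by simp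
          have "real (Suc n) * 1 \<le> L n" unfolding L_def using lsum[of n] by (intro mult_left_mono) auto
          then show "1 / L n \<le> 1 / real (Suc n)" by (intro divide_left_mono mult_pos_pos L) auto
        qed (use L[of n] in auto)
        finally have head: "(\<Sum>k<n. lam k * (coef ?D k)\<^sup>2) \<le> 1 / real (Suc n)" by simp
        have "vin ?D ?D = (\<Sum>k. lam (k + n) * (coef ?D (k + n))\<^sup>2) + (\<Sum>k<n. lam k * (coef ?D k)\<^sup>2)"
          unfolding V_expansion(3)[OF D] by (rule suminf_split_initial_segment[OF V_expansion(1)[OF D]])
        then show ?thesis using head tail by linarith
      qed
      have lim: "(\<lambda>n. 1 / real (Suc n) + (\<Sum>k. h (k + n))) \<longlonglongrightarrow> 0 + 0"
        by (intro tendsto_add suminf_tail_tendsto_0[OF h] LIMSEQ_Suc lim_inverse_n')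
      have "(\<lambda>n. vin (\<lambda>p. expand n (\<lambda>k. r n k t) p - ?U p) (\<lambda>p. expand n (\<lambda>k. r n k t) p - ?U p)) \<longlonglongrightarrow> 0"
        by (rule tendsto_sandwich[OF _ _ tendsto_const lim[unfolded add_0]])
          (intro always_eventually allI fin_vin_nonneg le)+
      from tendsto_real_sqrt[OF this]
      have "(\<lambda>n. vnorm (\<lambda>p. expand n (\<lambda>k. r n k t) p - ?U p)) \<longlonglongrightarrow> 0"
        unfolding V_norm_eq[OF V_diff[OF expand_V U]] by simp
      with U show "?U \<in> V \<and> (\<lambda>n. vnorm (\<lambda>p. expand n (\<lambda>k. r n k t) p - ?U p)) \<longlonglongrightarrow> 0" by blast
    qed
  qed
qed

lemma H_space_component_L2:
  assumes "u \<in> H_space a b"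
  shows "(\<lambda>x. u x $ j) \<in> L2 R"
proof -
  have u: "u \<in> borel_measurable M" "integrable M (\<lambda>x. (norm (u x))\<^sup>2)"
    using assms by (auto simp: H_space_def L2_def)
  have m: "(\<lambda>x. u x $ j) \<in> borel_measurable M"
    using borel_measurable_continuous_on[OF _ u(1), of "\<lambda>y. y $ j"] by (simp add: continuous_intros)
  have "integrable M (\<lambda>x. (u x $ j)\<^sup>2)"
  proof (rule Bochner_Integration.integrable_bound[OF u(2)])
    show "(\<lambda>x. (u x $ j)\<^sup>2) \<in> borel_measurable M" using m by measurable
    show "AE x in M. norm ((u x $ j)\<^sup>2) \<le> norm ((norm (u x))\<^sup>2)"
    proof (rule AE_I2)
      fix x
      have "\<bar>u x $ j\<bar>\<^sup>2 \<le> (norm (u x))\<^sup>2" by (intro power_mono component_le_norm_cart) simp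
      then show "norm ((u x $ j)\<^sup>2) \<le> norm ((norm (u x))\<^sup>2)" by simp
    qed
  qed
  with m show ?thesis by (simp add: L2_real_iff)
qed

section \<open>Time continuity, initial value and time derivative\<close>

text \<open>A square summable sequence acts on \<open>V\<close> through its pairing with
  coefficients, whether or not it comes from a field in \<open>V\<close>. Splitting each product
  into factors with \<open>sqrt (lam k)\<close> below and above gives the dual norm bound by
  Cauchy-Schwarz.\<close>

lemma series_functional:
  assumes d: "summable (\<lambda>k. (d k)\<^sup>2)"
  shows "v \<in> V \<Longrightarrow> summable (\<lambda>k. d k * coef v k)"
    "v \<in> V \<Longrightarrow> \<bar>\<Sum>k. d k * coef v k\<bar> \<le> sqrt (\<Sum>k. (d k)\<^sup>2 / lam k) * vnorm v"
    "summable (\<lambda>k. (d k)\<^sup>2 / lam k)"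
    "(\<lambda>v. \<Sum>k. d k * coef v k) \<in> Vd"
proof -
  have sl: "summable (\<lambda>k. (d k)\<^sup>2 / lam k)"
  proof (rule summable_comparison_test'[of "\<lambda>k. (d k)\<^sup>2 / lam0" 0])
    show "summable (\<lambda>k. (d k)\<^sup>2 / lam0)" by (rule summable_divide[OF d])
    show "norm ((d k)\<^sup>2 / lam k) \<le> (d k)\<^sup>2 / lam0" for k
      using lam0 lam_pos[of k] by (auto intro!: divide_left_mono mult_pos_pos)
  qed
  then show "summable (\<lambda>k. (d k)\<^sup>2 / lam k)" .
  show S: "summable (\<lambda>k. d k * coef v k)" if v: "v \<in> V" for v
  proof (rule summable_comparison_test'[of "\<lambda>k. (d k)\<^sup>2 + (coef v k)\<^sup>2" 0])
    show "summable (\<lambda>k. (d k)\<^sup>2 + (coef v k)\<^sup>2)"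
      using V_expansion(4)[OF v] by (intro summable_add d) (rule sums_summable)
    show "norm (d k * coef v k) \<le> (d k)\<^sup>2 + (coef v k)\<^sup>2" for k
      using sum_squares_bound[of "\<bar>d k\<bar>" "\<bar>coef v k\<bar>"] abs_ge_zero[of "d k * coef v k"]
      unfolding real_norm_def abs_mult power2_abs by linarith
  qed
  show bnd: "\<bar>\<Sum>k. d k * coef v k\<bar> \<le> sqrt (\<Sum>k. (d k)\<^sup>2 / lam k) * vnorm v" if v: "v \<in> V" for v
  proof (rule LIMSEQ_le_const2)
    show "(\<lambda>n. \<bar>\<Sum>k<n. d k * coef v k\<bar>) \<longlonglongrightarrow> \<bar>\<Sum>k. d k * coef v k\<bar>"
      by (intro tendsto_rabs summable_LIMSEQ S v)
    have "\<bar>\<Sum>k<n. d k * coef v k\<bar> \<le> sqrt (\<Sum>k. (d k)\<^sup>2 / lam k) * vnorm v" for n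
    proof -
      have "\<bar>\<Sum>k<n. d k * coef v k\<bar> \<le> (\<Sum>k<n. \<bar>d k / sqrt (lam k)\<bar> * \<bar>sqrt (lam k) * coef v k\<bar>)"
      proof (rule order_trans[OF sum_abs], rule sum_mono)
        fix k
        show "\<bar>d k * coef v k\<bar> \<le> \<bar>d k / sqrt (lam k)\<bar> * \<bar>sqrt (lam k) * coef v k\<bar>"
          using lam_pos[of k] by (simp add: abs_mult)
      qed
      also have "\<dots> \<le> L2_set (\<lambda>k. d k / sqrt (lam k)) {..<n} * L2_set (\<lambda>k. sqrt (lam k) * coef v k) {..<n}"
        by (rule L2_set_mult_ineq)
      also have "\<dots> = sqrt (\<Sum>k<n. (d k)\<^sup>2 / lam k) * sqrt (\<Sum>k<n. lam k * (coef v k)\<^sup>2)"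
        using lam_pos by (simp add: L2_set_def power_divide power_mult_distrib less_imp_le)
      also have "\<dots> \<le> sqrt (\<Sum>k. (d k)\<^sup>2 / lam k) * vnorm v"
        unfolding V_norm_eq[OF v] using lam_pos
        by (intro mult_mono real_sqrt_le_mono sum_le_suminf[OF sl] Bessel_V v)
          (auto simp: less_imp_le fin_vin_nonneg intro!: suminf_nonneg[OF sl] sum_nonneg)
      finally show ?thesis .
    qed
    then show "\<exists>N. \<forall>n\<ge>N. \<bar>\<Sum>k<n. d k * coef v k\<bar> \<le> sqrt (\<Sum>k. (d k)\<^sup>2 / lam k) * vnorm v" by blast
  qed
  show "(\<lambda>v. \<Sum>k. d k * coef v k) \<in> Vd"
  proof (rule Vd_I[OF _ _ bnd])
    fix u v assume "u \<in> V" "v \<in> V"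
    then show "(\<Sum>k. d k * coef (\<lambda>x. u x + v x) k) = (\<Sum>k. d k * coef u k) + (\<Sum>k. d k * coef v k)"
      by (simp add: coef_add distrib_left suminf_add S)
  next
    fix c u assume "u \<in> V"
    then show "(\<Sum>k. d k * coef (\<lambda>x. c *\<^sub>R u x) k) = c * (\<Sum>k. d k * coef u k)"
      by (simp add: coef_scale mult.left_commute suminf_mult S)
  qed
qed

text \<open>Continuity of the single coefficients together with a uniform energy bound gives
  continuity in the dual norm: the weights \<open>1 / lam k\<close> make the tail uniformly small,
  and the head is a finite sum.\<close>

lemma weighted_suminf_tendsto_0:
  fixes c :: "nat \<Rightarrow> real \<Rightarrow> real"
  assumes cont: "\<And>k. continuous_on {0..T} (c k)" and s: "\<And>t. t \<in> {0..T} \<Longrightarrow> summable (\<lambda>k. (c k t)\<^sup>2)"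
    and K: "\<And>t. t \<in> {0..T} \<Longrightarrow> (\<Sum>k. (c k t)\<^sup>2) \<le> K" and t: "t \<in> {0..T}"
  shows "((\<lambda>s. \<Sum>k. (c k s - c k t)\<^sup>2 / lam k) \<longlongrightarrow> 0) (at t within {0..T})"
proof (rule order_tendstoI)
  have sd: "summable (\<lambda>k. (c k s - c k t)\<^sup>2)" and le4: "(\<Sum>k. (c k s - c k t)\<^sup>2) \<le> 4 * K" if "s \<in> {0..T}" for s
  proof -
    have le: "(c k s - c k t)\<^sup>2 \<le> 2 * (c k s)\<^sup>2 + 2 * (c k t)\<^sup>2" for k
      by (rule power2_diff_le)
    have S: "summable (\<lambda>k. 2 * (c k s)\<^sup>2 + 2 * (c k t)\<^sup>2)"
      by (intro summable_add summable_mult s that t)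
    show sd: "summable (\<lambda>k. (c k s - c k t)\<^sup>2)"
      by (rule summable_comparison_test'[OF S, of 0]) (use le in simp)
    have "(\<Sum>k. (c k s - c k t)\<^sup>2) \<le> (\<Sum>k. 2 * (c k s)\<^sup>2 + 2 * (c k t)\<^sup>2)" by (rule suminf_le[OF le sd S])
    also have "\<dots> = 2 * (\<Sum>k. (c k s)\<^sup>2) + 2 * (\<Sum>k. (c k t)\<^sup>2)"
      by (subst suminf_add[symmetric]) (auto intro!: summable_mult s that t simp: suminf_mult[OF s[OF that]] suminf_mult[OF s[OF t]])
    finally show "(\<Sum>k. (c k s - c k t)\<^sup>2) \<le> 4 * K" using K[OF that] K[OF t] by linarith
  qed
  have K0: "0 \<le> K" using order_trans[OF suminf_nonneg[OF s[OF t]] K[OF t]] by simp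
  note sf = series_functional(3)[OF sd]
  show "\<forall>\<^sub>F s in at t within {0..T}. e < (\<Sum>k. (c k s - c k t)\<^sup>2 / lam k)" if "e < 0" for e
    unfolding eventually_at_filter
  proof (intro always_eventually allI impI)
    fix s assume "s \<in> {0..T}"
    then have "0 \<le> (\<Sum>k. (c k s - c k t)\<^sup>2 / lam k)"
      by (intro suminf_nonneg[OF sf] divide_nonneg_nonneg) (auto simp: less_imp_le[OF lam_pos])
    with that show "e < (\<Sum>k. (c k s - c k t)\<^sup>2 / lam k)" by linarith
  qed
  fix e :: real assume e: "0 < e"
  \<comment> \<open>Makes the tail bound \<open>4 * K / \<Lambda>\<close> smaller than
    \<open>e / 2\<close>; the summand 1 gives strictness and positivity.\<close>
  define \<Lambda> where "\<Lambda> = 8 * K / e + 1"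
  have \<Lambda>: "0 < \<Lambda>" "4 * K / \<Lambda> < e / 2" using e K0 by (auto simp: \<Lambda>_def field_simps add_pos_nonneg)
  obtain N where N: "\<And>k. N \<le> k \<Longrightarrow> \<Lambda> \<le> lam k"
    using lam_tendsto unfolding filterlim_at_top eventually_sequentially by blast
  have "((\<lambda>s. \<Sum>k<N. (c k s - c k t)\<^sup>2 / lam k) \<longlongrightarrow> (\<Sum>k<N. (c k t - c k t)\<^sup>2 / lam k)) (at t within {0..T})"
    using cont t lam_pos by (intro tendsto_sum tendsto_divide tendsto_power tendsto_diff tendsto_const)
      (auto simp: continuous_on_def less_imp_neq[symmetric])
  then have "\<forall>\<^sub>F s in at t within {0..T}. (\<Sum>k<N. (c k s - c k t)\<^sup>2 / lam k) < e / 2"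
    using order_tendstoD(2)[of _ "0 :: real" _ "e / 2"] e by simp
  moreover have "\<forall>\<^sub>F s in at t within {0..T}. s \<in> {0..T}" by (simp add: eventually_at_filter)
  ultimately show "\<forall>\<^sub>F s in at t within {0..T}. (\<Sum>k. (c k s - c k t)\<^sup>2 / lam k) < e"
  proof eventually_elim
    fix s assume h: "(\<Sum>k<N. (c k s - c k t)\<^sup>2 / lam k) < e / 2" and st: "s \<in> {0..T}"
    note sd = sd[OF st] and sf = sf[OF st]
    have "(\<Sum>k. (c (k + N) s - c (k + N) t)\<^sup>2 / lam (k + N)) \<le> (\<Sum>k. (c (k + N) s - c (k + N) t)\<^sup>2 / \<Lambda>)"
    proof (rule suminf_le)
      show "summable (\<lambda>k. (c (k + N) s - c (k + N) t)\<^sup>2 / lam (k + N))" using sf by (rule summable_ignore_initial_segment)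
      show "summable (\<lambda>k. (c (k + N) s - c (k + N) t)\<^sup>2 / \<Lambda>)"
        using summable_ignore_initial_segment[OF sd] by (rule summable_divide)
      show "(c (k + N) s - c (k + N) t)\<^sup>2 / lam (k + N) \<le> (c (k + N) s - c (k + N) t)\<^sup>2 / \<Lambda>" for k
        using N[of "k + N"] \<Lambda>(1) lam_pos[of "k + N"] by (intro divide_left_mono mult_pos_pos) auto
    qed
    also have "\<dots> = (\<Sum>k. (c (k + N) s - c (k + N) t)\<^sup>2) / \<Lambda>"
      by (rule suminf_divide[OF summable_ignore_initial_segment[OF sd]])
    also have "\<dots> \<le> 4 * K / \<Lambda>"
    proof (rule divide_right_mono)
      have "(\<Sum>k. (c k s - c k t)\<^sup>2) = (\<Sum>k. (c (k + N) s - c (k + N) t)\<^sup>2) + (\<Sum>k<N. (c k s - c k t)\<^sup>2)"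
        by (rule suminf_split_initial_segment[OF sd])
      moreover have "0 \<le> (\<Sum>k<N. (c k s - c k t)\<^sup>2)" by (intro sum_nonneg) simp
      ultimately show "(\<Sum>k. (c (k + N) s - c (k + N) t)\<^sup>2) \<le> 4 * K" using le4[OF st] by linarith
    qed (use \<Lambda>(1) in simp)
    finally have "(\<Sum>k. (c (k + N) s - c (k + N) t)\<^sup>2 / lam (k + N)) < e / 2" using \<Lambda>(2) by linarith
    moreover have "(\<Sum>k. (c k s - c k t)\<^sup>2 / lam k) = (\<Sum>k. (c (k + N) s - c (k + N) t)\<^sup>2 / lam (k + N)) + (\<Sum>k<N. (c k s - c k t)\<^sup>2 / lam k)"
      by (rule suminf_split_initial_segment[OF sf])
    ultimately show "(\<Sum>k. (c k s - c k t)\<^sup>2 / lam k) < e" using h by linarith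
  qed
qed

text \<open>The continuous representative is the functional with coefficients \<open>c k t\<close>.
  It is defined at every time of the closed interval, while the fields \<open>u t\<close> are known
  to lie in \<open>V\<close> only for almost every time.\<close>

lemma initial_value_if_coef:
  fixes c :: "nat \<Rightarrow> real \<Rightarrow> real"
  assumes cont: "\<And>k. continuous_on {0..T} (c k)" and s: "\<And>t. t \<in> {0..T} \<Longrightarrow> summable (\<lambda>k. (c k t)\<^sup>2)"
    and K: "\<And>t. t \<in> {0..T} \<Longrightarrow> (\<Sum>k. (c k t)\<^sup>2) \<le> K"
    and u: "AE t in lebesgue_on {0<..<T}. u t \<in> V \<and> (\<forall>k. coef (u t) k = c k t)"
    and u0: "\<And>j. (\<lambda>x. u0 x $ j) \<in> L2 R" and c0: "\<And>k. c k 0 = fin u0 (wf k)"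
  shows "has_initial_value T Vd dnorm (\<lambda>t. emb a b (u t)) (emb a b u0)"
  unfolding has_initial_value_def
proof (intro exI[of _ "\<lambda>t v. \<Sum>k. c k t * coef v k"] conjI ballI)
  fix t assume t: "t \<in> {0..T}"
  show "(\<lambda>v. \<Sum>k. c k t * coef v k) \<in> Vd" by (rule series_functional(4)[OF s[OF t]])
  have l: "((\<lambda>s. sqrt (\<Sum>k. (c k s - c k t)\<^sup>2 / lam k)) \<longlongrightarrow> 0) (at t within {0..T})"
    using tendsto_real_sqrt[OF weighted_suminf_tendsto_0[OF cont s K t]] by simp
  have le: "0 \<le> dnorm (\<lambda>v. (\<Sum>k. c k r * coef v k) - (\<Sum>k. c k t * coef v k)) \<and>
      dnorm (\<lambda>v. (\<Sum>k. c k r * coef v k) - (\<Sum>k. c k t * coef v k)) \<le> sqrt (\<Sum>k. (c k r - c k t)\<^sup>2 / lam k)" if r: "r \<in> {0..T}" for r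
  proof
    have sd: "summable (\<lambda>k. (c k r - c k t)\<^sup>2)"
    proof (rule summable_comparison_test'[of "\<lambda>k. 2 * (c k r)\<^sup>2 + 2 * (c k t)\<^sup>2" 0])
      show "summable (\<lambda>k. 2 * (c k r)\<^sup>2 + 2 * (c k t)\<^sup>2)" by (intro summable_add summable_mult s r t)
      show "norm ((c k r - c k t)\<^sup>2) \<le> 2 * (c k r)\<^sup>2 + 2 * (c k t)\<^sup>2" for k
        using power2_diff_le[of "c k r" "c k t"] by simp
    qed
    show "dnorm (\<lambda>v. (\<Sum>k. c k r * coef v k) - (\<Sum>k. c k t * coef v k)) \<le> sqrt (\<Sum>k. (c k r - c k t)\<^sup>2 / lam k)"
    proof (rule dnorm_le)
      fix v assume v: "v \<in> V"
      have "(\<Sum>k. c k r * coef v k) - (\<Sum>k. c k t * coef v k) = (\<Sum>k. (c k r - c k t) * coef v k)"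
        using suminf_diff[OF series_functional(1)[OF s[OF r] v] series_functional(1)[OF s[OF t] v]]
        by (simp only: left_diff_distrib)
      then show "\<bar>(\<Sum>k. c k r * coef v k) - (\<Sum>k. c k t * coef v k)\<bar> \<le> sqrt (\<Sum>k. (c k r - c k t)\<^sup>2 / lam k) * vnorm v"
        using series_functional(2)[OF sd v] by simp
    qed (auto intro!: suminf_nonneg series_functional(3)[OF sd] simp: less_imp_le[OF lam_pos])
    show "0 \<le> dnorm (\<lambda>v. (\<Sum>k. c k r * coef v k) - (\<Sum>k. c k t * coef v k))"
      by (intro dnorm_nonneg Vd.diff series_functional(4) s r t)
  qed
  show "((\<lambda>s. dnorm (\<lambda>v. (\<Sum>k. c k s * coef v k) - (\<Sum>k. c k t * coef v k))) \<longlongrightarrow> 0) (at t within {0..T})"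
    by (rule tendsto_sandwich[OF _ _ tendsto_const l]) (simp_all add: eventually_at_filter le)
next
  have *: "dnorm (\<lambda>v. (\<Sum>k. c k t * coef v k) - emb a b f v) = 0"
    if f: "\<And>j. (\<lambda>x. f x $ j) \<in> L2 R" and ft: "\<And>k. c k t = fin f (wf k)" for t f
  proof (rule dnorm_eq_0)
    fix v assume v: "v \<in> V"
    have "(\<lambda>k. c k t * coef v k) sums fin f v"
      using V_fin_sums[OF f v] by (simp add: ft mult.commute)
    moreover have "emb a b f v = fin f v"
      unfolding emb_def by (intro H_inner_eq f H1_fieldD(2) V_H1_field v)
    ultimately show "(\<Sum>k. c k t * coef v k) - emb a b f v = 0" by (simp add: sums_iff)
  qed
  show "AE t in lebesgue_on {0<..<T}. dnorm (\<lambda>v. (\<Sum>k. c k t * coef v k) - emb a b (u t) v) = 0"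
    using u
  proof eventually_elim
    fix t assume "u t \<in> V \<and> (\<forall>k. coef (u t) k = c k t)"
    then show "dnorm (\<lambda>v. (\<Sum>k. c k t * coef v k) - emb a b (u t) v) = 0"
      by (intro * H1_fieldD(2) V_H1_field) (auto simp: coef_def)
  qed
  show "dnorm (\<lambda>v. (\<Sum>k. c k 0 * coef v k) - emb a b u0 v) = 0" by (rule *[OF u0 c0])
qed

lemma scale_Vd_integrable:
  fixes S :: "real set"
  assumes S: "S \<in> lmeasurable" "bounded S" and f: "strongly_measurable (lebesgue_on S) Vd dnorm f"
    and i: "integrable (lebesgue_on S) (\<lambda>t. dnorm (f t))" and \<phi>: "continuous_on UNIV (\<phi> :: real \<Rightarrow> real)"
  shows "strongly_measurable (lebesgue_on S) Vd dnorm (\<lambda>t p. \<phi> t *\<^sub>R f t p)"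
    "integrable (lebesgue_on S) (\<lambda>t. dnorm (\<lambda>p. \<phi> t *\<^sub>R f t p))"
proof -
  have Sl: "S \<in> sets lebesgue" using S by (simp add: fmeasurableD)
  show m: "strongly_measurable (lebesgue_on S) Vd dnorm (\<lambda>t p. \<phi> t *\<^sub>R f t p)"
    by (intro Vd.strongly_measurable_scale f continuous_imp_measurable_on_sets_lebesgue Sl continuous_on_subset[OF \<phi>]) simp
  have "compact (\<phi> ` closure S)"
    using S(2) by (intro compact_continuous_image continuous_on_subset[OF \<phi>]) auto
  then obtain C where C: "\<And>t. t \<in> closure S \<Longrightarrow> norm (\<phi> t) \<le> C"
    using compact_imp_bounded[of "\<phi> ` closure S"] by (auto simp: bounded_iff)
  show "integrable (lebesgue_on S) (\<lambda>t. dnorm (\<lambda>p. \<phi> t *\<^sub>R f t p))"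
  proof (rule Bochner_Integration.integrable_bound)
    show "integrable (lebesgue_on S) (\<lambda>t. C * dnorm (f t))" using i by simp
    show "(\<lambda>t. dnorm (\<lambda>p. \<phi> t *\<^sub>R f t p)) \<in> borel_measurable (lebesgue_on S)" by (rule Vd.N_measurable[OF Sl m])
    have "AE t in lebesgue_on S. f t \<in> Vd" using f by (simp add: strongly_measurable_def)
    then show "AE t in lebesgue_on S. norm (dnorm (\<lambda>p. \<phi> t *\<^sub>R f t p)) \<le> norm (C * dnorm (f t))"
      using AE_space
    proof eventually_elim
      fix t assume ft: "f t \<in> Vd" and "t \<in> space (lebesgue_on S)"
      then have "\<bar>\<phi> t\<bar> \<le> \<bar>C\<bar>" using C[of t] closure_subset[of S] by auto
      then show "norm (dnorm (\<lambda>p. \<phi> t *\<^sub>R f t p)) \<le> norm (C * dnorm (f t))"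
        unfolding Vd.homogeneous[OF ft] by (simp add: abs_mult mult_right_mono)
    qed
  qed
qed

text \<open>Let \<open>I\<close> and \<open>J\<close> be the integrals of the two sides. Tested on
  an eigenfield, \<open>I + J\<close> is the integral of the derivative of
  \<open>c k * \<phi>\<close> by the product rule, and it vanishes because \<open>\<phi>\<close> is
  0 at both ends. By density of the expansions \<open>I + J\<close> is then zero on all of
  \<open>V\<close>.\<close>

lemma time_derivative_if_coef:
  fixes c g :: "nat \<Rightarrow> real \<Rightarrow> real"
  assumes T: "0 < T" and u: "strongly_measurable (lebesgue_on {0<..<T}) V vnorm u"
    and ui: "integrable (lebesgue_on {0<..<T}) (\<lambda>t. vnorm (u t))"
    and coef_u: "AE t in lebesgue_on {0<..<T}. \<forall>k. coef (u t) k = c k t"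
    and u': "strongly_measurable (lebesgue_on {0<..<T}) Vd dnorm u'"
    and u'i: "integrable (lebesgue_on {0<..<T}) (\<lambda>t. dnorm (u' t))"
    and g: "\<And>k. g k absolutely_integrable_on {0..T}" "\<And>k. AE t in lebesgue_on {0<..<T}. u' t (wf k) = g k t"
    and c: "\<And>k t. t \<in> {0..T} \<Longrightarrow> c k t = c k 0 + integral {0..t} (g k)"
  shows "has_time_derivative T Vd dnorm (\<lambda>t. emb a b (u t)) u'"
  unfolding has_time_derivative_def
proof
  let ?L = "lebesgue_on {0<..<T}"
  have SL: "{0<..<T} \<in> lmeasurable" "bounded {0<..<T}" "{0<..<T} \<in> sets lebesgue" by auto
  have uV: "AE t in ?L. u t \<in> V" using u by (simp add: strongly_measurable_def)
  note e = strongly_measurable_emb[OF u]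
  have ei: "integrable ?L (\<lambda>t. dnorm (emb a b (u t)))"
  proof (rule Bochner_Integration.integrable_bound)
    show "integrable ?L (\<lambda>t. vnorm (u t) / lam0)" using ui by simp
    show "(\<lambda>t. dnorm (emb a b (u t))) \<in> borel_measurable ?L" by (rule Vd.N_measurable[OF SL(3) e])
    show "AE t in ?L. norm (dnorm (emb a b (u t))) \<le> norm (vnorm (u t) / lam0)"
      using uV
    proof eventually_elim
      fix t assume ut: "u t \<in> V"
      show "norm (dnorm (emb a b (u t))) \<le> norm (vnorm (u t) / lam0)"
        unfolding real_norm_def abs_of_nonneg[OF dnorm_nonneg[OF emb_Vd(1)[OF ut]]]
        by (rule order_trans[OF emb_Vd(2)[OF ut] abs_ge_self])
    qed
  qed
  fix \<phi> assume "\<phi> \<in> test_functions {0<..<T}"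
  note \<phi> = test_function_real[OF this]
  note d = scale_Vd_integrable[OF SL(1,2) e ei \<phi>(3)] and p = scale_Vd_integrable[OF SL(1,2) u' u'i \<phi>(2)]
  define I where "I v = (LINT t|?L. deriv \<phi> t *\<^sub>R emb a b (u t) v)" for v
  define J where "J v = (LINT t|?L. \<phi> t *\<^sub>R u' t v)" for v
  have I: "I \<in> Vd" unfolding I_def by (rule integral_Vd[OF SL(3) d])
  have J: "J \<in> Vd" unfolding J_def by (rule integral_Vd[OF SL(3) p])
  have IJ: "I v + J v = 0" if "v \<in> V" for v
  proof (rule Vd_eq_0_if_basis[OF Vd.add[OF I J] _ that])
    fix k
    have \<phi>T: "\<phi> t = \<phi> 0 + integral {0..t} (deriv \<phi>)" if "t \<in> {0..T}" for t
    proof -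
      have "(deriv \<phi> has_integral \<phi> t - \<phi> 0) {0..t}"
        using that by (intro fundamental_theorem_of_calculus)
          (auto intro!: has_field_derivative_at_within[OF \<phi>(1)] simp: has_real_derivative_iff_has_vector_derivative[symmetric])
      then show ?thesis by (simp add: integral_unique)
    qed
    have \<phi>'i: "deriv \<phi> absolutely_integrable_on {0..T}"
      by (intro absolutely_integrable_continuous_real continuous_on_subset[OF \<phi>(3)]) simp
    note ac = ac_product[OF less_imp_le[OF T] g(1)[of k] \<phi>'i c[where k = k] \<phi>T]
    have "I (wf k) + J (wf k) = (LINT t|?L. deriv \<phi> t *\<^sub>R emb a b (u t) (wf k) + \<phi> t *\<^sub>R u' t (wf k))"
      unfolding I_def J_def
      by (rule Bochner_Integration.integral_add[symmetric, OF Vd_apply_integrable[OF SL(3) d w_V] Vd_apply_integrable[OF SL(3) p w_V]])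
    also have "\<dots> = (LINT t|?L. g k t * \<phi> t + c k t * deriv \<phi> t)"
    proof (rule integral_cong_AE)
      show "AE t in ?L. deriv \<phi> t *\<^sub>R emb a b (u t) (wf k) + \<phi> t *\<^sub>R u' t (wf k) = g k t * \<phi> t + c k t * deriv \<phi> t"
        using uV coef_u g(2)[of k]
      proof eventually_elim
        fix t assume ut: "u t \<in> V" and ct: "\<forall>k. coef (u t) k = c k t" and gt: "u' t (wf k) = g k t"
        have "emb a b (u t) (wf k) = c k t" using ct by (simp add: emb_eq[OF ut w_V] coef_def)
        then show "deriv \<phi> t *\<^sub>R emb a b (u t) (wf k) + \<phi> t *\<^sub>R u' t (wf k) = g k t * \<phi> t + c k t * deriv \<phi> t"
          unfolding gt by simp
      qed
    qed (use integrable_Ioo_if_Icc(1)[OF ac(1)] Vd_apply_measurable[OF SL(3) d(1) w_V[of k]] Vd_apply_measurable[OF SL(3) p(1) w_V[of k]] in auto)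
    also have "\<dots> = integral {0..T} (\<lambda>t. g k t * \<phi> t + c k t * deriv \<phi> t)"
      by (rule integrable_Ioo_if_Icc(2)[OF ac(1)])
    also have "\<dots> = c k T * \<phi> T - c k 0 * \<phi> 0" by (rule ac(2))
    also have "\<dots> = 0" by (simp add: \<phi>(4,5))
    finally show "I (wf k) + J (wf k) = 0" .
  qed
  have mI: "(\<lambda>v. - I v) \<in> Vd" using Vd.scale[OF I, of "-1"] by simp
  show "\<exists>I. has_bochner_integral_in ?L Vd dnorm (\<lambda>t v. deriv \<phi> t *\<^sub>R emb a b (u t) v) I \<and>
      has_bochner_integral_in ?L Vd dnorm (\<lambda>t v. \<phi> t *\<^sub>R u' t v) (\<lambda>v. - I v)"
  proof (intro exI[of _ I] conjI)
    show "has_bochner_integral_in ?L Vd dnorm (\<lambda>t v. deriv \<phi> t *\<^sub>R emb a b (u t) v) I"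
      by (rule has_bochner_integral_Vd[OF SL(1) d I]) (rule I_def)
    show "has_bochner_integral_in ?L Vd dnorm (\<lambda>t v. \<phi> t *\<^sub>R u' t v) (\<lambda>v. - I v)"
    proof (rule has_bochner_integral_Vd[OF SL(1) p mI])
      fix v assume "v \<in> V"
      from IJ[OF this] have "- I v = J v" by simp
      then show "- I v = (LINT t|?L. \<phi> t *\<^sub>R u' t v)" unfolding J_def .
    qed
  qed
qed

section \<open>Assembly of the weak solution\<close>

lemma galerkin_coefficients:
  assumes T: "0 < T" and \<nu>: "0 < \<nu>" and F: "F \<in> bochner_L 2 T Vd dnorm"
    and u0: "\<And>j. (\<lambda>x. u0 x $ j) \<in> L2 R"
  obtains c g :: "nat \<Rightarrow> real \<Rightarrow> real" and K :: real where
    "\<And>k. continuous_on {0..T} (c k)"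
    "\<And>t. t \<in> {0..T} \<Longrightarrow> summable (\<lambda>k. (c k t)\<^sup>2)"
    "\<And>t. t \<in> {0..T} \<Longrightarrow> (\<Sum>k. (c k t)\<^sup>2) \<le> K"
    "AE t in lebesgue_on {0<..<T}. summable (\<lambda>k. lam k * (c k t)\<^sup>2)"
    "integrable (lebesgue_on {0<..<T}) (\<lambda>t. \<Sum>k. lam k * (c k t)\<^sup>2)"
    "\<And>k. g k absolutely_integrable_on {0..T}"
    "\<And>k t. t \<in> {0..T} \<Longrightarrow> c k t = fin u0 (wf k) + integral {0..t} (g k)"
    "\<And>k. AE t in lebesgue_on {0<..<T}. g k t = F t (wf k) - \<nu> * lam k * c k t + nonlin k (\<lambda>i. c i t)"
proof -
  let ?L = "lebesgue_on {0<..<T}"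
  interpret L: finite_measure ?L by (rule finite_measure_lebesgue_on) simp
  have Fm: "strongly_measurable ?L Vd dnorm F" and Fi: "integrable ?L (\<lambda>t. (dnorm (F t))\<^sup>2)"
    using F by (auto simp: bochner_L_def)
  have FV: "AE t in ?L. F t \<in> Vd" using Fm by (simp add: strongly_measurable_def)
  have Nm: "(\<lambda>t. dnorm (F t)) \<in> borel_measurable ?L" by (rule Vd.N_measurable[OF _ Fm]) simp
  have F1: "integrable ?L (\<lambda>t. dnorm (F t))"
    by (rule L.square_integrable_imp_integrable[OF Nm Fi])
  \<comment> \<open>The coefficient system asks for its force bound at every time, whereas
    \<open>F t\<close> is a bounded functional only for almost every \<open>t\<close>; on the
    exceptional set it is replaced by zero. For the same reason \<open>Fk\<close> and
    \<open>f2\<close> are 0 at the endpoints.\<close>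
  define G where "G t = (if F t \<in> Vd then F t else (\<lambda>v. 0))" for t
  have GV: "G t \<in> Vd" for t by (simp add: G_def Vd.zero)
  have FG: "AE t in ?L. F t = G t" using FV by eventually_elim (simp add: G_def)
  have G2: "integrable ?L (\<lambda>t. (dnorm (G t))\<^sup>2)"
  proof (rule integrable_cong_AE_imp[OF Fi])
    have "(\<lambda>t. dnorm (G t)) \<in> borel_measurable ?L"
      using FG by (intro borel_measurable_AE_lebesgue_on[OF _ Nm]) (auto elim: eventually_mono)
    then show "(\<lambda>t. (dnorm (G t))\<^sup>2) \<in> borel_measurable ?L" by measurable
    show "AE t in ?L. (dnorm (F t))\<^sup>2 = (dnorm (G t))\<^sup>2" using FG by eventually_elim simp
  qed
  have Gk: "integrable ?L (\<lambda>t. G t (wf k))" for k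
  proof (rule integrable_cong_AE_imp)
    show i: "integrable ?L (\<lambda>t. F t (wf k))" by (rule Vd_apply_integrable[OF _ Fm F1 w_V]) simp
    show "(\<lambda>t. G t (wf k)) \<in> borel_measurable ?L"
      using FG by (intro borel_measurable_AE_lebesgue_on[OF _ borel_measurable_integrable[OF i]]) (auto elim: eventually_mono)
    show "AE t in ?L. F t (wf k) = G t (wf k)" using FG by eventually_elim simp
  qed
  define Fk where "Fk k t = (if t \<in> {0<..<T} then G t (wf k) else 0)" for k t
  define f2 where "f2 t = (if t \<in> {0<..<T} then (dnorm (G t))\<^sup>2 else 0)" for t
  interpret gd: galerkin_data lam nonlin "\<lambda>k. 4 * (\<bar>nrm k\<bar> * lam k)" Fk f2 "\<lambda>k. fin u0 (wf k)" \<nu> T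
  proof
    show "0 < T" "0 < \<nu>" by fact+
    show "0 < lam k" for k by (rule lam_pos)
    show "filterlim lam at_top sequentially" by (rule lam_tendsto)
    show "summable (\<lambda>k. (fin u0 (wf k))\<^sup>2)"
      by (rule summableI_nonneg_bounded[OF _ Bessel_L2[OF u0]]) simp
    show "Fk k absolutely_integrable_on {0..T}" for k
      unfolding Fk_def[abs_def] by (rule absolutely_integrable_Icc_if_Ioo[OF Gk])
    show "f2 absolutely_integrable_on {0..T}"
      unfolding f2_def[abs_def] by (rule absolutely_integrable_Icc_if_Ioo[OF G2])
    show "(\<Sum>k<n. (Fk k t)\<^sup>2 / lam k) \<le> f2 t" for n t
      using Vd_Bessel[OF GV, of t n] by (cases "t \<in> {0<..<T}") (auto simp: Fk_def f2_def)
    show "0 \<le> 4 * (\<bar>nrm k\<bar> * lam k)" for k by (simp add: less_imp_le[OF lam_pos])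
    show "nonlin k (\<lambda>i. 0) = 0" for k
      by (rule nonlin_zero)
  qed (intro nonlin_lip nonlin_cancel; simp)+
  obtain c :: "nat \<Rightarrow> real \<Rightarrow> real" where c:
    "\<And>k. continuous_on {0..T} (c k)"
    "\<And>t. t \<in> {0..T} \<Longrightarrow> summable (\<lambda>k. (c k t)\<^sup>2)"
    "\<And>t. t \<in> {0..T} \<Longrightarrow> (\<Sum>k. (c k t)\<^sup>2) \<le> gd.K"
    "AE t in lebesgue_on {0..T}. summable (\<lambda>k. lam k * (c k t)\<^sup>2)"
    "integrable (lebesgue_on {0..T}) (\<lambda>t. \<Sum>k. lam k * (c k t)\<^sup>2)"
    "\<And>k. (\<lambda>s. Fk k s - \<nu> * lam k * c k s + nonlin k (\<lambda>i. c i s)) absolutely_integrable_on {0..T}"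
    "\<And>k t. t \<in> {0..T} \<Longrightarrow> c k t = fin u0 (wf k) + integral {0..t} (\<lambda>s. Fk k s - \<nu> * lam k * c k s + nonlin k (\<lambda>i. c i s))"
    by (rule gd.galerkin_limit) blast
  show ?thesis
  proof (rule that[OF c(1-3) AE_Ioo_if_Icc[OF c(4)] integrable_Ioo_if_Icc(1) c(6) c(7)])
    show "(\<lambda>t. \<Sum>k. lam k * (c k t)\<^sup>2) absolutely_integrable_on {0..T}"
      using c(5) by (simp add: set_integrable_def integrable_restrict_space)
    fix k
    show "AE t in ?L. Fk k t - \<nu> * lam k * c k t + nonlin k (\<lambda>i. c i t) = F t (wf k) - \<nu> * lam k * c k t + nonlin k (\<lambda>i. c i t)"
      using FG AE_space by eventually_elim (simp add: Fk_def)
  qed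
qed

lemma A_op_B_op_basis:
  assumes "u \<in> V"
  shows "A_op a b u (wf k) = lam k * coef u k" "B_op a b u (wf k) = - b_form a b u (wf k) u"
  using assms vin_w_coef(1)[OF assms, of k] fin_vin_commute(2)[of u "wf k"]
  by (simp_all add: A_op_Vd(3) w_V B_op_def b_form_antisym[of u "wf k" u])

text \<open>\<open>u'\<close> is defined by solving the equation for it, so the equation holds for
  all \<open>t\<close> and \<open>v\<close>, and integrability of \<open>u'\<close> is the sum of
  the three operator bounds. What has to be proved is that this functional is the time derivative,
  and for that its values on eigenfields are compared with the derivatives of the
  coefficients.\<close>

lemma weak_solution:
  assumes T: "0 < T" and \<nu>: "0 < \<nu>" and F: "F \<in> bochner_L 2 T Vd dnorm"
    and u0: "u0 \<in> H_space a b"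
  obtains u u' where "u \<in> bochner_L 2 T V vnorm"
    "has_time_derivative T Vd dnorm (\<lambda>t. emb a b (u t)) u'"
    "u' \<in> bochner_L 1 T Vd dnorm"
    "\<And>t v. u' t v + \<nu> * A_op a b (u t) v + B_op a b (u t) v = F t v"
    "has_initial_value T Vd dnorm (\<lambda>t. emb a b (u t)) (emb a b u0)"
proof -
  let ?L = "lebesgue_on {0<..<T}"
  interpret L: finite_measure ?L by (rule finite_measure_lebesgue_on) simp
  have SL: "{0<..<T} \<in> sets lebesgue" by simp
  note u0' = H_space_component_L2[OF u0]
  obtain c g K where cont: "\<And>k. continuous_on {0..T} (c k)"
    and c2: "\<And>t. t \<in> {0..T} \<Longrightarrow> summable (\<lambda>k. (c k t)\<^sup>2)"
    and cK: "\<And>t. t \<in> {0..T} \<Longrightarrow> (\<Sum>k. (c k t)\<^sup>2) \<le> K"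
    and cl: "AE t in ?L. summable (\<lambda>k. lam k * (c k t)\<^sup>2)"
    and cli: "integrable ?L (\<lambda>t. \<Sum>k. lam k * (c k t)\<^sup>2)"
    and g: "\<And>k. g k absolutely_integrable_on {0..T}"
    and cg: "\<And>k t. t \<in> {0..T} \<Longrightarrow> c k t = fin u0 (wf k) + integral {0..t} (g k)"
    and gF: "\<And>k. AE t in ?L. g k t = F t (wf k) - \<nu> * lam k * c k t + nonlin k (\<lambda>i. c i t)"
    by (rule galerkin_coefficients[OF T \<nu> F u0']) blast
  define u where "u t = synth (\<lambda>k. c k t)" for t
  define u' where "u' t v = F t v + (- \<nu>) *\<^sub>R A_op a b (u t) v + (- 1) *\<^sub>R B_op a b (u t) v" for t v
  have c_bdd: "\<bar>c k t\<bar> \<le> sqrt K" if "t \<in> {0<..<T}" for k t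
  proof -
    have t: "t \<in> {0..T}" using that by simp
    have "(c k t)\<^sup>2 \<le> (\<Sum>k. (c k t)\<^sup>2)" using sum_le_suminf[OF c2[OF t], of "{k}"] by simp
    also note cK[OF t]
    finally show ?thesis by (rule real_le_rsqrt[OF order_trans[OF eq_refl], rotated]) simp
  qed
  have um: "strongly_measurable ?L V vnorm u"
    unfolding u_def[abs_def]
    by (rule strongly_measurable_synth[OF SL _ c_bdd cl])
      (auto intro!: continuous_imp_measurable_on_sets_lebesgue continuous_on_subset[OF cont])
  have uV: "AE t in ?L. u t \<in> V \<and> (\<forall>k. coef (u t) k = c k t)"
    using cl by eventually_elim (simp add: u_def synth)
  have un: "AE t in ?L. (\<Sum>k. lam k * (c k t)\<^sup>2) = (vnorm (u t))\<^sup>2"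
    using uV by eventually_elim (simp add: vnorm_sq V_expansion(3))
  have Nu: "(\<lambda>t. vnorm (u t)) \<in> borel_measurable ?L" by (rule V.N_measurable[OF SL um])
  have u2: "integrable ?L (\<lambda>t. (vnorm (u t))\<^sup>2)"
    by (rule integrable_cong_AE_imp[OF cli _ un]) (use Nu in measurable)
  have u1: "integrable ?L (\<lambda>t. vnorm (u t))" by (rule L.square_integrable_imp_integrable[OF Nu u2])
  have Fm: "strongly_measurable ?L Vd dnorm F" and Fi: "integrable ?L (\<lambda>t. (dnorm (F t))\<^sup>2)"
    using F by (auto simp: bochner_L_def)
  have F1: "integrable ?L (\<lambda>t. dnorm (F t))"
    by (rule L.square_integrable_imp_integrable[OF Vd.N_measurable[OF SL Fm] Fi])
  have u'm: "strongly_measurable ?L Vd dnorm u'"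
    unfolding u'_def[abs_def]
    by (intro Vd.strongly_measurable_add Vd.strongly_measurable_scale Fm strongly_measurable_A_op strongly_measurable_B_op um) simp_all
  have u'i: "integrable ?L (\<lambda>t. dnorm (u' t))"
  proof (rule Bochner_Integration.integrable_bound)
    show "integrable ?L (\<lambda>t. dnorm (F t) + \<nu> * vnorm (u t) + KB * (vnorm (u t))\<^sup>2)"
      using F1 u1 u2 by simp
    show "(\<lambda>t. dnorm (u' t)) \<in> borel_measurable ?L" by (rule Vd.N_measurable[OF SL u'm])
    have "AE t in ?L. F t \<in> Vd" using Fm by (simp add: strongly_measurable_def)
    then show "AE t in ?L. norm (dnorm (u' t)) \<le> norm (dnorm (F t) + \<nu> * vnorm (u t) + KB * (vnorm (u t))\<^sup>2)"
      using uV
    proof eventually_elim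
      fix t assume Ft: "F t \<in> Vd" and "u t \<in> V \<and> (\<forall>k. coef (u t) k = c k t)"
      then have ut: "u t \<in> V" by simp
      let ?A = "A_op a b (u t)" and ?B = "B_op a b (u t)"
      note A = A_op_Vd(1,2)[OF ut] and B = B_op_Vd[OF ut]
      have sA: "(\<lambda>v. (- \<nu>) *\<^sub>R ?A v) \<in> Vd" and sB: "(\<lambda>v. (- 1) *\<^sub>R ?B v) \<in> Vd" by (intro Vd.scale A B)+
      have FA: "(\<lambda>v. F t v + (- \<nu>) *\<^sub>R ?A v) \<in> Vd" by (intro Vd.add Ft sA)
      have e: "u' t = (\<lambda>v. (F t v + (- \<nu>) *\<^sub>R ?A v) + (- 1) *\<^sub>R ?B v)" by (simp add: u'_def fun_eq_iff)
      have "dnorm (u' t) \<le> dnorm (\<lambda>v. F t v + (- \<nu>) *\<^sub>R ?A v) + dnorm (\<lambda>v. (- 1) *\<^sub>R ?B v)"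
        unfolding e by (rule Vd.triangle[OF FA sB])
      also have "\<dots> \<le> (dnorm (F t) + dnorm (\<lambda>v. (- \<nu>) *\<^sub>R ?A v)) + dnorm (\<lambda>v. (- 1) *\<^sub>R ?B v)"
        by (intro add_right_mono Vd.triangle Ft sA)
      also have "\<dots> = dnorm (F t) + \<nu> * dnorm ?A + dnorm ?B"
        unfolding Vd.homogeneous[OF A(1)] Vd.homogeneous[OF B(1)] using \<nu> by simp
      also have "\<dots> \<le> dnorm (F t) + \<nu> * vnorm (u t) + KB * (vnorm (u t))\<^sup>2"
        using A(2) B(2) \<nu> by (intro add_mono mult_left_mono) auto
      finally have le: "dnorm (u' t) \<le> dnorm (F t) + \<nu> * vnorm (u t) + KB * (vnorm (u t))\<^sup>2" .
      have "0 \<le> dnorm (u' t)" unfolding e by (intro dnorm_nonneg Vd.add FA sB)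
      then show "norm (dnorm (u' t)) \<le> norm (dnorm (F t) + \<nu> * vnorm (u t) + KB * (vnorm (u t))\<^sup>2)"
        unfolding real_norm_def using le by linarith
    qed
  qed
  have c0: "c k 0 = fin u0 (wf k)" for k using cg[of 0 k] T by simp
  have u'g: "AE t in ?L. u' t (wf k) = g k t" for k
    using uV cl gF[of k]
  proof eventually_elim
    fix t assume ut: "u t \<in> V \<and> (\<forall>k. coef (u t) k = c k t)" and s: "summable (\<lambda>k. lam k * (c k t)\<^sup>2)"
      and gt: "g k t = F t (wf k) - \<nu> * lam k * c k t + nonlin k (\<lambda>i. c i t)"
    have "nonlin k (\<lambda>i. c i t) = b_form a b (u t) (wf k) (u t)" using s by (simp add: nonlin_def u_def)
    then show "u' t (wf k) = g k t" unfolding gt u'_def using ut by (simp add: A_op_B_op_basis)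
  qed
  show ?thesis
  proof
    show "u \<in> bochner_L 2 T V vnorm" using um u2 by (simp add: bochner_L_def)
    show "u' \<in> bochner_L 1 T Vd dnorm" using u'm u'i by (simp add: bochner_L_def)
    show "u' t v + \<nu> * A_op a b (u t) v + B_op a b (u t) v = F t v" for t v by (simp add: u'_def)
    show "has_time_derivative T Vd dnorm (\<lambda>t. emb a b (u t)) u'"
      by (rule time_derivative_if_coef[OF T um u1 _ u'm u'i g u'g])
        (use uV cg in \<open>auto simp: c0 elim: eventually_mono\<close>)
    show "has_initial_value T Vd dnorm (\<lambda>t. emb a b (u t)) (emb a b u0)"
      by (rule initial_value_if_coef[OF cont c2 cK uV u0' c0])
  qed
qed

end

theorem theorem2p6p4:
  fixes a b T \<nu> :: real
    and F :: "real \<Rightarrow> field \<Rightarrow> real"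
    and u0 :: field
  assumes "0 < a" and "0 < b" and "0 < T" and "0 < \<nu>"
    and "F \<in> bochner_L 2 T (V_dual a b) (V_dual_norm a b)"
    and "u0 \<in> H_space a b"
  shows "\<exists>(u :: real \<Rightarrow> field) (u' :: real \<Rightarrow> field \<Rightarrow> real).
      u \<in> bochner_L 2 T (V_space a b) (V_norm a b) \<and>
      has_time_derivative T (V_dual a b) (V_dual_norm a b) (\<lambda>t. emb a b (u t)) u' \<and>
      u' \<in> bochner_L 1 T (V_dual a b) (V_dual_norm a b) \<and>
      (AE t in lebesgue_on {0<..<T}. \<forall>v\<in>V_space a b.
         u' t v + \<nu> * A_op a b (u t) v + B_op a b (u t) v = F t v) \<and>
      has_initial_value T (V_dual a b) (V_dual_norm a b) (\<lambda>t. emb a b (u t)) (emb a b u0)"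
proof -
  interpret rectangle a b by unfold_locales fact+
  obtain u u' where u: "u \<in> bochner_L 2 T (V_space a b) (V_norm a b)"
    "has_time_derivative T (V_dual a b) (V_dual_norm a b) (\<lambda>t. emb a b (u t)) u'"
    "u' \<in> bochner_L 1 T (V_dual a b) (V_dual_norm a b)"
    "\<And>t v. u' t v + \<nu> * A_op a b (u t) v + B_op a b (u t) v = F t v"
    "has_initial_value T (V_dual a b) (V_dual_norm a b) (\<lambda>t. emb a b (u t)) (emb a b u0)"
    by (rule weak_solution[OF assms(3-6)]) blast
  show ?thesis
    by (intro exI[of _ u] exI[of _ u'] conjI u) (simp add: u(4))
qed

end
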